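(* Let $n\ge 4$ and let $\gamma=(i_1,\ldots,i_n)$ be a cyclic ordering on $S_n=\{1,\ldots,n\}$. Then the abelian group $Pic(\overline{\mathfrak{M}}_{0,n})$ is presented as follows. It is generated by the set of classes of all the boundary divisors of $\overline{\mathfrak{M}}_{0,n}$, i.e. the classes $\delta_A$ with $A\subset S_n$, $2\le |A|\le n-2$, $\delta_A=\delta_{S_n\setminus A}$, subject to the relations $$\delta_I=\sum_{J\in\mathcal{J}_I}\delta_J-\sum_{K\in\mathcal{K}_I}\delta_K,$$ one for each subset $I\subset S_n$ with $2\le |I|\le n-2$ that is consecutive for the ordering $\gamma$. Here: (1) $\mathcal{J}_I$ is the set of subsets $J=B_1\cup\cdots\cup B_N$ of $S_n$ that are non-adjacent for $\gamma$, contain $1$, and are such that $I$ is equal to a segment of even length, of the form $B_i,G_i,\ldots,B_k,G_k$ or $G_i,B_{i+1},G_{i+1},\ldots,G_k,B_{k+1}$, of the block-gap sequence $(B_1,G_1,\ldots,B_N,G_N)$ of $J$; (2) $\mathcal{K}_I$ is the set of subsets $K=B_1\cup\cdots\cup B_N$ of $S_n$ that are non-adjacent for $\gamma$, contain $1$, and are such that $I$ is equal to a segment of odd length, of the form $B_i,G_i,\ldots,B_k,G_k,B_{k+1}$ or $G_i,B_{i+1},G_{i+1},\ldots,B_k,G_k$ (length $1$ allowed), of the block-gap sequence $(B_1,G_1,\ldots,B_N,G_N)$ of $K$.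
   Context: $\overline{\mathfrak{M}}_{0,n}$ is the Deligne-Mumford compactification of the moduli space $\mathfrak{M}_{0,n}$ of smooth genus $0$ curves over $\mathbb{C}$ with $n$ marked points indexed by $S_n=\{1,\ldots,n\}$. $Pic(\overline{\mathfrak{M}}_{0,n})$ is its Picard group: the group of Weil divisors modulo principal divisors (equivalently, modulo numerical equivalence). A boundary divisor means an irreducible component of $\overline{\mathfrak{M}}_{0,n}\setminus\mathfrak{M}_{0,n}$. The boundary divisors are in bijection with the unordered partitions $\{A,S_n\setminus A\}$ of $S_n$ with $2\le|A|\le n-2$. The divisor $d_A=d_{S_n\setminus A}$ is the one whose generic point is a nodal curve with two components, one carrying the marked points indexed by $A$ and the other those indexed by $S_n\setminus A$. The class of $d_A$ in $Pic(\overline{\mathfrak{M}}_{0,n})$ is denoted $\delta_A=\delta_{S_n\setminus A}$. A cyclic ordering $\gamma=(i_1,\ldots,i_n)$ on $S_n$ is an arrangement of the elements of $S_n$ as the vertices of an oriented $n$-gon, with $i_{p+1}$ following $i_p$ clockwise (and $i_1$ following $i_n$), so $(i_1,\ldots,i_n)=(i_2,\ldots,i_n,i_1)=\cdots$. A nonempty proper subset of $S_n$ is consecutive (or adjacent) for $\gamma$ if its elements form a set of successive vertices $i_m,i_{m+1},\ldots,i_{m+p}$ of this polygon, with subscripts modulo $n$. Block-gap sequence: let $A\subset S_n$ with $2\le|A|\le n-2$. Since $d_A=d_{S_n\setminus A}$, each boundary divisor is represented by its unique representative $A$ containing $1$, so assume $1\in A$. Write $A$ uniquely as a disjoint union of its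 maximal consecutive subsets for $\gamma$ (the blocks) $B_1,\ldots,B_N$, numbered in the cyclic order induced by $\gamma$ with $1\in B_1$. For each $i$ let $G_i$ (the gap) be the set of elements of $S_n\setminus A$ lying strictly between $B_i$ and $B_{i+1}$ in the cyclic order (with $B_{N+1}=B_1$). The cyclic sequence $(B_1,G_1,B_2,G_2,\ldots,B_N,G_N)$ is the block-gap sequence of $A$; its terms are nonempty and partition $S_n$. The set $A$ is non-adjacent for $\gamma$ if $N\ge2$. A segment of length $s$ of the block-gap sequence is a set of $s$ cyclically successive terms of it (subscripts of the $B$'s and $G$'s modulo $N$). "$I$ is equal to a segment" means that $I$ is the union of the terms of that segment. "Generated by a set of classes subject to relations" means that $Pic(\overline{\mathfrak{M}}_{0,n})$ is the quotient of the free abelian group on the set of boundary divisors (one generator per unordered partition $\{A,S_n\setminus A\}$) by the subgroup generated by the listed relations, with the generator of $\{A,S_n\setminus A\}$ mapping to $\delta_A$. *)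

theory Defs
  imports
    "HOL-Analysis.Analysis"
    "HOL-Algebra.Free_Abelian_Groups"
begin

section \<open>Subvarieties of products of complex projective lines\<close>

datatype P1 = Finite complex | Infinity

primrec hcoord :: "P1 \<Rightarrow> complex \<times> complex" where
  "hcoord (Finite z) = (z, 1)"
| "hcoord Infinity = (1, 0)"

text \<open>The point with homogeneous coordinates \<open>[a : b]\<close>, for \<open>(a, b) \<noteq> (0, 0)\<close>.\<close>

definition P1_point :: "complex \<Rightarrow> complex \<Rightarrow> P1" where
  "P1_point a b = (if b = 0 then Infinity else Finite (a / b))"

text \<open>Multihomogeneous polynomials of multidegree \<open>d\<close> on the product of copies of the projective
  line indexed by \<open>Q\<close>, as functions of the homogeneous coordinates (the base field is infinite, so
  polynomials and polynomial functions are the same thing).\<close>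

inductive multihom_poly ::
  "'q set \<Rightarrow> ('q \<Rightarrow> nat) \<Rightarrow> (('q \<Rightarrow> complex \<times> complex) \<Rightarrow> complex) \<Rightarrow> bool"
  for Q :: "'q set" where
  const: "multihom_poly Q (\<lambda>_. 0) (\<lambda>_. c)"
| coord1: "q \<in> Q \<Longrightarrow> multihom_poly Q (\<lambda>r. if r = q then 1 else 0) (\<lambda>x. fst (x q))"
| coord2: "q \<in> Q \<Longrightarrow> multihom_poly Q (\<lambda>r. if r = q then 1 else 0) (\<lambda>x. snd (x q))"
| add: "multihom_poly Q d F \<Longrightarrow> multihom_poly Q d G \<Longrightarrow> multihom_poly Q d (\<lambda>x. F x + G x)"
| mult: "multihom_poly Q d F \<Longrightarrow> multihom_poly Q e G \<Longrightarrow>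
    multihom_poly Q (\<lambda>r. d r + e r) (\<lambda>x. F x * G x)"

text \<open>The value at the normalised coordinates of a point. Only its vanishing, and quotients of
  values of polynomials of equal multidegree, have a meaning independent of the normalisation.\<close>

definition eval_at :: "(('q \<Rightarrow> complex \<times> complex) \<Rightarrow> complex) \<Rightarrow> ('q \<Rightarrow> P1) \<Rightarrow> complex" where
  "eval_at F p = F (\<lambda>q. hcoord (p q))"

definition zariski_ambient :: "'q set \<Rightarrow> ('q \<Rightarrow> P1) topology" where
  "zariski_ambient Q = topology_generated_by
     {{p \<in> Q \<rightarrow>\<^sub>E UNIV. eval_at F p \<noteq> 0} | F d. multihom_poly Q d F}"

definition zariski :: "'q set \<Rightarrow> ('q \<Rightarrow> P1) set \<Rightarrow> ('q \<Rightarrow> P1) topology" where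
  "zariski Q X = subtopology (zariski_ambient Q) X"

definition irreducible_in :: "'a topology \<Rightarrow> 'a set \<Rightarrow> bool" where
  "irreducible_in T S \<longleftrightarrow> S \<noteq> {} \<and> S \<subseteq> topspace T \<and>
     (\<forall>C D. closedin T C \<and> closedin T D \<and> S \<subseteq> C \<union> D \<longrightarrow> S \<subseteq> C \<or> S \<subseteq> D)"

definition irreducible_component :: "'a topology \<Rightarrow> 'a set \<Rightarrow> 'a set \<Rightarrow> bool" where
  "irreducible_component T S D \<longleftrightarrow> irreducible_in T D \<and> D \<subseteq> S \<and>
     (\<forall>D'. irreducible_in T D' \<and> D' \<subseteq> S \<and> D \<subseteq> D' \<longrightarrow> D' = D)"


section \<open>Rational functions, Weil divisors and the divisor class group\<close>

definition regular_on :: "'q set \<Rightarrow> ('q \<Rightarrow> P1) set \<Rightarrow> ('q \<Rightarrow> P1) set \<Rightarrow> (('q \<Rightarrow> P1) \<Rightarrow> complex) \<Rightarrow> bool"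
  where
  "regular_on Q X U f \<longleftrightarrow> openin (zariski Q X) U \<and>
     (\<forall>p\<in>U. \<exists>V d G H. openin (zariski Q X) V \<and> p \<in> V \<and> V \<subseteq> U \<and>
        multihom_poly Q d G \<and> multihom_poly Q d H \<and>
        (\<forall>x\<in>V. eval_at H x \<noteq> 0 \<and> f x = eval_at G x / eval_at H x))"

text \<open>For irreducible \<open>X\<close>, elements of the function field are represented by functions that are
  regular on some nonempty open subset (with arbitrary values elsewhere), two such functions being
  identified when they agree on a nonempty open subset.\<close>

definition rational_function :: "'q set \<Rightarrow> ('q \<Rightarrow> P1) set \<Rightarrow> (('q \<Rightarrow> P1) \<Rightarrow> complex) \<Rightarrow> bool" where
  "rational_function Q X f \<longleftrightarrow> (\<exists>U. U \<noteq> {} \<and> regular_on Q X U f)"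

definition rational_eq ::
  "'q set \<Rightarrow> ('q \<Rightarrow> P1) set \<Rightarrow> (('q \<Rightarrow> P1) \<Rightarrow> complex) \<Rightarrow> (('q \<Rightarrow> P1) \<Rightarrow> complex) \<Rightarrow> bool" where
  "rational_eq Q X f g \<longleftrightarrow> (\<exists>U. openin (zariski Q X) U \<and> U \<noteq> {} \<and> (\<forall>x\<in>U. f x = g x))"

text \<open>Irreducible closed subsets of codimension one; \<open>X\<close> is assumed irreducible.\<close>

definition prime_divisor :: "'q set \<Rightarrow> ('q \<Rightarrow> P1) set \<Rightarrow> ('q \<Rightarrow> P1) set \<Rightarrow> bool" where
  "prime_divisor Q X Y \<longleftrightarrow>
     closedin (zariski Q X) Y \<and> irreducible_in (zariski Q X) Y \<and> Y \<noteq> X \<and>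
     (\<forall>Z. closedin (zariski Q X) Z \<and> irreducible_in (zariski Q X) Z \<and> Y \<subseteq> Z \<longrightarrow> Z = Y \<or> Z = X)"

text \<open>Representatives of the elements of the local ring of \<open>X\<close> along \<open>Y\<close> (at the generic point of
  \<open>Y\<close>) and of its maximal ideal.\<close>

definition local_ring ::
  "'q set \<Rightarrow> ('q \<Rightarrow> P1) set \<Rightarrow> ('q \<Rightarrow> P1) set \<Rightarrow> (('q \<Rightarrow> P1) \<Rightarrow> complex) set" where
  "local_ring Q X Y = {f. \<exists>U. U \<inter> Y \<noteq> {} \<and> regular_on Q X U f}"

definition local_maximal_ideal ::
  "'q set \<Rightarrow> ('q \<Rightarrow> P1) set \<Rightarrow> ('q \<Rightarrow> P1) set \<Rightarrow> (('q \<Rightarrow> P1) \<Rightarrow> complex) set" where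
  "local_maximal_ideal Q X Y =
     {f. \<exists>U. U \<inter> Y \<noteq> {} \<and> regular_on Q X U f \<and> (\<forall>x \<in> U \<inter> Y. f x = 0)}"

definition uniformizer ::
  "'q set \<Rightarrow> ('q \<Rightarrow> P1) set \<Rightarrow> ('q \<Rightarrow> P1) set \<Rightarrow> (('q \<Rightarrow> P1) \<Rightarrow> complex) \<Rightarrow> bool" where
  "uniformizer Q X Y t \<longleftrightarrow> t \<in> local_maximal_ideal Q X Y \<and>
     (\<forall>g \<in> local_maximal_ideal Q X Y. \<exists>h \<in> local_ring Q X Y. rational_eq Q X g (\<lambda>x. t x * h x))"

text \<open>The valuation of the local ring of \<open>X\<close> along a prime divisor, which is a discrete valuation
  ring when \<open>X\<close> is nonsingular in codimension one: \<open>f = u t\<^sup>k\<close> with \<open>t\<close> a uniformizer and \<open>u\<close>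
  a unit.\<close>

definition ord_along ::
  "'q set \<Rightarrow> ('q \<Rightarrow> P1) set \<Rightarrow> ('q \<Rightarrow> P1) set \<Rightarrow> (('q \<Rightarrow> P1) \<Rightarrow> complex) \<Rightarrow> int" where
  "ord_along Q X Y f = (THE k. \<exists>t u. uniformizer Q X Y t \<and>
     u \<in> local_ring Q X Y - local_maximal_ideal Q X Y \<and>
     rational_eq Q X f (\<lambda>x. u x * t x powi k))"

definition weil_divisors :: "'q set \<Rightarrow> ('q \<Rightarrow> P1) set \<Rightarrow> (('q \<Rightarrow> P1) set \<Rightarrow>\<^sub>0 int) monoid" where
  "weil_divisors Q X = free_Abelian_group {Y. prime_divisor Q X Y}"

definition principal_divisors :: "'q set \<Rightarrow> ('q \<Rightarrow> P1) set \<Rightarrow> (('q \<Rightarrow> P1) set \<Rightarrow>\<^sub>0 int) set" where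
  "principal_divisors Q X = {D \<in> carrier (weil_divisors Q X).
     \<exists>f. rational_function Q X f \<and> \<not> rational_eq Q X f (\<lambda>_. 0) \<and>
       (\<forall>Y. prime_divisor Q X Y \<longrightarrow> Poly_Mapping.lookup D Y = ord_along Q X Y f)}"

definition divisor_class_group ::
  "'q set \<Rightarrow> ('q \<Rightarrow> P1) set \<Rightarrow> (('q \<Rightarrow> P1) set \<Rightarrow>\<^sub>0 int) set monoid" where
  "divisor_class_group Q X = weil_divisors Q X Mod principal_divisors Q X"

definition divisor_class ::
  "'q set \<Rightarrow> ('q \<Rightarrow> P1) set \<Rightarrow> ('q \<Rightarrow> P1) set \<Rightarrow> (('q \<Rightarrow> P1) set \<Rightarrow>\<^sub>0 int) set" where
  "divisor_class Q X Y = principal_divisors Q X #>\<^bsub>weil_divisors Q X\<^esub> frag_of Y"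


section \<open>Stable marked curves of genus zero\<close>

text \<open>A connected nodal curve of arithmetic genus zero is a tree of projective lines. The record
  contains the components, the (symmetric) adjacency relation of the dual graph, the position
  \<open>node_pt C a b\<close> on the component \<open>a\<close> of its node with the component \<open>b\<close>, and for each mark the
  component carrying it and its position there.\<close>

record marked_curve =
  comps :: "nat set"
  adj :: "(nat \<times> nat) set"
  node_pt :: "nat \<Rightarrow> nat \<Rightarrow> P1"
  mark_comp :: "nat \<Rightarrow> nat"
  mark_pt :: "nat \<Rightarrow> P1"

definition marks_on :: "nat \<Rightarrow> marked_curve \<Rightarrow> nat \<Rightarrow> nat set" where
  "marks_on n C a = {i \<in> {1..n}. mark_comp C i = a}"

text \<open>The equation for the number of edges (each counted twice in \<open>adj C\<close>) says that the connected
  dual graph is a tree.\<close>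

definition stable_curve :: "nat \<Rightarrow> marked_curve \<Rightarrow> bool" where
  "stable_curve n C \<longleftrightarrow>
     finite (comps C) \<and> comps C \<noteq> {} \<and>
     adj C \<subseteq> comps C \<times> comps C \<and> sym (adj C) \<and> irrefl (adj C) \<and>
     (\<forall>a\<in>comps C. \<forall>b\<in>comps C. (a, b) \<in> (adj C)\<^sup>*) \<and>
     card (adj C) = 2 * (card (comps C) - 1) \<and>
     (\<forall>i\<in>{1..n}. mark_comp C i \<in> comps C) \<and>
     (\<forall>a\<in>comps C.
        inj_on (node_pt C a) (adj C `` {a}) \<and>
        inj_on (mark_pt C) (marks_on n C a) \<and>
        node_pt C a ` (adj C `` {a}) \<inter> mark_pt C ` marks_on n C a = {} \<and>
        card (adj C `` {a}) + card (marks_on n C a) \<ge> 3)"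

text \<open>The image of the mark \<open>i\<close> when all components other than \<open>a\<close> are contracted: the mark itself,
  or the node of \<open>a\<close> in the direction of the component carrying it.\<close>

definition next_comp :: "marked_curve \<Rightarrow> nat \<Rightarrow> nat \<Rightarrow> nat" where
  "next_comp C a c = (THE b. (a, b) \<in> adj C \<and> (b, c) \<in> (adj C \<inter> (- {a}) \<times> (- {a}))\<^sup>*)"

definition contracted_mark :: "marked_curve \<Rightarrow> nat \<Rightarrow> nat \<Rightarrow> P1" where
  "contracted_mark C a i =
     (if mark_comp C i = a then mark_pt C i else node_pt C a (next_comp C a (mark_comp C i)))"

text \<open>The cross-ratio \<open>((a - c) (b - d)) / ((b - c) (a - d))\<close>, in homogeneous form; it makes sense
  as soon as three of the four points are distinct.\<close>

definition P1_det :: "P1 \<Rightarrow> P1 \<Rightarrow> complex" where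
  "P1_det a b = fst (hcoord a) * snd (hcoord b) - fst (hcoord b) * snd (hcoord a)"

definition cross_ratio :: "P1 \<Rightarrow> P1 \<Rightarrow> P1 \<Rightarrow> P1 \<Rightarrow> P1" where
  "cross_ratio a b c d = P1_point (P1_det a c * P1_det b d) (P1_det b c * P1_det a d)"

type_synonym quad = "nat \<times> nat \<times> nat \<times> nat"

definition quads :: "nat \<Rightarrow> quad set" where
  "quads n = {(i, j, k, l). {i, j, k, l} \<subseteq> {1..n} \<and> distinct [i, j, k, l]}"

text \<open>The cross-ratio of four marks of a stable curve, computed on any component on which at least
  three of their images are distinct (the result does not depend on the component). This is the
  point of \<open>Mbar\<^bsub>0,4\<^esub> = P1\<close> obtained by forgetting the other marks and stabilising.\<close>

definition curve_cross_ratio :: "marked_curve \<Rightarrow> quad \<Rightarrow> P1" where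
  "curve_cross_ratio C = (\<lambda>(i, j, k, l). THE w. \<exists>a\<in>comps C.
     card {contracted_mark C a i, contracted_mark C a j,
           contracted_mark C a k, contracted_mark C a l} \<ge> 3 \<and>
     w = cross_ratio (contracted_mark C a i) (contracted_mark C a j)
           (contracted_mark C a k) (contracted_mark C a l))"

definition moduli_point :: "nat \<Rightarrow> marked_curve \<Rightarrow> quad \<Rightarrow> P1" where
  "moduli_point n C = restrict (curve_cross_ratio C) (quads n)"


section \<open>The compactified moduli space and its boundary\<close>

text \<open>Two stable curves are isomorphic iff they have the same \<open>moduli_point\<close>, and the map
  \<open>moduli_point\<close> is a closed embedding of the Deligne-Mumford compactification in a product of
  projective lines (Gerritzen, Herrlich and van der Put, Stable n-pointed trees of projective lines,
  1988; see also McDuff and Salamon, J-holomorphic curves and symplectic topology, Appendix D).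
  So the set below, with the structure of a variety induced by the product, is that
  compactification, and its points are the isomorphism classes of stable curves.\<close>

definition Mbar :: "nat \<Rightarrow> (quad \<Rightarrow> P1) set" where
  "Mbar n = {moduli_point n C | C. stable_curve n C}"

definition M_smooth :: "nat \<Rightarrow> (quad \<Rightarrow> P1) set" where
  "M_smooth n = {moduli_point n C | C. stable_curve n C \<and> card (comps C) = 1}"

definition boundary_divisor :: "nat \<Rightarrow> (quad \<Rightarrow> P1) set \<Rightarrow> bool" where
  "boundary_divisor n D \<longleftrightarrow>
     irreducible_component (zariski (quads n) (Mbar n)) (Mbar n - M_smooth n) D"

definition two_comp_locus :: "nat \<Rightarrow> nat set \<Rightarrow> (quad \<Rightarrow> P1) set" where
  "two_comp_locus n A = {moduli_point n C | C. stable_curve n C \<and>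
     (\<exists>a b. a \<noteq> b \<and> comps C = {a, b} \<and> marks_on n C a = A \<and> marks_on n C b = {1..n} - A)}"

text \<open>The generic point of \<open>D\<close> lies in a locus iff a nonempty open subset of \<open>D\<close> does.\<close>

definition d_divisor :: "nat \<Rightarrow> nat set \<Rightarrow> (quad \<Rightarrow> P1) set" where
  "d_divisor n A = (THE D. boundary_divisor n D \<and>
     (\<exists>U. openin (zariski (quads n) (Mbar n)) U \<and> U \<inter> D \<noteq> {} \<and> U \<inter> D \<subseteq> two_comp_locus n A))"

definition Pic_Mbar :: "nat \<Rightarrow> ((quad \<Rightarrow> P1) set \<Rightarrow>\<^sub>0 int) set monoid" where
  "Pic_Mbar n = divisor_class_group (quads n) (Mbar n)"

definition delta :: "nat \<Rightarrow> nat set \<Rightarrow> ((quad \<Rightarrow> P1) set \<Rightarrow>\<^sub>0 int) set" where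
  "delta n A = divisor_class (quads n) (Mbar n) (d_divisor n A)"


section \<open>Cyclic orderings and block-gap sequences\<close>

text \<open>A cyclic ordering is given by any list that enumerates the marks in clockwise order.\<close>

definition cyclic_ordering :: "nat \<Rightarrow> nat list \<Rightarrow> bool" where
  "cyclic_ordering n \<gamma> \<longleftrightarrow> distinct \<gamma> \<and> set \<gamma> = {1..n}"

definition vertex :: "nat list \<Rightarrow> nat \<Rightarrow> nat" where
  "vertex \<gamma> p = \<gamma> ! (p mod length \<gamma>)"

text \<open>The set of \<open>s\<close> successive vertices beginning at position \<open>p\<close>.\<close>

definition run :: "nat list \<Rightarrow> nat \<Rightarrow> nat \<Rightarrow> nat set" where
  "run \<gamma> p s = vertex \<gamma> ` {p..<p + s}"

definition consecutive :: "nat list \<Rightarrow> nat set \<Rightarrow> bool" where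
  "consecutive \<gamma> S \<longleftrightarrow> S \<noteq> {} \<and> S \<subset> set \<gamma> \<and> (\<exists>p s. S = run \<gamma> p s)"

definition blocks :: "nat list \<Rightarrow> nat set \<Rightarrow> nat set set" where
  "blocks \<gamma> A = {B. consecutive \<gamma> B \<and> B \<subseteq> A \<and>
     (\<forall>B'. consecutive \<gamma> B' \<and> B' \<subseteq> A \<and> B \<subseteq> B' \<longrightarrow> B' = B)}"

text \<open>The last condition says that, going clockwise, one leaves the block \<open>Bs ! i\<close>, runs through
  \<open>Gs ! i\<close> without meeting \<open>A\<close>, and then enters the block with the next index.\<close>

definition block_gap :: "nat list \<Rightarrow> nat set \<Rightarrow> nat set list \<Rightarrow> nat set list \<Rightarrow> bool" where
  "block_gap \<gamma> A Bs Gs \<longleftrightarrow>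
     distinct Bs \<and> set Bs = blocks \<gamma> A \<and> Bs \<noteq> [] \<and> 1 \<in> Bs ! 0 \<and> length Gs = length Bs \<and>
     (\<forall>i < length Bs. \<exists>p s t. s \<ge> 1 \<and> t \<ge> 1 \<and>
        Bs ! i = run \<gamma> p s \<and> Gs ! i = run \<gamma> (p + s) t \<and> Gs ! i \<inter> A = {} \<and>
        vertex \<gamma> (p + s + t) \<in> Bs ! (Suc i mod length Bs))"

definition non_adjacent :: "nat list \<Rightarrow> nat set \<Rightarrow> bool" where
  "non_adjacent \<gamma> A \<longleftrightarrow> card (blocks \<gamma> A) \<ge> 2"

text \<open>The term with index \<open>m\<close> (modulo \<open>2 N\<close>) of the cyclic sequence
  \<open>B\<^sub>1, G\<^sub>1, \<dots>, B\<^sub>N, G\<^sub>N\<close>, counted from 0.\<close>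

definition bg_term :: "nat set list \<Rightarrow> nat set list \<Rightarrow> nat \<Rightarrow> nat set" where
  "bg_term Bs Gs m = (let r = m mod (2 * length Bs) in
     if even r then Bs ! (r div 2) else Gs ! (r div 2))"

definition is_segment :: "nat set list \<Rightarrow> nat set list \<Rightarrow> nat \<Rightarrow> nat set \<Rightarrow> bool" where
  "is_segment Bs Gs s I \<longleftrightarrow> 1 \<le> s \<and> s \<le> 2 * length Bs \<and>
     (\<exists>m. I = (\<Union>j<s. bg_term Bs Gs (m + j)))"

definition even_segment_sets :: "nat \<Rightarrow> nat list \<Rightarrow> nat set \<Rightarrow> nat set set" where
  "even_segment_sets n \<gamma> I = {J. J \<subseteq> {1..n} \<and> 1 \<in> J \<and> 2 \<le> card J \<and> card J \<le> n - 2 \<and>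
     non_adjacent \<gamma> J \<and> (\<exists>Bs Gs s. block_gap \<gamma> J Bs Gs \<and> even s \<and> is_segment Bs Gs s I)}"

definition odd_segment_sets :: "nat \<Rightarrow> nat list \<Rightarrow> nat set \<Rightarrow> nat set set" where
  "odd_segment_sets n \<gamma> I = {K. K \<subseteq> {1..n} \<and> 1 \<in> K \<and> 2 \<le> card K \<and> card K \<le> n - 2 \<and>
     non_adjacent \<gamma> K \<and> (\<exists>Bs Gs s. block_gap \<gamma> K Bs Gs \<and> odd s \<and> is_segment Bs Gs s I)}"


section \<open>The presentation\<close>

definition bipartition :: "nat \<Rightarrow> nat set \<Rightarrow> nat set set" where
  "bipartition n A = {A, {1..n} - A}"

definition boundary_index :: "nat \<Rightarrow> nat set \<Rightarrow> bool" where
  "boundary_index n A \<longleftrightarrow> A \<subseteq> {1..n} \<and> 2 \<le> card A \<and> card A \<le> n - 2"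

definition free_on_boundary :: "nat \<Rightarrow> (nat set set \<Rightarrow>\<^sub>0 int) monoid" where
  "free_on_boundary n = free_Abelian_group {bipartition n A | A. boundary_index n A}"

definition relator :: "nat \<Rightarrow> nat list \<Rightarrow> nat set \<Rightarrow> nat set set \<Rightarrow>\<^sub>0 int" where
  "relator n \<gamma> I = frag_of (bipartition n I) -
     ((\<Sum>J\<in>even_segment_sets n \<gamma> I. frag_of (bipartition n J)) -
      (\<Sum>K\<in>odd_segment_sets n \<gamma> I. frag_of (bipartition n K)))"

definition relation_subgroup :: "nat \<Rightarrow> nat list \<Rightarrow> (nat set set \<Rightarrow>\<^sub>0 int) set" where
  "relation_subgroup n \<gamma> = generate (free_on_boundary n)
     {relator n \<gamma> I | I. boundary_index n I \<and> consecutive \<gamma> I}"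

end

theory Submission
  imports Defs "HOL-Computational_Algebra.Fundamental_Theorem_Algebra"
begin

text \<open>Give the marks \<open>i \<in> A\<close> the coordinates \<open>z i\<close> and the other marks the coordinates \<open>1 / (t * w j)\<close>, with
  two of the \<open>z i\<close> and two of the \<open>w j\<close> normalised to 0 and 1. For \<open>t \<noteq> 0\<close> these are smooth curves, for \<open>t = 0\<close>
  curves with two components, so one obtains a chart around the generic point of \<open>d\<^sub>A\<close>, isomorphic to the complement
  of a hypersurface in affine space. Prime divisors that meet the chart are irreducible polynomials there, and orders
  are multiplicities. That the charts are dense, and that every singular curve lies in the closure of a two-component
  stratum, is shown by smoothing trees of projective lines leaf by leaf.

  On the open stratum \<open>t \<noteq> 0\<close> polynomials factor uniquely, and the irreducible polynomials without zeros on it are, up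
  to constants, products of cross-ratios. So the Picard group is the free group on the boundary divisors modulo the
  divisors of the cross-ratios of marks \<open>i, j, k, l\<close>, which are the sums of \<open>(a i - a j) * (a k - a l)\<close> times \<open>d\<^sub>A\<close>,
  where \<open>a\<close> is the indicator function of \<open>A\<close>.

  If \<open>I\<close> occupies the positions \<open>p + 1, \<dots>, p + s\<close> of the polygon, then up to the sign the relation for \<open>I\<close> is the
  divisor of the cross-ratio of the marks at \<open>p, p + 1, p + s, p + s + 1\<close>: the factor \<open>a p - a (p + 1)\<close> is nonzero
  iff a term of the block-gap sequence of \<open>A\<close> ends at \<open>p\<close>, and the sign of the product is the parity of the segment.
  Telescoping along the polygon gives all cross-ratios of non-crossing pairs, and the identity
  \<open>(p - r) * (q - s) = (p - q) * (r - s) - (q - r) * (s - p)\<close> the remaining ones.\<close>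

section \<open>The ring of polynomial functions in countably many variables\<close>

text \<open>Orders along a divisor depend only on its generic point. Hence one chart per boundary
  divisor suffices, and since every chart contains the whole interior, a prime divisor that meets
  the interior may be examined in any of them. That the relations hold is a computation of orders;
  the hard half is that there are no others. For this all rational functions whose divisor is
  supported on the boundary have to be found, and here unique factorization is indispensable.

  Polynomials are taken as functions because the varieties are given by polynomial functions. A
  prime polynomial is tied to its zero set by a Nullstellensatz for hypersurfaces.

  A point of \<open>Mbar n\<close> is just a family of cross-ratios, and its neighbourhoods are
  explored through one-parameter families of curves. For these the order at \<open>t = 0\<close> and
  the lowest coefficient of each determinant of two marks determine the limit of every cross-ratio.
  The same families show that the cross-ratio of a stable curve does not depend on the component on
  which it is computed.\<close>

inductive polyfun :: "nat set \<Rightarrow> ((nat \<Rightarrow> complex) \<Rightarrow> complex) \<Rightarrow> bool" for V where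
  const: "polyfun V (\<lambda>_. c)"
| var: "v \<in> V \<Longrightarrow> polyfun V (\<lambda>x. x v)"
| add: "polyfun V f \<Longrightarrow> polyfun V g \<Longrightarrow> polyfun V (\<lambda>x. f x + g x)"
| mult: "polyfun V f \<Longrightarrow> polyfun V g \<Longrightarrow> polyfun V (\<lambda>x. f x * g x)"

typedef mp = "{f. polyfun UNIV f}" morphisms ev Mp
  by (rule exI[of _ "\<lambda>_. 0"]) (auto intro: polyfun.const)

setup_lifting type_definition_mp

lemma polyfun_ev: "polyfun UNIV (ev p)"
  using ev[of p] by simp

lemma mp_eqI: "(\<And>x. ev p x = ev q x) \<Longrightarrow> p = q"
  by (metis ev_inject ext)

lift_definition Cst :: "complex \<Rightarrow> mp" is "\<lambda>c _. c" by (rule polyfun.const)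
lift_definition Var :: "nat \<Rightarrow> mp" is "\<lambda>v x. x v" by (rule polyfun.var) simp

instantiation mp :: comm_ring_1
begin
lift_definition zero_mp :: mp is "\<lambda>_. 0" by (rule polyfun.const)
lift_definition one_mp :: mp is "\<lambda>_. 1" by (rule polyfun.const)
lift_definition plus_mp :: "mp \<Rightarrow> mp \<Rightarrow> mp" is "\<lambda>f g x. f x + g x" by (rule polyfun.add)
lift_definition times_mp :: "mp \<Rightarrow> mp \<Rightarrow> mp" is "\<lambda>f g x. f x * g x" by (rule polyfun.mult)
lift_definition uminus_mp :: "mp \<Rightarrow> mp" is "\<lambda>f x. - f x"
proof -
  fix f :: "(nat \<Rightarrow> complex) \<Rightarrow> complex"
  assume "polyfun UNIV f"
  then have "polyfun UNIV (\<lambda>x. (-1) * f x)"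
    by (intro polyfun.mult polyfun.const)
  then show "polyfun UNIV (\<lambda>x. - f x)" by simp
qed
lift_definition minus_mp :: "mp \<Rightarrow> mp \<Rightarrow> mp" is "\<lambda>f g x. f x - g x"
proof -
  fix f g :: "(nat \<Rightarrow> complex) \<Rightarrow> complex"
  assume "polyfun UNIV f" "polyfun UNIV g"
  then have "polyfun UNIV (\<lambda>x. f x + (-1) * g x)"
    by (intro polyfun.add polyfun.mult polyfun.const)
  then show "polyfun UNIV (\<lambda>x. f x - g x)" by simp
qed
instance
  by standard (transfer; simp add: algebra_simps fun_eq_iff)+
end

lemma ev_simps [simp]:
  "ev (Cst c) x = c" "ev (Var v) x = x v" "ev 0 x = 0" "ev 1 x = 1"
  "ev (p + q) x = ev p x + ev q x" "ev (p * q) x = ev p x * ev q x"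
  "ev (- p) x = - ev p x" "ev (p - q) x = ev p x - ev q x"
  by (simp_all add: Cst.rep_eq Var.rep_eq zero_mp.rep_eq one_mp.rep_eq plus_mp.rep_eq
      times_mp.rep_eq uminus_mp.rep_eq minus_mp.rep_eq)

lemma ev_power [simp]: "ev (p ^ k) x = ev p x ^ k"
  by (induction k) auto

lemma ev_sum [simp]: "ev (\<Sum>i\<in>A. f i) x = (\<Sum>i\<in>A. ev (f i) x)"
  by (induction A rule: infinite_finite_induct) auto

lemma ev_prod [simp]: "ev (\<Prod>i\<in>A. f i) x = (\<Prod>i\<in>A. ev (f i) x)"
  by (induction A rule: infinite_finite_induct) auto

lemma Cst_0 [simp]: "Cst 0 = 0" and Cst_1 [simp]: "Cst 1 = 1"
  by (auto intro!: mp_eqI)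

lemma Cst_mult: "Cst (a * b) = Cst a * Cst b"
  by (auto intro!: mp_eqI)

text \<open>Dependence is expressed by values, not by an expression. Intersections of variable sets
  and factors of polynomials are then handled by evaluating at points;
  \<open>vars_in_polyfun\<close> recovers an expression in the given variables.\<close>

definition vars_in :: "nat set \<Rightarrow> mp \<Rightarrow> bool" where
  "vars_in V p \<longleftrightarrow> (\<forall>x y. (\<forall>v\<in>V. x v = y v) \<longrightarrow> ev p x = ev p y)"

lemma vars_inD: "vars_in V p \<Longrightarrow> (\<And>v. v \<in> V \<Longrightarrow> x v = y v) \<Longrightarrow> ev p x = ev p y"
  unfolding vars_in_def by blast

lemma vars_in_mono: "vars_in V p \<Longrightarrow> V \<subseteq> W \<Longrightarrow> vars_in W p"
  unfolding vars_in_def by blast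

lemma vars_in_UNIV [simp]: "vars_in UNIV p"
  unfolding vars_in_def by (metis UNIV_I ext)

lemma vars_in_simps [simp]:
  "vars_in V (Cst c)" "vars_in V 0" "vars_in V 1" "v \<in> V \<Longrightarrow> vars_in V (Var v)"
  "vars_in V p \<Longrightarrow> vars_in V q \<Longrightarrow> vars_in V (p + q)"
  "vars_in V p \<Longrightarrow> vars_in V q \<Longrightarrow> vars_in V (p * q)"
  "vars_in V p \<Longrightarrow> vars_in V q \<Longrightarrow> vars_in V (p - q)"
  "vars_in V p \<Longrightarrow> vars_in V (- p)"
  unfolding vars_in_def by (auto, metis+)

lemma vars_in_power [simp]: "vars_in V p \<Longrightarrow> vars_in V (p ^ k)"
  by (induction k) auto

lemma vars_in_sum: "(\<And>i. i \<in> A \<Longrightarrow> vars_in V (f i)) \<Longrightarrow> vars_in V (\<Sum>i\<in>A. f i)"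
  by (induction A rule: infinite_finite_induct) auto

lemma vars_in_prod: "(\<And>i. i \<in> A \<Longrightarrow> vars_in V (f i)) \<Longrightarrow> vars_in V (\<Prod>i\<in>A. f i)"
  by (induction A rule: infinite_finite_induct) auto

text \<open>A point that follows \<open>x\<close> on \<open>V\<close> and \<open>y\<close> elsewhere
  agrees with \<open>x\<close> on \<open>V\<close> and with \<open>y\<close> on
  \<open>W\<close>.\<close>

lemma vars_in_Int:
  assumes "vars_in V p" "vars_in W p"
  shows "vars_in (V \<inter> W) p"
  unfolding vars_in_def
proof (intro allI impI)
  fix x y :: "nat \<Rightarrow> complex"
  assume xy: "\<forall>v\<in>V \<inter> W. x v = y v"
  define z where "z = (\<lambda>v. if v \<in> V then x v else y v)"
  have "ev p x = ev p z" by (rule vars_inD[OF assms(1)]) (simp add: z_def)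
  also have "\<dots> = ev p y" by (rule vars_inD[OF assms(2)]) (use xy in \<open>auto simp: z_def\<close>)
  finally show "ev p x = ev p y" .
qed

definition restr :: "nat set \<Rightarrow> (nat \<Rightarrow> complex) \<Rightarrow> nat \<Rightarrow> complex" where
  "restr V x = (\<lambda>v. if v \<in> V then x v else 0)"

lemma polyfun_restr: "polyfun W f \<Longrightarrow> polyfun V (\<lambda>x. f (restr V x))"
proof (induction rule: polyfun.induct)
  case (var v)
  then show ?case by (cases "v \<in> V") (auto simp: restr_def intro: polyfun.intros)
qed (auto intro: polyfun.intros)

text \<open>Setting the coordinates outside \<open>V\<close> to 0 does not change the values and
  turns any expression into one that uses only variables of \<open>V\<close>.\<close>

lemma vars_in_polyfun: "vars_in V p \<Longrightarrow> polyfun V (ev p)"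
proof -
  assume "vars_in V p"
  then have "ev p = (\<lambda>x. ev p (restr V x))"
    by (auto intro!: ext vars_inD[of V] simp: restr_def)
  then show ?thesis using polyfun_restr[OF polyfun_ev, of V p] by simp
qed

text \<open>Induction along an expression in the variables of \<open>V\<close>, for elements that
  are only known to depend on these variables.\<close>

lemma mp_induct [consumes 1, case_names const var add mult]:
  assumes "vars_in V p"
    and Cst: "\<And>c. P (Cst c)" and Var: "\<And>v. v \<in> V \<Longrightarrow> P (Var v)"
    and add: "\<And>p q. vars_in V p \<Longrightarrow> vars_in V q \<Longrightarrow> P p \<Longrightarrow> P q \<Longrightarrow> P (p + q)"
    and mult: "\<And>p q. vars_in V p \<Longrightarrow> vars_in V q \<Longrightarrow> P p \<Longrightarrow> P q \<Longrightarrow> P (p * q)"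
  shows "P p"
proof -
  have *: "\<exists>p. ev p = f \<and> vars_in V p \<and> P p" if "polyfun V f" for f
    using that
  proof (induction rule: polyfun.induct)
    case (const c)
    then show ?case using Cst[of c] by (intro exI[of _ "Cst c"]) auto
  next
    case (var v)
    then show ?case using Var[of v] by (intro exI[of _ "Var v"]) auto
  next
    case (add f g)
    then obtain p q where "ev p = f" "vars_in V p" "P p" "ev q = g" "vars_in V q" "P q" by blast
    then show ?case using assms(4)[of p q] by (intro exI[of _ "p + q"]) auto
  next
    case (mult f g)
    then obtain p q where "ev p = f" "vars_in V p" "P p" "ev q = g" "vars_in V q" "P q" by blast
    then show ?case using assms(5)[of p q] by (intro exI[of _ "p * q"]) auto
  qed
  show ?thesis using *[OF vars_in_polyfun[OF assms(1)]] by (metis mp_eqI)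
qed

lemma ex_finite_vars: "\<exists>V. finite V \<and> vars_in V p"
  using vars_in_UNIV[of p]
proof (induction rule: mp_induct)
  case (const c) then show ?case by (intro exI[of _ "{}"]) auto
next
  case (var v) then show ?case by (intro exI[of _ "{v}"]) auto
next
  case (add p q)
  then obtain V W where "finite V" "vars_in V p" "finite W" "vars_in W q" by blast
  then show ?case using vars_in_mono[of V p "V \<union> W"] vars_in_mono[of W q "V \<union> W"]
    by (intro exI[of _ "V \<union> W"]) simp
next
  case (mult p q)
  then obtain V W where "finite V" "vars_in V p" "finite W" "vars_in W q" by blast
  then show ?case using vars_in_mono[of V p "V \<union> W"] vars_in_mono[of W q "V \<union> W"]
    by (intro exI[of _ "V \<union> W"]) simp
qed

lemma ev_on_line: "\<exists>P. \<forall>s. ev p (\<lambda>v. x v + s * y v) = poly P s"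
  using vars_in_UNIV[of p]
proof (induction rule: mp_induct)
  case (const c) then show ?case by (intro exI[of _ "[:c:]"]) auto
next
  case (var v) then show ?case by (intro exI[of _ "[:x v, y v:]"]) auto
next
  case (add p q)
  then obtain P Q where "\<forall>s. ev p (\<lambda>v. x v + s * y v) = poly P s"
    "\<forall>s. ev q (\<lambda>v. x v + s * y v) = poly Q s" by blast
  then show ?case by (intro exI[of _ "P + Q"]) simp
next
  case (mult p q)
  then obtain P Q where "\<forall>s. ev p (\<lambda>v. x v + s * y v) = poly P s"
    "\<forall>s. ev q (\<lambda>v. x v + s * y v) = poly Q s" by blast
  then show ?case by (intro exI[of _ "P * Q"]) simp
qed

text \<open>Join a point where \<open>p\<close> is nonzero to a point where \<open>q\<close> is
  nonzero by a line. On the line both become nonzero univariate polynomials, and their product has a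
  nonroot.\<close>

instance mp :: idom
proof
  fix p q :: mp
  assume "p \<noteq> 0" "q \<noteq> 0"
  then obtain x y where xy: "ev p x \<noteq> 0" "ev q y \<noteq> 0" by (metis ev_simps(3) mp_eqI)
  obtain P Q where P: "\<And>s. ev p (\<lambda>v. x v + s * (y v - x v)) = poly P s"
    and Q: "\<And>s. ev q (\<lambda>v. x v + s * (y v - x v)) = poly Q s"
    using ev_on_line[of p x "\<lambda>v. y v - x v"] ev_on_line[of q x "\<lambda>v. y v - x v"] by auto
  have "P \<noteq> 0" using P[of 0] xy by auto
  moreover have "Q \<noteq> 0" using Q[of 1] xy by auto
  ultimately have "P * Q \<noteq> 0" by simp
  then obtain s where "poly (P * Q) s \<noteq> 0" using poly_all_0_iff_0 by blast
  then have "ev (p * q) (\<lambda>v. x v + s * (y v - x v)) \<noteq> 0" using P Q by simp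
  then show "p * q \<noteq> 0" by (metis ev_simps(3))
qed

instantiation mp :: idom_divide
begin
definition divide_mp :: "mp \<Rightarrow> mp \<Rightarrow> mp" where
  "divide_mp p q = (if q = 0 then 0 else if q dvd p then THE r. p = r * q else 0)"
instance
proof
  fix p q :: mp assume "q \<noteq> 0"
  then show "p * q div q = p" by (auto simp: divide_mp_def)
qed (simp add: divide_mp_def)
end

instance mp :: algebraic_semidom ..

lemma mp_nonzero_ev: "p \<noteq> 0 \<Longrightarrow> \<exists>x. ev p x \<noteq> 0"
  by (metis ev_simps(3) mp_eqI)

section \<open>Unique factorization\<close>

definition coeffs_in :: "nat set \<Rightarrow> mp poly \<Rightarrow> bool" where
  "coeffs_in V F \<longleftrightarrow> (\<forall>i. vars_in V (coeff F i))"

lemma coeffs_in_0 [simp]: "coeffs_in V 0"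
  by (simp add: coeffs_in_def)

lemma coeffs_in_add: "coeffs_in V F \<Longrightarrow> coeffs_in V G \<Longrightarrow> coeffs_in V (F + G)"
  and coeffs_in_diff: "coeffs_in V F \<Longrightarrow> coeffs_in V G \<Longrightarrow> coeffs_in V (F - G)"
  and coeffs_in_mult: "coeffs_in V F \<Longrightarrow> coeffs_in V G \<Longrightarrow> coeffs_in V (F * G)"
  and coeffs_in_smult: "coeffs_in V F \<Longrightarrow> vars_in V c \<Longrightarrow> coeffs_in V (smult c F)"
  and coeffs_in_mono: "coeffs_in V F \<Longrightarrow> V \<subseteq> W \<Longrightarrow> coeffs_in W F"
  by (auto simp: coeffs_in_def coeff_mult intro!: vars_in_sum intro: vars_in_mono)

lemma coeffs_in_pCons [intro]: "vars_in V c \<Longrightarrow> coeffs_in V F \<Longrightarrow> coeffs_in V (pCons c F)"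
  by (auto simp: coeffs_in_def coeff_pCons split: nat.split)

lemma ex_poly_in_var:
  assumes "vars_in (insert v V) p"
  shows "\<exists>F. coeffs_in V F \<and> p = poly F (Var v)"
  using assms
proof (induction rule: mp_induct)
  case (const c) then show ?case by (intro exI[of _ "[:Cst c:]"]) (auto intro: coeffs_in_pCons)
next
  case (var w)
  show ?case
  proof (cases "w = v")
    case True
    then show ?thesis by (intro exI[of _ "[:0, 1:]"] conjI coeffs_in_pCons) auto
  next
    case False
    then show ?thesis using var by (intro exI[of _ "[:Var w:]"]) (auto intro: coeffs_in_pCons)
  qed
next
  case (add p q) then show ?case by (metis coeffs_in_add poly_add)
next
  case (mult p q) then show ?case by (metis coeffs_in_mult poly_mult)
qed

lemma ev_poly_upd:
  assumes "coeffs_in (- {v}) F"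
  shows "ev (poly F (Var v)) (x(v := s)) = poly (map_poly (\<lambda>c. ev c x) F) s"
  using assms
proof (induction F)
  case (pCons c F)
  have "coeffs_in (- {v}) F"
    unfolding coeffs_in_def using pCons(3) by (metis coeff_pCons_Suc coeffs_in_def)
  moreover have "ev c (x(v := s)) = ev c x"
    using pCons(3) by (intro vars_inD[of "- {v}"]) (auto simp: coeffs_in_def coeff_pCons split: nat.splits)
  moreover have "(x(v := s)) v = s" by simp
  ultimately show ?case using pCons by (simp add: map_poly_pCons del: fun_upd_apply)
qed auto

text \<open>For fixed values of the other variables both sides are univariate polynomials with the
  same values, so each coefficient agrees at every point.\<close>

lemma poly_in_var_unique:
  assumes "coeffs_in (- {v}) F" "coeffs_in (- {v}) G" "poly F (Var v) = poly G (Var v)"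
  shows "F = G"
proof (rule poly_eqI, rule mp_eqI)
  fix i x
  have "poly (map_poly (\<lambda>c. ev c x) F) = poly (map_poly (\<lambda>c. ev c x) G)"
    using ev_poly_upd[OF assms(1), of x] ev_poly_upd[OF assms(2), of x] assms(3) by auto
  then have "coeff (map_poly (\<lambda>c. ev c x) F) i = coeff (map_poly (\<lambda>c. ev c x) G) i"
    by (simp add: poly_eq_poly_eq_iff)
  then show "ev (coeff F i) x = ev (coeff G i) x" by (simp add: coeff_map_poly)
qed

definition in_var :: "nat \<Rightarrow> mp \<Rightarrow> mp poly" where
  "in_var v p = (THE F. coeffs_in (- {v}) F \<and> p = poly F (Var v))"

lemma in_var_eqI: "coeffs_in (- {v}) F \<Longrightarrow> p = poly F (Var v) \<Longrightarrow> in_var v p = F"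
  unfolding in_var_def by (rule the_equality) (auto intro: poly_in_var_unique)

lemma in_var: "coeffs_in (- {v}) (in_var v p)" "poly (in_var v p) (Var v) = p"
proof -
  have "insert v (- {v}) = UNIV" by auto
  then obtain F where "coeffs_in (- {v}) F" "p = poly F (Var v)"
    using ex_poly_in_var[of v "- {v}" p] by auto
  then show "coeffs_in (- {v}) (in_var v p)" "poly (in_var v p) (Var v) = p"
    using in_var_eqI by auto
qed

lemma coeffs_in_in_var:
  assumes "vars_in (insert v V) p" "v \<notin> V"
  shows "coeffs_in V (in_var v p)"
proof -
  obtain F where F: "coeffs_in V F" "p = poly F (Var v)" using ex_poly_in_var[OF assms(1)] by blast
  then have "in_var v p = F"
    using assms(2) by (intro in_var_eqI) (auto intro: coeffs_in_mono)
  then show ?thesis using F by simp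
qed

lemma in_var_mult: "in_var v (p * q) = in_var v p * in_var v q"
  by (rule in_var_eqI) (simp_all add: in_var coeffs_in_mult)

lemma in_var_indep: "vars_in (- {v}) p \<Longrightarrow> in_var v p = [:p:]"
  by (rule in_var_eqI) (auto intro: coeffs_in_pCons)

lemma in_var_eq_0_iff [simp]: "in_var v p = 0 \<longleftrightarrow> p = 0"
  by (metis in_var(2) in_var_indep pCons_0_0 poly_0 vars_in_simps(2))

definition degv :: "nat \<Rightarrow> mp \<Rightarrow> nat" where
  "degv v p = degree (in_var v p)"

lemma degv_mult: "p \<noteq> 0 \<Longrightarrow> q \<noteq> 0 \<Longrightarrow> degv v (p * q) = degv v p + degv v q"
  by (simp add: degv_def in_var_mult degree_mult_eq)

lemma degv_eq_0_iff: "degv v p = 0 \<longleftrightarrow> vars_in (- {v}) p"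
proof
  assume "degv v p = 0"
  then obtain c where c: "in_var v p = [:c:]" by (metis degv_def degree_eq_zeroE)
  then have "vars_in (- {v}) c" using in_var(1)[of v p] by (metis coeff_pCons_0 coeffs_in_def)
  then show "vars_in (- {v}) p" using in_var(2)[of v p] c by simp
qed (simp add: degv_def in_var_indep)

text \<open>Some finite set of variables suffices for \<open>p\<close>; its members outside
  \<open>V\<close> are removed one at a time by \<open>vars_in_Int\<close>.\<close>

lemma degv_eq_0_vars_in:
  assumes "\<And>v. v \<notin> V \<Longrightarrow> degv v p = 0"
  shows "vars_in V p"
proof -
  obtain W where W: "finite W" "vars_in W p" using ex_finite_vars by blast
  have "vars_in (W - S) p" if "finite S" "S \<inter> V = {}" for S
    using that
  proof (induction S rule: finite_induct)
    case (insert v S)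
    then have "vars_in ((W - S) \<inter> - {v}) p"
      using assms[of v] by (intro vars_in_Int) (auto simp: degv_eq_0_iff)
    moreover have "(W - S) \<inter> - {v} = W - insert v S" by auto
    ultimately show ?case by simp
  qed (use W in auto)
  from this[of "W - V"] have "vars_in (W - (W - V)) p" using W(1) by blast
  then show ?thesis by (rule vars_in_mono) auto
qed

lemma degv_notin: "vars_in V p \<Longrightarrow> v \<notin> V \<Longrightarrow> degv v p = 0"
  by (auto simp: degv_eq_0_iff intro: vars_in_mono)

text \<open>Degrees in each variable add, so a factor has degree 0 wherever the product has.\<close>

lemma vars_in_factor:
  assumes "vars_in V (p * q)" "p * q \<noteq> 0"
  shows "vars_in V p"
  using assms degv_mult[of p q] degv_notin[OF assms(1)] by (intro degv_eq_0_vars_in) auto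

lemma vars_in_dvd: "p dvd q \<Longrightarrow> q \<noteq> 0 \<Longrightarrow> vars_in V q \<Longrightarrow> vars_in V p"
  by (metis dvd_def vars_in_factor)

lemma vars_in_empty: "vars_in {} p \<Longrightarrow> \<exists>c. p = Cst c"
  by (intro exI[of _ "ev p (\<lambda>_. 0)"] mp_eqI) (auto intro: vars_inD[of "{}"])

lemma is_unit_Cst: "c \<noteq> 0 \<Longrightarrow> is_unit (Cst c)"
proof -
  assume "c \<noteq> 0"
  then have "Cst c * Cst (1 / c) = 1" by (simp flip: Cst_mult)
  then show ?thesis by (metis dvd_triv_left)
qed

lemma is_unit_mp_iff: "is_unit p \<longleftrightarrow> (\<exists>c. c \<noteq> 0 \<and> p = Cst c)"
proof
  assume *: "is_unit p"
  then have "vars_in {} p" by (rule vars_in_dvd) auto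
  then obtain c where "p = Cst c" using vars_in_empty by blast
  then show "\<exists>c. c \<noteq> 0 \<and> p = Cst c" using * by (cases "c = 0") auto
qed (auto simp: is_unit_Cst)

text \<open>The sum of the degrees in the finitely many variables of \<open>p\<close> is additive on
  products and vanishes only on units, so it decreases when a nontrivial factor is split
  off.\<close>

lemma irreducible_factorization:
  fixes p :: mp
  assumes "p \<noteq> 0"
  shows "\<exists>u A. is_unit u \<and> (\<forall>q\<in>#A. irreducible q) \<and> p = u * prod_mset A"
proof -
  obtain V where V: "finite V" "vars_in V p" using ex_finite_vars by blast
  define m where "m = (\<lambda>p. \<Sum>v\<in>V. degv v p)"
  have m_mult: "m (p * q) = m p + m q" if "p \<noteq> 0" "q \<noteq> 0" for p q
    using that by (simp add: m_def degv_mult sum.distrib)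
  have unit: "is_unit p" if "m p = 0" "vars_in V p" "p \<noteq> 0" for p
  proof -
    have "degv v p = 0" for v
      using that V degv_notin[of V p v] by (cases "v \<in> V") (auto simp: m_def)
    then have "vars_in {} p" by (intro degv_eq_0_vars_in) auto
    then show ?thesis using that vars_in_empty by (metis Cst_0 is_unit_Cst)
  qed
  show ?thesis using V(2) assms
  proof (induction "m p" arbitrary: p rule: less_induct)
    case less
    consider "is_unit p" | "irreducible p" | "\<not> is_unit p" "\<not> irreducible p" by blast
    then show ?case
    proof cases
      case 1
      then show ?thesis by (intro exI[of _ p] exI[of _ "{#}"]) auto
    next
      case 2
      then show ?thesis by (intro exI[of _ 1] exI[of _ "{#p#}"]) auto
    next
      case 3
      then obtain a b where ab: "p = a * b" "\<not> is_unit a" "\<not> is_unit b"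
        using less(3) by (auto simp: irreducible_def)
      have nz: "a \<noteq> 0" "b \<noteq> 0" using ab less by auto
      have va: "vars_in V a" "vars_in V b" using vars_in_factor[of V a b] vars_in_factor[of V b a] less ab
        by (auto simp: mult.commute)
      have "m a > 0" "m b > 0" using unit ab nz va by blast+
      then have "m a < m p" "m b < m p" using m_mult nz ab by auto
      then obtain u A w B where "is_unit u" "\<forall>q\<in>#A. irreducible q" "a = u * prod_mset A"
        "is_unit w" "\<forall>q\<in>#B. irreducible q" "b = w * prod_mset B"
        using less(1)[OF _ va(1) nz(1)] less(1)[OF _ va(2) nz(2)] by blast
      then show ?thesis
        by (intro exI[of _ "u * w"] exI[of _ "A + B"]) (auto simp: ab mult_ac)
    qed
  qed
qed

text \<open>Long division in which \<open>F\<close> is multiplied by the leading coefficient of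
  \<open>H\<close> before each step, so that nothing has to be divided in the coefficient
  ring.\<close>

lemma pseudo_division:
  assumes "coeffs_in V H" "degree H > 0" "coeffs_in V F"
  shows "\<exists>k Q R. coeffs_in V Q \<and> coeffs_in V R \<and> smult (lead_coeff H ^ k) F = H * Q + R \<and>
    degree R < degree H"
  using assms(3)
proof (induction "degree F" arbitrary: F rule: less_induct)
  case less
  show ?case
  proof (cases "degree F < degree H")
    case True
    then show ?thesis using less by (intro exI[of _ 0] exI[of _ F]) (auto intro!: exI[of _ 0])
  next
    case False
    define M where "M = monom (lead_coeff F) (degree F - degree H)"
    define F' where "F' = smult (lead_coeff H) F - H * M"
    have cM: "coeffs_in V M" using less(2) by (auto simp: M_def coeffs_in_def)
    have c: "coeffs_in V F'" unfolding F'_def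
      using less(2) assms(1) cM by (intro coeffs_in_diff coeffs_in_smult coeffs_in_mult) (auto simp: coeffs_in_def)
    have "degree (H * M) \<le> degree F"
      using degree_mult_le[of H M] False degree_monom_le[of "lead_coeff F" "degree F - degree H"]
      by (simp add: M_def)
    then have "degree F' \<le> degree F"
      unfolding F'_def by (intro degree_diff_le) (auto simp: degree_smult_le)
    moreover have "coeff (H * M) (degree F) = lead_coeff H * lead_coeff F"
      using False by (simp add: M_def mult.commute[of H] coeff_monom_mult)
    then have "coeff F' (degree F) = 0" unfolding F'_def by simp
    ultimately have "degree F' < degree F" using False assms(2)
      by (metis coeff_0_degree_minus_1 degree_0 leading_coeff_0_iff le_neq_implies_less linorder_not_le order_less_le_trans)
    then obtain k Q R where kQR: "coeffs_in V Q" "coeffs_in V R"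
      "smult (lead_coeff H ^ k) F' = H * Q + R" "degree R < degree H"
      using less(1)[OF _ c] by blast
    have "smult (lead_coeff H ^ Suc k) F = smult (lead_coeff H ^ k) F' + smult (lead_coeff H ^ k) (H * M)"
      unfolding F'_def by (simp add: smult_diff_right mult.commute)
    also have "\<dots> = H * (Q + smult (lead_coeff H ^ k) M) + R"
      using kQR(3) by (simp add: algebra_simps)
    finally have "smult (lead_coeff H ^ Suc k) F = H * (Q + smult (lead_coeff H ^ k) M) + R" .
    moreover have "coeffs_in V (Q + smult (lead_coeff H ^ k) M)"
      using kQR(1) cM assms(1) by (intro coeffs_in_add coeffs_in_smult) (auto simp: coeffs_in_def)
    ultimately show ?thesis using kQR by blast
  qed
qed

text \<open>The induction on the number of variables works with the following relative notion.\<close>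

definition primes_in :: "nat set \<Rightarrow> nat set \<Rightarrow> bool" where
  "primes_in V W \<longleftrightarrow> (\<forall>p f g. irreducible p \<longrightarrow> vars_in V p \<longrightarrow> vars_in W f \<longrightarrow> vars_in W g \<longrightarrow>
     p dvd f * g \<longrightarrow> p dvd f \<or> p dvd g)"

lemma const_dvd_in_var:
  assumes "vars_in (- {v}) c"
  shows "c dvd p \<longleftrightarrow> (\<forall>i. c dvd coeff (in_var v p) i)"
proof
  assume "c dvd p"
  then obtain q where "p = c * q" by blast
  then have "in_var v p = smult c (in_var v q)" using assms by (simp add: in_var_mult in_var_indep)
  then show "\<forall>i. c dvd coeff (in_var v p) i" by simp
next
  assume "\<forall>i. c dvd coeff (in_var v p) i"
  then have "[:c:] dvd in_var v p" by (simp add: const_poly_dvd_iff)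
  then obtain Q where "in_var v p = [:c:] * Q" by blast
  then have "p = poly ([:c:] * Q) (Var v)" by (metis in_var(2))
  then show "c dvd p" by simp
qed

text \<open>Gauss's argument: take the first coefficients of \<open>f\<close> and of
  \<open>g\<close> that \<open>c\<close> does not divide. The coefficient of \<open>f * g\<close> at
  the sum of their indices is their product up to multiples of \<open>c\<close>.\<close>

lemma gauss_lemma:
  assumes "primes_in V V" "v \<notin> V"
  shows "primes_in V (insert v V)"
  unfolding primes_in_def
proof (intro allI impI)
  fix c f g
  assume c: "irreducible c" "vars_in V c" and f: "vars_in (insert v V) f" and g: "vars_in (insert v V) g"
    and dvd: "c dvd f * g"
  have cv: "vars_in (- {v}) c" using c(2) assms(2) by (auto intro: vars_in_mono)
  define F G where "F = in_var v f" and "G = in_var v g"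
  have cF: "\<And>i. vars_in V (coeff F i)" "\<And>i. vars_in V (coeff G i)"
    using coeffs_in_in_var[OF f assms(2)] coeffs_in_in_var[OF g assms(2)]
    by (auto simp: coeffs_in_def F_def G_def)
  show "c dvd f \<or> c dvd g"
  proof (rule ccontr)
    assume "\<not> (c dvd f \<or> c dvd g)"
    then have ex: "\<exists>i. \<not> c dvd coeff F i" "\<exists>i. \<not> c dvd coeff G i"
      using const_dvd_in_var[OF cv, of f] const_dvd_in_var[OF cv, of g] unfolding F_def G_def by blast+
    define i j where "i = (LEAST i. \<not> c dvd coeff F i)" and "j = (LEAST i. \<not> c dvd coeff G i)"
    have i: "\<not> c dvd coeff F i" "\<And>k. k < i \<Longrightarrow> c dvd coeff F k"
      unfolding i_def using LeastI_ex[OF ex(1)] not_less_Least by blast+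
    have j: "\<not> c dvd coeff G j" "\<And>k. k < j \<Longrightarrow> c dvd coeff G k"
      unfolding j_def using LeastI_ex[OF ex(2)] not_less_Least by blast+
    have "c dvd coeff (F * G) (i + j)"
      using dvd const_dvd_in_var[OF cv, of "f * g"] by (simp add: in_var_mult F_def G_def)
    also have "coeff (F * G) (i + j) = coeff F i * coeff G j +
        (\<Sum>k\<in>{..i + j} - {i}. coeff F k * coeff G (i + j - k))"
      unfolding coeff_mult by (subst sum.remove[of _ i]) auto
    finally have *: "c dvd coeff F i * coeff G j +
        (\<Sum>k\<in>{..i + j} - {i}. coeff F k * coeff G (i + j - k))" .
    have "c dvd (\<Sum>k\<in>{..i + j} - {i}. coeff F k * coeff G (i + j - k))"
    proof (rule dvd_sum)
      fix k assume k: "k \<in> {..i + j} - {i}"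
      then consider "k < i" | "i + j - k < j" by force
      then show "c dvd coeff F k * coeff G (i + j - k)" using i(2) j(2) by cases auto
    qed
    then have "c dvd coeff F i * coeff G j" using * dvd_add_left_iff by blast
    then show False using assms(1) c cF i(1) j(1) unfolding primes_in_def by blast
  qed
qed

text \<open>The irreducible factors \<open>q\<close> of \<open>d\<close> are cancelled one by one.
  Such a \<open>q\<close> is prime for the larger variable set, and it cannot divide
  \<open>p\<close>: then \<open>p\<close> would be an associate of \<open>q\<close> and so free of
  the new variables.\<close>

lemma dvd_cancel_const:
  assumes pr: "primes_in V W" and p: "irreducible p" "vars_in W p" "\<not> vars_in V p"
    and d: "d \<noteq> 0" "vars_in V d" and f: "vars_in W f" and VW: "V \<subseteq> W" and dvd: "p dvd d * f"
  shows "p dvd f"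
proof -
  obtain u A where uA: "is_unit u" "\<forall>q\<in>#A. irreducible q" "d = u * prod_mset A"
    using irreducible_factorization[OF d(1)] by blast
  have "vars_in V q" if "q \<in># A" for q
    using that uA d by (intro vars_in_dvd[OF _ d]) (auto intro: dvd_prod_mset dvd_mult)
  then have A: "\<forall>q\<in>#A. irreducible q \<and> vars_in V q" using uA by blast
  have "p dvd prod_mset A * f"
    using dvd uA by (simp add: mult.assoc dvd_mult_unit_iff')
  then show ?thesis using A
  proof (induction A)
    case (add q A)
    obtain s where s: "p * s = q * (prod_mset A * f)"
      using add.prems(1) by (metis dvd_def mult.assoc prod_mset.add_mset)
    show ?case
    proof (cases "f = 0")
      case False
      have Anz: "q * prod_mset A \<noteq> 0" using add.prems(2) by (auto simp: irreducible_def)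
      have vA: "vars_in W (prod_mset A)" using add.prems(2) VW
        by (induction A) (auto intro!: vars_in_simps intro: vars_in_mono)
      have vs: "vars_in W s"
      proof (rule vars_in_factor[of W s p])
        have "vars_in W q" using add.prems(2) VW by (auto intro: vars_in_mono)
        then show "vars_in W (s * p)" using s f vA by (metis mult.commute vars_in_simps(6))
        show "s * p \<noteq> 0" using s Anz False by (auto simp: mult.commute)
      qed
      have "q dvd p \<or> q dvd s"
        using pr add.prems(2) p vs s unfolding primes_in_def by (metis dvd_triv_left union_single_eq_member)
      moreover have "\<not> q dvd p"
      proof
        assume "q dvd p"
        then obtain m where m: "p = q * m" by blast
        have "is_unit m" using p(1) m add.prems(2) irreducible_def by (metis union_single_eq_member)
        then have "vars_in V m" by (auto simp: is_unit_mp_iff)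
        then show False using m p(3) add.prems(2) by simp
      qed
      ultimately obtain s' where "s = q * s'" by blast
      then have "q * (p * s') = q * (prod_mset A * f)" using s by (simp add: mult_ac)
      then have "p * s' = prod_mset A * f" using Anz by simp
      then show ?thesis using add by (metis dvd_triv_left union_iff add_mset_add_single)
    qed auto
  qed auto
qed

text \<open>Each irreducible factor of \<open>d\<close> is absorbed by \<open>q\<close> or by
  \<open>h\<close>. What remains is a factorization of the irreducible \<open>p\<close> in which the
  part of \<open>h\<close> still involves a new variable; it is therefore not a unit, and the other
  part is.\<close>

lemma dvd_cancel_const':
  assumes pr: "primes_in V W" and p: "irreducible p" "vars_in W p"
    and d: "d \<noteq> 0" "vars_in V d" and VW: "V \<subseteq> W" and h: "vars_in W h" "\<not> vars_in V h"
    and eq: "d * p = q * h" and q: "vars_in W q"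
  shows "p dvd h"
proof -
  obtain u A where uA: "is_unit u" "\<forall>q\<in>#A. irreducible q" "d = u * prod_mset A"
    using irreducible_factorization[OF d(1)] by blast
  have "vars_in V q" if "q \<in># A" for q
    using that uA d by (intro vars_in_dvd[OF _ d]) (auto intro: dvd_prod_mset dvd_mult)
  then have A: "\<forall>q\<in>#A. irreducible q \<and> vars_in V q" using uA by blast
  have claim: "p dvd h" if "prod_mset A * p = q * h" "vars_in W q" "vars_in W h" "\<not> vars_in V h"
    for q h using A that
  proof (induction A arbitrary: q h)
    case empty
    then have "is_unit q \<or> is_unit h" using p(1) by (auto simp: irreducible_def)
    moreover have "\<not> is_unit h" using empty by (auto simp: is_unit_mp_iff)
    ultimately show ?case using empty(2) by (simp add: mult_unit_dvd_iff')
  next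
    case (add x A)
    have x: "irreducible x" "vars_in V x" and xnz: "x \<noteq> 0" using add.prems(1) by auto
    have nz: "prod_mset (add_mset x A) * p \<noteq> 0"
      using add.prems(1) p(1) by (auto simp: prod_mset_zero_iff)
    have qh: "q \<noteq> 0" "h \<noteq> 0" using nz add.prems(2) by auto
    have "x dvd q * h" using add.prems(2) by (metis dvd_triv_left mult.assoc prod_mset.add_mset)
    then have "x dvd q \<or> x dvd h"
      using pr x add.prems(3,4) unfolding primes_in_def by blast
    then consider "x dvd q" | "x dvd h" by blast
    then show ?case
    proof cases
      case 1
      then obtain q' where q': "q = x * q'" by blast
      have "vars_in W q'" using add.prems(3) q' qh by (intro vars_in_factor[of W q' x]) (auto simp: mult.commute)
      moreover have "x * (prod_mset A * p) = x * (q' * h)" using add.prems(2) q' by (simp add: mult_ac)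
      then have "prod_mset A * p = q' * h" using xnz by simp
      ultimately show ?thesis using add by (auto simp: add.IH)
    next
      case 2
      then obtain h' where h': "h = x * h'" by blast
      have "vars_in W h'" using add.prems(4) h' qh by (intro vars_in_factor[of W h' x]) (auto simp: mult.commute)
      moreover have "x * (prod_mset A * p) = x * (q * h')" using add.prems(2) h' by (simp add: mult_ac)
      then have "prod_mset A * p = q * h'" using xnz by simp
      moreover have "\<not> vars_in V h'" using add.prems(5) h' x by auto
      ultimately have "p dvd h'" using add by (auto simp: add.IH)
      then show ?thesis using h' by simp
    qed
  qed
  \<comment> \<open>The multiset \<open>A\<close> multiplies to \<open>d\<close> only up to the unit
    \<open>u\<close>; its inverse \<open>w\<close> is moved into the cofactor
    \<open>q\<close>.\<close>
  obtain w where w: "1 = u * w" using uA(1) by blast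
  have "w dvd 1" using w by (metis dvd_triv_right)
  then have "vars_in W w" by (rule vars_in_dvd) auto
  moreover have "prod_mset A * p = w * q * h" 
    using eq uA(3) w by (metis mult.assoc mult.commute mult_1)
  ultimately show ?thesis using claim[of "w * q" h] q h by simp
qed

text \<open>A substitute for the resultant. Let \<open>h\<close> be an element of least degree in
  \<open>v\<close> in the ideal of \<open>p\<close> and \<open>f\<close>. If \<open>h\<close>
  involved \<open>v\<close>, then by pseudo-division it would divide multiples of \<open>p\<close>
  and of \<open>f\<close> by powers of its leading coefficient. The first makes \<open>p\<close>
  divide \<open>h\<close>, the second then makes \<open>p\<close> divide \<open>f\<close>.\<close>

lemma bezout_in_var:
  assumes pr: "primes_in V (insert v V)" and v: "v \<notin> V"
    and p: "irreducible p" "vars_in (insert v V) p" "\<not> vars_in V p"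
    and f: "vars_in (insert v V) f" "\<not> p dvd f"
  shows "\<exists>a b h. h \<noteq> 0 \<and> vars_in V h \<and> h = a * p + b * f"
proof -
  let ?W = "insert v V"
  define I where "I = {h. h \<noteq> 0 \<and> vars_in ?W h \<and> (\<exists>a b. h = a * p + b * f)}"
  have "\<exists>a b. p = a * p + b * f" by (rule exI[of _ 1], rule exI[of _ 0]) simp
  then have "p \<in> I" unfolding I_def using p by (auto simp: irreducible_def)
  define h where "h = arg_min (degv v) (\<lambda>h. h \<in> I)"
  have hI: "h \<in> I" and hmin: "\<And>g. g \<in> I \<Longrightarrow> degv v h \<le> degv v g"
    unfolding h_def using arg_min_nat_lemma[of "\<lambda>h. h \<in> I" p "degv v"] \<open>p \<in> I\<close> by auto
  obtain a b where ab: "h = a * p + b * f" using hI unfolding I_def by blast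
  have indep: "vars_in V g" if "vars_in ?W g" "degv v g = 0" for g
    using vars_in_Int[OF that(1), of "- {v}"] that(2) v by (auto simp: degv_eq_0_iff intro: vars_in_mono)
  have "vars_in V h"
  proof (rule ccontr)
    assume nV: "\<not> vars_in V h"
    have hW: "vars_in ?W h" and hnz: "h \<noteq> 0" using hI unfolding I_def by auto
    have deg: "degree (in_var v h) > 0"
      using indep[of h] nV hW by (auto simp: degv_def)
    define c where "c = lead_coeff (in_var v h)"
    have ch: "coeffs_in V (in_var v h)" by (rule coeffs_in_in_var[OF hW v])
    have cV: "vars_in V c" "c \<noteq> 0" using ch hnz by (auto simp: c_def coeffs_in_def)
    have div: "\<exists>k q. c ^ k * g = q * h \<and> vars_in ?W q" if g: "vars_in ?W g" and gI: "\<exists>a b. g = a * p + b * f" for g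
    proof -
      obtain k Q R where kQR: "coeffs_in V Q" "coeffs_in V R"
        "smult (c ^ k) (in_var v g) = in_var v h * Q + R" "degree R < degree (in_var v h)"
        using pseudo_division[OF ch deg coeffs_in_in_var[OF g v]] unfolding c_def by blast
      define q r where "q = poly Q (Var v)" and "r = poly R (Var v)"
      have "poly (smult (c ^ k) (in_var v g)) (Var v) = poly (in_var v h * Q + R) (Var v)"
        by (simp only: kQR(3))
      then have eq: "c ^ k * g = h * q + r" by (simp add: in_var q_def r_def)
      have coeffs_poly: "vars_in ?W (poly F (Var v))" if "coeffs_in V F" for F
        unfolding poly_altdef using that
        by (intro vars_in_sum vars_in_simps vars_in_power) (auto simp: coeffs_in_def intro: vars_in_mono)
      have qr: "vars_in ?W q" "vars_in ?W r" unfolding q_def r_def by (auto intro: coeffs_poly kQR)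
      \<comment> \<open>The remainder lies in the same ideal and has smaller degree in
        \<open>v\<close> than \<open>h\<close>, which was chosen minimal.\<close>
      have "r = 0"
      proof (rule ccontr)
        assume "r \<noteq> 0"
        obtain a' b' where "g = a' * p + b' * f" using gI by blast
        then have "r = (c ^ k * a' - q * a) * p + (c ^ k * b' - q * b) * f"
          using eq ab by (simp add: algebra_simps)
        then have "r \<in> I" unfolding I_def using \<open>r \<noteq> 0\<close> qr by blast
        moreover have "in_var v r = R"
          using kQR(2) v by (intro in_var_eqI) (auto simp: r_def intro: coeffs_in_mono)
        ultimately show False using hmin[of r] kQR(4) by (simp add: degv_def)
      qed
      then have "c ^ k * g = q * h" using eq by (simp add: mult.commute)
      then show ?thesis using qr by blast
    qed
    have "\<exists>a b. p = a * p + b * f" by (rule exI[of _ 1], rule exI[of _ 0]) simp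
    then obtain k q where 1: "c ^ k * p = q * h" "vars_in ?W q" using div[OF p(2)] by blast
    have "\<exists>a b. f = a * p + b * f" by (rule exI[of _ 0], rule exI[of _ 1]) simp
    then obtain k' q' where 2: "c ^ k' * f = q' * h" using div[OF f(1)] by blast
    have "p dvd h"
      by (rule dvd_cancel_const'[OF pr p(1,2) _ _ _ hW nV 1(1,2)]) (use cV in auto)
    then have "p dvd c ^ k' * f" using 2 by simp
    then have "p dvd f"
      by (intro dvd_cancel_const[OF pr p(1,2,3) _ _ f(1)]) (use cV in auto)
    then show False using f by simp
  qed
  then show ?thesis using ab hI unfolding I_def by blast
qed

text \<open>Induction on the number of variables. For \<open>p\<close> free of the new variable this
  is Gauss's lemma. Otherwise, if \<open>p\<close> does not divide \<open>f\<close>, a nonzero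
  combination \<open>h\<close> of \<open>p\<close> and \<open>f\<close> is free of that variable;
  \<open>p\<close> divides \<open>h * g\<close>, and \<open>h\<close> can be cancelled.\<close>

lemma primes_in_finite: "finite V \<Longrightarrow> primes_in V V"
proof (induction V rule: finite_induct)
  case empty
  show ?case unfolding primes_in_def
    by (metis Cst_0 irreducible_def is_unit_Cst vars_in_empty)
next
  case (insert v V)
  have pr: "primes_in V (insert v V)" by (rule gauss_lemma[OF insert.IH insert.hyps(2)])
  show ?case
    unfolding primes_in_def
  proof (intro allI impI)
    fix p f g
    assume p: "irreducible p" "vars_in (insert v V) p"
      and fg: "vars_in (insert v V) f" "vars_in (insert v V) g" and dvd: "p dvd f * g"
    show "p dvd f \<or> p dvd g"
    proof (cases "vars_in V p")
      case True
      then show ?thesis using pr p fg dvd unfolding primes_in_def by blast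
    next
      case False
      show ?thesis
      proof (rule disjCI, rule ccontr)
        assume "\<not> p dvd g" "\<not> p dvd f"
        then obtain a b h where h: "h \<noteq> 0" "vars_in V h" "h = a * p + b * f"
          using bezout_in_var[OF pr insert.hyps(2) p False fg(1)] by blast
        have "h * g = p * (a * g) + b * (f * g)" using h(3) by (simp add: algebra_simps)
        then have "p dvd h * g" using dvd by (metis dvd_add dvd_mult dvd_triv_left)
        then show False
          using dvd_cancel_const[OF pr p False h(1,2) fg(2)] \<open>\<not> p dvd g\<close> by blast
      qed
    qed
  qed
qed

lemma irreducible_imp_prime_elem_mp:
  fixes p :: mp
  assumes "irreducible p"
  shows "prime_elem p"
proof (rule prime_elemI)
  fix f g assume "p dvd f * g"
  obtain V1 V2 V3 where V: "finite V1" "vars_in V1 p" "finite V2" "vars_in V2 f" "finite V3" "vars_in V3 g"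
    using ex_finite_vars by metis
  then have "primes_in (V1 \<union> V2 \<union> V3) (V1 \<union> V2 \<union> V3)" by (intro primes_in_finite) auto
  moreover have "vars_in (V1 \<union> V2 \<union> V3) p" "vars_in (V1 \<union> V2 \<union> V3) f" "vars_in (V1 \<union> V2 \<union> V3) g"
    using V by (auto intro: vars_in_mono)
  ultimately show "p dvd f \<or> p dvd g" using assms \<open>p dvd f * g\<close> unfolding primes_in_def by blast
qed (use assms in \<open>auto simp: irreducible_def\<close>)

text \<open>A normalisation is an arbitrary choice of one representative in each class of associates,
  which makes the multiplicities of the library available.\<close>

definition assoc_rep :: "mp \<Rightarrow> mp" where
  "assoc_rep p = (if is_unit p then 1 else (SOME q. p dvd q \<and> q dvd p))"

lemma assoc_rep: "p dvd assoc_rep p" "assoc_rep p dvd p"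
proof -
  have "p dvd assoc_rep p \<and> assoc_rep p dvd p"
    unfolding assoc_rep_def using someI[of "\<lambda>q. p dvd q \<and> q dvd p" p] by auto
  then show "p dvd assoc_rep p" "assoc_rep p dvd p" by auto
qed

lemma assoc_rep_cong: "p dvd q \<Longrightarrow> q dvd p \<Longrightarrow> assoc_rep p = assoc_rep q"
proof -
  assume *: "p dvd q" "q dvd p"
  then have "(p dvd r \<and> r dvd p) = (q dvd r \<and> r dvd q)" for r by (meson dvd_trans)
  moreover have "is_unit p = is_unit q" using * by (meson dvd_trans)
  ultimately show ?thesis by (simp add: assoc_rep_def)
qed

instantiation mp :: normalization_semidom
begin
definition normalize_mp :: "mp \<Rightarrow> mp" where "normalize_mp p = assoc_rep p"
definition unit_factor_mp :: "mp \<Rightarrow> mp" where "unit_factor_mp p = p div assoc_rep p"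
instance
proof
  fix p q :: mp
  show uf: "unit_factor p * normalize p = p" for p :: mp
    by (simp add: unit_factor_mp_def normalize_mp_def assoc_rep)
  show "normalize (0::mp) = 0" using assoc_rep(1)[of 0] by (simp add: normalize_mp_def)
  show "unit_factor (0::mp) = 0" by (simp add: unit_factor_mp_def)
  show "is_unit (unit_factor p)" if "p \<noteq> 0"
  proof -
    obtain s where s: "assoc_rep p = p * s" using assoc_rep(1)[of p] by blast
    have "p * (unit_factor p * s) = p * 1" using uf[of p] s by (simp add: normalize_mp_def mult_ac)
    then have "unit_factor p * s = 1" using that mult_cancel_left by blast
    then show ?thesis by (metis dvd_triv_left)
  qed
  show "unit_factor p = p" if "is_unit p"
    using that by (simp add: unit_factor_mp_def assoc_rep_def)
  show "unit_factor (p * q) = p * unit_factor q" if "is_unit p"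
  proof (cases "q = 0")
    case False
    have "assoc_rep (p * q) = assoc_rep q"
      using that by (intro assoc_rep_cong) (auto simp: mult_unit_dvd_iff')
    then show ?thesis using False
      by (simp add: unit_factor_mp_def div_mult_swap assoc_rep(2))
  qed (simp add: unit_factor_mp_def)
qed
end

instance mp :: factorial_semiring
proof
  fix p :: mp assume "p \<noteq> 0"
  then obtain u A where uA: "is_unit u" "\<forall>q\<in>#A. irreducible q" "p = u * prod_mset A"
    using irreducible_factorization by blast
  moreover have "normalize p = normalize (prod_mset A)"
    using uA(1,3) by (intro associatedI) (auto simp: mult_unit_dvd_iff')
  ultimately show "\<exists>A. (\<forall>x. x \<in># A \<longrightarrow> prime_elem x) \<and> normalize (prod_mset A) = normalize p"
    using irreducible_imp_prime_elem_mp by metis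
qed

section \<open>The Nullstellensatz for irreducible hypersurfaces\<close>

text \<open>Otherwise a nonzero combination \<open>h\<close> of \<open>p\<close> and
  \<open>f\<close> is free of a variable \<open>v\<close> that occurs in \<open>p\<close>. Over a
  point with \<open>h\<close> nonzero the fundamental theorem of algebra provides a zero of
  \<open>p\<close>; there \<open>f\<close> vanishes too, and hence \<open>h\<close>.\<close>

lemma prime_hypersurface_nullstellensatz:
  assumes p: "prime_elem p" and van: "\<And>x. ev p x = 0 \<Longrightarrow> ev f x = 0"
  shows "p dvd f"
proof (rule ccontr)
  assume "\<not> p dvd f"
  have irr: "irreducible p" using p by (rule prime_elem_imp_irreducible)
  obtain V1 V2 where V: "finite V1" "vars_in V1 p" "finite V2" "vars_in V2 f"
    using ex_finite_vars by metis
  have "\<exists>v. degv v p \<noteq> 0"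
  proof (rule ccontr)
    assume "\<nexists>v. degv v p \<noteq> 0"
    then have "vars_in {} p" by (intro degv_eq_0_vars_in) auto
    then show False using irr vars_in_empty by (metis Cst_0 irreducible_def is_unit_Cst)
  qed
  then obtain v where v: "degv v p \<noteq> 0" by blast
  define V where "V = V1 \<union> V2 - {v}"
  have fin: "finite V" and vV: "v \<notin> V" using V by (auto simp: V_def)
  have pf: "vars_in (insert v V) p" "vars_in (insert v V) f"
    using V by (auto simp: V_def intro: vars_in_mono)
  have "\<not> vars_in V p" using v vV degv_notin[of V p v] by auto
  then obtain a b h where h: "h \<noteq> 0" "vars_in V h" "h = a * p + b * f"
    using bezout_in_var[OF gauss_lemma[OF primes_in_finite[OF fin] vV] vV irr pf(1) _ pf(2)]
      \<open>\<not> p dvd f\<close> by blast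
  \<comment> \<open>Where the leading coefficient does not vanish, specialising the other variables
    keeps the degree in \<open>v\<close> positive, so a root exists.\<close>
  define l where "l = lead_coeff (in_var v p)"
  have "l \<noteq> 0" using irr by (auto simp: l_def irreducible_def)
  then obtain x where x: "ev (h * l) x \<noteq> 0" using h(1) mp_nonzero_ev[of "h * l"] by auto
  define P where "P = map_poly (\<lambda>c. ev c x) (in_var v p)"
  have "coeff P (degv v p) \<noteq> 0" using x by (simp add: P_def coeff_map_poly degv_def l_def)
  then have "degree P > 0" using v le_degree by (metis gr0I le_zero_eq)
  then obtain s where s: "poly P s = 0"
    using fundamental_theorem_of_algebra[of P] constant_degree[of P] by auto
  then have "ev p (x(v := s)) = 0"
    using ev_poly_upd[OF in_var(1)[of v p], of x s] by (simp add: in_var(2) P_def)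
  then have "ev h (x(v := s)) = 0" using van h(3) by simp
  moreover have "ev h (x(v := s)) = ev h x" using h(2) vV by (intro vars_inD[of V]) auto
  ultimately show False using x by simp
qed

section \<open>Zariski-open sets of subspaces of products of projective lines\<close>

lemma topspace_zariski: "X \<subseteq> Q \<rightarrow>\<^sub>E UNIV \<Longrightarrow> topspace (zariski Q X) = X"
proof -
  assume X: "X \<subseteq> Q \<rightarrow>\<^sub>E UNIV"
  have "{p \<in> Q \<rightarrow>\<^sub>E UNIV. eval_at (\<lambda>_. 1) p \<noteq> 0} = Q \<rightarrow>\<^sub>E UNIV" by (simp add: eval_at_def)
  then have "Q \<rightarrow>\<^sub>E UNIV \<subseteq> topspace (zariski_ambient Q)"
    unfolding zariski_ambient_def topology_generated_by_topspace
    using multihom_poly.const[of Q 1] by blast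
  then show ?thesis using X by (auto simp: zariski_def)
qed

lemma openin_zariskiI:
  assumes X: "X \<subseteq> Q \<rightarrow>\<^sub>E UNIV" and "W \<subseteq> X"
    and "\<And>x. x \<in> W \<Longrightarrow> \<exists>F d. multihom_poly Q d F \<and> eval_at F x \<noteq> 0 \<and> {y\<in>X. eval_at F y \<noteq> 0} \<subseteq> W"
  shows "openin (zariski Q X) W"
proof (subst openin_subopen, intro ballI)
  fix x assume "x \<in> W"
  then obtain F d where F: "multihom_poly Q d F" "eval_at F x \<noteq> 0" "{y\<in>X. eval_at F y \<noteq> 0} \<subseteq> W"
    using assms(3) by blast
  have "openin (zariski_ambient Q) {y \<in> Q \<rightarrow>\<^sub>E UNIV. eval_at F y \<noteq> 0}"
    unfolding zariski_ambient_def using F(1) by (intro topology_generated_by_Basis) blast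
  then have "openin (zariski Q X) ({y \<in> Q \<rightarrow>\<^sub>E UNIV. eval_at F y \<noteq> 0} \<inter> X)"
    unfolding zariski_def openin_subtopology by blast
  moreover have "{y \<in> Q \<rightarrow>\<^sub>E UNIV. eval_at F y \<noteq> 0} \<inter> X = {y\<in>X. eval_at F y \<noteq> 0}"
    using X by auto
  ultimately show "\<exists>T. openin (zariski Q X) T \<and> x \<in> T \<and> T \<subseteq> W"
    using F \<open>x \<in> W\<close> \<open>W \<subseteq> X\<close> by (intro exI[of _ "{y\<in>X. eval_at F y \<noteq> 0}"]) auto
qed

text \<open>Nonvanishing loci intersect in the locus of the product, so the generating sets form a
  base of the topology.\<close>

lemma openin_zariskiD:
  assumes X: "X \<subseteq> Q \<rightarrow>\<^sub>E UNIV" and W: "openin (zariski Q X) W" and x: "x \<in> W"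
  shows "\<exists>F d. multihom_poly Q d F \<and> eval_at F x \<noteq> 0 \<and> {y\<in>X. eval_at F y \<noteq> 0} \<subseteq> W"
proof -
  let ?S = "{{p \<in> Q \<rightarrow>\<^sub>E UNIV. eval_at F p \<noteq> 0} | F d. multihom_poly Q d F}"
  obtain T where T: "openin (zariski_ambient Q) T" "W = T \<inter> X"
    using W unfolding zariski_def openin_subtopology by blast
  have "generate_topology_on ?S T"
    using T(1) unfolding zariski_ambient_def openin_topology_generated_by_iff .
  then have "\<forall>x\<in>T. \<exists>F d. multihom_poly Q d F \<and> eval_at F x \<noteq> 0 \<and>
    {y \<in> Q \<rightarrow>\<^sub>E UNIV. eval_at F y \<noteq> 0} \<subseteq> T"
  proof induction
    case (Int A B)
    show ?case
    proof
      fix x assume "x \<in> A \<inter> B"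
      then obtain F d G e where "multihom_poly Q d F" "eval_at F x \<noteq> 0" "{y \<in> Q \<rightarrow>\<^sub>E UNIV. eval_at F y \<noteq> 0} \<subseteq> A"
        "multihom_poly Q e G" "eval_at G x \<noteq> 0" "{y \<in> Q \<rightarrow>\<^sub>E UNIV. eval_at G y \<noteq> 0} \<subseteq> B"
        using Int.IH by (meson IntE)
      then show "\<exists>F d. multihom_poly Q d F \<and> eval_at F x \<noteq> 0 \<and>
          {y \<in> Q \<rightarrow>\<^sub>E UNIV. eval_at F y \<noteq> 0} \<subseteq> A \<inter> B"
        by (intro exI[of _ "\<lambda>x. F x * G x"] exI[of _ "\<lambda>r. d r + e r"])
          (auto simp: eval_at_def intro: multihom_poly.mult)
    qed
  next
    case (UN K)
    then show ?case by (meson UnionE Union_upper subset_trans)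
  qed auto
  then obtain F d where "multihom_poly Q d F" "eval_at F x \<noteq> 0" "{y \<in> Q \<rightarrow>\<^sub>E UNIV. eval_at F y \<noteq> 0} \<subseteq> T"
    using T(2) x by blast
  then show ?thesis using T(2) X by (intro exI[of _ F] exI[of _ d]) auto
qed

lemma multihom_scale:
  assumes "finite Q" "multihom_poly Q d F"
  shows "F (\<lambda>q. (c q * fst (x q), c q * snd (x q))) = (\<Prod>q\<in>Q. c q ^ d q) * F x"
  using assms(2)
proof (induction rule: multihom_poly.induct)
  case (coord1 q)
  have "(\<Prod>r\<in>Q. c r ^ (if r = q then 1 else 0)) = (\<Prod>r\<in>Q. if r = q then c r else 1)"
    by (rule prod.cong) auto
  then show ?case using assms(1) coord1 by simp
next
  case (coord2 q)
  have "(\<Prod>r\<in>Q. c r ^ (if r = q then 1 else 0)) = (\<Prod>r\<in>Q. if r = q then c r else 1)"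
    by (rule prod.cong) auto
  then show ?case using assms(1) coord2 by simp
qed (auto simp: algebra_simps power_add prod.distrib)

lemma multihom_cong:
  assumes "multihom_poly Q d F" "\<And>q. q \<in> Q \<Longrightarrow> x q = y q"
  shows "F x = F y"
  using assms by (induction rule: multihom_poly.induct) auto

lemma hcoord_P1_point:
  "(a, b) \<noteq> (0, 0) \<Longrightarrow> (if b = 0 then a else b) * fst (hcoord (P1_point a b)) = a"
  "(if b = 0 then a else b) * snd (hcoord (P1_point a b)) = b"
  by (auto simp: P1_point_def)

text \<open>The link between arbitrary homogeneous coordinates and the normalised ones in
  \<open>eval_at\<close>. The factor between the two values is nonzero and depends only on the
  multidegree, so vanishing and quotients of equal multidegree can be read off in any
  coordinates.\<close>

lemma multihom_P1_point:
  assumes "finite Q" "multihom_poly Q d F"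
    and "\<And>q. q \<in> Q \<Longrightarrow> (a q, b q) \<noteq> (0, 0)" "\<And>q. q \<in> Q \<Longrightarrow> p q = P1_point (a q) (b q)"
  shows "F (\<lambda>q. (a q, b q)) = (\<Prod>q\<in>Q. (if b q = 0 then a q else b q) ^ d q) * eval_at F p"
  unfolding eval_at_def multihom_scale[OF assms(1,2), symmetric]
proof (rule multihom_cong[OF assms(2)], goal_cases)
  case (1 q)
  then show ?case using assms(3,4) by (simp add: prod_eq_iff hcoord_P1_point del: prod.inject)
qed

lemma multihom_pullback:
  assumes "multihom_poly Q d F" "\<And>q. q \<in> Q \<Longrightarrow> vars_in V (nq q) \<and> vars_in V (dq q)"
  shows "\<exists>f. vars_in V f \<and> (\<forall>v. ev f v = F (\<lambda>q. (ev (nq q) v, ev (dq q) v)))"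
  using assms
proof (induction rule: multihom_poly.induct)
  case (const c) then show ?case by (intro exI[of _ "Cst c"]) auto
next
  case (coord1 q) then show ?case by (intro exI[of _ "nq q"]) auto
next
  case (coord2 q) then show ?case by (intro exI[of _ "dq q"]) auto
next
  case (add d F G)
  then obtain f g where "vars_in V f" "vars_in V g" "\<forall>v. ev f v = F (\<lambda>q. (ev (nq q) v, ev (dq q) v))"
    "\<forall>v. ev g v = G (\<lambda>q. (ev (nq q) v, ev (dq q) v))" by blast
  then show ?case by (intro exI[of _ "f + g"]) auto
next
  case (mult d F e G)
  then obtain f g where "vars_in V f" "vars_in V g" "\<forall>v. ev f v = F (\<lambda>q. (ev (nq q) v, ev (dq q) v))"
    "\<forall>v. ev g v = G (\<lambda>q. (ev (nq q) v, ev (dq q) v))" by blast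
  then show ?case by (intro exI[of _ "f * g"]) auto
qed

lemma irreducible_in_closure:
  assumes "irreducible_in T S"
  shows "irreducible_in T (T closure_of S)"
proof -
  have S: "S \<subseteq> T closure_of S" using assms by (simp add: closure_of_subset irreducible_in_def)
  show ?thesis
    unfolding irreducible_in_def
  proof (intro conjI allI impI)
    fix C D assume *: "closedin T C \<and> closedin T D \<and> T closure_of S \<subseteq> C \<union> D"
    then have "S \<subseteq> C \<or> S \<subseteq> D" using assms S unfolding irreducible_in_def by blast
    then show "T closure_of S \<subseteq> C \<or> T closure_of S \<subseteq> D" using * closure_of_minimal by blast
  qed (use S assms in \<open>auto simp: irreducible_in_def closure_of_subset_topspace\<close>)
qed

text \<open>\<open>Y\<close> is covered by the complement of \<open>W\<close> and the closure of
  \<open>W \<inter> Y\<close>, and it is not contained in the first.\<close>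

lemma irreducible_in_subset_closure:
  assumes "irreducible_in T Y" "openin T W" "W \<inter> Y \<noteq> {}"
  shows "Y \<subseteq> T closure_of (W \<inter> Y)"
proof -
  have Y: "Y \<subseteq> topspace T" using assms(1) by (simp add: irreducible_in_def)
  have "W \<inter> Y \<subseteq> T closure_of (W \<inter> Y)" by (rule closure_of_subset) (use Y in auto)
  then have "Y \<subseteq> (topspace T - W) \<union> (T closure_of (W \<inter> Y))" using Y by auto
  moreover have "closedin T (topspace T - W)" using assms(2) by blast
  moreover have "closedin T (T closure_of (W \<inter> Y))" by simp
  ultimately have "Y \<subseteq> topspace T - W \<or> Y \<subseteq> T closure_of (W \<inter> Y)"
    using assms(1) unfolding irreducible_in_def by blast
  then show ?thesis using assms(3) by blast
qed

lemma irreducible_in_opens_meet: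
  assumes "irreducible_in T Y" "openin T W" "W \<inter> Y \<noteq> {}" "openin T W'" "W' \<inter> Y \<noteq> {}"
  shows "W \<inter> W' \<inter> Y \<noteq> {}"
proof
  assume "W \<inter> W' \<inter> Y = {}"
  then have "Y \<subseteq> (topspace T - W) \<union> (topspace T - W')"
    using assms(1) by (auto simp: irreducible_in_def)
  then have "Y \<subseteq> topspace T - W \<or> Y \<subseteq> topspace T - W'"
    using assms(1,2,4) unfolding irreducible_in_def by blast
  then show False using assms by blast
qed

lemma irreducible_in_finite_Union:
  assumes "irreducible_in T Y" "finite \<C>" "\<And>C. C \<in> \<C> \<Longrightarrow> closedin T C" "Y \<subseteq> \<Union>\<C>"
  shows "\<exists>C\<in>\<C>. Y \<subseteq> C"
  using assms(2,3,4)
proof (induction \<C> rule: finite_induct)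
  case empty then show ?case using assms(1) by (auto simp: irreducible_in_def)
next
  case (insert C \<C>)
  have "closedin T (\<Union>\<C>)" using insert by (intro closedin_Union) auto
  moreover have "Y \<subseteq> C \<union> \<Union>\<C>" using insert by auto
  ultimately have "Y \<subseteq> C \<or> Y \<subseteq> \<Union>\<C>" using assms(1) insert.prems(1)[of C]
    unfolding irreducible_in_def by blast
  then show ?case using insert by blast
qed

section \<open>Charts\<close>

text \<open>A dense open subset \<open>U\<close> of \<open>X\<close> that is identified with the complement of the hypersurface
  \<open>D = 0\<close> in affine space with coordinates indexed by \<open>V\<close>. The coordinate \<open>v\<close> is read off from the
  component \<open>qv v\<close> of the ambient product.\<close>

locale chart =
  fixes Q :: "'q set" and X U :: "('q \<Rightarrow> P1) set" and V :: "nat set" and D :: mp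
    and nq dq :: "'q \<Rightarrow> mp" and psi :: "(nat \<Rightarrow> complex) \<Rightarrow> 'q \<Rightarrow> P1" and qv :: "nat \<Rightarrow> 'q"
  assumes finQ: "finite Q" and XQ: "X \<subseteq> Q \<rightarrow>\<^sub>E UNIV"
    and D_vars: "vars_in V D" and D_nz: "D \<noteq> 0"
    and coord_vars: "\<And>q. q \<in> Q \<Longrightarrow> vars_in V (nq q) \<and> vars_in V (dq q)"
    and openU: "openin (zariski Q X) U"
    and dense: "\<And>W. openin (zariski Q X) W \<Longrightarrow> W \<noteq> {} \<Longrightarrow> W \<inter> U \<noteq> {}"
    and psi_in: "\<And>v. ev D v \<noteq> 0 \<Longrightarrow> psi v \<in> U"
    and psi_nz: "\<And>v q. ev D v \<noteq> 0 \<Longrightarrow> q \<in> Q \<Longrightarrow> (ev (nq q) v, ev (dq q) v) \<noteq> (0, 0)"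
    and psi_coord: "\<And>v q. ev D v \<noteq> 0 \<Longrightarrow> q \<in> Q \<Longrightarrow> psi v q = P1_point (ev (nq q) v) (ev (dq q) v)"
    and qv: "\<And>v. v \<in> V \<Longrightarrow> qv v \<in> Q"
    and qv_fin: "\<And>v x. v \<in> V \<Longrightarrow> x \<in> U \<Longrightarrow> x (qv v) \<noteq> Infinity"
    and D_phi: "\<And>x. x \<in> U \<Longrightarrow> ev D (\<lambda>v. if v \<in> V then fst (hcoord (x (qv v))) else 0) \<noteq> 0"
    and psi_phi': "\<And>x. x \<in> U \<Longrightarrow> psi (\<lambda>v. if v \<in> V then fst (hcoord (x (qv v))) else 0) = x"
    and phi_psi': "\<And>v x. ev D x \<noteq> 0 \<Longrightarrow> v \<in> V \<Longrightarrow> psi x (qv v) = Finite (x v)"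
begin

abbreviation T where "T \<equiv> zariski Q X"

text \<open>The inverse of \<open>psi\<close>, which the assumptions of the locale spell out. The
  value 0 off \<open>V\<close> is a default that polynomials in the variables of \<open>V\<close> do
  not see.\<close>

definition phi :: "('q \<Rightarrow> P1) \<Rightarrow> nat \<Rightarrow> complex" where
  "phi x = (\<lambda>v. if v \<in> V then fst (hcoord (x (qv v))) else 0)"

lemma topspace_T [simp]: "topspace T = X"
  by (rule topspace_zariski[OF XQ])

lemma closedin_compl: "openin T W \<Longrightarrow> closedin T (X - W)"
  using closedin_diff[OF closedin_topspace, of T W] by simp

lemma openin_compl: "closedin T W \<Longrightarrow> openin T (X - W)"
  using openin_diff[OF openin_topspace, of T W] by simp

lemma U_X: "U \<subseteq> X"
  using openin_subset[OF openU] by simp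

lemma D_phi_nz: "x \<in> U \<Longrightarrow> ev D (phi x) \<noteq> 0" and psi_phi: "x \<in> U \<Longrightarrow> psi (phi x) = x"
  by (simp_all add: phi_def D_phi psi_phi')

lemma ev_phi_psi: "vars_in V f \<Longrightarrow> ev D v \<noteq> 0 \<Longrightarrow> ev f (phi (psi v)) = ev f v"
  by (rule vars_inD[of V]) (auto simp: phi_def phi_psi')

text \<open>The product of \<open>e\<close> with \<open>k\<close> and \<open>D\<close> vanishes at
  every point of affine space, hence is the zero polynomial, and the other two factors are
  nonzero.\<close>

lemma zeroI:
  assumes "vars_in V e" "vars_in V k" "k \<noteq> 0" "\<And>y. y \<in> U \<Longrightarrow> ev k (phi y) \<noteq> 0 \<Longrightarrow> ev e (phi y) = 0"
  shows "e = 0"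
proof -
  have "ev (e * k * D) v = 0" for v
  proof (cases "ev D v = 0 \<or> ev k v = 0")
    case False
    then show ?thesis using assms(4)[of "psi v"] psi_in[of v] ev_phi_psi assms(1,2) by simp
  qed auto
  then have "e * k * D = 0" by (intro mp_eqI) simp
  then show ?thesis using assms(3) D_nz by simp
qed

lemma nonzero_point: "vars_in V f \<Longrightarrow> f \<noteq> 0 \<Longrightarrow> \<exists>x\<in>U. ev f (phi x) \<noteq> 0"
  using zeroI[of f 1] by auto

lemma pullback:
  assumes "multihom_poly Q d F"
  shows "\<exists>f. vars_in V f \<and> (\<forall>x\<in>U. ev f (phi x) =
    (\<Prod>q\<in>Q. (if ev (dq q) (phi x) = 0 then ev (nq q) (phi x) else ev (dq q) (phi x)) ^ d q) * eval_at F x)"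
proof -
  obtain f where f: "vars_in V f" "\<And>v. ev f v = F (\<lambda>q. (ev (nq q) v, ev (dq q) v))"
    using multihom_pullback[OF assms, of V nq dq] coord_vars by blast
  show ?thesis
  proof (intro exI[of _ f] conjI ballI f(1), unfold f(2), rule multihom_P1_point[OF finQ assms])
    fix x q assume x: "x \<in> U" and q: "q \<in> Q"
    then show "(ev (nq q) (phi x), ev (dq q) (phi x)) \<noteq> (0, 0)" by (intro psi_nz D_phi_nz)
    show "x q = P1_point (ev (nq q) (phi x)) (ev (dq q) (phi x))"
      using psi_coord[OF D_phi_nz[OF x] q] psi_phi[OF x] by simp
  qed
qed

lemma scale_nz: "x \<in> U \<Longrightarrow>
    (\<Prod>q\<in>Q. (if ev (dq q) (phi x) = 0 then ev (nq q) (phi x) else ev (dq q) (phi x)) ^ d q) \<noteq> 0"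
  using psi_nz[OF D_phi_nz] finQ by (auto split: if_splits)

text \<open>Together with \<open>open_nonvanishing\<close> this says that the topology of
  \<open>X\<close> induces on \<open>U\<close> the Zariski topology of an affine open set.\<close>

lemma openin_near:
  assumes "openin T W" "x \<in> W" "x \<in> U"
  shows "\<exists>h. vars_in V h \<and> ev h (phi x) \<noteq> 0 \<and> (\<forall>y\<in>U. ev h (phi y) \<noteq> 0 \<longrightarrow> y \<in> W)"
proof -
  obtain F d where F: "multihom_poly Q d F" "eval_at F x \<noteq> 0" "{y\<in>X. eval_at F y \<noteq> 0} \<subseteq> W"
    using openin_zariskiD[OF XQ assms(1,2)] by blast
  obtain f where f: "vars_in V f" "\<forall>x\<in>U. ev f (phi x) =
    (\<Prod>q\<in>Q. (if ev (dq q) (phi x) = 0 then ev (nq q) (phi x) else ev (dq q) (phi x)) ^ d q) * eval_at F x"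
    using pullback[OF F(1)] by blast
  show ?thesis
    using f F assms(3) U_X scale_nz[of x d] by (intro exI[of _ f]) auto
qed

text \<open>A chart coordinate is the quotient of the two homogeneous coordinates of one factor of
  the ambient product. Equality of the multidegrees of numerator and denominator survives sums and
  products of such quotients.\<close>

lemma pushforward:
  assumes "vars_in V f"
  shows "\<exists>F G d. multihom_poly Q d F \<and> multihom_poly Q d G \<and>
    (\<forall>x\<in>U. eval_at G x \<noteq> 0 \<and> ev f (phi x) = eval_at F x / eval_at G x)"
  using assms
proof (induction rule: mp_induct)
  case (const c)
  have "\<forall>x\<in>U. eval_at (\<lambda>_. 1) x \<noteq> 0 \<and> ev (Cst c) (phi x) = eval_at (\<lambda>_. c) x / eval_at (\<lambda>_. 1) x"
    by (simp add: eval_at_def)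
  then show ?case using multihom_poly.const[of Q c] multihom_poly.const[of Q 1] by blast
next
  case (var v)
  have "ev (Var v) (phi x) = fst (hcoord (x (qv v)))" "snd (hcoord (x (qv v))) = 1" if "x \<in> U" for x
    using qv_fin[OF var that] var by (cases "x (qv v)"; simp add: phi_def)+
  then have "\<forall>x\<in>U. eval_at (\<lambda>x. snd (x (qv v))) x \<noteq> 0 \<and>
      ev (Var v) (phi x) = eval_at (\<lambda>x. fst (x (qv v))) x / eval_at (\<lambda>x. snd (x (qv v))) x"
    by (simp add: eval_at_def)
  then show ?case
    using multihom_poly.coord1[OF qv[OF var]] multihom_poly.coord2[OF qv[OF var]] by blast
next
  case (add f g)
  then obtain F G d F' G' d' where FG: "multihom_poly Q d F" "multihom_poly Q d G"
    "multihom_poly Q d' F'" "multihom_poly Q d' G'"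
    "\<forall>x\<in>U. eval_at G x \<noteq> 0 \<and> ev f (phi x) = eval_at F x / eval_at G x"
    "\<forall>x\<in>U. eval_at G' x \<noteq> 0 \<and> ev g (phi x) = eval_at F' x / eval_at G' x" by blast
  have "multihom_poly Q (\<lambda>r. d r + d' r) (\<lambda>x. F x * G' x + G x * F' x)"
    using FG by (intro multihom_poly.add multihom_poly.mult)
  moreover have "multihom_poly Q (\<lambda>r. d r + d' r) (\<lambda>x. G x * G' x)"
    using FG by (intro multihom_poly.mult)
  moreover have "\<forall>x\<in>U. eval_at (\<lambda>x. G x * G' x) x \<noteq> 0 \<and>
      ev (f + g) (phi x) = eval_at (\<lambda>x. F x * G' x + G x * F' x) x / eval_at (\<lambda>x. G x * G' x) x"
    using FG(5,6) by (auto simp: eval_at_def field_simps)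
  ultimately show ?case by blast
next
  case (mult f g)
  then obtain F G d F' G' d' where FG: "multihom_poly Q d F" "multihom_poly Q d G"
    "multihom_poly Q d' F'" "multihom_poly Q d' G'"
    "\<forall>x\<in>U. eval_at G x \<noteq> 0 \<and> ev f (phi x) = eval_at F x / eval_at G x"
    "\<forall>x\<in>U. eval_at G' x \<noteq> 0 \<and> ev g (phi x) = eval_at F' x / eval_at G' x" by blast
  have "multihom_poly Q (\<lambda>r. d r + d' r) (\<lambda>x. F x * F' x)" "multihom_poly Q (\<lambda>r. d r + d' r) (\<lambda>x. G x * G' x)"
    using FG by (auto intro: multihom_poly.mult)
  moreover have "\<forall>x\<in>U. eval_at (\<lambda>x. G x * G' x) x \<noteq> 0 \<and>
      ev (f * g) (phi x) = eval_at (\<lambda>x. F x * F' x) x / eval_at (\<lambda>x. G x * G' x) x"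
    using FG(5,6) by (auto simp: eval_at_def)
  ultimately show ?case by blast
qed

lemma open_nonvanishing:
  assumes "vars_in V h"
  shows "openin T {y\<in>U. ev h (phi y) \<noteq> 0}"
proof (subst openin_subopen, intro ballI)
  fix x assume x: "x \<in> {y\<in>U. ev h (phi y) \<noteq> 0}"
  obtain F G d where FG: "multihom_poly Q d F" "multihom_poly Q d G"
    "\<forall>x\<in>U. eval_at G x \<noteq> 0 \<and> ev h (phi x) = eval_at F x / eval_at G x"
    using pushforward[OF assms] by blast
  have "openin T {y\<in>X. eval_at F y \<noteq> 0}"
    using FG(1) by (intro openin_zariskiI[OF XQ]) auto
  then have "openin T (U \<inter> {y\<in>X. eval_at F y \<noteq> 0})" using openU by blast
  then show "\<exists>W. openin T W \<and> x \<in> W \<and> W \<subseteq> {y\<in>U. ev h (phi y) \<noteq> 0}"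
    using x FG(3) U_X by (intro exI[of _ "U \<inter> {y\<in>X. eval_at F y \<noteq> 0}"]) auto
qed

lemma regular_onD:
  assumes "regular_on Q X W f" "x \<in> W" "x \<in> U"
  shows "\<exists>g h. vars_in V g \<and> vars_in V h \<and> ev h (phi x) \<noteq> 0 \<and>
    (\<forall>y\<in>U. ev h (phi y) \<noteq> 0 \<longrightarrow> y \<in> W \<and> f y = ev g (phi y) / ev h (phi y))"
proof -
  obtain W' d G H where *: "openin T W'" "x \<in> W'" "W' \<subseteq> W" "multihom_poly Q d G" "multihom_poly Q d H"
    "\<forall>y\<in>W'. eval_at H y \<noteq> 0 \<and> f y = eval_at G y / eval_at H y"
    using assms(1,2) unfolding regular_on_def by blast
  obtain g where g: "vars_in V g" "\<forall>x\<in>U. ev g (phi x) =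
    (\<Prod>q\<in>Q. (if ev (dq q) (phi x) = 0 then ev (nq q) (phi x) else ev (dq q) (phi x)) ^ d q) * eval_at G x"
    using pullback[OF *(4)] by blast
  obtain h where h: "vars_in V h" "\<forall>x\<in>U. ev h (phi x) =
    (\<Prod>q\<in>Q. (if ev (dq q) (phi x) = 0 then ev (nq q) (phi x) else ev (dq q) (phi x)) ^ d q) * eval_at H x"
    using pullback[OF *(5)] by blast
  obtain k where k: "vars_in V k" "ev k (phi x) \<noteq> 0" "\<forall>y\<in>U. ev k (phi y) \<noteq> 0 \<longrightarrow> y \<in> W'"
    using openin_near[OF *(1,2) assms(3)] by blast
  show ?thesis
  \<comment> \<open>The factor \<open>k\<close> shrinks the locus where the denominator is nonzero
    into \<open>W'\<close>; in the quotient it cancels.\<close>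
  proof (rule exI[of _ "g * k"], rule exI[of _ "h * k"], intro conjI ballI impI)
    show "ev (h * k) (phi x) \<noteq> 0" using h(2) k(2) *(2,6) assms(3) scale_nz[OF assms(3), of d] by simp
    fix y assume y: "y \<in> U" "ev (h * k) (phi y) \<noteq> 0"
    then have "y \<in> W'" using k(3) by simp
    then show "y \<in> W" "f y = ev (g * k) (phi y) / ev (h * k) (phi y)"
      using *(3,6) y g(2) h(2) scale_nz[OF y(1), of d] by auto
  qed (use g h k in auto)
qed

lemma regular_onI:
  assumes "vars_in V g" "vars_in V h"
    and "\<And>y. y \<in> U \<Longrightarrow> ev h (phi y) \<noteq> 0 \<Longrightarrow> f y = ev g (phi y) / ev h (phi y)"
  shows "regular_on Q X {y\<in>U. ev h (phi y) \<noteq> 0} f"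
proof -
  let ?W = "{y\<in>U. ev h (phi y) \<noteq> 0}"
  obtain F G d where FG: "multihom_poly Q d F" "multihom_poly Q d G"
    "\<forall>x\<in>U. eval_at G x \<noteq> 0 \<and> ev h (phi x) = eval_at F x / eval_at G x"
    using pushforward[OF assms(2)] by blast
  obtain F' G' d' where FG': "multihom_poly Q d' F'" "multihom_poly Q d' G'"
    "\<forall>x\<in>U. eval_at G' x \<noteq> 0 \<and> ev g (phi x) = eval_at F' x / eval_at G' x"
    using pushforward[OF assms(1)] by blast
  have W: "openin T ?W" by (rule open_nonvanishing[OF assms(2)])
  have "multihom_poly Q (\<lambda>r. d' r + d r) (\<lambda>x. F' x * G x)" "multihom_poly Q (\<lambda>r. d' r + d r) (\<lambda>x. G' x * F x)"
    using FG FG' by (auto intro: multihom_poly.mult)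
  moreover have "eval_at (\<lambda>x. G' x * F x) x \<noteq> 0 \<and> f x = eval_at (\<lambda>x. F' x * G x) x / eval_at (\<lambda>x. G' x * F x) x"
    if "x \<in> ?W" for x
    using that FG(3) FG'(3) assms(3) by (auto simp: eval_at_def)
  ultimately show ?thesis using W unfolding regular_on_def by blast
qed

lemma opens_meet:
  assumes "openin T W" "W \<noteq> {}" "openin T W'" "W' \<noteq> {}"
  shows "\<exists>k. vars_in V k \<and> k \<noteq> 0 \<and> (\<forall>y\<in>U. ev k (phi y) \<noteq> 0 \<longrightarrow> y \<in> W \<inter> W')"
proof -
  obtain x y where xy: "x \<in> W" "x \<in> U" "y \<in> W'" "y \<in> U" using dense assms by (meson disjoint_iff)
  obtain h where h: "vars_in V h" "ev h (phi x) \<noteq> 0" "\<forall>y\<in>U. ev h (phi y) \<noteq> 0 \<longrightarrow> y \<in> W"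
    using openin_near[OF assms(1) xy(1,2)] by blast
  obtain k where k: "vars_in V k" "ev k (phi y) \<noteq> 0" "\<forall>y\<in>U. ev k (phi y) \<noteq> 0 \<longrightarrow> y \<in> W'"
    using openin_near[OF assms(3) xy(3,4)] by blast
  have "h \<noteq> 0" "k \<noteq> 0" using h(2) k(2) by auto
  then show ?thesis using h k by (intro exI[of _ "h * k"]) auto
qed

lemma opens_meet_U:
  assumes "openin T W" "W \<noteq> {}"
  shows "\<exists>k. vars_in V k \<and> k \<noteq> 0 \<and> (\<forall>y\<in>U. ev k (phi y) \<noteq> 0 \<longrightarrow> y \<in> W)"
  using opens_meet[OF assms assms] by auto

subsection \<open>Hypersurfaces\<close>

text \<open>A prime that divides \<open>D\<close> has no zeros on the chart. The remaining ones
  correspond to the prime divisors that meet \<open>U\<close>.\<close>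

definition good :: "mp \<Rightarrow> bool" where
  "good p \<longleftrightarrow> prime_elem p \<and> vars_in V p \<and> \<not> p dvd D"

definition hyp :: "mp \<Rightarrow> ('q \<Rightarrow> P1) set" where
  "hyp p = {x\<in>U. ev p (phi x) = 0}"

definition hyp_cl :: "mp \<Rightarrow> ('q \<Rightarrow> P1) set" where
  "hyp_cl p = T closure_of hyp p"

lemma hyp_X: "hyp p \<subseteq> X"
  using U_X by (auto simp: hyp_def)

text \<open>Multiplied by \<open>k\<close> and \<open>D\<close>, the polynomial \<open>f\<close>
  vanishes on the entire hypersurface in affine space. The Nullstellensatz applies to the product,
  and primality of \<open>p\<close> removes the two factors.\<close>

lemma vanishing_imp_dvd:
  assumes p: "good p" and k: "vars_in V k" "\<not> p dvd k" and f: "vars_in V f"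
    and van: "\<And>x. x \<in> hyp p \<Longrightarrow> ev k (phi x) \<noteq> 0 \<Longrightarrow> ev f (phi x) = 0"
  shows "p dvd f"
proof -
  have pp: "prime_elem p" "vars_in V p" "\<not> p dvd D" using p by (auto simp: good_def)
  have "p dvd f * k * D"
  proof (rule prime_hypersurface_nullstellensatz[OF pp(1)])
    fix v assume "ev p v = 0"
    show "ev (f * k * D) v = 0"
    proof (cases "ev D v = 0 \<or> ev k v = 0")
      case False
      then have "psi v \<in> hyp p" using \<open>ev p v = 0\<close> psi_in ev_phi_psi pp by (simp add: hyp_def)
      then show ?thesis using van[of "psi v"] False ev_phi_psi f k by simp
    qed auto
  qed
  then show ?thesis using pp k(2) prime_elem_dvd_mult_iff by blast
qed

lemma hyp_point:
  assumes "good p" "vars_in V k" "\<not> p dvd k"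
  shows "\<exists>x\<in>hyp p. ev k (phi x) \<noteq> 0"
proof (rule ccontr)
  assume "\<not> ?thesis"
  then have "p dvd 1" using vanishing_imp_dvd[OF assms, of 1] by auto
  then show False using assms(1) by (auto simp: good_def prime_elem_def)
qed

text \<open>Open sets that meet the hypersurface contain the loci of some \<open>h\<close> and
  \<open>k\<close> not divisible by \<open>p\<close>. Then \<open>p\<close> does not divide
  \<open>h * k\<close> either, and \<open>hyp_point\<close> yields a point in both.\<close>

lemma irreducible_hyp:
  assumes p: "good p"
  shows "irreducible_in T (hyp p)"
  unfolding irreducible_in_def
proof (intro conjI allI impI)
  show "hyp p \<noteq> {}" using hyp_point[OF p D_vars] p by (auto simp: good_def)
  show "hyp p \<subseteq> topspace T" using hyp_X by simp
  fix C D' assume *: "closedin T C \<and> closedin T D' \<and> hyp p \<subseteq> C \<union> D'"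
  show "hyp p \<subseteq> C \<or> hyp p \<subseteq> D'"
  proof (rule ccontr)
    assume "\<not> (hyp p \<subseteq> C \<or> hyp p \<subseteq> D')"
    then obtain x y where xy: "x \<in> hyp p" "x \<notin> C" "y \<in> hyp p" "y \<notin> D'" by blast
    have o: "openin T (X - C)" "openin T (X - D')" using * by (simp_all add: openin_compl)
    obtain h where h: "vars_in V h" "ev h (phi x) \<noteq> 0" "\<forall>y\<in>U. ev h (phi y) \<noteq> 0 \<longrightarrow> y \<in> X - C"
      using openin_near[OF o(1), of x] xy U_X by (auto simp: hyp_def)
    obtain k where k: "vars_in V k" "ev k (phi y) \<noteq> 0" "\<forall>y\<in>U. ev k (phi y) \<noteq> 0 \<longrightarrow> y \<in> X - D'"
      using openin_near[OF o(2), of y] xy U_X by (auto simp: hyp_def)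
    have "\<not> p dvd h" "\<not> p dvd k" using h(2) k(2) xy(1,3) by (auto simp: hyp_def)
    then have "\<not> p dvd h * k" using p by (auto simp: good_def prime_elem_dvd_mult_iff)
    then obtain z where "z \<in> hyp p" "ev (h * k) (phi z) \<noteq> 0"
      using hyp_point[OF p, of "h * k"] h(1) k(1) by auto
    then show False using h(3) k(3) * by (auto simp: hyp_def)
  qed
qed

lemma hyp_cl_U:
  assumes "vars_in V p"
  shows "hyp_cl p \<inter> U = hyp p"
proof -
  have "closedin T (X - {y\<in>U. ev p (phi y) \<noteq> 0})"
    using open_nonvanishing[OF assms] by (rule closedin_compl)
  moreover have "hyp p \<subseteq> X - {y\<in>U. ev p (phi y) \<noteq> 0}" using U_X by (auto simp: hyp_def)
  ultimately have "hyp_cl p \<subseteq> X - {y\<in>U. ev p (phi y) \<noteq> 0}"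
    unfolding hyp_cl_def by (intro closure_of_minimal)
  moreover have "hyp p \<subseteq> hyp_cl p"
    unfolding hyp_cl_def by (rule closure_of_subset) (use hyp_X in simp)
  ultimately show ?thesis by (auto simp: hyp_def)
qed

lemma irreducible_hyp_cl: "good p \<Longrightarrow> irreducible_in T (hyp_cl p)"
  unfolding hyp_cl_def by (intro irreducible_in_closure irreducible_hyp)

lemma closedin_hyp_cl: "closedin T (hyp_cl p)"
  unfolding hyp_cl_def by simp

lemma hyp_cl_neq_X: "good p \<Longrightarrow> hyp_cl p \<noteq> X"
proof
  assume p: "good p" and "hyp_cl p = X"
  then have "hyp p = U" using hyp_cl_U[of p] U_X by (auto simp: good_def)
  moreover have "p \<noteq> 0" "vars_in V p" using p by (auto simp: good_def)
  ultimately show False using nonzero_point[of p] by (auto simp: hyp_def)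
qed

text \<open>Some nonzero \<open>k\<close> vanishes on \<open>Z \<inter> U\<close>. By irreducibility
  one irreducible factor of \<open>k\<close> already does, and it does not divide \<open>D\<close>
  because it has a zero on the chart. The rest of \<open>Z\<close> lies in the closure of
  \<open>Z \<inter> U\<close>.\<close>

lemma subset_hyp_cl:
  assumes Z: "closedin T Z" "irreducible_in T Z" "Z \<noteq> X" "Z \<inter> U \<noteq> {}"
  shows "\<exists>p. good p \<and> Z \<subseteq> hyp_cl p"
proof -
  have ZX: "Z \<subseteq> X" using closedin_subset[OF Z(1)] by simp
  have "openin T (X - Z)" using Z(1) by (rule openin_compl)
  then obtain k where k: "vars_in V k" "k \<noteq> 0" "\<forall>y\<in>U. ev k (phi y) \<noteq> 0 \<longrightarrow> y \<in> X - Z"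
    using opens_meet_U[of "X - Z"] Z(3) ZX by blast
  obtain u A where uA: "is_unit u" "\<forall>q\<in>#A. irreducible q" "k = u * prod_mset A"
    using irreducible_factorization[OF k(2)] by blast
  have vA: "vars_in V q" if "q \<in># A" for q
    using that uA(3) by (intro vars_in_dvd[OF _ k(2,1)]) (auto intro: dvd_prod_mset dvd_mult)
  \<comment> \<open>\<open>?C q\<close> contains all of \<open>X - U\<close>, which makes it closed
    in \<open>X\<close> and takes care of the points of \<open>Z\<close> outside the chart.\<close>
  let ?C = "\<lambda>q. X - {y\<in>U. ev q (phi y) \<noteq> 0}"
  obtain x0 where x0: "x0 \<in> Z" "x0 \<in> U" using Z(4) by blast
  have "Z \<subseteq> \<Union>(?C ` set_mset A)"
  proof
    fix x assume x: "x \<in> Z"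
    have "\<exists>q\<in>#A. ev q (phi y) = 0" if "y \<in> Z" "y \<in> U" for y
    proof -
      have "ev k (phi y) = 0" using k(3) that by blast
      moreover have "ev u (phi y) \<noteq> 0" using uA(1) by (auto simp: is_unit_mp_iff)
      ultimately have "ev (prod_mset A) (phi y) = 0" using uA(3) by simp
      then show ?thesis by (induction A) auto
    qed
    then have "\<exists>q\<in>#A. x \<in> U \<longrightarrow> ev q (phi x) = 0" using x x0 by blast
    then show "x \<in> \<Union>(?C ` set_mset A)" using ZX x by auto
  qed
  then obtain q where q: "q \<in># A" "Z \<subseteq> ?C q"
    using irreducible_in_finite_Union[OF Z(2), of "?C ` set_mset A"] closedin_compl[OF open_nonvanishing[OF vA]]
    by auto
  have "\<not> q dvd D"
  proof
    assume "q dvd D"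
    then have "ev q (phi x0) \<noteq> 0" using D_phi_nz[OF x0(2)] by (auto elim!: dvdE)
    then show False using q(2) x0 by blast
  qed
  then have good: "good q"
    using q(1) uA(2) vA irreducible_imp_prime_elem_mp by (auto simp: good_def)
  have "Z \<subseteq> T closure_of (U \<inter> Z)"
    by (rule irreducible_in_subset_closure[OF Z(2) openU]) (use x0 in auto)
  also have "\<dots> \<subseteq> hyp_cl q"
    unfolding hyp_cl_def by (rule closure_of_mono) (use q(2) in \<open>auto simp: hyp_def\<close>)
  finally show ?thesis using good by blast
qed

lemma hyp_cl_mono_imp_eq:
  assumes p: "good p" and q: "good q" and sub: "hyp_cl p \<subseteq> hyp_cl q"
  shows "hyp_cl p = hyp_cl q" "p dvd q" "q dvd p"
proof -
  have vp: "vars_in V p" "vars_in V q" using p q by (auto simp: good_def)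
  have "hyp p \<subseteq> hyp q" using sub hyp_cl_U[OF vp(1)] hyp_cl_U[OF vp(2)] by blast
  then have pq: "p dvd q"
    using p q by (intro vanishing_imp_dvd[OF p, of 1 q]) (auto simp: good_def hyp_def prime_elem_def)
  then obtain m where m: "q = p * m" by blast
  have "irreducible q" "\<not> is_unit p"
    using p q by (auto simp: good_def prime_elem_imp_irreducible)
  then have "is_unit m" using m by (meson irreducibleD)
  then have qp: "q dvd p" using m by (simp add: mult_unit_dvd_iff)
  have "a dvd b \<Longrightarrow> ev a y = 0 \<Longrightarrow> ev b y = 0" for a b y by (auto elim!: dvdE)
  from this[OF pq] this[OF qp] have "hyp p = hyp q" by (auto simp: hyp_def)
  then show "hyp_cl p = hyp_cl q" by (simp add: hyp_cl_def)
  show "p dvd q" "q dvd p" by fact+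
qed

text \<open>A closed irreducible set between the hypersurface and \<open>X\<close> lies in another
  hypersurface by \<open>subset_hyp_cl\<close>; inclusion of hypersurfaces is divisibility of
  irreducibles and so equality.\<close>

lemma prime_divisor_hyp_cl:
  assumes p: "good p"
  shows "prime_divisor Q X (hyp_cl p)"
  unfolding prime_divisor_def
proof (intro conjI allI impI)
  fix Z assume Z: "closedin T Z \<and> irreducible_in T Z \<and> hyp_cl p \<subseteq> Z"
  show "Z = hyp_cl p \<or> Z = X"
  proof (rule disjCI)
    assume "Z \<noteq> X"
    have "hyp p \<noteq> {}" using irreducible_hyp[OF p] by (simp add: irreducible_in_def)
    then have "Z \<inter> U \<noteq> {}" using Z hyp_cl_U[of p] p by (auto simp: good_def)
    then obtain q where q: "good q" "Z \<subseteq> hyp_cl q" using subset_hyp_cl[of Z] Z \<open>Z \<noteq> X\<close> by blast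
    then show "Z = hyp_cl p" using hyp_cl_mono_imp_eq(1)[OF p q(1)] Z by blast
  qed
qed (fact closedin_hyp_cl irreducible_hyp_cl[OF p] hyp_cl_neq_X[OF p])+

lemma prime_divisor_eq_hyp_cl:
  assumes "prime_divisor Q X Y" "Y \<inter> U \<noteq> {}"
  shows "\<exists>p. good p \<and> Y = hyp_cl p"
proof -
  obtain p where p: "good p" "Y \<subseteq> hyp_cl p"
    using subset_hyp_cl[of Y] assms unfolding prime_divisor_def by blast
  then have "hyp_cl p = Y \<or> hyp_cl p = X"
    using assms(1) irreducible_hyp_cl[OF p(1)] closedin_hyp_cl unfolding prime_divisor_def by blast
  then show ?thesis using p hyp_cl_neq_X by blast
qed

subsection \<open>Orders of rational functions\<close>

text \<open>Numerator and denominator may have common factors. This keeps products and inverses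
  simple, and only the difference of multiplicities is used later.\<close>

definition frac_rep :: "(('q \<Rightarrow> P1) \<Rightarrow> complex) \<Rightarrow> mp \<Rightarrow> mp \<Rightarrow> bool" where
  "frac_rep f g h \<longleftrightarrow> vars_in V g \<and> vars_in V h \<and> h \<noteq> 0 \<and>
     (\<forall>y\<in>U. ev h (phi y) \<noteq> 0 \<longrightarrow> f y = ev g (phi y) / ev h (phi y))"

lemma frac_unique:
  assumes "frac_rep f g h" "frac_rep f' g' h'" "openin T W" "W \<noteq> {}" "\<And>y. y \<in> W \<Longrightarrow> f y = f' y"
  shows "g * h' = g' * h"
proof -
  obtain k where k: "vars_in V k" "k \<noteq> 0" "\<forall>y\<in>U. ev k (phi y) \<noteq> 0 \<longrightarrow> y \<in> W"
    using opens_meet_U[OF assms(3,4)] by blast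
  have "g * h' - g' * h = 0"
  proof (rule zeroI[of _ "h * h' * k"])
    fix y assume y: "y \<in> U" "ev (h * h' * k) (phi y) \<noteq> 0"
    then have "f y = f' y" using assms(5) k(3) by simp
    then have "ev g (phi y) / ev h (phi y) = ev g' (phi y) / ev h' (phi y)"
      using y assms(1,2) by (simp add: frac_rep_def)
    then show "ev (g * h' - g' * h) (phi y) = 0" using y by (simp add: frac_eq_eq)
  qed (use assms(1,2) k in \<open>auto simp: frac_rep_def\<close>)
  then show ?thesis by simp
qed

lemma frac_rational_eq:
  "frac_rep f g h \<Longrightarrow> frac_rep f' g' h' \<Longrightarrow> rational_eq Q X f f' \<Longrightarrow> g * h' = g' * h"
  unfolding rational_eq_def using frac_unique[of f g h f' g' h'] by blast

lemma rational_eq_fracI: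
  assumes "vars_in V k" "k \<noteq> 0" "\<And>y. y \<in> U \<Longrightarrow> ev k (phi y) \<noteq> 0 \<Longrightarrow> f y = g y"
  shows "rational_eq Q X f g"
  unfolding rational_eq_def
  using assms nonzero_point[of k] open_nonvanishing[OF assms(1)]
  by (intro exI[of _ "{y\<in>U. ev k (phi y) \<noteq> 0}"]) auto

lemma frac_self: "vars_in V f \<Longrightarrow> frac_rep (\<lambda>y. ev f (phi y)) f 1"
  by (simp add: frac_rep_def)

lemma frac_mult: "frac_rep f g h \<Longrightarrow> frac_rep f' g' h' \<Longrightarrow> frac_rep (\<lambda>y. f y * f' y) (g * g') (h * h')"
  by (auto simp: frac_rep_def)

text \<open>The extra factor \<open>h\<close> above and below confines the claim to points where
  \<open>f\<close> is known to equal \<open>g / h\<close>.\<close>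

lemma frac_inverse: "frac_rep f g h \<Longrightarrow> g \<noteq> 0 \<Longrightarrow> frac_rep (\<lambda>y. inverse (f y)) (h * h) (g * h)"
  by (auto simp: frac_rep_def)

lemma frac_power: "frac_rep f g h \<Longrightarrow> frac_rep (\<lambda>y. f y ^ k) (g ^ k) (h ^ k)"
  by (induction k) (auto simp: frac_rep_def power_divide)

lemma rational_function_frac: "rational_function Q X f \<Longrightarrow> \<exists>g h. frac_rep f g h"
proof -
  assume "rational_function Q X f"
  then obtain W where W: "regular_on Q X W f" "W \<noteq> {}" unfolding rational_function_def by blast
  then obtain x where "x \<in> W" "x \<in> U" using dense[of W] by (auto simp: regular_on_def)
  then obtain g h where "vars_in V g" "vars_in V h" "ev h (phi x) \<noteq> 0"
    "\<forall>y\<in>U. ev h (phi y) \<noteq> 0 \<longrightarrow> y \<in> W \<and> f y = ev g (phi y) / ev h (phi y)"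
    using regular_onD[OF W(1)] by blast
  moreover from this have "h \<noteq> 0" by auto
  ultimately have "frac_rep f g h" by (simp add: frac_rep_def)
  then show ?thesis by blast
qed

lemma frac_rational_function: "frac_rep f g h \<Longrightarrow> rational_function Q X f"
  unfolding rational_function_def
  using regular_onI[of g h f] nonzero_point[of h]
  by (intro exI[of _ "{y\<in>U. ev h (phi y) \<noteq> 0}"]) (auto simp: frac_rep_def)

lemma frac_zero_iff: "frac_rep f g h \<Longrightarrow> rational_eq Q X f (\<lambda>_. 0) \<longleftrightarrow> g = 0"
proof
  assume f: "frac_rep f g h"
  have 0: "frac_rep (\<lambda>_. 0) 0 1" by (simp add: frac_rep_def)
  show "g = 0" if "rational_eq Q X f (\<lambda>_. 0)"
    using frac_rational_eq[OF f 0 that] by simp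
  show "rational_eq Q X f (\<lambda>_. 0)" if "g = 0"
    using that f by (intro rational_eq_fracI[of h]) (auto simp: frac_rep_def)
qed

text \<open>By irreducibility an open set that meets the closure of the hypersurface meets the
  hypersurface inside the chart. A fraction for \<open>f\<close> near such a point has a denominator
  that is nonzero there, hence not divisible by \<open>p\<close>.\<close>

lemma local_ring_frac:
  assumes p: "good p" and f: "f \<in> local_ring Q X (hyp_cl p)"
  shows "\<exists>g h. frac_rep f g h \<and> \<not> p dvd h"
    and "f \<in> local_maximal_ideal Q X (hyp_cl p) \<Longrightarrow> \<exists>g h. frac_rep f g h \<and> \<not> p dvd h \<and> p dvd g"
proof -
  have pV: "vars_in V p" using p by (simp add: good_def)
  have ne: "hyp p \<noteq> {}" using irreducible_hyp[OF p] by (simp add: irreducible_in_def)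
  have *: "\<exists>g h. frac_rep f g h \<and> \<not> p dvd h \<and> (\<forall>y\<in>U. ev h (phi y) \<noteq> 0 \<longrightarrow> y \<in> W \<and> f y = ev g (phi y) / ev h (phi y))"
    if W: "W \<inter> hyp_cl p \<noteq> {}" "regular_on Q X W f" for W
  proof -
    have "U \<inter> hyp_cl p \<noteq> {}" using hyp_cl_U[OF pV] ne by blast
    then have "W \<inter> U \<inter> hyp_cl p \<noteq> {}"
      using irreducible_in_opens_meet[OF irreducible_hyp_cl[OF p], of W U] W openU
      unfolding regular_on_def by blast
    then obtain x where x: "x \<in> W" "x \<in> U" "x \<in> hyp p" using hyp_cl_U[OF pV] by blast
    obtain g h where gh: "vars_in V g" "vars_in V h" "ev h (phi x) \<noteq> 0"
      "\<forall>y\<in>U. ev h (phi y) \<noteq> 0 \<longrightarrow> y \<in> W \<and> f y = ev g (phi y) / ev h (phi y)"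
      using regular_onD[OF W(2) x(1,2)] by blast
    moreover have "\<not> p dvd h" using gh(3) x(3) by (auto simp: hyp_def)
    moreover have "h \<noteq> 0" using gh(3) by auto
    then have "frac_rep f g h" using gh by (simp add: frac_rep_def)
    ultimately show ?thesis by blast
  qed
  then show "\<exists>g h. frac_rep f g h \<and> \<not> p dvd h" using f unfolding local_ring_def by blast
  assume "f \<in> local_maximal_ideal Q X (hyp_cl p)"
  then obtain W where W: "W \<inter> hyp_cl p \<noteq> {}" "regular_on Q X W f" "\<forall>x\<in>W \<inter> hyp_cl p. f x = 0"
    unfolding local_maximal_ideal_def by blast
  obtain g h where gh: "frac_rep f g h" "\<not> p dvd h"
    "\<forall>y\<in>U. ev h (phi y) \<noteq> 0 \<longrightarrow> y \<in> W \<and> f y = ev g (phi y) / ev h (phi y)"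
    using *[OF W(1,2)] by blast
  have "p dvd g"
  proof (rule vanishing_imp_dvd[OF p, of h])
    fix x assume x: "x \<in> hyp p" "ev h (phi x) \<noteq> 0"
    then have "x \<in> U" "x \<in> hyp_cl p" using hyp_cl_U[OF pV] by auto
    then have "f x = 0" "f x = ev g (phi x) / ev h (phi x)" using gh(3) W(3) x(2) by blast+
    then show "ev g (phi x) = 0" using x(2) by simp
  qed (use gh(1,2) in \<open>simp_all add: frac_rep_def\<close>)
  then show "\<exists>g h. frac_rep f g h \<and> \<not> p dvd h \<and> p dvd g" using gh by blast
qed

lemma maximal_ideal_sub_local_ring: "local_maximal_ideal Q X Y \<subseteq> local_ring Q X Y"
  by (auto simp: local_ring_def local_maximal_ideal_def)

text \<open>Membership in the maximal ideal is witnessed by some fraction with numerator divisible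
  by \<open>p\<close>; cross-multiplication with the given fraction transfers the
  divisibility.\<close>

lemma frac_local_ring:
  assumes p: "good p" and f: "frac_rep f g h" and h: "\<not> p dvd h"
  shows "f \<in> local_ring Q X (hyp_cl p)"
    and "f \<in> local_maximal_ideal Q X (hyp_cl p) \<longleftrightarrow> p dvd g"
proof -
  let ?W = "{y\<in>U. ev h (phi y) \<noteq> 0}"
  have pV: "vars_in V p" using p by (simp add: good_def)
  have gh: "vars_in V g" "vars_in V h" using f by (auto simp: frac_rep_def)
  have reg: "regular_on Q X ?W f" using f by (intro regular_onI) (auto simp: frac_rep_def)
  have ne: "?W \<inter> hyp_cl p \<noteq> {}"
  proof -
    obtain x where x: "x \<in> hyp p" "ev h (phi x) \<noteq> 0" using hyp_point[OF p gh(2) h] by blast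
    then have "x \<in> hyp_cl p" "x \<in> U" using hyp_cl_U[OF pV] by blast+
    then show ?thesis using x(2) by blast
  qed
  show lr: "f \<in> local_ring Q X (hyp_cl p)"
    unfolding local_ring_def mem_Collect_eq by (rule exI[of _ ?W], rule conjI[OF ne reg])
  show "f \<in> local_maximal_ideal Q X (hyp_cl p) \<longleftrightarrow> p dvd g"
  proof
    assume "p dvd g"
    then obtain m where m: "g = p * m" by blast
    have "f x = 0" if x: "x \<in> ?W \<inter> hyp_cl p" for x
    proof -
      have "x \<in> hyp p" using x hyp_cl_U[OF pV] by blast
      then have "ev g (phi x) = 0" by (simp add: m hyp_def)
      moreover have "f x = ev g (phi x) / ev h (phi x)" using x f unfolding frac_rep_def by blast
      ultimately show ?thesis by simp
    qed
    then show "f \<in> local_maximal_ideal Q X (hyp_cl p)"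
      unfolding local_maximal_ideal_def mem_Collect_eq
      by (intro exI[of _ ?W] conjI ne reg) blast
  next
    assume "f \<in> local_maximal_ideal Q X (hyp_cl p)"
    then obtain g' h' where gh': "frac_rep f g' h'" "\<not> p dvd h'" "p dvd g'"
      using local_ring_frac(2)[OF p lr] by blast
    have "g * h' = g' * h" by (rule frac_unique[OF f gh'(1) openin_topspace]) (use U_X nonzero_point[of 1] in auto)
    then have "p dvd g * h'" using gh'(3) by simp
    then show "p dvd g" using gh'(2) p by (auto simp: good_def prime_elem_dvd_mult_iff)
  qed
qed

lemma uniformizer_p:
  assumes p: "good p"
  shows "uniformizer Q X (hyp_cl p) (\<lambda>y. ev p (phi y))"
proof -
  have pV: "vars_in V p" "prime_elem p" using p by (auto simp: good_def)
  have 1: "\<not> p dvd 1" using pV by (simp add: prime_elem_def)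
  show ?thesis
    unfolding uniformizer_def
  proof (intro conjI ballI)
    show "(\<lambda>y. ev p (phi y)) \<in> local_maximal_ideal Q X (hyp_cl p)"
      using frac_local_ring(2)[OF p frac_self[OF pV(1)] 1] by simp
    fix f assume f: "f \<in> local_maximal_ideal Q X (hyp_cl p)"
    then obtain g h where gh: "frac_rep f g h" "\<not> p dvd h" "p dvd g"
      using local_ring_frac(2)[OF p] maximal_ideal_sub_local_ring by blast
    obtain g' where g': "g = p * g'" using gh(3) by blast
    have vg': "vars_in V g'"
      using gh(1) g' vars_in_factor[of V g' p] by (cases "g' = 0") (use pV in \<open>auto simp: frac_rep_def mult.commute prime_elem_def\<close>)
    have fr: "frac_rep (\<lambda>y. ev g' (phi y) / ev h (phi y)) g' h" using gh(1) vg' by (simp add: frac_rep_def)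
    show "\<exists>k\<in>local_ring Q X (hyp_cl p). rational_eq Q X f (\<lambda>x. ev p (phi x) * k x)"
    proof (rule bexI[OF _ frac_local_ring(1)[OF p fr gh(2)]])
      show "rational_eq Q X f (\<lambda>x. ev p (phi x) * (ev g' (phi x) / ev h (phi x)))"
        using gh(1) g' by (intro rational_eq_fracI[of h]) (auto simp: frac_rep_def)
    qed
  qed
qed

text \<open>Since \<open>p\<close> is a multiple of \<open>t\<close> in the local ring, its
  multiplicity 1 bounds that of the numerator of \<open>t\<close>.\<close>

lemma uniformizer_frac:
  assumes p: "good p" and t: "uniformizer Q X (hyp_cl p) t"
  shows "\<exists>g h. frac_rep t g h \<and> g \<noteq> 0 \<and> multiplicity p g = 1 \<and> \<not> p dvd h"
proof -
  have pV: "vars_in V p" "prime_elem p" using p by (auto simp: good_def)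
  have tm: "t \<in> local_maximal_ideal Q X (hyp_cl p)" using t by (simp add: uniformizer_def)
  then obtain g h where gh: "frac_rep t g h" "\<not> p dvd h" "p dvd g"
    using local_ring_frac(2)[OF p] maximal_ideal_sub_local_ring by blast
  have "(\<lambda>y. ev p (phi y)) \<in> local_maximal_ideal Q X (hyp_cl p)"
    using uniformizer_p[OF p] by (simp add: uniformizer_def)
  then obtain k where k: "k \<in> local_ring Q X (hyp_cl p)" "rational_eq Q X (\<lambda>y. ev p (phi y)) (\<lambda>x. t x * k x)"
    using t unfolding uniformizer_def by blast
  obtain a b where ab: "frac_rep k a b" "\<not> p dvd b" using local_ring_frac(1)[OF p k(1)] by blast
  have eq: "p * (h * b) = g * a * 1"
    using frac_rational_eq[OF frac_self[OF pV(1)] frac_mult[OF gh(1) ab(1)] k(2)] .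
  have nz: "p \<noteq> 0" "h \<noteq> 0" "b \<noteq> 0" using pV gh ab by (auto simp: frac_rep_def prime_elem_def)
  then have g0: "g \<noteq> 0" using eq by auto
  have "\<not> p ^ 2 dvd g"
  proof
    assume "p ^ 2 dvd g"
    then obtain c where "g = p ^ 2 * c" by (elim dvdE)
    then have "g = p * (p * c)" by (simp add: power2_eq_square mult.assoc)
    then have "p * (h * b) = p * (p * (c * a))" using eq by (simp add: mult_ac)
    then have "p dvd h * b" using nz by simp
    then show False using gh ab pV by (auto simp: prime_elem_dvd_mult_iff)
  qed
  then have "multiplicity p g = 1"
    using gh(3) by (intro multiplicity_eqI) (auto simp: power2_eq_square)
  then show ?thesis using gh g0 by blast
qed

text \<open>Existence of the exponent: split off the powers of \<open>p\<close> from
  \<open>g\<close> and \<open>h\<close>; the rest is a unit of the local ring. Uniqueness, for an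
  arbitrary uniformizer: clear denominators and compare the multiplicities of \<open>p\<close> on
  both sides.\<close>

theorem ord_along_hyp_cl:
  assumes p: "good p" and f: "frac_rep f g h" "g \<noteq> 0"
  shows "ord_along Q X (hyp_cl p) f = int (multiplicity p g) - int (multiplicity p h)"
  unfolding ord_along_def
proof (rule the_equality)
  have pV: "vars_in V p" "prime_elem p" using p by (auto simp: good_def)
  have fh: "h \<noteq> 0" "vars_in V g" "vars_in V h" using f by (auto simp: frac_rep_def)
  have nu: "\<not> is_unit p" using pV by (simp add: prime_elem_def)
  define a b where "a = multiplicity p g" and "b = multiplicity p h"
  obtain g' where g': "g = p ^ a * g'" "\<not> p dvd g'"
    using multiplicity_decompose'[OF f(2) nu] unfolding a_def by blast
  obtain h' where h': "h = p ^ b * h'" "\<not> p dvd h'"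
    using multiplicity_decompose'[OF fh(1) nu] unfolding b_def by blast
  have v': "vars_in V g'" "vars_in V h'"
    using vars_in_factor[of V g' "p ^ a"] vars_in_factor[of V h' "p ^ b"] fh f(2) g' h' by (auto simp: mult.commute)
  define u where "u = (\<lambda>y. ev g' (phi y) / ev h' (phi y))"
  have nz: "g' \<noteq> 0" "h' \<noteq> 0" "p \<noteq> 0" using g' h' f(2) fh(1) pV by (auto simp: prime_elem_def)
  have fu: "frac_rep u g' h'" using v' nz by (simp add: frac_rep_def u_def)
  have "rational_eq Q X f (\<lambda>x. u x * ev p (phi x) powi (int a - int b))"
  \<comment> \<open>The factor \<open>p\<close> excludes the zeros of \<open>p\<close>, where the
    law for differences of integer exponents fails.\<close>
  proof (rule rational_eq_fracI[of "h * p"])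
    fix y assume y: "y \<in> U" "ev (h * p) (phi y) \<noteq> 0"
    then have "f y = ev g (phi y) / ev h (phi y)" using f by (simp add: frac_rep_def)
    also have "\<dots> = u y * (ev p (phi y) ^ a / ev p (phi y) ^ b)" by (simp add: u_def g'(1) h'(1) mult_ac)
    also have "ev p (phi y) ^ a / ev p (phi y) ^ b = ev p (phi y) powi (int a - int b)"
      using y by (simp add: power_int_diff)
    finally show "f y = u y * ev p (phi y) powi (int a - int b)" .
  qed (use fh nz pV in auto)
  then show "\<exists>t u. uniformizer Q X (hyp_cl p) t \<and>
     u \<in> local_ring Q X (hyp_cl p) - local_maximal_ideal Q X (hyp_cl p) \<and>
     rational_eq Q X f (\<lambda>x. u x * t x powi (int a - int b))"
    using uniformizer_p[OF p] frac_local_ring[OF p fu h'(2)] g'(2) by blast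
  fix k
  assume "\<exists>t u. uniformizer Q X (hyp_cl p) t \<and>
     u \<in> local_ring Q X (hyp_cl p) - local_maximal_ideal Q X (hyp_cl p) \<and>
     rational_eq Q X f (\<lambda>x. u x * t x powi k)"
  then obtain t u where t: "uniformizer Q X (hyp_cl p) t" and u: "u \<in> local_ring Q X (hyp_cl p)"
    "u \<notin> local_maximal_ideal Q X (hyp_cl p)" and eq: "rational_eq Q X f (\<lambda>x. u x * t x powi k)" by blast
  obtain gt ht where gt: "frac_rep t gt ht" "gt \<noteq> 0" "multiplicity p gt = 1" "\<not> p dvd ht"
    using uniformizer_frac[OF p t] by blast
  obtain gu hu where gu: "frac_rep u gu hu" "\<not> p dvd hu" using local_ring_frac(1)[OF p u(1)] by blast
  have gu': "\<not> p dvd gu" using frac_local_ring(2)[OF p gu] u(2) by blast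
  have m0: "multiplicity p gu = 0" "multiplicity p hu = 0" "multiplicity p ht = 0"
    using gu gu' gt by (auto simp: not_dvd_imp_multiplicity_0)
  have nz': "gu \<noteq> 0" "hu \<noteq> 0" "ht \<noteq> 0" using gu gu' gt by auto
  note mult = prime_elem_multiplicity_mult_distrib[OF pV(2)] prime_elem_multiplicity_power_distrib[OF pV(2)]
  show "k = int a - int b"
  proof (cases "k \<ge> 0")
    case True
    then obtain m where m: "k = int m" using nonneg_int_cases by blast
    have "g * (hu * ht ^ m) = (gu * gt ^ m) * h"
      by (rule frac_rational_eq[OF f(1) frac_mult[OF gu(1) frac_power[OF gt(1)]]]) (use eq m in simp)
    then have "multiplicity p (g * (hu * ht ^ m)) = multiplicity p ((gu * gt ^ m) * h)" by simp
    then show ?thesis using nz' f(2) fh(1) gt m0 m by (simp add: mult a_def b_def)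
  next
    case False
    \<comment> \<open>For a negative exponent the fraction of \<open>t\<close> is inverted first,
      which by \<open>frac_inverse\<close> puts \<open>ht * ht\<close> over
      \<open>gt * ht\<close>.\<close>
    define m where "m = nat (- k)"
    have m: "k = - int m" using False by (simp add: m_def)
    have "g * (hu * (gt * ht) ^ m) = (gu * (ht * ht) ^ m) * h"
      by (rule frac_rational_eq[OF f(1) frac_mult[OF gu(1) frac_power[OF frac_inverse[OF gt(1,2)]]]])
        (use eq m in \<open>simp add: power_int_minus power_inverse\<close>)
    then have "multiplicity p (g * (hu * (gt * ht) ^ m)) = multiplicity p ((gu * (ht * ht) ^ m) * h)" by simp
    then show ?thesis using nz' f(2) fh(1) gt m0 m by (simp add: mult a_def b_def)
  qed
qed

end

section \<open>Points of the projective line and cross-ratios\<close>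

lemma hcoord_nz: "hcoord p \<noteq> (0, 0)"
  by (cases p) auto

lemma P1_point_hcoord [simp]: "P1_point (fst (hcoord p)) (snd (hcoord p)) = p"
  by (cases p) (auto simp: P1_point_def)

lemma P1_det_eq_0_iff [simp]: "P1_det p q = 0 \<longleftrightarrow> p = q"
  by (cases p; cases q) (auto simp: P1_det_def)

lemma P1_det_self [simp]: "P1_det p p = 0"
  by simp

lemma P1_det_swap: "P1_det p q = - P1_det q p"
  by (simp add: P1_det_def)

lemma P1_point_scale: "c \<noteq> 0 \<Longrightarrow> P1_point (c * a) (c * b) = P1_point a b"
  by (simp add: P1_point_def)

lemma P1_point_scale': "c \<noteq> 0 \<Longrightarrow> a' = c * a \<Longrightarrow> b' = c * b \<Longrightarrow> P1_point a' b' = P1_point a b"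
  by (simp add: P1_point_scale)

lemma P1_point_simps [simp]:
  "P1_point a 0 = Infinity" "b \<noteq> 0 \<Longrightarrow> P1_point 0 b = Finite 0" "b \<noteq> 0 \<Longrightarrow> P1_point b b = Finite 1"
  "P1_point a 1 = Finite a"
  by (auto simp: P1_point_def)

lemma P1_point_eq_iff:
  assumes "(a, b) \<noteq> (0, 0)" "(c, d) \<noteq> (0, 0)"
  shows "P1_point a b = P1_point c d \<longleftrightarrow> a * d = c * b"
  using assms by (auto simp: P1_point_def field_simps)

lemma P1_det_P1_point:
  assumes "(a, b) \<noteq> (0, 0)" "(c, d) \<noteq> (0, 0)"
  shows "a * d - c * b = (if b = 0 then a else b) * (if d = 0 then c else d) * P1_det (P1_point a b) (P1_point c d)"
  using assms by (auto simp: P1_det_def P1_point_def field_simps)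

text \<open>Each point occurs once in the numerator and once in the denominator, so a change of its
  homogeneous coordinates multiplies both by the same factor.\<close>

lemma cross_ratio_P1_point:
  assumes nz: "(a1, b1) \<noteq> (0, 0)" "(a2, b2) \<noteq> (0, 0)" "(a3, b3) \<noteq> (0, 0)" "(a4, b4) \<noteq> (0, 0)"
  shows "cross_ratio (P1_point a1 b1) (P1_point a2 b2) (P1_point a3 b3) (P1_point a4 b4) =
    P1_point ((a1 * b3 - a3 * b1) * (a2 * b4 - a4 * b2)) ((a2 * b3 - a3 * b2) * (a1 * b4 - a4 * b1))"
proof -
  define s where "s = (\<lambda>a b::complex. if b = 0 then a else b)"
  have s: "s a1 b1 \<noteq> 0" "s a2 b2 \<noteq> 0" "s a3 b3 \<noteq> 0" "s a4 b4 \<noteq> 0"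
    using nz by (auto simp: s_def)
  have d: "a * d - c * b = s a b * s c d * P1_det (P1_point a b) (P1_point c d)"
    if "(a, b) \<noteq> (0, 0)" "(c, d) \<noteq> (0, 0)" for a b c d
    using P1_det_P1_point[OF that] by (simp add: s_def)
  show ?thesis
    unfolding cross_ratio_def d[OF nz(1,3)] d[OF nz(2,4)] d[OF nz(2,3)] d[OF nz(1,4)] using s
    by (intro P1_point_scale'[symmetric, of "s a1 b1 * s a2 b2 * s a3 b3 * s a4 b4"])
      (simp_all add: mult_ac)
qed

text \<open>The values 0, 1 and \<open>Infinity\<close> are the three boundary points of the moduli
  space of four marks, one for each way to pair them.\<close>

lemma cross_ratio_degenerate:
  "p \<noteq> r \<Longrightarrow> p \<noteq> s \<Longrightarrow> cross_ratio p p r s = Finite 1"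
  "p \<noteq> r \<Longrightarrow> p \<noteq> s \<Longrightarrow> cross_ratio r s p p = Finite 1"
  "q \<noteq> p \<Longrightarrow> p \<noteq> r \<Longrightarrow> cross_ratio p q p r = Finite 0"
  "q \<noteq> p \<Longrightarrow> p \<noteq> r \<Longrightarrow> cross_ratio q p r p = Finite 0"
  "q \<noteq> p \<Longrightarrow> p \<noteq> r \<Longrightarrow> cross_ratio q p p r = Infinity"
  "q \<noteq> p \<Longrightarrow> p \<noteq> r \<Longrightarrow> cross_ratio p q r p = Infinity"
  by (simp_all add: cross_ratio_def mult.commute eq_commute[of p])

section \<open>Stable trees and smoothing families\<close>

text \<open>The conditions of \<open>stable_curve\<close> for an arbitrary finite set of marks:
  removing a leaf, on which the inductions rest, changes the marks.\<close>

definition tree_curve :: "nat set \<Rightarrow> marked_curve \<Rightarrow> bool" where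
  "tree_curve S C \<longleftrightarrow> finite S \<and>
     finite (comps C) \<and> comps C \<noteq> {} \<and>
     adj C \<subseteq> comps C \<times> comps C \<and> sym (adj C) \<and> irrefl (adj C) \<and>
     (\<forall>a\<in>comps C. \<forall>b\<in>comps C. (a, b) \<in> (adj C)\<^sup>*) \<and>
     card (adj C) = 2 * (card (comps C) - 1) \<and>
     (\<forall>i\<in>S. mark_comp C i \<in> comps C) \<and>
     (\<forall>a\<in>comps C.
        inj_on (node_pt C a) (adj C `` {a}) \<and>
        inj_on (mark_pt C) {i\<in>S. mark_comp C i = a} \<and>
        node_pt C a ` (adj C `` {a}) \<inter> mark_pt C ` {i\<in>S. mark_comp C i = a} = {} \<and>
        card (adj C `` {a}) + card {i\<in>S. mark_comp C i = a} \<ge> 3)"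

lemma stable_curve_tree_curve: "stable_curve n C \<longleftrightarrow> tree_curve {1..n} C"
  by (simp add: stable_curve_def tree_curve_def marks_on_def)

text \<open>The degrees in a tree add up to \<open>2 * (card (comps C) - 1)\<close>, so some
  component has degree less than 2; connectedness excludes degree 0.\<close>

lemma ex_leaf:
  assumes "tree_curve S C" "card (comps C) \<ge> 2"
  shows "\<exists>a b. a \<in> comps C \<and> b \<in> comps C \<and> adj C `` {b} = {a}"
proof -
  have fin: "finite (comps C)" and sub: "adj C \<subseteq> comps C \<times> comps C"
    and conn: "\<And>a b. a \<in> comps C \<Longrightarrow> b \<in> comps C \<Longrightarrow> (a, b) \<in> (adj C)\<^sup>*"
    and cd: "card (adj C) = 2 * (card (comps C) - 1)"
    using assms(1) by (auto simp: tree_curve_def)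
  have finadj: "finite (adj C)" using fin sub by (meson finite_SigmaI finite_subset)
  have fini: "finite (adj C `` {b})" for b using finadj by (rule finite_Image)
  have "adj C = Sigma (comps C) (\<lambda>b. adj C `` {b})" using sub by auto
  then have sum: "card (adj C) = (\<Sum>b\<in>comps C. card (adj C `` {b}))"
    using card_SigmaI[OF fin, of "\<lambda>b. adj C `` {b}"] fini by simp
  have "\<exists>b\<in>comps C. card (adj C `` {b}) < 2"
  proof (rule ccontr)
    assume "\<not> ?thesis"
    then have "2 \<le> card (adj C `` {b})" if "b \<in> comps C" for b using that by (meson not_less)
    then have "of_nat (card (comps C)) * 2 \<le> (\<Sum>b\<in>comps C. card (adj C `` {b}))"
      by (intro sum_bounded_below)
    then have "card (comps C) * 2 \<le> card (adj C)" unfolding sum by (simp only: of_nat_id)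
    then show False using cd assms(2) by linarith
  qed
  then obtain b where b: "b \<in> comps C" "card (adj C `` {b}) < 2" by blast
  have "adj C `` {b} \<noteq> {}"
  proof
    assume e: "adj C `` {b} = {}"
    obtain c where c: "c \<in> comps C" "c \<noteq> b"
      using assms(2) b(1) by (metis One_nat_def Suc_1 card_le_Suc0_iff_eq fin not_less_eq_eq)
    from conn[OF b(1) c(1)] show False using e c(2) by (cases rule: converse_rtranclE) auto
  qed
  then have "card (adj C `` {b}) = 1" using b(2) fini[of b] by (metis One_nat_def card_0_eq less_2_cases_iff)
  then obtain a where "adj C `` {b} = {a}" by (auto simp: card_1_singleton_iff)
  moreover have "a \<in> comps C" using calculation sub by auto
  ultimately show ?thesis using b by blast
qed

text \<open>Remove the leaf \<open>b\<close>, attached to \<open>a\<close>, and put the mark \<open>s\<close> in the place of the node.\<close>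

definition prune :: "marked_curve \<Rightarrow> nat \<Rightarrow> nat \<Rightarrow> nat \<Rightarrow> marked_curve" where
  "prune C a b s = C\<lparr>comps := comps C - {b}, adj := adj C \<inter> (- {b}) \<times> (- {b}),
     mark_comp := (mark_comp C)(s := a), mark_pt := (mark_pt C)(s := node_pt C a b)\<rparr>"

locale leaf =
  fixes S :: "nat set" and C :: marked_curve and a b s :: nat
  assumes tree: "tree_curve S C" and a: "a \<in> comps C" and b: "b \<in> comps C"
    and leaf: "adj C `` {b} = {a}" and s: "s \<in> S" "mark_comp C s = b"
begin

definition "Sb = {i\<in>S. mark_comp C i = b}"
definition "S' = insert s (S - Sb)"
definition "C' = prune C a b s"
text \<open>Seen from the rest of the curve every mark of the leaf sits at the node, which carries
  the mark \<open>s\<close> after pruning.\<close>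

definition rho :: "nat \<Rightarrow> nat" where "rho i = (if i \<in> Sb then s else i)"

lemma C'_simps [simp]: "comps C' = comps C - {b}" "adj C' = adj C \<inter> (- {b}) \<times> (- {b})"
  "mark_comp C' = (mark_comp C)(s := a)" "mark_pt C' = (mark_pt C)(s := node_pt C a b)"
  "node_pt C' = node_pt C"
  by (simp_all add: C'_def prune_def)

lemma adj_props: "finite (adj C)" "sym (adj C)" "irrefl (adj C)" "adj C \<subseteq> comps C \<times> comps C"
  using tree finite_subset[of "adj C" "comps C \<times> comps C"] by (auto simp: tree_curve_def)

lemma adj_b: "(b, x) \<in> adj C \<longleftrightarrow> x = a" "(x, b) \<in> adj C \<longleftrightarrow> x = a"
  using leaf adj_props(2) by (auto dest: symD)

lemma ab: "a \<noteq> b"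
  using adj_b adj_props(3) by (auto simp: irrefl_def)

text \<open>Moving \<open>b\<close> onto its only neighbour \<open>a\<close> contracts the edge
  between them and keeps all other edges. The set \<open>R\<close> is the component left out in
  \<open>next_comp\<close>, or empty for plain connectedness.\<close>

lemma retract_path:
  assumes "(x, y) \<in> (adj C \<inter> (- R) \<times> (- R))\<^sup>*"
  shows "((if x = b then a else x), (if y = b then a else y)) \<in> (adj C' \<inter> (- R) \<times> (- R))\<^sup>*"
  using assms
proof (induction rule: rtrancl_induct)
  case (step y z)
  let ?y = "if y = b then a else y" and ?z = "if z = b then a else z"
  have "(?y, ?z) \<in> (adj C' \<inter> (- R) \<times> (- R))\<^sup>*"
    using step(2) adj_b ab by (cases "y = b"; cases "z = b") auto
  then show ?case using step.IH by (rule rtrancl_trans[rotated])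
qed auto

lemma unretract_path: "(x, y) \<in> (adj C' \<inter> R)\<^sup>* \<Longrightarrow> (x, y) \<in> (adj C \<inter> R)\<^sup>*"
  by (rule rtrancl_mono[THEN subsetD, rotated]) auto

lemma no_path_b: "(x, b) \<in> (adj C \<inter> (- {a}) \<times> (- {a}))\<^sup>* \<Longrightarrow> x = b"
  by (erule rtranclE) (auto simp: adj_b)

lemma no_path_b': "(b, x) \<in> (adj C \<inter> (- {a}) \<times> (- {a}))\<^sup>* \<Longrightarrow> x = b"
  by (erule converse_rtranclE) (auto simp: adj_b)

text \<open>The conditions in the two definite descriptions are equivalent for each candidate
  \<open>e\<close>, so the descriptions have the same value.\<close>

lemma next_comp_same:
  assumes "c \<noteq> b" "d \<noteq> b"
  shows "next_comp C c d = next_comp C' c d"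
proof -
  have "(c, e) \<in> adj C \<and> (e, d) \<in> (adj C \<inter> (- {c}) \<times> (- {c}))\<^sup>* \<longleftrightarrow>
      (c, e) \<in> adj C' \<and> (e, d) \<in> (adj C' \<inter> (- {c}) \<times> (- {c}))\<^sup>*" for e
  proof (cases "e = b")
    case True
    then show ?thesis using assms no_path_b'[of d] adj_b by auto
  next
    case False
    then show ?thesis using assms retract_path[of e d "{c}"] unretract_path[of e d "(- {c}) \<times> (- {c})"] by auto
  qed
  then show ?thesis unfolding next_comp_def by presburger
qed

lemma next_comp_to_b:
  assumes "c \<noteq> b" "c \<noteq> a"
  shows "next_comp C c b = next_comp C' c a"
proof -
  have "(c, e) \<in> adj C \<and> (e, b) \<in> (adj C \<inter> (- {c}) \<times> (- {c}))\<^sup>* \<longleftrightarrow>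
      (c, e) \<in> adj C' \<and> (e, a) \<in> (adj C' \<inter> (- {c}) \<times> (- {c}))\<^sup>*" for e
  proof (cases "e = b")
    case True
    then show ?thesis using assms adj_b by auto
  next
    case False
    have "(e, b) \<in> (adj C \<inter> (- {c}) \<times> (- {c}))\<^sup>*" if "(e, a) \<in> (adj C' \<inter> (- {c}) \<times> (- {c}))\<^sup>*"
    proof (rule rtrancl.rtrancl_into_rtrancl)
      show "(e, a) \<in> (adj C \<inter> (- {c}) \<times> (- {c}))\<^sup>*" using that by (rule unretract_path)
      show "(a, b) \<in> adj C \<inter> (- {c}) \<times> (- {c})" using adj_b assms by auto
    qed
    then show ?thesis using False assms retract_path[of e b "{c}"] by auto
  qed
  then show ?thesis unfolding next_comp_def by presburger
qed

lemma next_comp_a_b: "next_comp C a b = b"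
  unfolding next_comp_def by (rule the_equality) (auto simp: adj_b dest: no_path_b)

lemma conn: "x \<in> comps C \<Longrightarrow> y \<in> comps C \<Longrightarrow> (x, y) \<in> (adj C)\<^sup>*"
  using tree by (auto simp: tree_curve_def)

lemma next_comp_from_b:
  assumes "d \<in> comps C" "d \<noteq> b"
  shows "next_comp C b d = a"
  unfolding next_comp_def
proof (rule the_equality)
  have "(a, d) \<in> (adj C \<inter> (- {}) \<times> (- {}))\<^sup>*" using conn[OF a assms(1)] by simp
  then have "(a, d) \<in> (adj C')\<^sup>*" using retract_path[of a d "{}"] ab assms by simp
  then show "(b, a) \<in> adj C \<and> (a, d) \<in> (adj C \<inter> (- {b}) \<times> (- {b}))\<^sup>*" by (simp add: adj_b)
qed (simp add: adj_b)

lemma contracted_mark_b: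
  assumes "i \<in> S"
  shows "contracted_mark C b i = (if i \<in> Sb then mark_pt C i else node_pt C b a)"
  using assms next_comp_from_b tree by (auto simp: contracted_mark_def Sb_def tree_curve_def)

lemma contracted_mark_other:
  assumes "i \<in> S" "c \<noteq> b"
  shows "contracted_mark C c i = contracted_mark C' c (rho i)"
proof (cases "i \<in> Sb")
  case True
  then have r: "rho i = s" and mc: "mark_comp C i = b" by (auto simp: rho_def Sb_def)
  show ?thesis
    using assms(2) next_comp_to_b[OF assms(2)] by (cases "c = a") (simp_all add: contracted_mark_def r mc next_comp_a_b)
next
  case False
  then have "i \<noteq> s" "mark_comp C i \<noteq> b" using assms s by (auto simp: Sb_def)
  moreover have "rho i = i" using False by (simp add: rho_def)
  ultimately show ?thesis using next_comp_same[OF assms(2), of "mark_comp C i"]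
    by (simp add: contracted_mark_def)
qed

text \<open>Only the component \<open>a\<close> changes: it loses the node with \<open>b\<close> and
  gains the mark \<open>s\<close> at the same point. Distinctness of the special points and the
  stability count are preserved, and one edge goes with one component.\<close>

lemma tree': "tree_curve S' C'"
proof -
  have fin: "finite (comps C)" "finite S" and cd: "card (adj C) = 2 * (card (comps C) - 1)"
    and mc: "\<And>i. i \<in> S \<Longrightarrow> mark_comp C i \<in> comps C"
    using tree by (auto simp: tree_curve_def)
  have sb: "s \<in> Sb" using s by (simp add: Sb_def)
  have adj': "adj C' = adj C - {(a, b), (b, a)}" using adj_b by auto
  have "{(a, b), (b, a)} \<subseteq> adj C" using adj_b by auto
  then have "card (adj C') = card (adj C) - card {(a, b), (b, a)}"
    unfolding adj' by (intro card_Diff_subset) auto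
  then have c1: "card (adj C') = 2 * (card (comps C') - 1)" using cd ab b fin by simp
  have c2: "(x, y) \<in> (adj C')\<^sup>*" if "x \<in> comps C'" "y \<in> comps C'" for x y
    using retract_path[of x y "{}"] conn[of x y] that by simp
  have stab: "inj_on (node_pt C' c) (adj C' `` {c}) \<and>
        inj_on (mark_pt C') {i\<in>S'. mark_comp C' i = c} \<and>
        node_pt C' c ` (adj C' `` {c}) \<inter> mark_pt C' ` {i\<in>S'. mark_comp C' i = c} = {} \<and>
        card (adj C' `` {c}) + card {i\<in>S'. mark_comp C' i = c} \<ge> 3" if c: "c \<in> comps C'" for c
  proof -
    have cc: "c \<in> comps C" "c \<noteq> b" using c by auto
    have st: "inj_on (node_pt C c) (adj C `` {c})" "inj_on (mark_pt C) {i\<in>S. mark_comp C i = c}"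
        "node_pt C c ` (adj C `` {c}) \<inter> mark_pt C ` {i\<in>S. mark_comp C i = c} = {}"
        "card (adj C `` {c}) + card {i\<in>S. mark_comp C i = c} \<ge> 3"
      using tree cc(1) unfolding tree_curve_def by blast+
    show ?thesis
    proof (cases "c = a")
      case False
      have 1: "adj C' `` {c} = adj C `` {c}" using False cc adj_b by auto
      have 2: "{i\<in>S'. mark_comp C' i = c} = {i\<in>S. mark_comp C i = c}"
        using False cc s by (auto simp: S'_def Sb_def)
      have 3: "mark_pt C' i = mark_pt C i" if "i \<in> {i\<in>S. mark_comp C i = c}" for i
        using that s cc by auto
      have "inj_on (mark_pt C') {i\<in>S. mark_comp C i = c}"
        using st(2) inj_on_cong[of "{i\<in>S. mark_comp C i = c}" "mark_pt C'" "mark_pt C"] 3 by blast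
      moreover have "mark_pt C' ` {i\<in>S. mark_comp C i = c} = mark_pt C ` {i\<in>S. mark_comp C i = c}"
        using 3 by (intro image_cong) auto
      ultimately show ?thesis unfolding 1 2 using st by simp
    next
      case True
      let ?M = "{i\<in>S. mark_comp C i = a}"
      have 1: "adj C' `` {c} = adj C `` {a} - {b}" using True ab by auto
      have 2: "{i\<in>S'. mark_comp C' i = c} = insert s ?M"
        using True ab s by (auto simp: S'_def Sb_def)
      have sM: "s \<notin> ?M" using s ab by auto
      have 3: "mark_pt C' i = mark_pt C i" if "i \<in> ?M" for i using that sM by auto
      have im: "mark_pt C' ` ?M = mark_pt C ` ?M" using 3 by (intro image_cong) auto
      have bn: "b \<in> adj C `` {a}" using adj_b by auto
      have nb: "node_pt C a b \<notin> mark_pt C ` ?M" using st(3) bn True by blast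
      have "inj_on (mark_pt C') ?M"
        using st(2) inj_on_cong[of ?M "mark_pt C'" "mark_pt C"] 3 True by blast
      then have i1: "inj_on (mark_pt C') (insert s ?M)"
        using nb im sM by (subst inj_on_insert) auto
      have nb': "node_pt C a b \<notin> node_pt C a ` (adj C `` {a} - {b})"
        using st(1) bn True by (auto dest: inj_onD)
      have i2: "node_pt C a ` (adj C `` {a} - {b}) \<inter> mark_pt C' ` insert s ?M = {}"
      proof -
        have "mark_pt C' ` insert s ?M = insert (mark_pt C' s) (mark_pt C' ` ?M)" by (rule image_insert)
        also have "\<dots> = insert (node_pt C a b) (mark_pt C ` ?M)" unfolding im by simp
        finally have eq: "mark_pt C' ` insert s ?M = insert (node_pt C a b) (mark_pt C ` ?M)" .
        have "node_pt C a ` (adj C `` {a} - {b}) \<inter> mark_pt C ` ?M = {}"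
          by (rule subset_empty[THEN iffD1], rule subset_trans[OF _ eq_refl[OF st(3)[unfolded True]]]) blast
        then show ?thesis unfolding eq using nb' by simp
      qed
      have "finite (adj C `` {a})" using adj_props(1) by (rule finite_Image)
      then have "card (adj C `` {a} - {b}) + card (insert s ?M) = card (adj C `` {a}) + card ?M"
        using bn sM fin card_Suc_Diff1[of "adj C `` {a}" b] by simp
      then show ?thesis unfolding 1 2 using True st(1,4) i1 i2 by (auto intro: inj_on_subset)
    qed
  qed
  show ?thesis
    unfolding tree_curve_def
    using fin c1 c2 stab a ab adj_props mc
    by (auto simp: S'_def Sb_def irrefl_def sym_def)
qed

lemma card_Sb: "card Sb \<ge> 2"
proof -
  have "card (adj C `` {b}) + card {i\<in>S. mark_comp C i = b} \<ge> 3"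
    using tree b unfolding tree_curve_def by blast
  then show ?thesis using leaf by (simp add: Sb_def)
qed

lemma leaf_points:
  shows "inj_on (mark_pt C) Sb" "\<And>i. i \<in> Sb \<Longrightarrow> mark_pt C i \<noteq> node_pt C b a"
proof -
  have "inj_on (mark_pt C) Sb" "node_pt C b ` {a} \<inter> mark_pt C ` Sb = {}"
    using tree b leaf unfolding tree_curve_def Sb_def by fastforce+
  then show "inj_on (mark_pt C) Sb" "\<And>i. i \<in> Sb \<Longrightarrow> mark_pt C i \<noteq> node_pt C b a"
    by (blast, metis disjoint_iff image_eqI singletonI)
qed

lemma rho_S': "i \<in> S \<Longrightarrow> rho i \<in> S'"
  by (auto simp: rho_def S'_def)

lemma S'_sub: "S' \<subseteq> S"
  using s by (auto simp: S'_def)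

end

section \<open>Order of vanishing and lowest coefficient of polynomials in the parameter
  \<open>t\<close>\<close>

definition pdet :: "complex poly \<times> complex poly \<Rightarrow> complex poly \<times> complex poly \<Rightarrow> complex poly" where
  "pdet u v = fst u * snd v - fst v * snd u"

lemma pdet_swap: "pdet u v = - pdet v u"
  by (simp add: pdet_def)

definition val :: "complex poly \<Rightarrow> nat" where "val p = Polynomial.order 0 p"
definition low :: "complex poly \<Rightarrow> complex" where "low p = coeff p (Polynomial.order 0 p)"

lemma val_lowI:
  assumes "p = monom 1 m * q" "poly q 0 \<noteq> 0"
  shows "val p = m" "low p = poly q 0" "p \<noteq> 0"
proof -
  have q0: "q \<noteq> 0" using assms(2) by auto
  have "Polynomial.order 0 (monom 1 m :: complex poly) = m"
  proof (rule order_unique_lemma)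
    have m: "(monom 1 m :: complex poly) = [:- 0, 1:] ^ m" by (simp add: monom_altdef)
    show "[:- 0, 1:] ^ m dvd (monom 1 m :: complex poly)" unfolding m by simp
    show "\<not> [:- 0, 1:] ^ Suc m dvd (monom 1 m :: complex poly)"
    proof
      assume "[:- 0, 1:] ^ Suc m dvd (monom 1 m :: complex poly)"
      then have "degree ([:- 0, 1:] ^ Suc m :: complex poly) \<le> degree (monom 1 m :: complex poly)"
        by (intro dvd_imp_degree_le) auto
      then show False by (simp add: degree_power_eq degree_monom_eq)
    qed
  qed
  moreover have "Polynomial.order 0 q = 0" using assms(2) by (simp add: order_0I)
  ultimately show v: "val p = m" using assms(1) q0 by (simp add: val_def order_mult)
  show "low p = poly q 0"
    using v assms(1) by (simp add: low_def val_def coeff_monom_mult poly_0_coeff_0)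
  show "p \<noteq> 0" using assms(1) q0 by simp
qed

lemma val_decomp:
  assumes "p \<noteq> 0"
  shows "\<exists>q. p = monom 1 (val p) * q \<and> poly q 0 = low p \<and> low p \<noteq> 0"
proof -
  obtain q where q: "p = [:- 0, 1:] ^ Polynomial.order 0 p * q" "\<not> [:- 0, 1:] dvd q"
    using order_decomp[OF assms] by blast
  have "p = monom 1 (val p) * q" using q(1) by (simp add: val_def monom_altdef)
  moreover have "poly q 0 \<noteq> 0" using q(2) by (simp add: poly_eq_0_iff_dvd)
  ultimately show ?thesis using val_lowI by metis
qed

lemma low_nz: "p \<noteq> 0 \<Longrightarrow> low p \<noteq> 0"
  using val_decomp by blast

lemma val_low_mult:
  assumes "p \<noteq> 0" "q \<noteq> 0"
  shows "val (p * q) = val p + val q" "low (p * q) = low p * low q"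
proof -
  obtain p' q' where pq: "p = monom 1 (val p) * p'" "poly p' 0 = low p" "low p \<noteq> 0"
    "q = monom 1 (val q) * q'" "poly q' 0 = low q" "low q \<noteq> 0"
    using val_decomp assms by metis
  have "p * q = (monom 1 (val p) * p') * (monom 1 (val q) * q')" using pq(1,4) by simp
  also have "\<dots> = monom 1 (val p + val q) * (p' * q')"
    by (simp add: mult_monom[of 1 _ "1::complex", simplified, symmetric] mult_ac)
  finally have *: "p * q = monom 1 (val p + val q) * (p' * q')" .
  have "poly (p' * q') 0 \<noteq> 0" using pq by simp
  from val_lowI[OF * this] show "val (p * q) = val p + val q" "low (p * q) = low p * low q"
    using pq by simp_all
qed

lemma val_low_smult: "p \<noteq> 0 \<Longrightarrow> c \<noteq> 0 \<Longrightarrow> val (smult c p) = val p \<and> low (smult c p) = c * low p"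
proof -
  assume "p \<noteq> 0" "c \<noteq> 0"
  then obtain q where q: "p = monom 1 (val p) * q" "poly q 0 = low p" "low p \<noteq> 0" using val_decomp by blast
  have "smult c p = monom 1 (val p) * smult c q" using q(1) by (metis mult_smult_right)
  then show ?thesis using val_lowI[of "smult c p" "val p" "smult c q"] q \<open>c \<noteq> 0\<close> by simp
qed

lemma val_low_uminus: "p \<noteq> 0 \<Longrightarrow> val (- p) = val p \<and> low (- p) = - low p"
  using val_low_smult[of p "-1"] by simp

lemma val_low_perturb:
  assumes "p \<noteq> 0" "c \<noteq> 0" "val p < m"
  shows "val (smult c p + monom 1 m * r) = val p" "low (smult c p + monom 1 m * r) = c * low p"
    "smult c p + monom 1 m * r \<noteq> 0"
proof -
  obtain q where q: "p = monom 1 (val p) * q" "poly q 0 = low p" "low p \<noteq> 0"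
    using val_decomp assms(1) by blast
  obtain d where d: "m = val p + Suc d" using assms(3) less_iff_Suc_add by auto
  have m: "monom (1::complex) m = monom 1 (val p) * monom 1 (Suc d)" by (simp add: d mult_monom)
  have *: "smult c p + monom 1 m * r = monom 1 (val p) * (smult c q + monom 1 (Suc d) * r)"
    by (subst q(1)) (simp add: m algebra_simps)
  have **: "poly (smult c q + monom 1 (Suc d) * r) 0 = c * low p" using q by (simp add: poly_monom)
  have "poly (smult c q + monom 1 (Suc d) * r) 0 \<noteq> 0" unfolding ** using q assms(2) by simp
  from val_lowI[OF * this, unfolded **]
  show "val (smult c p + monom 1 m * r) = val p" "low (smult c p + monom 1 m * r) = c * low p"
    "smult c p + monom 1 m * r \<noteq> 0" .
qed

text \<open>The limit, as \<open>t\<close> tends to 0, of \<open>D\<^sub>1 t^E\<^sub>1 / (D\<^sub>2 t^E\<^sub>2)\<close>.\<close>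

definition crv :: "nat \<Rightarrow> complex \<Rightarrow> nat \<Rightarrow> complex \<Rightarrow> P1" where
  "crv E1 D1 E2 D2 = (if E1 > E2 then Finite 0 else if E1 < E2 then Infinity else P1_point D1 D2)"

lemma crv_scale: "c \<noteq> 0 \<Longrightarrow> crv E1 (c * D1) E2 (c * D2) = crv E1 D1 E2 D2"
  by (simp add: crv_def P1_point_scale)

text \<open>Divide both by the smaller of the two powers of \<open>t\<close>. Then not both vanish
  at 0, and their values there are homogeneous coordinates of the limit.\<close>

lemma crv_limit:
  assumes "F \<noteq> 0" "G \<noteq> 0"
  shows "\<exists>m F' G'. F = monom 1 m * F' \<and> G = monom 1 m * G' \<and> (poly F' 0, poly G' 0) \<noteq> (0, 0) \<and>
    crv (val F) (low F) (val G) (low G) = P1_point (poly F' 0) (poly G' 0)"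
proof -
  obtain f where f: "F = monom 1 (val F) * f" "poly f 0 = low F" "low F \<noteq> 0" using val_decomp assms(1) by blast
  obtain g where g: "G = monom 1 (val G) * g" "poly g 0 = low G" "low G \<noteq> 0" using val_decomp assms(2) by blast
  consider "val F = val G" | "val F < val G" | "val G < val F" by linarith
  then show ?thesis
  proof cases
    case 1
    then show ?thesis using f g by (intro exI[of _ "val F"] exI[of _ f] exI[of _ g]) (auto simp: crv_def)
  next
    case 2
    then obtain d where d: "val G = val F + Suc d" using less_iff_Suc_add by auto
    have "G = monom 1 (val F) * (monom 1 (Suc d) * g)"
      by (subst g(1)) (simp add: d mult_monom flip: mult.assoc)
    then show ?thesis using f g 2
      by (intro exI[of _ "val F"] exI[of _ f] exI[of _ "monom 1 (Suc d) * g"]) (auto simp: crv_def poly_monom)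
  next
    case 3
    then obtain d where d: "val F = val G + Suc d" using less_iff_Suc_add by auto
    have "F = monom 1 (val G) * (monom 1 (Suc d) * f)"
      by (subst f(1)) (simp add: d mult_monom flip: mult.assoc)
    then show ?thesis using f g 3
      by (intro exI[of _ "val G"] exI[of _ "monom 1 (Suc d) * f"] exI[of _ g]) (auto simp: crv_def poly_monom)
  qed
qed

definition crnum where "crnum z i j k l = pdet (z i) (z k) * pdet (z j) (z l)"
definition crden where "crden z i j k l = pdet (z j) (z k) * pdet (z i) (z l)"

definition crlim :: "(nat \<Rightarrow> complex poly \<times> complex poly) \<Rightarrow> nat \<Rightarrow> nat \<Rightarrow> nat \<Rightarrow> nat \<Rightarrow> P1" where
  "crlim z i j k l = crv (val (crnum z i j k l)) (low (crnum z i j k l))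
     (val (crden z i j k l)) (low (crden z i j k l))"

definition generic :: "nat set \<Rightarrow> (nat \<Rightarrow> complex poly \<times> complex poly) \<Rightarrow> bool" where
  "generic S z \<longleftrightarrow> (\<forall>i\<in>S. \<forall>j\<in>S. i \<noteq> j \<longrightarrow> pdet (z i) (z j) \<noteq> 0)"

text \<open>A family of marks moving on a single projective line, generically distinct, whose
  cross-ratios tend to those of the curve. Because all components that see three distinct points are
  required to give the same limit, a smoothing also proves that the cross-ratio does not depend on
  the component.\<close>

definition smoothing :: "nat set \<Rightarrow> marked_curve \<Rightarrow> (nat \<Rightarrow> complex poly \<times> complex poly) \<Rightarrow> bool" where
  "smoothing S C z \<longleftrightarrow> generic S z \<and>
     (\<forall>i j k l. {i, j, k, l} \<subseteq> S \<longrightarrow> distinct [i, j, k, l] \<longrightarrow>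
       (\<exists>a\<in>comps C. card (contracted_mark C a ` {i, j, k, l}) \<ge> 3) \<and>
       (\<forall>a\<in>comps C. card (contracted_mark C a ` {i, j, k, l}) \<ge> 3 \<longrightarrow>
          cross_ratio (contracted_mark C a i) (contracted_mark C a j)
           (contracted_mark C a k) (contracted_mark C a l) = crlim z i j k l))"

lemma crlim_eq:
  assumes "generic S z" "{i, j, k, l} \<subseteq> S" "distinct [i, j, k, l]"
  shows "crlim z i j k l = crv (val (pdet (z i) (z k)) + val (pdet (z j) (z l)))
    (low (pdet (z i) (z k)) * low (pdet (z j) (z l)))
    (val (pdet (z j) (z k)) + val (pdet (z i) (z l))) (low (pdet (z j) (z k)) * low (pdet (z i) (z l)))"
proof -
  have "pdet (z i) (z k) \<noteq> 0" "pdet (z j) (z l) \<noteq> 0" "pdet (z j) (z k) \<noteq> 0" "pdet (z i) (z l) \<noteq> 0"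
    using assms by (auto simp: generic_def)
  then show ?thesis by (simp add: crlim_def crnum_def crden_def val_low_mult)
qed

lemma smoothing_one_component:
  assumes "tree_curve S C" "card (comps C) = 1"
  shows "smoothing S C (\<lambda>i. ([:fst (hcoord (mark_pt C i)):], [:snd (hcoord (mark_pt C i)):]))"
    (is "smoothing S C ?z")
proof -
  obtain a where a: "comps C = {a}" using assms(2) by (auto simp: card_1_singleton_iff)
  have mc: "contracted_mark C a i = mark_pt C i" "mark_comp C i = a" if "i \<in> S" for i
    using that assms(1) a by (auto simp: contracted_mark_def tree_curve_def)
  have "{i\<in>S. mark_comp C i = a} = S" using mc by auto
  then have inj: "inj_on (mark_pt C) S" using assms(1) a unfolding tree_curve_def by force
  have pd: "pdet (?z i) (?z j) = [:P1_det (mark_pt C i) (mark_pt C j):]" for i j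
    by (simp add: pdet_def P1_det_def mult.commute)
  have gen: "generic S ?z" using inj by (auto simp: generic_def pd dest: inj_onD)
  have vl: "val [:c:] = 0 \<and> low [:c:] = c" if "c \<noteq> 0" for c
    using val_lowI[of "[:c:]" 0 "[:c:]"] that by (simp add: monom_0)
  show ?thesis
    unfolding smoothing_def
  proof (intro conjI gen allI impI)
    fix i j k l assume ijkl: "{i, j, k, l} \<subseteq> S" "distinct [i, j, k, l]"
    then have "inj_on (contracted_mark C a) {i, j, k, l}"
      using inj mc by (auto simp: inj_on_def)
    then have "card (contracted_mark C a ` {i, j, k, l}) = card {i, j, k, l}" by (rule card_image)
    then show "\<exists>a\<in>comps C. card (contracted_mark C a ` {i, j, k, l}) \<ge> 3" using ijkl a by simp
    have ne: "mark_pt C x \<noteq> mark_pt C y" if "x \<in> {i, j, k, l}" "y \<in> {i, j, k, l}" "x \<noteq> y" for x y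
      using that inj ijkl by (meson inj_onD subsetD)
    have "crlim ?z i j k l = cross_ratio (mark_pt C i) (mark_pt C j) (mark_pt C k) (mark_pt C l)"
      unfolding crlim_eq[OF gen ijkl] pd
      using ijkl(2) ne by (simp add: vl crv_def cross_ratio_def)
    then show "\<forall>a\<in>comps C. card (contracted_mark C a ` {i, j, k, l}) \<ge> 3 \<longrightarrow>
          cross_ratio (contracted_mark C a i) (contracted_mark C a j)
           (contracted_mark C a k) (contracted_mark C a l) = crlim ?z i j k l"
      using a mc ijkl by simp
  qed
qed

section \<open>Gluing a leaf into a smoothing family of the pruned curve\<close>

context leaf
begin

definition node where "node = node_pt C b a"
text \<open>Any point different from the node would do. The pair of determinants \<open>beta\<close>
  and \<open>alpha\<close> are homogeneous coordinates on the leaf, in which the node is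
  \<open>beta = 0\<close>.\<close>

definition base where "base = (if node = Infinity then Finite 0 else Infinity)"
definition beta where "beta i = P1_det (mark_pt C i) node"
definition alpha where "alpha i = P1_det (mark_pt C i) base"
definition image_b where "image_b i = (if i \<in> Sb then mark_pt C i else node)"

lemma base_neq: "base \<noteq> node"
  by (auto simp: base_def)

text \<open>A Pluecker relation. It makes the determinant of two moving marks proportional to that
  of their positions on the leaf.\<close>

lemma beta_alpha: "beta i * alpha j - beta j * alpha i = P1_det (mark_pt C i) (mark_pt C j) * P1_det node base"
  by (simp add: beta_def alpha_def P1_det_def algebra_simps)

lemma finS: "finite S"
  using tree by (simp add: tree_curve_def)

lemma Sb_sub: "Sb \<subseteq> S"
  by (auto simp: Sb_def)

lemma s_in: "s \<in> Sb" "s \<in> S'"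
  using s by (auto simp: Sb_def S'_def)

text \<open>The marks of the leaf move on a disc of radius \<open>t^M\<close> around the mark that replaces it.\<close>

lemma ex_attach:
  assumes gen': "generic S' z'" and two: "S - Sb \<noteq> {}"
  obtains z M K where
    "\<And>x y. x \<in> Sb \<Longrightarrow> y \<in> Sb \<Longrightarrow> x \<noteq> y \<Longrightarrow> val (pdet (z x) (z y)) = M \<and>
       low (pdet (z x) (z y)) = P1_det (mark_pt C x) (mark_pt C y) * K"
    "K \<noteq> 0"
    "\<And>x y. x \<in> S - Sb \<Longrightarrow> y \<in> S - Sb \<Longrightarrow> val (pdet (z' s) (z' x)) + val (pdet (z' s) (z' y)) < M"
    "\<And>x y. x \<in> Sb \<Longrightarrow> y \<in> S - Sb \<Longrightarrow> val (pdet (z x) (z y)) = val (pdet (z' s) (z' y)) \<and>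
       low (pdet (z x) (z y)) = beta x * low (pdet (z' s) (z' y))"
    "\<And>x y. x \<in> Sb \<Longrightarrow> y \<in> S - Sb \<Longrightarrow> val (pdet (z y) (z x)) = val (pdet (z' s) (z' y)) \<and>
       low (pdet (z y) (z x)) = - beta x * low (pdet (z' s) (z' y))"
    "\<And>x y. x \<in> S - Sb \<Longrightarrow> y \<in> S - Sb \<Longrightarrow> pdet (z x) (z y) = pdet (z' x) (z' y)"
    "generic S z"
proof -
  define x0 y0 where "x0 = fst (z' s)" and "y0 = snd (z' s)"
  have nz': "pdet (z' s) (z' y) \<noteq> 0" if "y \<in> S - Sb" for y
    using gen' that s_in by (auto simp: generic_def S'_def)
  obtain y where "y \<in> S - Sb" using two by blast
  then have "x0 \<noteq> 0 \<or> y0 \<noteq> 0" using nz'[of y] by (auto simp: pdet_def x0_def y0_def)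
  \<comment> \<open>A direction independent of the position of \<open>s\<close>, along which the
    marks of the leaf spread out.\<close>
  define e :: "complex poly \<times> complex poly" where "e = (if y0 = 0 then (0, 1) else (1, 0))"
  have e: "pdet (z' s) e \<noteq> 0"
    using \<open>x0 \<noteq> 0 \<or> y0 \<noteq> 0\<close> by (auto simp: e_def pdet_def x0_def y0_def)
  \<comment> \<open>Larger than the sum of the orders of any two determinants between
    \<open>s\<close> and outer marks, so that marks of the leaf approach each other faster than they
    approach anything else.\<close>
  define M where "M = 1 + 2 * (\<Sum>x\<in>S. val (pdet (z' s) (z' x)))"
  have M: "2 * val (pdet (z' s) (z' x)) < M" if "x \<in> S" for x
    using member_le_sum[of x S "\<lambda>x. val (pdet (z' s) (z' x))"] that finS by (simp add: M_def)
  define z where "z = (\<lambda>i. if i \<in> Sb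
    then (smult (beta i) x0 + monom 1 M * (smult (alpha i) (fst e)), smult (beta i) y0 + monom 1 M * (smult (alpha i) (snd e)))
    else z' i)"
  have bnz: "beta x \<noteq> 0" if "x \<in> Sb" for x using leaf_points(2)[OF that] by (simp add: beta_def node_def)
  define K where "K = P1_det node base * low (pdet (z' s) e)"
  have K: "K \<noteq> 0" using base_neq[symmetric] e by (simp add: K_def low_nz)
  have bb: "pdet (z x) (z y) = monom 1 M * smult (P1_det (mark_pt C x) (mark_pt C y) * P1_det node base) (pdet (z' s) e)"
    if "x \<in> Sb" "y \<in> Sb" for x y
    unfolding beta_alpha[symmetric] using that
    by (simp add: z_def pdet_def x0_def y0_def algebra_simps smult_diff_left smult_diff_right)
  have bb': "val (pdet (z x) (z y)) = M + val (pdet (z' s) e) \<and>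
       low (pdet (z x) (z y)) = P1_det (mark_pt C x) (mark_pt C y) * K \<and> pdet (z x) (z y) \<noteq> 0"
    if "x \<in> Sb" "y \<in> Sb" "x \<noteq> y" for x y
  proof -
    have "mark_pt C x \<noteq> mark_pt C y" using leaf_points(1) that by (auto dest: inj_onD)
    then have c: "P1_det (mark_pt C x) (mark_pt C y) * P1_det node base \<noteq> 0" using base_neq by auto
    have m: "(monom 1 M :: complex poly) \<noteq> 0" "val (monom 1 M :: complex poly) = M" "low (monom 1 M :: complex poly) = 1"
      using val_lowI[of "monom 1 M" M 1] by simp_all
    define R where "R = smult (P1_det (mark_pt C x) (mark_pt C y) * P1_det node base) (pdet (z' s) e)"
    have R: "R \<noteq> 0" "val R = val (pdet (z' s) e)" "low R = P1_det (mark_pt C x) (mark_pt C y) * K"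
      using val_low_smult[OF e c] c e by (simp_all add: R_def K_def mult.assoc)
    show ?thesis
      unfolding bb[OF that(1,2)] R_def[symmetric] using val_low_mult[OF m(1) R(1)] m R by simp
  qed
  have bo: "pdet (z x) (z y) = smult (beta x) (pdet (z' s) (z' y)) + monom 1 M * smult (alpha x) (pdet e (z' y))"
    if "x \<in> Sb" "y \<in> S - Sb" for x y
    using that by (simp add: z_def pdet_def x0_def y0_def algebra_simps smult_diff_left smult_diff_right smult_add_right)
  have bo': "val (pdet (z x) (z y)) = val (pdet (z' s) (z' y)) \<and>
       low (pdet (z x) (z y)) = beta x * low (pdet (z' s) (z' y)) \<and> pdet (z x) (z y) \<noteq> 0"
    if "x \<in> Sb" "y \<in> S - Sb" for x y
  proof -
    have lt: "val (pdet (z' s) (z' y)) < M" using M[of y] that(2) by simp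
    show ?thesis
      unfolding bo[OF that] by (intro conjI val_low_perturb[OF nz'[OF that(2)] bnz[OF that(1)] lt])
  qed
  have ob': "val (pdet (z y) (z x)) = val (pdet (z' s) (z' y)) \<and>
       low (pdet (z y) (z x)) = - beta x * low (pdet (z' s) (z' y)) \<and> pdet (z y) (z x) \<noteq> 0"
    if "x \<in> Sb" "y \<in> S - Sb" for x y
    using bo'[OF that] val_low_uminus[of "pdet (z x) (z y)"] pdet_swap[of "z y" "z x"] by simp
  have oo: "pdet (z x) (z y) = pdet (z' x) (z' y)" if "x \<in> S - Sb" "y \<in> S - Sb" for x y
    using that by (simp add: z_def)
  have gen: "generic S z"
    unfolding generic_def
  proof (intro ballI impI)
    fix x y assume "x \<in> S" "y \<in> S" "x \<noteq> y"
    then show "pdet (z x) (z y) \<noteq> 0"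
      using bb'[of x y] bo'[of x y] ob'[of y x] oo[of x y] gen'
      by (cases "x \<in> Sb"; cases "y \<in> Sb") (auto simp: generic_def S'_def)
  qed
  show ?thesis
  proof (rule that[of z "M + val (pdet (z' s) e)" K])
    fix x y assume "x \<in> S - Sb" "y \<in> S - Sb"
    then show "val (pdet (z' s) (z' x)) + val (pdet (z' s) (z' y)) < M + val (pdet (z' s) e)"
      using M[of x] M[of y] by simp
  next
    fix x y
    show "val (pdet (z x) (z y)) = M + val (pdet (z' s) e) \<and>
       low (pdet (z x) (z y)) = P1_det (mark_pt C x) (mark_pt C y) * K" if "x \<in> Sb" "y \<in> Sb" "x \<noteq> y"
      using bb'[OF that] by simp
    show "val (pdet (z x) (z y)) = val (pdet (z' s) (z' y)) \<and>
       low (pdet (z x) (z y)) = beta x * low (pdet (z' s) (z' y))" if "x \<in> Sb" "y \<in> S - Sb"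
      using bo'[OF that] by simp
    show "val (pdet (z y) (z x)) = val (pdet (z' s) (z' y)) \<and>
       low (pdet (z y) (z x)) = - beta x * low (pdet (z' s) (z' y))" if "x \<in> Sb" "y \<in> S - Sb"
      using ob'[OF that] by simp
    show "pdet (z x) (z y) = pdet (z' x) (z' y)" if "x \<in> S - Sb" "y \<in> S - Sb"
      by (rule oo[OF that])
  next
    show "K \<noteq> 0" "generic S z" by (rule K, rule gen)
  qed
qed

text \<open>With at most one of the four marks on the leaf, its factor \<open>beta\<close> occurs
  above and below and cancels. With two or more, the high order \<open>M\<close> of determinants
  within the leaf decides, and the limit is computed on the leaf with the outer marks at the
  node.\<close>

lemma crlim_attach:
  assumes gen': "generic S' z'" and two: "S - Sb \<noteq> {}"
  obtains z where "generic S z"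
    "\<And>i j k l. {i, j, k, l} \<subseteq> S \<Longrightarrow> distinct [i, j, k, l] \<Longrightarrow> card (Sb \<inter> {i, j, k, l}) \<le> 1 \<Longrightarrow>
      crlim z i j k l = crlim z' (rho i) (rho j) (rho k) (rho l)"
    "\<And>i j k l. {i, j, k, l} \<subseteq> S \<Longrightarrow> distinct [i, j, k, l] \<Longrightarrow> card (Sb \<inter> {i, j, k, l}) \<ge> 2 \<Longrightarrow>
      crlim z i j k l = cross_ratio (image_b i) (image_b j) (image_b k) (image_b l)"
proof (rule ex_attach[OF assms])
  fix z M K
  assume bb: "\<And>x y. x \<in> Sb \<Longrightarrow> y \<in> Sb \<Longrightarrow> x \<noteq> y \<Longrightarrow> val (pdet (z x) (z y)) = M \<and>
       low (pdet (z x) (z y)) = P1_det (mark_pt C x) (mark_pt C y) * K"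
    and K: "K \<noteq> 0"
    and M: "\<And>x y. x \<in> S - Sb \<Longrightarrow> y \<in> S - Sb \<Longrightarrow> val (pdet (z' s) (z' x)) + val (pdet (z' s) (z' y)) < M"
    and bo: "\<And>x y. x \<in> Sb \<Longrightarrow> y \<in> S - Sb \<Longrightarrow> val (pdet (z x) (z y)) = val (pdet (z' s) (z' y)) \<and>
       low (pdet (z x) (z y)) = beta x * low (pdet (z' s) (z' y))"
    and ob: "\<And>x y. x \<in> Sb \<Longrightarrow> y \<in> S - Sb \<Longrightarrow> val (pdet (z y) (z x)) = val (pdet (z' s) (z' y)) \<and>
       low (pdet (z y) (z x)) = - beta x * low (pdet (z' s) (z' y))"
    and oo: "\<And>x y. x \<in> S - Sb \<Longrightarrow> y \<in> S - Sb \<Longrightarrow> pdet (z x) (z y) = pdet (z' x) (z' y)"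
    and gen: "generic S z"
  have bnz: "beta x \<noteq> 0" if "x \<in> Sb" for x using leaf_points(2)[OF that] by (simp add: beta_def node_def)
  have nz': "pdet (z' s) (z' x) \<noteq> 0" if "x \<in> S - Sb" for x
    using gen' that s_in by (auto simp: generic_def S'_def)
  have lnz: "low (pdet (z' s) (z' x)) \<noteq> 0" if "x \<in> S - Sb" for x
    by (rule low_nz[OF nz'[OF that]])
  have lsw: "low (pdet (z' x) (z' s)) = - low (pdet (z' s) (z' x)) \<and> val (pdet (z' x) (z' s)) = val (pdet (z' s) (z' x))"
    if "x \<in> S - Sb" for x
    using val_low_uminus[OF nz'[OF that]] by (simp add: pdet_swap[of "z' x" "z' s"])
  have bdet: "P1_det node (mark_pt C x) = - beta x" "P1_det (mark_pt C x) node = beta x" for x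
    by (simp_all add: beta_def P1_det_swap[of node])
  have one: "crlim z i j k l = crlim z' (rho i) (rho j) (rho k) (rho l)"
    if q: "{i, j, k, l} \<subseteq> S" "distinct [i, j, k, l]" and c: "card (Sb \<inter> {i, j, k, l}) \<le> 1" for i j k l
  proof -
    have amo: "x = y" if "x \<in> Sb \<inter> {i, j, k, l}" "y \<in> Sb \<inter> {i, j, k, l}" for x y
    proof -
      have "finite (Sb \<inter> {i, j, k, l})" by simp
      from card_le_Suc0_iff_eq[OF this] c that show ?thesis unfolding One_nat_def by blast
    qed
    have q': "{rho i, rho j, rho k, rho l} \<subseteq> S'" using q(1) rho_S' by auto
    have d': "distinct [rho i, rho j, rho k, rho l]"
    proof -
      have "rho x \<noteq> rho y" if "x \<in> {i, j, k, l}" "y \<in> {i, j, k, l}" "x \<noteq> y" for x y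
        using amo[of x y] that s_in(1) unfolding rho_def by (metis IntI)
      then show ?thesis using q(2) by simp
    qed
    define B where "B = (\<lambda>x. if x \<in> Sb then beta x else 1)"
    have B: "B x \<noteq> 0" for x using bnz by (simp add: B_def)
    have step: "val (pdet (z x) (z y)) = val (pdet (z' (rho x)) (z' (rho y))) \<and>
        low (pdet (z x) (z y)) = B x * B y * low (pdet (z' (rho x)) (z' (rho y)))"
      if xyq: "x \<in> {i, j, k, l}" "y \<in> {i, j, k, l}" "x \<noteq> y" for x y
    proof -
      have xy: "x \<in> S" "y \<in> S" using xyq q(1) by blast+
      consider "x \<in> Sb" "y \<notin> Sb" | "x \<notin> Sb" "y \<in> Sb" | "x \<notin> Sb" "y \<notin> Sb"
        using amo[of x y] xyq by blast
      then show ?thesis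
      proof cases
        case 1 then show ?thesis using bo[of x y] xy by (simp add: B_def rho_def)
      next
        case 2 then show ?thesis using ob[of y x] lsw[of x] xy by (simp add: B_def rho_def)
      next
        case 3 then show ?thesis using oo[of x y] xy by (simp add: B_def rho_def)
      qed
    qed
    \<comment> \<open>Each mark occurs exactly once in the numerator and once in the denominator, so
      both acquire the same factor \<open>b\<close>.\<close>
    define b where "b = B i * B j * B k * B l"
    have b: "b \<noteq> 0" using B by (simp add: b_def)
    have st: "val (pdet (z i) (z k)) = val (pdet (z' (rho i)) (z' (rho k)))"
      "low (pdet (z i) (z k)) = B i * B k * low (pdet (z' (rho i)) (z' (rho k)))"
      "val (pdet (z j) (z l)) = val (pdet (z' (rho j)) (z' (rho l)))"
      "low (pdet (z j) (z l)) = B j * B l * low (pdet (z' (rho j)) (z' (rho l)))"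
      "val (pdet (z j) (z k)) = val (pdet (z' (rho j)) (z' (rho k)))"
      "low (pdet (z j) (z k)) = B j * B k * low (pdet (z' (rho j)) (z' (rho k)))"
      "val (pdet (z i) (z l)) = val (pdet (z' (rho i)) (z' (rho l)))"
      "low (pdet (z i) (z l)) = B i * B l * low (pdet (z' (rho i)) (z' (rho l)))"
      by ((rule step[THEN conjunct1] | rule step[THEN conjunct2]); use q(2) in simp)+
    have arr: "B i * B k * u * (B j * B l * v) = b * (u * v)" "B j * B k * u * (B i * B l * v) = b * (u * v)" for u v
      by (simp_all add: b_def mult_ac)
    show ?thesis
      unfolding crlim_eq[OF gen q] crlim_eq[OF gen' q' d'] st arr crv_scale[OF b] ..
  qed
  have two: "crlim z i j k l = cross_ratio (image_b i) (image_b j) (image_b k) (image_b l)"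
    if q: "{i, j, k, l} \<subseteq> S" "distinct [i, j, k, l]" and c: "card (Sb \<inter> {i, j, k, l}) \<ge> 2" for i j k l
  proof -
    have ne: "mark_pt C x \<noteq> mark_pt C y" if "x \<in> Sb" "y \<in> Sb" "x \<noteq> y" for x y
      using leaf_points(1) that by (auto dest: inj_onD)
    have qs: "i \<in> S" "j \<in> S" "k \<in> S" "l \<in> S" "i \<noteq> j" "i \<noteq> k" "i \<noteq> l" "j \<noteq> k" "j \<noteq> l" "k \<noteq> l"
      using q by auto
    have v: "val (pdet (z x) (z y)) = (if x \<in> Sb then if y \<in> Sb then M else val (pdet (z' s) (z' y))
        else if y \<in> Sb then val (pdet (z' s) (z' x)) else val (pdet (z' x) (z' y)))"
      and w: "low (pdet (z x) (z y)) = (if x \<in> Sb then if y \<in> Sb then P1_det (mark_pt C x) (mark_pt C y) * K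
            else beta x * low (pdet (z' s) (z' y))
        else if y \<in> Sb then - beta y * low (pdet (z' s) (z' x)) else low (pdet (z' x) (z' y)))"
      if "x \<in> S" "y \<in> S" "x \<noteq> y" for x y
      using that bb[of x y] bo[of x y] ob[of y x] oo[of x y] by auto
    note E = crlim_eq[OF gen q] v[OF qs(1,3,6)] v[OF qs(2,4,9)] v[OF qs(2,3,8)] v[OF qs(1,4,7)]
      w[OF qs(1,3,6)] w[OF qs(2,4,9)] w[OF qs(2,3,8)] w[OF qs(1,4,7)]
    have bM: "val (pdet (z' s) (z' x)) + val (pdet (z' s) (z' y)) < M + m" if "x \<in> S - Sb" "y \<in> S - Sb" for x y m
      using M[OF that] by simp
    have bM': "val (pdet (z' s) (z' x)) + val (pdet (z' s) (z' y)) < m + M" if "x \<in> S - Sb" "y \<in> S - Sb" for x y m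
      using M[OF that] by simp
    have im: "image_b x \<in> {mark_pt C x, node}" for x by (simp add: image_b_def)
    show ?thesis
    \<comment> \<open>With three or four marks on the leaf the orders above and below agree, and the
      lowest coefficients give the cross-ratio. With two, the limit is 1 if they are
      \<open>i, j\<close> or \<open>k, l\<close>; otherwise the order \<open>M\<close> occurs on one
      side only and forces 0 or \<open>Infinity\<close>.\<close>
    proof (cases "i \<in> Sb"; cases "j \<in> Sb"; cases "k \<in> Sb"; cases "l \<in> Sb")
      assume "i \<in> Sb" "j \<in> Sb" "k \<in> Sb" "l \<in> Sb"
      then show ?thesis
        unfolding E using K by (simp add: crv_def image_b_def cross_ratio_def P1_point_scale'[of "K * K"])
    next
      assume m: "i \<in> Sb" "j \<in> Sb" "k \<in> Sb" "l \<notin> Sb"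
      then show ?thesis
        unfolding E using K lnz[of l] qs
        by (simp add: crv_def image_b_def cross_ratio_def bdet P1_point_scale'[of "K * low (pdet (z' s) (z' l))"])
    next
      assume m: "i \<in> Sb" "j \<in> Sb" "k \<notin> Sb" "l \<in> Sb"
      then show ?thesis
        unfolding E using K lnz[of k] qs
        by (simp add: crv_def image_b_def cross_ratio_def bdet P1_point_scale'[of "K * low (pdet (z' s) (z' k))"])
    next
      assume m: "i \<in> Sb" "j \<notin> Sb" "k \<in> Sb" "l \<in> Sb"
      then show ?thesis
        unfolding E using K lnz[of j] qs
        by (simp add: crv_def image_b_def cross_ratio_def bdet P1_point_scale'[of "K * low (pdet (z' s) (z' j))"])
    next
      assume m: "i \<notin> Sb" "j \<in> Sb" "k \<in> Sb" "l \<in> Sb"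
      then show ?thesis
        unfolding E using K lnz[of i] qs
        by (simp add: crv_def image_b_def cross_ratio_def bdet P1_point_scale'[of "K * low (pdet (z' s) (z' i))"])
    next
      assume m: "i \<in> Sb" "j \<in> Sb" "k \<notin> Sb" "l \<notin> Sb"
      then show ?thesis
        unfolding E using lnz[of k] lnz[of l] bnz[of i] bnz[of j] qs leaf_points(2) leaf_points(2)[symmetric]
        by (simp add: crv_def image_b_def cross_ratio_degenerate node_def mult_ac)
    next
      assume m: "i \<notin> Sb" "j \<notin> Sb" "k \<in> Sb" "l \<in> Sb"
      then show ?thesis
        unfolding E using lnz[of i] lnz[of j] bnz[of k] bnz[of l] qs leaf_points(2) leaf_points(2)[symmetric]
        by (simp add: crv_def image_b_def cross_ratio_degenerate node_def mult_ac)
    next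
      assume m: "i \<in> Sb" "j \<notin> Sb" "k \<in> Sb" "l \<notin> Sb"
      then show ?thesis
        unfolding E using bM[of j l "val (pdet (z' j) (z' l))"] qs leaf_points(2) leaf_points(2)[symmetric]
        by (simp add: crv_def image_b_def cross_ratio_degenerate node_def add.commute)
    next
      assume m: "i \<notin> Sb" "j \<in> Sb" "k \<notin> Sb" "l \<in> Sb"
      then show ?thesis
        unfolding E using bM[of i k "val (pdet (z' i) (z' k))"] qs leaf_points(2) leaf_points(2)[symmetric]
        by (simp add: crv_def image_b_def cross_ratio_degenerate node_def add.commute)
    next
      assume m: "i \<notin> Sb" "j \<in> Sb" "k \<in> Sb" "l \<notin> Sb"
      then show ?thesis
        unfolding E using bM[of i l "val (pdet (z' i) (z' l))"] qs leaf_points(2) leaf_points(2)[symmetric]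
        by (simp add: crv_def image_b_def cross_ratio_degenerate node_def add.commute)
    next
      assume m: "i \<in> Sb" "j \<notin> Sb" "k \<notin> Sb" "l \<in> Sb"
      then show ?thesis
        unfolding E using bM[of j k "val (pdet (z' j) (z' k))"] qs leaf_points(2) leaf_points(2)[symmetric]
        by (simp add: crv_def image_b_def cross_ratio_degenerate node_def add.commute)
    qed (use c in simp_all)
  qed
  show thesis by (rule that[OF gen one two])
qed

end

lemma tree_curve_card:
  assumes "tree_curve S C"
  shows "card S \<ge> 2"
proof (cases "card (comps C) = 1")
  case True
  then obtain a where a: "comps C = {a}" by (auto simp: card_1_singleton_iff)
  have "{i\<in>S. mark_comp C i = a} = S" using assms a by (auto simp: tree_curve_def)
  moreover have "adj C `` {a} = {}" using assms a by (auto simp: tree_curve_def irrefl_def)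
  moreover have "card (adj C `` {a}) + card {i\<in>S. mark_comp C i = a} \<ge> 3"
    using assms a unfolding tree_curve_def by blast
  ultimately show ?thesis by simp
next
  case False
  have "finite (comps C)" "comps C \<noteq> {}" "finite S" using assms by (auto simp: tree_curve_def)
  then have "card (comps C) \<ge> 2" using False by (metis One_nat_def Suc_1 card_0_eq less_2_cases linorder_not_le)
  then obtain a b where ab: "a \<in> comps C" "b \<in> comps C" "adj C `` {b} = {a}"
    using ex_leaf[OF assms] by blast
  have "card (adj C `` {b}) + card {i\<in>S. mark_comp C i = b} \<ge> 3"
    using assms ab unfolding tree_curve_def by blast
  then have "card {i\<in>S. mark_comp C i = b} \<ge> 2" using ab by simp
  then show ?thesis using card_mono[OF \<open>finite S\<close>, of "{i\<in>S. mark_comp C i = b}"] by auto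
qed

context leaf
begin

lemma outside_nonempty: "S - Sb \<noteq> {}"
proof
  assume "S - Sb = {}"
  then have "S' = {s}" by (simp only: S'_def)
  then show False using tree_curve_card[OF tree'] by simp
qed

lemma contracted_b: "i \<in> S \<Longrightarrow> contracted_mark C b i = image_b i"
  by (simp add: contracted_mark_b image_b_def node_def)

text \<open>Two marks of the leaf and any third mark have distinct images there, whether the third
  one is on the leaf or at the node.\<close>

lemma card_image_b:
  assumes q: "{i, j, k, l} \<subseteq> S" "distinct [i, j, k, l]" and c: "card (Sb \<inter> {i, j, k, l}) \<ge> 2"
  shows "card (image_b ` {i, j, k, l}) \<ge> 3"
proof -
  let ?A = "{i, j, k, l}"
  have "finite (Sb \<inter> ?A)" by simp
  moreover have "\<not> card (Sb \<inter> ?A) \<le> Suc 0" using c by linarith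
  ultimately have "\<exists>x\<in>Sb \<inter> ?A. \<exists>y\<in>Sb \<inter> ?A. x \<noteq> y" by (simp only: card_le_Suc0_iff_eq) blast
  then obtain x y where xy: "x \<in> Sb" "y \<in> Sb" "x \<in> ?A" "y \<in> ?A" "x \<noteq> y" by blast
  have "card (?A - {x, y}) \<ge> card ?A - card {x, y}" by (intro diff_card_le_card_Diff) simp
  then have "?A - {x, y} \<noteq> {}" using q(2) xy by auto
  then obtain w where w: "w \<in> ?A" "w \<noteq> x" "w \<noteq> y" by blast
  have ne: "image_b u \<noteq> image_b v" if "u \<in> Sb" "u \<noteq> v" for u v
    using that leaf_points by (auto simp: image_b_def node_def dest: inj_onD)
  have "image_b x \<noteq> image_b y" "image_b x \<noteq> image_b w" "image_b y \<noteq> image_b w"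
    using ne[of x y] ne[of x w] ne[of y w] xy w by auto
  then have "card {image_b x, image_b y, image_b w} = 3" by simp
  moreover have "{image_b x, image_b y, image_b w} \<subseteq> image_b ` ?A" using xy w by blast
  ultimately show ?thesis using card_mono[of "image_b ` ?A"] by (metis finite.emptyI finite_imageI finite_insert)
qed

text \<open>The other component sees the marks of the leaf at one point \<open>U\<close>. To see
  three points it needs exactly two of the marks on the leaf; then the cross-ratio is degenerate on
  both components, with the same pairing of the marks.\<close>

lemma cross_ratio_other_component:
  assumes q: "distinct [i, j, k, l]" and u: "\<And>x. x \<in> Sb \<Longrightarrow> u x = U"
    and c: "card (Sb \<inter> {i, j, k, l}) \<ge> 2" and cu: "card (u ` {i, j, k, l}) \<ge> 3"
  shows "cross_ratio (u i) (u j) (u k) (u l) = cross_ratio (image_b i) (image_b j) (image_b k) (image_b l)"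
proof -
  have T: "U \<noteq> u w \<and> U \<noteq> u w' \<and> u w \<noteq> U \<and> u w' \<noteq> U"
    if "x \<in> Sb" "y \<in> Sb" "{i, j, k, l} = {x, y, w, w'}" for x y w w'
  proof -
    have "u ` {i, j, k, l} = {U, u w, u w'}" unfolding that(3) using u[OF that(1)] u[OF that(2)] by simp
    then have "card {U, u w, u w'} \<ge> 3" using cu by simp
    then show ?thesis by (auto simp: card_insert_if split: if_splits)
  qed
  have T': "i \<in> Sb \<Longrightarrow> j \<in> Sb \<Longrightarrow> U \<noteq> u k \<and> U \<noteq> u l \<and> u k \<noteq> U \<and> u l \<noteq> U"
    "i \<in> Sb \<Longrightarrow> k \<in> Sb \<Longrightarrow> U \<noteq> u j \<and> U \<noteq> u l \<and> u j \<noteq> U \<and> u l \<noteq> U"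
    "i \<in> Sb \<Longrightarrow> l \<in> Sb \<Longrightarrow> U \<noteq> u j \<and> U \<noteq> u k \<and> u j \<noteq> U \<and> u k \<noteq> U"
    "j \<in> Sb \<Longrightarrow> k \<in> Sb \<Longrightarrow> U \<noteq> u i \<and> U \<noteq> u l \<and> u i \<noteq> U \<and> u l \<noteq> U"
    "j \<in> Sb \<Longrightarrow> l \<in> Sb \<Longrightarrow> U \<noteq> u i \<and> U \<noteq> u k \<and> u i \<noteq> U \<and> u k \<noteq> U"
    "k \<in> Sb \<Longrightarrow> l \<in> Sb \<Longrightarrow> U \<noteq> u i \<and> U \<noteq> u j \<and> u i \<noteq> U \<and> u j \<noteq> U"
    by (rule T; blast)+
  have *: "image_b x = mark_pt C x" "mark_pt C x \<noteq> node" "node \<noteq> mark_pt C x" if "x \<in> Sb" for x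
    using leaf_points(2)[OF that] that by (auto simp: image_b_def node_def)
  have **: "image_b x = node" if "x \<notin> Sb" for x using that by (simp add: image_b_def)
  show ?thesis
    by (cases "i \<in> Sb"; cases "j \<in> Sb"; cases "k \<in> Sb"; cases "l \<in> Sb")
      (use c T' in \<open>simp_all add: u * ** cross_ratio_degenerate\<close>)
qed

text \<open>With at most one mark on the leaf, \<open>b\<close> sees fewer than three points and the
  question passes to the pruned curve. With more, \<open>b\<close> itself sees three points, and all
  other components that do so agree with it.\<close>

lemma smoothing_attach:
  assumes "smoothing S' C' z'"
  obtains z where "smoothing S C z"
    "\<And>i j k l. {i, j, k, l} \<subseteq> S \<Longrightarrow> distinct [i, j, k, l] \<Longrightarrow> card (Sb \<inter> {i, j, k, l}) \<le> 1 \<Longrightarrow>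
      crlim z i j k l = crlim z' (rho i) (rho j) (rho k) (rho l)"
    "\<And>i j k l. {i, j, k, l} \<subseteq> S \<Longrightarrow> distinct [i, j, k, l] \<Longrightarrow> card (Sb \<inter> {i, j, k, l}) \<ge> 2 \<Longrightarrow>
      crlim z i j k l = cross_ratio (image_b i) (image_b j) (image_b k) (image_b l)"
proof -
  have gen': "generic S' z'" using assms by (simp add: smoothing_def)
  obtain z where gen: "generic S z"
    and one: "\<And>i j k l. {i, j, k, l} \<subseteq> S \<Longrightarrow> distinct [i, j, k, l] \<Longrightarrow> card (Sb \<inter> {i, j, k, l}) \<le> 1 \<Longrightarrow>
      crlim z i j k l = crlim z' (rho i) (rho j) (rho k) (rho l)"
    and two: "\<And>i j k l. {i, j, k, l} \<subseteq> S \<Longrightarrow> distinct [i, j, k, l] \<Longrightarrow> card (Sb \<inter> {i, j, k, l}) \<ge> 2 \<Longrightarrow>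
      crlim z i j k l = cross_ratio (image_b i) (image_b j) (image_b k) (image_b l)"
    using crlim_attach[OF gen' outside_nonempty] by blast
  have "smoothing S C z"
    unfolding smoothing_def
  proof (intro conjI gen allI impI)
    fix i j k l assume q: "{i, j, k, l} \<subseteq> S" "distinct [i, j, k, l]"
    let ?A = "{i, j, k, l}"
    have im: "contracted_mark C c ` ?A = contracted_mark C' c ` {rho i, rho j, rho k, rho l}" if "c \<noteq> b" for c
      using contracted_mark_other[OF _ that] q(1) by auto
    have eqs: "contracted_mark C c x = contracted_mark C' c (rho x)" if "c \<noteq> b" "x \<in> ?A" for c x
      using contracted_mark_other[OF _ that(1)] q(1) that(2) by blast
    have bs: "contracted_mark C b x = image_b x" if "x \<in> ?A" for x
      using contracted_b q(1) that by blast
    have imb: "contracted_mark C b ` ?A = image_b ` ?A" using bs by (intro image_cong) auto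
    have res: "(\<exists>a\<in>comps C. card (contracted_mark C a ` ?A) \<ge> 3) \<and>
       (\<forall>a\<in>comps C. card (contracted_mark C a ` ?A) \<ge> 3 \<longrightarrow>
          cross_ratio (contracted_mark C a i) (contracted_mark C a j)
           (contracted_mark C a k) (contracted_mark C a l) = crlim z i j k l)"
    proof (cases "card (Sb \<inter> ?A) \<le> 1")
      case True
      have amo: "x = y" if "x \<in> Sb \<inter> ?A" "y \<in> Sb \<inter> ?A" for x y
      proof -
        have "finite (Sb \<inter> ?A)" by simp
        from card_le_Suc0_iff_eq[OF this] True that show ?thesis unfolding One_nat_def by blast
      qed
      have "rho x \<noteq> rho y" if "x \<in> ?A" "y \<in> ?A" "x \<noteq> y" for x y
        using amo[of x y] that s_in(1) unfolding rho_def by (metis IntI)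
      then have q': "distinct [rho i, rho j, rho k, rho l]" "{rho i, rho j, rho k, rho l} \<subseteq> S'"
        using q rho_S' by auto
      have IH: "\<exists>a\<in>comps C'. card (contracted_mark C' a ` {rho i, rho j, rho k, rho l}) \<ge> 3"
          "\<forall>a\<in>comps C'. card (contracted_mark C' a ` {rho i, rho j, rho k, rho l}) \<ge> 3 \<longrightarrow>
          cross_ratio (contracted_mark C' a (rho i)) (contracted_mark C' a (rho j))
           (contracted_mark C' a (rho k)) (contracted_mark C' a (rho l)) = crlim z' (rho i) (rho j) (rho k) (rho l)"
        using assms q' unfolding smoothing_def by blast+
      have small: "card (contracted_mark C b ` ?A) < 3"
      proof -
        have "\<exists>w. Sb \<inter> ?A \<subseteq> {w}" using amo by blast
        then obtain w where w: "Sb \<inter> ?A \<subseteq> {w}" by blast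
        then have "image_b ` ?A \<subseteq> {mark_pt C w, node}" by (auto simp: image_b_def)
        then have "card (image_b ` ?A) \<le> card {mark_pt C w, node}" by (intro card_mono) auto
        also have "\<dots> \<le> 2" by (simp add: card_insert_if)
        finally show ?thesis using imb by simp
      qed
      show ?thesis
      proof (intro conjI ballI impI)
        obtain a where a: "a \<in> comps C'" "card (contracted_mark C' a ` {rho i, rho j, rho k, rho l}) \<ge> 3"
          using IH(1) by blast
        then show "\<exists>a\<in>comps C. card (contracted_mark C a ` ?A) \<ge> 3"
          using im[of a] by (intro bexI[of _ a]) auto
        fix c assume c: "c \<in> comps C" "card (contracted_mark C c ` ?A) \<ge> 3"
        then have cb: "c \<noteq> b" using small by auto
        then have "cross_ratio (contracted_mark C' c (rho i)) (contracted_mark C' c (rho j))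
           (contracted_mark C' c (rho k)) (contracted_mark C' c (rho l)) = crlim z' (rho i) (rho j) (rho k) (rho l)"
          using IH(2) c im[OF cb] by simp
        then show "cross_ratio (contracted_mark C c i) (contracted_mark C c j)
           (contracted_mark C c k) (contracted_mark C c l) = crlim z i j k l"
          using one[OF q True] eqs[OF cb] by simp
      qed
    next
      case False
      then have c2: "card (Sb \<inter> ?A) \<ge> 2" by simp
      show ?thesis
      proof (intro conjI ballI impI)
        show "\<exists>a\<in>comps C. card (contracted_mark C a ` ?A) \<ge> 3"
          using card_image_b[OF q c2] unfolding imb[symmetric] using b by (rule_tac bexI)
        fix c assume c: "c \<in> comps C" "card (contracted_mark C c ` ?A) \<ge> 3"
        have "cross_ratio (contracted_mark C c i) (contracted_mark C c j)
           (contracted_mark C c k) (contracted_mark C c l) =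
           cross_ratio (image_b i) (image_b j) (image_b k) (image_b l)"
        proof (cases "c = b")
          case True
          then show ?thesis using bs by simp
        next
          case cb: False
          show ?thesis
          proof (rule cross_ratio_other_component[OF q(2) _ c2 c(2)])
            fix x assume "x \<in> Sb"
            then show "contracted_mark C c x = contracted_mark C' c s"
              using contracted_mark_other[OF _ cb, of x] Sb_sub by (auto simp: rho_def)
          qed
        qed
        then show "cross_ratio (contracted_mark C c i) (contracted_mark C c j)
           (contracted_mark C c k) (contracted_mark C c l) = crlim z i j k l"
          using two[OF q c2] by simp
      qed
    qed
    show "\<exists>a\<in>comps C. card (contracted_mark C a ` ?A) \<ge> 3" by (rule res[THEN conjunct1])
    show "\<forall>a\<in>comps C. card (contracted_mark C a ` ?A) \<ge> 3 \<longrightarrow>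
          cross_ratio (contracted_mark C a i) (contracted_mark C a j)
           (contracted_mark C a k) (contracted_mark C a l) = crlim z i j k l" by (rule res[THEN conjunct2])
  qed
  then show ?thesis by (rule that[OF _ one two])
qed

end

lemma ex_leaf_locale:
  assumes "tree_curve S C" "card (comps C) \<noteq> 1"
  shows "\<exists>a b s. leaf S C a b s"
proof -
  have "finite (comps C)" "comps C \<noteq> {}" using assms by (auto simp: tree_curve_def)
  then have "card (comps C) \<ge> 2" using assms(2) by (metis One_nat_def Suc_1 card_0_eq less_2_cases linorder_not_le)
  then obtain a b where ab: "a \<in> comps C" "b \<in> comps C" "adj C `` {b} = {a}"
    using ex_leaf[OF assms(1)] by blast
  have "card (adj C `` {b}) + card {i\<in>S. mark_comp C i = b} \<ge> 3"
    using assms ab unfolding tree_curve_def by blast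
  then have "card {i\<in>S. mark_comp C i = b} \<noteq> 0" using ab by simp
  then have "{i\<in>S. mark_comp C i = b} \<noteq> {}" by (metis card.empty)
  then obtain s where "s \<in> S" "mark_comp C s = b" by blast
  then have "leaf S C a b s" using assms(1) ab by (intro leaf.intro)
  then show ?thesis by blast
qed

text \<open>Induction on the number of components by pruning leaves. It makes the definite
  description in \<open>curve_cross_ratio\<close> meaningful and will give the density of
  \<open>M_smooth n\<close>.\<close>

lemma ex_smoothing: "tree_curve S C \<Longrightarrow> \<exists>z. smoothing S C z"
proof (induction "card (comps C)" arbitrary: S C rule: less_induct)
  case less
  show ?case
  proof (cases "card (comps C) = 1")
    case True
    then show ?thesis using smoothing_one_component less.prems by blast
  next
    case False
    then obtain a b s where "leaf S C a b s" using ex_leaf_locale less.prems by blast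
    then interpret leaf S C a b s .
    have "finite (comps C)" using less.prems by (auto simp: tree_curve_def)
    then have "card (comps C') < card (comps C)" using card_Diff1_less[OF _ b] by (simp only: C'_simps)
    then obtain z' where z': "smoothing S' C' z'" using less.hyps[OF _ tree'] by blast
    show ?thesis by (rule smoothing_attach[OF z']) (rule exI)
  qed
qed

section \<open>Points of the moduli space\<close>

lemma quads_iff: "(i, j, k, l) \<in> quads n \<longleftrightarrow> {i, j, k, l} \<subseteq> {1..n} \<and> distinct [i, j, k, l]"
  by (simp add: quads_def)

lemma curve_cross_ratio_smoothing:
  assumes z: "smoothing {1..n} C z" and q: "(i, j, k, l) \<in> quads n"
  shows "moduli_point n C (i, j, k, l) = crlim z i j k l"
proof -
  have im: "contracted_mark C a ` {i, j, k, l} = {contracted_mark C a i, contracted_mark C a j,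
           contracted_mark C a k, contracted_mark C a l}" for a by simp
  have *: "\<exists>a\<in>comps C. card (contracted_mark C a ` {i, j, k, l}) \<ge> 3"
       "\<forall>a\<in>comps C. card (contracted_mark C a ` {i, j, k, l}) \<ge> 3 \<longrightarrow>
          cross_ratio (contracted_mark C a i) (contracted_mark C a j)
           (contracted_mark C a k) (contracted_mark C a l) = crlim z i j k l"
    using z q unfolding smoothing_def quads_iff by blast+
  show ?thesis
    unfolding moduli_point_def using q
    by (simp add: curve_cross_ratio_def, intro the_equality) (use * in \<open>auto simp: im\<close>)
qed

lemma moduli_point_eq:
  assumes C: "stable_curve n C" and q: "(i, j, k, l) \<in> quads n" and a: "a \<in> comps C"
    "card {contracted_mark C a i, contracted_mark C a j, contracted_mark C a k, contracted_mark C a l} \<ge> 3"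
  shows "moduli_point n C (i, j, k, l) = cross_ratio (contracted_mark C a i) (contracted_mark C a j)
           (contracted_mark C a k) (contracted_mark C a l)"
proof -
  obtain z where z: "smoothing {1..n} C z" using ex_smoothing C unfolding stable_curve_tree_curve by blast
  have im: "contracted_mark C a ` {i, j, k, l} = {contracted_mark C a i, contracted_mark C a j,
           contracted_mark C a k, contracted_mark C a l}" by simp
  have "cross_ratio (contracted_mark C a i) (contracted_mark C a j)
           (contracted_mark C a k) (contracted_mark C a l) = crlim z i j k l"
    using z q a unfolding smoothing_def quads_iff im[symmetric] by blast
  then show ?thesis using curve_cross_ratio_smoothing[OF z q] by simp
qed

lemma moduli_point_PiE: "moduli_point n C \<in> quads n \<rightarrow>\<^sub>E UNIV"
  by (simp add: moduli_point_def)

lemma Mbar_PiE: "Mbar n \<subseteq> quads n \<rightarrow>\<^sub>E UNIV"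
  unfolding Mbar_def using moduli_point_PiE by blast

lemma finite_quads: "finite (quads n)"
proof -
  have "quads n \<subseteq> {1..n} \<times> {1..n} \<times> {1..n} \<times> {1..n}" by (auto simp: quads_def)
  then show ?thesis by (rule finite_subset) auto
qed

definition smooth_curve :: "(nat \<Rightarrow> P1) \<Rightarrow> marked_curve" where
  "smooth_curve P = \<lparr>comps = {0}, adj = {}, node_pt = (\<lambda>_ _. Infinity), mark_comp = (\<lambda>_. 0), mark_pt = P\<rparr>"

lemma smooth_curve_simps [simp]:
  "comps (smooth_curve P) = {0}" "adj (smooth_curve P) = {}" "mark_comp (smooth_curve P) i = 0"
  "mark_pt (smooth_curve P) = P"
  by (simp_all add: smooth_curve_def)

lemma marks_on_smooth_curve: "marks_on n (smooth_curve P) 0 = {1..n}"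
  unfolding marks_on_def by auto

lemma smooth_curve:
  assumes "n \<ge> 3" "inj_on P {1..n}"
  shows "stable_curve n (smooth_curve P)"
    "(i, j, k, l) \<in> quads n \<Longrightarrow> moduli_point n (smooth_curve P) (i, j, k, l) = cross_ratio (P i) (P j) (P k) (P l)"
    "moduli_point n (smooth_curve P) \<in> M_smooth n"
proof -
  show st: "stable_curve n (smooth_curve P)"
    using assms by (simp add: stable_curve_def sym_def irrefl_def marks_on_smooth_curve)
  then show "moduli_point n (smooth_curve P) \<in> M_smooth n"
    unfolding M_smooth_def by (auto intro!: exI[of _ "smooth_curve P"])
  assume q: "(i, j, k, l) \<in> quads n"
  have c: "contracted_mark (smooth_curve P) 0 x = P x" for x
    by (simp add: contracted_mark_def)
  have "distinct [P i, P j, P k, P l]" using q assms(2) by (auto simp: quads_iff dest: inj_onD)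
  then have "card {P i, P j, P k, P l} \<ge> 3" by simp
  then show "moduli_point n (smooth_curve P) (i, j, k, l) = cross_ratio (P i) (P j) (P k) (P l)"
    using moduli_point_eq[OF st q, of 0] by (simp add: c)
qed

lemma M_smooth_E:
  assumes "x \<in> M_smooth n"
  obtains P where "inj_on P {1..n}" "\<And>i j k l. (i, j, k, l) \<in> quads n \<Longrightarrow> x (i, j, k, l) = cross_ratio (P i) (P j) (P k) (P l)"
proof -
  obtain C where C: "x = moduli_point n C" "stable_curve n C" "card (comps C) = 1"
    using assms by (auto simp: M_smooth_def)
  then obtain a where a: "comps C = {a}" by (auto simp: card_1_singleton_iff)
  have mc2: "mark_comp C i = a" if "i \<in> {1..n}" for i
    using that C(2) a unfolding stable_curve_def by blast
  have mc: "contracted_mark C a i = mark_pt C i" if "i \<in> {1..n}" for i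
    using mc2[OF that] by (simp add: contracted_mark_def)
  have "marks_on n C a = {1..n}" using mc2 unfolding marks_on_def by blast
  moreover have "inj_on (mark_pt C) (marks_on n C a)" using C(2) a unfolding stable_curve_def by blast
  ultimately have inj: "inj_on (mark_pt C) {1..n}" by simp
  have "x (i, j, k, l) = cross_ratio (mark_pt C i) (mark_pt C j) (mark_pt C k) (mark_pt C l)"
    if q: "(i, j, k, l) \<in> quads n" for i j k l
  proof -
    have "distinct [mark_pt C i, mark_pt C j, mark_pt C k, mark_pt C l]"
      using q inj by (auto simp: quads_iff dest: inj_onD)
    then have "card {mark_pt C i, mark_pt C j, mark_pt C k, mark_pt C l} \<ge> 3" by simp
    moreover have "i \<in> {1..n}" "j \<in> {1..n}" "k \<in> {1..n}" "l \<in> {1..n}" using q by (auto simp: quads_iff)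
    ultimately show ?thesis using moduli_point_eq[OF C(2) q, of a] a mc C(1) by simp
  qed
  then show ?thesis using that inj by blast
qed

text \<open>Two components, carrying the marks in \<open>A\<close> respectively not in \<open>A\<close>, with nodes at \<open>\<nu>\<close> and \<open>\<mu>\<close>.\<close>

definition two_curve :: "nat set \<Rightarrow> P1 \<Rightarrow> P1 \<Rightarrow> (nat \<Rightarrow> P1) \<Rightarrow> marked_curve" where
  "two_curve A \<nu> \<mu> P = \<lparr>comps = {0, 1}, adj = {(0, 1), (1, 0)}, node_pt = (\<lambda>a _. if a = 0 then \<nu> else \<mu>),
     mark_comp = (\<lambda>i. if i \<in> A then 0 else 1), mark_pt = P\<rparr>"

definition im :: "nat set \<Rightarrow> P1 \<Rightarrow> (nat \<Rightarrow> P1) \<Rightarrow> nat \<Rightarrow> P1" where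
  "im A \<nu> P i = (if i \<in> A then P i else \<nu>)"

text \<open>Of four marks at least two lie in \<open>A\<close> or at least two lie outside, so one
  of the clauses always determines the value. When both apply they say the same degenerate
  cross-ratio, seen from either component.\<close>

definition two_formula :: "nat \<Rightarrow> nat set \<Rightarrow> P1 \<Rightarrow> P1 \<Rightarrow> (nat \<Rightarrow> P1) \<Rightarrow> (quad \<Rightarrow> P1) \<Rightarrow> bool" where
  "two_formula n A \<nu> \<mu> P x \<longleftrightarrow>
     inj_on P A \<and> inj_on P ({1..n} - A) \<and> \<nu> \<notin> P ` A \<and> \<mu> \<notin> P ` ({1..n} - A) \<and>
     (\<forall>i j k l. (i, j, k, l) \<in> quads n \<longrightarrow>
       (card (A \<inter> {i, j, k, l}) \<ge> 2 \<longrightarrow>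
          x (i, j, k, l) = cross_ratio (im A \<nu> P i) (im A \<nu> P j) (im A \<nu> P k) (im A \<nu> P l)) \<and>
       (card (({1..n} - A) \<inter> {i, j, k, l}) \<ge> 2 \<longrightarrow>
          x (i, j, k, l) = cross_ratio (im ({1..n} - A) \<mu> P i) (im ({1..n} - A) \<mu> P j)
            (im ({1..n} - A) \<mu> P k) (im ({1..n} - A) \<mu> P l)))"

lemma leaf_formula:
  assumes S: "S = {1..n}" and "leaf S C a b s"
  defines "B \<equiv> marks_on n C b"
  shows "inj_on (mark_pt C) B" "node_pt C b a \<notin> mark_pt C ` B"
    "(i, j, k, l) \<in> quads n \<Longrightarrow> card (B \<inter> {i, j, k, l}) \<ge> 2 \<Longrightarrow> moduli_point n C (i, j, k, l) =
       cross_ratio (im B (node_pt C b a) (mark_pt C) i) (im B (node_pt C b a) (mark_pt C) j)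
         (im B (node_pt C b a) (mark_pt C) k) (im B (node_pt C b a) (mark_pt C) l)"
proof -
  interpret leaf S C a b s by fact
  have B: "B = Sb" unfolding B_def marks_on_def S[symmetric] Sb_def ..
  have imb: "im B (node_pt C b a) (mark_pt C) = image_b"
    by (rule ext) (simp add: im_def image_b_def B node_def)
  show "inj_on (mark_pt C) B" "node_pt C b a \<notin> mark_pt C ` B"
    using leaf_points unfolding B by force+
  assume q: "(i, j, k, l) \<in> quads n" and c: "card (B \<inter> {i, j, k, l}) \<ge> 2"
  have q': "{i, j, k, l} \<subseteq> S" "distinct [i, j, k, l]" using q unfolding S quads_iff by blast+
  have cb: "contracted_mark C b x = image_b x" if "x \<in> {i, j, k, l}" for x
    using contracted_b q'(1) that by blast
  have "card {image_b i, image_b j, image_b k, image_b l} \<ge> 3"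
    using card_image_b[OF q'] c unfolding B by simp
  then have c3: "card {contracted_mark C b i, contracted_mark C b j, contracted_mark C b k, contracted_mark C b l} \<ge> 3"
    using cb by simp
  have "stable_curve n C" using tree unfolding S stable_curve_tree_curve .
  from moduli_point_eq[OF this q b c3] show "moduli_point n C (i, j, k, l) =
       cross_ratio (im B (node_pt C b a) (mark_pt C) i) (im B (node_pt C b a) (mark_pt C) j)
         (im B (node_pt C b a) (mark_pt C) k) (im B (node_pt C b a) (mark_pt C) l)"
    unfolding imb using cb by simp
qed

text \<open>Each of the two components is a leaf attached to the other one.\<close>

lemma two_component_formula:
  assumes C: "stable_curve n C" and ab: "a \<noteq> b" "comps C = {a, b}"
    and A: "marks_on n C a = A" "marks_on n C b = {1..n} - A"
  shows "two_formula n A (node_pt C a b) (node_pt C b a) (mark_pt C) (moduli_point n C)"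
proof -
  have C': "tree_curve {1..n} C" using C by (simp only: stable_curve_tree_curve)
  have sub: "adj C \<subseteq> {a, b} \<times> {a, b}" and ir: "irrefl (adj C)" and sy: "sym (adj C)"
    and conn: "(a, b) \<in> (adj C)\<^sup>*"
    using C' ab unfolding tree_curve_def by auto
  from conn ab(1) have "adj C `` {a} \<noteq> {}" by (auto elim: converse_rtranclE)
  then have 1: "(a, b) \<in> adj C" using sub ir by (auto simp: irrefl_def)
  then have 2: "(b, a) \<in> adj C" using sy by (rule symD[rotated])
  have na: "adj C `` {a} = {b}" and nb: "adj C `` {b} = {a}"
    using 1 2 sub ir by (auto simp: irrefl_def)
  have card: "card (adj C `` {c}) + card (marks_on n C c) \<ge> 3" if "c \<in> {a, b}" for c
    using C ab that unfolding stable_curve_def by blast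
  have ne: "marks_on n C c \<noteq> {}" if "c \<in> {a, b}" for c
  proof
    assume "marks_on n C c = {}"
    then show False using card[OF that] that na nb by auto
  qed
  have "\<exists>s. leaf {1..n} C a b s"
  proof -
    obtain s where "s \<in> marks_on n C b" using ne by auto
    then show ?thesis using C' ab nb by (intro exI[of _ s] leaf.intro) (auto simp: marks_on_def)
  qed
  moreover have "\<exists>s. leaf {1..n} C b a s"
  proof -
    obtain s where "s \<in> marks_on n C a" using ne by auto
    then show ?thesis using C' ab na by (intro exI[of _ s] leaf.intro) (auto simp: marks_on_def)
  qed
  ultimately obtain s s' where s: "leaf {1..n} C a b s" "leaf {1..n} C b a s'" by blast
  show ?thesis
    unfolding two_formula_def
    using leaf_formula[OF refl s(1)] leaf_formula[OF refl s(2)] unfolding A by blast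
qed

lemma two_curve_simps [simp]:
  "comps (two_curve A \<nu> \<mu> P) = {0, 1}" "adj (two_curve A \<nu> \<mu> P) = {(0, 1), (1, 0)}"
  "node_pt (two_curve A \<nu> \<mu> P) 0 x = \<nu>" "node_pt (two_curve A \<nu> \<mu> P) (Suc 0) x = \<mu>"
  "mark_comp (two_curve A \<nu> \<mu> P) i = (if i \<in> A then 0 else 1)" "mark_pt (two_curve A \<nu> \<mu> P) = P"
  by (simp_all add: two_curve_def)

lemma marks_on_two_curve:
  "A \<subseteq> {1..n} \<Longrightarrow> marks_on n (two_curve A \<nu> \<mu> P) 0 = A"
  "marks_on n (two_curve A \<nu> \<mu> P) 1 = {1..n} - A"
  unfolding marks_on_def two_curve_simps by auto

lemma two_curve:
  assumes A: "boundary_index n A" and P: "inj_on P A" "inj_on P ({1..n} - A)" "\<nu> \<notin> P ` A" "\<mu> \<notin> P ` ({1..n} - A)"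
  shows "moduli_point n (two_curve A \<nu> \<mu> P) \<in> two_comp_locus n A"
    "two_formula n A \<nu> \<mu> P (moduli_point n (two_curve A \<nu> \<mu> P))"
proof -
  let ?C = "two_curve A \<nu> \<mu> P"
  have A': "A \<subseteq> {1..n}" "2 \<le> card A" "card A \<le> n - 2" using A by (auto simp: boundary_index_def)
  have "finite A" using A'(1) finite_subset by blast
  then have cA: "card ({1..n} - A) \<ge> 2" using A' card_Diff_subset[of A "{1..n}"] card_mono[OF _ A'(1)] by simp
  note m = marks_on_two_curve(1)[OF A'(1)] marks_on_two_curve(2)
  have st: "stable_curve n ?C"
    unfolding stable_curve_def
  proof (intro conjI ballI)
    fix a b assume "a \<in> comps ?C" "b \<in> comps ?C"
    then show "(a, b) \<in> (adj ?C)\<^sup>*" by auto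
  next
    have adj: "adj ?C `` {0} = {1}" "adj ?C `` {1} = {0}" by auto
    have np: "node_pt ?C 0 1 = \<nu>" "node_pt ?C 1 0 = \<mu>" by (simp_all add: two_curve_def)
    let ?stab = "\<lambda>a. inj_on (node_pt ?C a) (adj ?C `` {a}) \<and> inj_on (mark_pt ?C) (marks_on n ?C a) \<and>
      node_pt ?C a ` (adj ?C `` {a}) \<inter> mark_pt ?C ` marks_on n ?C a = {} \<and>
      card (adj ?C `` {a}) + card (marks_on n ?C a) \<ge> 3"
    have "?stab 0" "?stab 1"
      unfolding adj m two_curve_simps(6) using P A'(2) cA np by auto
    moreover fix a assume "a \<in> comps ?C"
    then have "a = 0 \<or> a = 1" by simp
    ultimately show "inj_on (node_pt ?C a) (adj ?C `` {a})" "inj_on (mark_pt ?C) (marks_on n ?C a)"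
      "node_pt ?C a ` (adj ?C `` {a}) \<inter> mark_pt ?C ` marks_on n ?C a = {}"
      "card (adj ?C `` {a}) + card (marks_on n ?C a) \<ge> 3" by blast+
  qed (auto simp: sym_def irrefl_def)
  show "moduli_point n ?C \<in> two_comp_locus n A"
    unfolding two_comp_locus_def using st m
    by (intro CollectI exI[of _ ?C] conjI refl exI[of _ 0] exI[of _ 1]) auto
  show "two_formula n A \<nu> \<mu> P (moduli_point n ?C)"
    using two_component_formula[OF st, of 0 1 A] m by (simp add: two_curve_def)
qed

lemma two_comp_locus_E:
  assumes "x \<in> two_comp_locus n A"
  obtains \<nu> \<mu> P where "two_formula n A \<nu> \<mu> P x"
  using assms two_component_formula unfolding two_comp_locus_def by blast

lemma two_comp_locus_compl:
  assumes "A \<subseteq> {1..n}"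
  shows "two_comp_locus n ({1..n} - A) = two_comp_locus n A"
proof -
  have *: "{1..n} - ({1..n} - A) = A" using assms by auto
  have "two_comp_locus n B \<subseteq> two_comp_locus n ({1..n} - B)" if "B \<subseteq> {1..n}" for B
  proof
    fix x assume "x \<in> two_comp_locus n B"
    then obtain C a b where C: "x = moduli_point n C" "stable_curve n C" "a \<noteq> b" "comps C = {a, b}"
      "marks_on n C a = B" "marks_on n C b = {1..n} - B" unfolding two_comp_locus_def by blast
    have "{1..n} - ({1..n} - B) = B" using that by auto
    then show "x \<in> two_comp_locus n ({1..n} - B)"
      unfolding two_comp_locus_def using C
      by (intro CollectI exI[of _ C] conjI exI[of _ b] exI[of _ a]) auto
  qed
  from this[OF assms] this[of "{1..n} - A", unfolded *, OF Diff_subset] show ?thesis by (rule subset_antisym[rotated])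
qed

lemma two_comp_locus_Mbar: "two_comp_locus n A \<subseteq> Mbar n"
  unfolding two_comp_locus_def Mbar_def by blast

lemma M_smooth_Mbar: "M_smooth n \<subseteq> Mbar n"
  unfolding M_smooth_def Mbar_def by blast

section \<open>Density of the strata\<close>

lemma multihom_poly_curve:
  assumes "multihom_poly Q d F"
  shows "\<exists>G. \<forall>t. poly G t = F (\<lambda>q. (poly (a q) t, poly (b q) t))"
  using assms
proof (induction rule: multihom_poly.induct)
  case (const c) show ?case by (intro exI[of _ "[:c:]"]) simp
next
  case (coord1 q) show ?case by (intro exI[of _ "a q"]) simp
next
  case (coord2 q) show ?case by (intro exI[of _ "b q"]) simp
next
  case (add d F G)
  then obtain f g where "\<forall>t. poly f t = F (\<lambda>q. (poly (a q) t, poly (b q) t))"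
    "\<forall>t. poly g t = G (\<lambda>q. (poly (a q) t, poly (b q) t))" by blast
  then show ?case by (intro exI[of _ "f + g"]) simp
next
  case (mult d F e G)
  then obtain f g where "\<forall>t. poly f t = F (\<lambda>q. (poly (a q) t, poly (b q) t))"
    "\<forall>t. poly g t = G (\<lambda>q. (poly (a q) t, poly (b q) t))" by blast
  then show ?case by (intro exI[of _ "f * g"]) simp
qed

text \<open>Along the family the polynomial that cuts out a neighbourhood of \<open>x\<close>
  becomes a univariate polynomial \<open>G\<close> with nonzero value at 0. The family stays in
  \<open>W\<close> off the finitely many roots of \<open>G\<close>.\<close>

lemma open_at_limit:
  assumes Q: "finite Q" "X \<subseteq> Q \<rightarrow>\<^sub>E UNIV" and W: "openin (zariski Q X) W" "x \<in> W"
    and x: "\<And>q. q \<in> Q \<Longrightarrow> (poly (a q) 0, poly (b q) 0) \<noteq> (0, 0) \<and> x q = P1_point (poly (a q) 0) (poly (b q) 0)"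
  shows "\<exists>G. G \<noteq> 0 \<and> (\<forall>t y. poly G t \<noteq> 0 \<longrightarrow> y \<in> X \<longrightarrow> (\<forall>q\<in>Q. (poly (a q) t, poly (b q) t) \<noteq> (0, 0) \<and>
    y q = P1_point (poly (a q) t) (poly (b q) t)) \<longrightarrow> y \<in> W)"
proof -
  obtain F d where F: "multihom_poly Q d F" "eval_at F x \<noteq> 0" "{y\<in>X. eval_at F y \<noteq> 0} \<subseteq> W"
    using openin_zariskiD[OF Q(2) W] by blast
  obtain G where G: "\<And>t. poly G t = F (\<lambda>q. (poly (a q) t, poly (b q) t))"
    using multihom_poly_curve[OF F(1)] by blast
  have key: "poly G t = (\<Prod>q\<in>Q. (if poly (b q) t = 0 then poly (a q) t else poly (b q) t) ^ d q) * eval_at F y"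
    "(\<Prod>q\<in>Q. (if poly (b q) t = 0 then poly (a q) t else poly (b q) t) ^ d q) \<noteq> 0"
    if "\<And>q. q \<in> Q \<Longrightarrow> (poly (a q) t, poly (b q) t) \<noteq> (0, 0) \<and> y q = P1_point (poly (a q) t) (poly (b q) t)" for t y
  proof -
    show "poly G t = (\<Prod>q\<in>Q. (if poly (b q) t = 0 then poly (a q) t else poly (b q) t) ^ d q) * eval_at F y"
      unfolding G by (rule multihom_P1_point[OF Q(1) F(1)]) (use that in auto)
    show "(\<Prod>q\<in>Q. (if poly (b q) t = 0 then poly (a q) t else poly (b q) t) ^ d q) \<noteq> 0"
      using that Q(1) by auto
  qed
  have "poly G 0 \<noteq> 0" using key[OF x] F(2) by simp
  then have "G \<noteq> 0" by auto
  moreover have "y \<in> W" if "poly G t \<noteq> 0" "y \<in> X" "\<forall>q\<in>Q. (poly (a q) t, poly (b q) t) \<noteq> (0, 0) \<and>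
    y q = P1_point (poly (a q) t) (poly (b q) t)" for t y
    using key(1)[of t y] that F(3) by auto
  ultimately show ?thesis by blast
qed

lemma poly_nonroot: "(G :: complex poly) \<noteq> 0 \<Longrightarrow> \<exists>t. poly G t \<noteq> 0"
  using poly_all_0_iff_0 by blast

definition point_at :: "(nat \<Rightarrow> complex poly \<times> complex poly) \<Rightarrow> complex \<Rightarrow> nat \<Rightarrow> P1" where
  "point_at z t i = P1_point (poly (fst (z i)) t) (poly (snd (z i)) t)"

definition discr :: "nat set \<Rightarrow> (nat \<Rightarrow> complex poly \<times> complex poly) \<Rightarrow> complex poly" where
  "discr S z = (\<Prod>i\<in>S. \<Prod>j\<in>S - {i}. pdet (z i) (z j))"

lemma discr_nz: "finite S \<Longrightarrow> generic S z \<Longrightarrow> discr S z \<noteq> 0"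
  by (auto simp: discr_def generic_def)

lemma discr_nzD: "finite S \<Longrightarrow> poly (discr S z) t \<noteq> 0 \<Longrightarrow> i \<in> S \<Longrightarrow> j \<in> S \<Longrightarrow> i \<noteq> j \<Longrightarrow> poly (pdet (z i) (z j)) t \<noteq> 0"
  by (auto simp: discr_def poly_prod)

lemma point_at_cross_ratio:
  assumes fin: "finite S" and d: "poly (discr S z) t \<noteq> 0" and q: "{i, j, k, l} \<subseteq> S" "distinct [i, j, k, l]"
  shows "cross_ratio (point_at z t i) (point_at z t j) (point_at z t k) (point_at z t l) =
    P1_point (poly (crnum z i j k l) t) (poly (crden z i j k l) t)"
    "poly (crnum z i j k l) t \<noteq> 0" "poly (crden z i j k l) t \<noteq> 0"
proof -
  have pd: "poly (pdet (z x) (z y)) t \<noteq> 0" if "x \<in> {i, j, k, l}" "y \<in> {i, j, k, l}" "x \<noteq> y" for x y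
    using discr_nzD[OF fin d] q(1) that by blast
  have "(poly (fst (z x)) t, poly (snd (z x)) t) \<noteq> (0, 0)" if "x \<in> {i, j, k, l}" for x
  proof -
    obtain y where "y \<in> {i, j, k, l}" "x \<noteq> y" using q(2) that by auto
    from pd[OF that this] show ?thesis by (auto simp: pdet_def)
  qed
  then show "cross_ratio (point_at z t i) (point_at z t j) (point_at z t k) (point_at z t l) =
    P1_point (poly (crnum z i j k l) t) (poly (crden z i j k l) t)"
    unfolding point_at_def crnum_def crden_def by (subst cross_ratio_P1_point) (auto simp: pdet_def)
  show "poly (crnum z i j k l) t \<noteq> 0" "poly (crden z i j k l) t \<noteq> 0"
    using pd q(2) by (simp_all add: crnum_def crden_def)
qed

lemma point_at_inj:
  assumes fin: "finite S" and d: "poly (discr S z) t \<noteq> 0"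
  shows "inj_on (point_at z t) S"
proof (rule inj_onI, rule ccontr)
  fix x y assume xy: "x \<in> S" "y \<in> S" "point_at z t x = point_at z t y" "x \<noteq> y"
  have "poly (pdet (z x) (z y)) t \<noteq> 0" using discr_nzD[OF fin d] xy by blast
  then have ne: "poly (fst (z x)) t * poly (snd (z y)) t \<noteq> poly (fst (z y)) t * poly (snd (z x)) t"
    by (simp add: pdet_def)
  then have "(poly (fst (z x)) t, poly (snd (z x)) t) \<noteq> (0, 0)" "(poly (fst (z y)) t, poly (snd (z y)) t) \<noteq> (0, 0)"
    by auto
  then show False using xy(3) ne by (simp add: point_at_def P1_point_eq_iff)
qed

lemma crnum_crden_nz:
  assumes "generic S z" "{i, j, k, l} \<subseteq> S" "distinct [i, j, k, l]"
  shows "crnum z i j k l \<noteq> 0" "crden z i j k l \<noteq> 0"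
  using assms by (auto simp: generic_def crnum_def crden_def)

lemma monom_scale: "t \<noteq> 0 \<Longrightarrow> F = monom 1 m * F' \<Longrightarrow> G = monom 1 m * G' \<Longrightarrow>
  P1_point (poly F t) (poly G t) = P1_point (poly F' t) (poly G' t) \<and>
  ((poly F t \<noteq> 0) = (poly F' t \<noteq> 0)) \<and> ((poly G t \<noteq> 0) = (poly G' t \<noteq> 0))"
  by (simp add: poly_monom P1_point_scale)

text \<open>Once common powers of \<open>t\<close> are removed from numerators and denominators, a
  smoothing family passes through the given point at \<open>t = 0\<close>, and its general member is
  a smooth curve.\<close>

lemma M_smooth_dense:
  assumes n: "n \<ge> 3" and W: "openin (zariski (quads n) (Mbar n)) W" "W \<noteq> {}"
  shows "W \<inter> M_smooth n \<noteq> {}"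
proof -
  obtain x where x: "x \<in> W" using W(2) by blast
  then have "x \<in> Mbar n" using openin_subset[OF W(1)] topspace_zariski[OF Mbar_PiE] by auto
  then obtain C where C: "x = moduli_point n C" "stable_curve n C" by (auto simp: Mbar_def)
  obtain z where z: "smoothing {1..n} C z" using ex_smoothing C(2) unfolding stable_curve_tree_curve by blast
  then have gen: "generic {1..n} z" by (simp add: smoothing_def)
  have "\<forall>q\<in>quads n. \<exists>r. case q of (i, j, k, l) \<Rightarrow> case r of (m, a, b) \<Rightarrow>
      crnum z i j k l = monom 1 m * a \<and> crden z i j k l = monom 1 m * b \<and> (poly a 0, poly b 0) \<noteq> (0, 0) \<and>
      x q = P1_point (poly a 0) (poly b 0)"
  proof
    fix q assume q: "q \<in> quads n"
    obtain i j k l where ijkl: "q = (i, j, k, l)" by (cases q)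
    have "crnum z i j k l \<noteq> 0" "crden z i j k l \<noteq> 0"
      using crnum_crden_nz[OF gen] q by (auto simp: ijkl quads_iff)
    from crv_limit[OF this] obtain m a b where "crnum z i j k l = monom 1 m * a" "crden z i j k l = monom 1 m * b"
      "(poly a 0, poly b 0) \<noteq> (0, 0)" "crlim z i j k l = P1_point (poly a 0) (poly b 0)"
      unfolding crlim_def by blast
    then show "\<exists>r. case q of (i, j, k, l) \<Rightarrow> case r of (m, a, b) \<Rightarrow>
      crnum z i j k l = monom 1 m * a \<and> crden z i j k l = monom 1 m * b \<and> (poly a 0, poly b 0) \<noteq> (0, 0) \<and>
      x q = P1_point (poly a 0) (poly b 0)"
      using curve_cross_ratio_smoothing[OF z q[unfolded ijkl]] C(1) ijkl
      by (intro exI[of _ "(m, a, b)"]) simp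
  qed
  then obtain r where r: "\<forall>q\<in>quads n. case q of (i, j, k, l) \<Rightarrow> case r q of (m, a, b) \<Rightarrow>
      crnum z i j k l = monom 1 m * a \<and> crden z i j k l = monom 1 m * b \<and> (poly a 0, poly b 0) \<noteq> (0, 0) \<and>
      x q = P1_point (poly a 0) (poly b 0)" using bchoice by meson
  define a b m where "a = (\<lambda>q. fst (snd (r q)))" and "b = (\<lambda>q. snd (snd (r q)))" and "m = (\<lambda>q. fst (r q))"
  have r': "crnum z i j k l = monom 1 (m (i,j,k,l)) * a (i,j,k,l)" "crden z i j k l = monom 1 (m (i,j,k,l)) * b (i,j,k,l)"
     "(poly (a (i,j,k,l)) 0, poly (b (i,j,k,l)) 0) \<noteq> (0, 0) \<and> x (i,j,k,l) = P1_point (poly (a (i,j,k,l)) 0) (poly (b (i,j,k,l)) 0)"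
    if "(i, j, k, l) \<in> quads n" for i j k l
    using bspec[OF r that] by (auto simp: a_def b_def m_def split: prod.splits)
  have r'': "(poly (a q) 0, poly (b q) 0) \<noteq> (0, 0) \<and> x q = P1_point (poly (a q) 0) (poly (b q) 0)"
    if "q \<in> quads n" for q
    using r'(3) that by (cases q) simp
  obtain G where G: "G \<noteq> 0" "\<And>t y. poly G t \<noteq> 0 \<Longrightarrow> y \<in> Mbar n \<Longrightarrow> (\<forall>q\<in>quads n. (poly (a q) t, poly (b q) t) \<noteq> (0, 0) \<and>
    y q = P1_point (poly (a q) t) (poly (b q) t)) \<Longrightarrow> y \<in> W"
    using open_at_limit[OF finite_quads Mbar_PiE W(1) x r''] by blast
  \<comment> \<open>The parameter must avoid the roots of \<open>G\<close>, the value 0, and the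
    values at which two marks collide.\<close>
  have "G * [:0, 1:] * discr {1..n} z \<noteq> 0" using G(1) discr_nz[OF _ gen] by simp
  then obtain t where "poly (G * [:0, 1:] * discr {1..n} z) t \<noteq> 0" using poly_nonroot by blast
  then have t: "poly G t \<noteq> 0" "t \<noteq> 0" "poly (discr {1..n} z) t \<noteq> 0" by auto
  let ?y = "moduli_point n (smooth_curve (point_at z t))"
  have inj: "inj_on (point_at z t) {1..n}" using point_at_inj[OF _ t(3)] by simp
  have yM: "?y \<in> M_smooth n" using smooth_curve[OF n inj] by simp
  moreover have "?y \<in> W"
  proof (rule G(2)[OF t(1)])
    show "?y \<in> Mbar n" using yM M_smooth_Mbar by blast
    show "\<forall>q\<in>quads n. (poly (a q) t, poly (b q) t) \<noteq> (0, 0) \<and> ?y q = P1_point (poly (a q) t) (poly (b q) t)"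
    proof
      fix q assume q: "q \<in> quads n"
      obtain i j k l where ijkl: "q = (i, j, k, l)" by (cases q)
      have q': "{i, j, k, l} \<subseteq> {1..n}" "distinct [i, j, k, l]" using q by (auto simp: ijkl quads_iff)
      show "(poly (a q) t, poly (b q) t) \<noteq> (0, 0) \<and> ?y q = P1_point (poly (a q) t) (poly (b q) t)"
        using smooth_curve(2)[OF n inj q[unfolded ijkl]] point_at_cross_ratio[OF _ t(3) q']
          monom_scale[OF t(2) r'(1,2)[OF q[unfolded ijkl]]] unfolding ijkl by simp
    qed
  qed
  ultimately show ?thesis by blast
qed

lemma two_elements:
  assumes "card A \<ge> 2"
  shows "\<exists>x y. x \<in> A \<and> y \<in> A \<and> x \<noteq> y"
proof (rule ccontr)
  assume "\<not> ?thesis"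
  moreover have "finite A" using assms card_ge_0_finite by force
  ultimately have "card A \<le> Suc 0" using card_le_Suc0_iff_eq[of A] by blast
  then show False using assms by simp
qed

text \<open>Applied to a pruned curve, one of whose marks is the substitute \<open>s\<close>, it
  leaves at least two marks off each leaf, as required for a boundary index.\<close>

lemma tree_curve_card3: "tree_curve S C \<Longrightarrow> card S \<ge> 3"
proof (induction "card (comps C)" arbitrary: S C rule: less_induct)
  case less
  have fin: "finite S" "finite (comps C)" using less.prems by (auto simp: tree_curve_def)
  show ?case
  proof (cases "card (comps C) = 1")
    case True
    then obtain a where a: "comps C = {a}" by (auto simp: card_1_singleton_iff)
    have "card (adj C `` {a}) + card {i\<in>S. mark_comp C i = a} \<ge> 3"
      using less.prems a unfolding tree_curve_def by blast
    moreover have "adj C `` {a} = {}" using less.prems a by (auto simp: tree_curve_def irrefl_def)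
    moreover have "card {i\<in>S. mark_comp C i = a} \<le> card S" using fin by (intro card_mono) auto
    ultimately show ?thesis by simp
  next
    case False
    then obtain a b s where "leaf S C a b s" using ex_leaf_locale less.prems by blast
    then interpret leaf S C a b s .
    have "card (comps C') < card (comps C)" using card_Diff1_less[OF _ b] fin by (simp only: C'_simps)
    then have "card S' \<ge> 3" using less.hyps[OF _ tree'] by blast
    then show ?thesis using card_mono[OF fin(1) S'_sub] by linarith
  qed
qed

section \<open>Approximating a singular curve by curves with two components\<close>

context leaf
begin

lemma card_outside: "card (S - Sb) \<ge> 2"
proof -
  have "card S' = Suc (card (S - Sb))" unfolding S'_def using finS s_in by simp
  then show ?thesis using tree_curve_card3[OF tree'] by linarith
qed

lemma leaf_zero:
  assumes z: "smoothing S C z" and q: "i \<in> Sb" "k \<in> Sb" "i \<noteq> k" "j \<in> S - Sb" "l \<in> S - Sb" "j \<noteq> l"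
  shows "crlim z i j k l = Finite 0"
proof -
  have q': "{i, j, k, l} \<subseteq> S" "distinct [i, j, k, l]" using q Sb_sub by auto
  have "{i, k} \<subseteq> Sb \<inter> {i, j, k, l}" using q by blast
  then have "card {i, k} \<le> card (Sb \<inter> {i, j, k, l})" by (rule card_mono[rotated]) simp
  then have c: "card (Sb \<inter> {i, j, k, l}) \<ge> 2" using q by simp
  have cb: "contracted_mark C b ` {i, j, k, l} = image_b ` {i, j, k, l}"
    using contracted_b q'(1) by (intro image_cong refl) blast
  have "cross_ratio (contracted_mark C b i) (contracted_mark C b j)
           (contracted_mark C b k) (contracted_mark C b l) = crlim z i j k l"
    using z q' card_image_b[OF q' c] b cb unfolding smoothing_def by metis
  moreover have "contracted_mark C b i = mark_pt C i" "contracted_mark C b k = mark_pt C k"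
    "contracted_mark C b j = node" "contracted_mark C b l = node"
    using contracted_b q q' by (simp_all add: image_b_def)
  ultimately show ?thesis
    using leaf_points(2) q by (metis cross_ratio_degenerate(4) node_def)
qed

text \<open>Keep the leaf and smooth only the rest, with the node following the moving mark
  \<open>s\<close>. Cross-ratios that the leaf sees are constant; all others are those of the
  smoothing of the pruned curve.\<close>

lemma two_comp_dense:
  assumes S: "S = {1..n}" and W: "openin (zariski (quads n) (Mbar n)) W" "moduli_point n C \<in> W"
  shows "W \<inter> two_comp_locus n Sb \<noteq> {}"
proof -
  define x where "x = moduli_point n C"
  obtain z' where z': "smoothing S' C' z'" using ex_smoothing[OF tree'] by blast
  then have gen': "generic S' z'" by (simp add: smoothing_def)
  have finS': "finite S'" using finS S'_sub finite_subset by blast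
  obtain z where z: "smoothing S C z" and
    one: "\<And>i j k l. {i, j, k, l} \<subseteq> S \<Longrightarrow> distinct [i, j, k, l] \<Longrightarrow> card (Sb \<inter> {i, j, k, l}) \<le> 1 \<Longrightarrow>
      crlim z i j k l = crlim z' (rho i) (rho j) (rho k) (rho l)"
    and two: "\<And>i j k l. {i, j, k, l} \<subseteq> S \<Longrightarrow> distinct [i, j, k, l] \<Longrightarrow> card (Sb \<inter> {i, j, k, l}) \<ge> 2 \<Longrightarrow>
      crlim z i j k l = cross_ratio (image_b i) (image_b j) (image_b k) (image_b l)"
    by (rule smoothing_attach[OF z']) (rule that; blast)
  have xz: "x (i, j, k, l) = crlim z i j k l" if "(i, j, k, l) \<in> quads n" for i j k l
    unfolding x_def using curve_cross_ratio_smoothing[OF z[unfolded S] that] .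
  have rho_q: "{rho i, rho j, rho k, rho l} \<subseteq> S'" "distinct [rho i, rho j, rho k, rho l]"
    if q: "{i, j, k, l} \<subseteq> S" "distinct [i, j, k, l]" and c: "card (Sb \<inter> {i, j, k, l}) \<le> 1" for i j k l
  proof -
    have amo: "u = v" if "u \<in> Sb \<inter> {i, j, k, l}" "v \<in> Sb \<inter> {i, j, k, l}" for u v
    proof -
      have "finite (Sb \<inter> {i, j, k, l})" by simp
      from card_le_Suc0_iff_eq[OF this] c that show ?thesis unfolding One_nat_def by blast
    qed
    have "rho u \<noteq> rho v" if "u \<in> {i, j, k, l}" "v \<in> {i, j, k, l}" "u \<noteq> v" for u v
      using amo[of u v] that s_in(1) unfolding rho_def by (metis IntI)
    then show "distinct [rho i, rho j, rho k, rho l]" using q(2) by simp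
    show "{rho i, rho j, rho k, rho l} \<subseteq> S'" using q(1) rho_S' by blast
  qed
  \<comment> \<open>The triple \<open>(m, a, b)\<close> records the power of \<open>t\<close>
    removed and the remaining homogeneous coordinates, which are constant for the quadruples seen on
    the leaf.\<close>
  define R where "R = (\<lambda>q r. case q of (i, j, k, l) \<Rightarrow> case r of (m, a, b) \<Rightarrow>
      (poly a 0, poly b 0) \<noteq> (0, 0) \<and> x q = P1_point (poly a 0) (poly b 0) \<and>
      (card (Sb \<inter> {i, j, k, l}) \<le> 1 \<longrightarrow> crnum z' (rho i) (rho j) (rho k) (rho l) = monom 1 m * a \<and>
         crden z' (rho i) (rho j) (rho k) (rho l) = monom 1 m * b) \<and>
      (card (Sb \<inter> {i, j, k, l}) \<ge> 2 \<longrightarrow> a = [:fst (hcoord (x q)):] \<and> b = [:snd (hcoord (x q)):]))"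
  have "\<forall>q\<in>quads n. \<exists>r. R q r"
  proof
    fix q assume q: "q \<in> quads n"
    obtain i j k l where ijkl: "q = (i, j, k, l)" by (cases q)
    have q': "{i, j, k, l} \<subseteq> S" "distinct [i, j, k, l]" using q unfolding ijkl quads_iff S by blast+
    show "\<exists>r. R q r"
    proof (cases "card (Sb \<inter> {i, j, k, l}) \<le> 1")
      case True
      from crv_limit[OF crnum_crden_nz[OF gen' rho_q[OF q' True]]]
      obtain m a b where "crnum z' (rho i) (rho j) (rho k) (rho l) = monom 1 m * a"
        "crden z' (rho i) (rho j) (rho k) (rho l) = monom 1 m * b"
        "(poly a 0, poly b 0) \<noteq> (0, 0)" "crlim z' (rho i) (rho j) (rho k) (rho l) = P1_point (poly a 0) (poly b 0)"
        unfolding crlim_def by blast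
      then have "R q (m, a, b)" using xz[OF q[unfolded ijkl]] one[OF q' True] True unfolding R_def ijkl by simp
      then show ?thesis by blast
    next
      case False
      then have "R q (0, [:fst (hcoord (x q)):], [:snd (hcoord (x q)):])"
        using hcoord_nz[of "x q"] unfolding R_def ijkl by (auto simp: prod_eq_iff)
      then show ?thesis by blast
    qed
  qed
  then obtain r where r: "\<forall>q\<in>quads n. R q (r q)" using bchoice by meson
  define a' b' m where "a' = (\<lambda>q. fst (snd (r q)))" and "b' = (\<lambda>q. snd (snd (r q)))" and "m = (\<lambda>q. fst (r q))"
  have r': "R q (m q, a' q, b' q)" if "q \<in> quads n" for q
    using bspec[OF r that] by (simp add: a'_def b'_def m_def)
  have r'': "(poly (a' q) 0, poly (b' q) 0) \<noteq> (0, 0) \<and> x q = P1_point (poly (a' q) 0) (poly (b' q) 0)"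
    if "q \<in> quads n" for q
    using r'[OF that] unfolding R_def by (auto split: prod.splits)
  obtain G where G: "G \<noteq> 0" "\<And>t y. poly G t \<noteq> 0 \<Longrightarrow> y \<in> Mbar n \<Longrightarrow> (\<forall>q\<in>quads n. (poly (a' q) t, poly (b' q) t) \<noteq> (0, 0) \<and>
    y q = P1_point (poly (a' q) t) (poly (b' q) t)) \<Longrightarrow> y \<in> W"
    using open_at_limit[OF finite_quads Mbar_PiE W(1) W(2)[folded x_def] r''] by blast
  have "G * [:0, 1:] * discr S' z' \<noteq> 0" using G(1) discr_nz[OF finS' gen'] by simp
  then obtain t where "poly (G * [:0, 1:] * discr S' z') t \<noteq> 0" using poly_nonroot by blast
  then have t: "poly G t \<noteq> 0" "t \<noteq> 0" "poly (discr S' z') t \<noteq> 0" by auto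
  define P where "P = (\<lambda>i. if i \<in> Sb then mark_pt C i else point_at z' t i)"
  define \<nu> where "\<nu> = point_at z' t s"
  have inj: "inj_on (point_at z' t) S'" using point_at_inj[OF finS' t(3)] .
  have SbS: "{1..n} - Sb = S - Sb" by (simp only: S)
  have "boundary_index n Sb"
  proof -
    have "card (S - Sb) = card S - card Sb" using Sb_sub finS by (intro card_Diff_subset) (auto intro: finite_subset)
    then show ?thesis
      unfolding boundary_index_def using Sb_sub card_Sb card_outside by (simp add: S)
  qed
  moreover have "inj_on P Sb" using leaf_points(1) by (simp add: P_def inj_on_def)
  moreover have "inj_on P ({1..n} - Sb)"
    unfolding SbS using inj by (simp add: P_def inj_on_def S'_def)
  moreover have "node \<notin> P ` Sb" using leaf_points(2) by (force simp: P_def node_def)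
  moreover have "\<nu> \<notin> P ` ({1..n} - Sb)"
    unfolding SbS \<nu>_def using inj s_in by (force simp: P_def inj_on_def S'_def)
  ultimately have y: "moduli_point n (two_curve Sb node \<nu> P) \<in> two_comp_locus n Sb"
    "two_formula n Sb node \<nu> P (moduli_point n (two_curve Sb node \<nu> P))"
    using two_curve by blast+
  define y where "y = moduli_point n (two_curve Sb node \<nu> P)"
  have "y \<in> W"
  proof (rule G(2)[OF t(1)])
    show "y \<in> Mbar n" using y(1) two_comp_locus_Mbar unfolding y_def by blast
    show "\<forall>q\<in>quads n. (poly (a' q) t, poly (b' q) t) \<noteq> (0, 0) \<and> y q = P1_point (poly (a' q) t) (poly (b' q) t)"
    proof
      fix q assume q: "q \<in> quads n"
      obtain i j k l where ijkl: "q = (i, j, k, l)" by (cases q)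
      have q': "{i, j, k, l} \<subseteq> S" "distinct [i, j, k, l]" using q unfolding ijkl quads_iff S by blast+
      show "(poly (a' q) t, poly (b' q) t) \<noteq> (0, 0) \<and> y q = P1_point (poly (a' q) t) (poly (b' q) t)"
      proof (cases "card (Sb \<inter> {i, j, k, l}) \<le> 1")
        case True
        have "card {i, j, k, l} = 4" using q'(2) by simp
        moreover have "{i, j, k, l} = (Sb \<inter> {i, j, k, l}) \<union> (({1..n} - Sb) \<inter> {i, j, k, l})"
          using q'(1) unfolding S by blast
        then have "card {i, j, k, l} \<le> card (Sb \<inter> {i, j, k, l}) + card (({1..n} - Sb) \<inter> {i, j, k, l})"
          by (metis card_Un_le)
        ultimately have "card (({1..n} - Sb) \<inter> {i, j, k, l}) \<ge> 2" using True by linarith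
        then have "y q = cross_ratio (im ({1..n} - Sb) \<nu> P i) (im ({1..n} - Sb) \<nu> P j)
            (im ({1..n} - Sb) \<nu> P k) (im ({1..n} - Sb) \<nu> P l)"
          using y(2) q unfolding two_formula_def y_def ijkl by blast
        moreover have "im ({1..n} - Sb) \<nu> P u = point_at z' t (rho u)" if "u \<in> {i, j, k, l}" for u
          using that q'(1) unfolding SbS by (auto simp: im_def P_def rho_def \<nu>_def)
        ultimately have "y q = P1_point (poly (crnum z' (rho i) (rho j) (rho k) (rho l)) t)
            (poly (crden z' (rho i) (rho j) (rho k) (rho l)) t)"
          using point_at_cross_ratio(1)[OF finS' t(3) rho_q[OF q' True]] by simp
        moreover note nz = point_at_cross_ratio(2,3)[OF finS' t(3) rho_q[OF q' True]]
        moreover have R: "crnum z' (rho i) (rho j) (rho k) (rho l) = monom 1 (m q) * a' q"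
          "crden z' (rho i) (rho j) (rho k) (rho l) = monom 1 (m q) * b' q"
          using r'[OF q] True unfolding R_def ijkl by auto
        ultimately show ?thesis using monom_scale[OF t(2) R] by simp
      next
        case False
        then have c: "card (Sb \<inter> {i, j, k, l}) \<ge> 2" by linarith
        then have "y q = cross_ratio (im Sb node P i) (im Sb node P j) (im Sb node P k) (im Sb node P l)"
          using y(2) q unfolding two_formula_def y_def ijkl by blast
        moreover have "im Sb node P u = image_b u" for u
          by (simp add: im_def P_def image_b_def)
        ultimately have yx: "y q = x q" using two[OF q' c] xz[OF q[unfolded ijkl]] unfolding ijkl by simp
        have ab': "a' q = [:fst (hcoord (x q)):]" "b' q = [:snd (hcoord (x q)):]"
          using r'[OF q] c unfolding R_def ijkl prod.case by blast+
        show ?thesis using hcoord_nz[of "x q"] unfolding yx ab' by simp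
      qed
    qed
  qed
  then show ?thesis using y(1) unfolding y_def by blast
qed

end

text \<open>The condition under which the cross-ratio of \<open>i, j, k, l\<close> vanishes along
  the divisor of \<open>A\<close>.\<close>

definition splits :: "nat set \<Rightarrow> nat \<Rightarrow> nat \<Rightarrow> nat \<Rightarrow> nat \<Rightarrow> bool" where
  "splits A i j k l \<longleftrightarrow> (i \<in> A \<longleftrightarrow> k \<in> A) \<and> (j \<in> A \<longleftrightarrow> l \<in> A) \<and> (i \<in> A \<longleftrightarrow> j \<notin> A)"

text \<open>Fix two elements inside \<open>B\<close> and two outside, and vary one of them:
  membership in \<open>A\<close> is constant on \<open>B\<close> and takes the opposite value off
  \<open>B\<close>.\<close>

lemma splits_determine:
  assumes A: "A \<subseteq> S" and B: "B \<subseteq> S" "card B \<ge> 2" "card (S - B) \<ge> 2"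
    and sp: "\<And>i j k l. i \<in> B \<Longrightarrow> k \<in> B \<Longrightarrow> i \<noteq> k \<Longrightarrow> j \<in> S - B \<Longrightarrow> l \<in> S - B \<Longrightarrow> j \<noteq> l \<Longrightarrow> splits A i j k l"
  shows "B = A \<or> B = S - A"
proof -
  obtain i k where ik: "i \<in> B" "k \<in> B" "i \<noteq> k" using B(2) two_elements by blast
  obtain j l where jl: "j \<in> S - B" "l \<in> S - B" "j \<noteq> l" using B(3) two_elements by blast
  have 1: "u \<in> A \<longleftrightarrow> i \<in> A" if "u \<in> B" for u
    using sp[OF ik(1) that _ jl] by (cases "u = i") (auto simp: splits_def)
  have 2: "u \<in> A \<longleftrightarrow> i \<notin> A" if "u \<in> S - B" for u
  proof (cases "u = j")
    case True then show ?thesis using sp[OF ik jl] by (auto simp: splits_def)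
  next
    case False then show ?thesis using sp[OF ik jl(1) that] by (auto simp: splits_def)
  qed
  show ?thesis using 1 2 B(1) A by (cases "i \<in> A") blast+
qed

text \<open>The marks of any leaf of the curve serve as \<open>A\<close>.\<close>

lemma boundary_point_closure:
  assumes x: "x \<in> Mbar n" "x \<notin> M_smooth n"
  shows "\<exists>A. boundary_index n A \<and> x \<in> zariski (quads n) (Mbar n) closure_of two_comp_locus n A"
proof -
  obtain C where C: "x = moduli_point n C" "stable_curve n C" using x(1) by (auto simp: Mbar_def)
  then have c1: "card (comps C) \<noteq> 1" using x(2) by (auto simp: M_smooth_def)
  have C': "tree_curve {1..n} C" using C(2) unfolding stable_curve_tree_curve .
  obtain a b s where l: "leaf {1..n} C a b s" using ex_leaf_locale[OF C' c1] by blast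
  define S where "S = {1..n}"
  interpret leaf S C a b s using l by (simp only: S_def)
  have "card (S - Sb) = card S - card Sb" using Sb_sub finS by (intro card_Diff_subset) (auto intro: finite_subset)
  then have "boundary_index n Sb"
    unfolding boundary_index_def using Sb_sub card_Sb card_outside by (simp add: S_def)
  moreover have "x \<in> zariski (quads n) (Mbar n) closure_of two_comp_locus n Sb"
    unfolding in_closure_of topspace_zariski[OF Mbar_PiE]
  proof (intro conjI allI impI x(1))
    fix T assume "x \<in> T \<and> openin (zariski (quads n) (Mbar n)) T"
    then show "\<exists>y. y \<in> two_comp_locus n Sb \<and> y \<in> T"
      using two_comp_dense[OF S_def, of T] C(1) by auto
  qed
  ultimately show ?thesis by blast
qed

text \<open>Two marks on a leaf and two off it have a vanishing cross-ratio, so by hypothesis every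
  leaf has marks \<open>A\<close> or the complement. A further leaf, found after pruning, would give
  a vanishing cross-ratio that \<open>A\<close> does not split; hence there are only two
  components.\<close>

lemma stratum_A:
  assumes x: "x \<in> Mbar n" and A: "A \<subseteq> {1..n}"
    and nz: "\<And>i j k l. (i, j, k, l) \<in> quads n \<Longrightarrow> \<not> splits A i j k l \<Longrightarrow> x (i, j, k, l) \<noteq> Finite 0"
  shows "x \<in> M_smooth n \<or> x \<in> two_comp_locus n A"
proof (rule disjCI)
  assume ns: "x \<notin> two_comp_locus n A"
  show "x \<in> M_smooth n"
  proof (rule ccontr)
    assume xM: "x \<notin> M_smooth n"
    obtain C where C: "x = moduli_point n C" "stable_curve n C" using x(1) by (auto simp: Mbar_def)
    then have c1: "card (comps C) \<noteq> 1" using xM by (auto simp: M_smooth_def)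
    have C': "tree_curve {1..n} C" using C(2) unfolding stable_curve_tree_curve .
    obtain a b s where l: "leaf {1..n} C a b s" using ex_leaf_locale[OF C' c1] by blast
    define S where "S = {1..n}"
    interpret leaf S C a b s using l by (simp only: S_def)
    obtain z' where z': "smoothing S' C' z'" using ex_smoothing[OF tree'] by blast
    obtain z where z: "smoothing S C z" and
      one: "\<And>i j k l. {i, j, k, l} \<subseteq> S \<Longrightarrow> distinct [i, j, k, l] \<Longrightarrow> card (Sb \<inter> {i, j, k, l}) \<le> 1 \<Longrightarrow>
        crlim z i j k l = crlim z' (rho i) (rho j) (rho k) (rho l)"
      by (rule smoothing_attach[OF z']) (rule that; blast)
    have xz: "x (i, j, k, l) = crlim z i j k l" if "(i, j, k, l) \<in> quads n" for i j k l
      unfolding C(1) using curve_cross_ratio_smoothing[OF z[unfolded S_def] that] .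
    have sp: "splits A i j k l" if "i \<in> Sb" "k \<in> Sb" "i \<noteq> k" "j \<in> S - Sb" "l \<in> S - Sb" "j \<noteq> l" for i j k l
    proof (rule ccontr)
      assume n: "\<not> splits A i j k l"
      have q: "(i, j, k, l) \<in> quads n" using that Sb_sub unfolding quads_iff S_def by auto
      show False using nz[OF q n] xz[OF q] leaf_zero[OF z that] by simp
    qed
    have AB: "Sb = A \<or> Sb = S - A"
      by (rule splits_determine[OF A[folded S_def] Sb_sub card_Sb card_outside sp])
    have "card (comps C') = 1"
    proof (rule ccontr)
      assume "card (comps C') \<noteq> 1"
      then obtain a' b' s' where "leaf S' C' a' b' s'" using ex_leaf_locale[OF tree'] by blast
      then interpret L: leaf S' C' a' b' s' .
      obtain i k where ik: "i \<in> L.Sb" "k \<in> L.Sb" "i \<noteq> k"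
        using L.card_Sb two_elements by blast
      obtain j l where jl: "j \<in> S' - L.Sb" "l \<in> S' - L.Sb" "j \<noteq> l"
        using L.card_outside two_elements by blast
      have sub: "{i, j, k, l} \<subseteq> S'" "distinct [i, j, k, l]" using ik jl L.Sb_sub by auto
      \<comment> \<open>Pruning keeps no mark of the first leaf except \<open>s\<close>, whereas a
        quadruple split by \<open>A\<close> would contain two of them.\<close>
      have "Sb \<inter> {i, j, k, l} \<subseteq> {s}" using sub(1) unfolding S'_def by blast
      then have c: "card (Sb \<inter> {i, j, k, l}) \<le> 1" using card_mono[of "{s}"] by simp
      have subS: "{i, j, k, l} \<subseteq> S" using sub(1) S'_sub by blast
      have q: "(i, j, k, l) \<in> quads n"
        unfolding quads_iff by (rule conjI[OF subS[unfolded S_def] sub(2)])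
      have rid: "rho u = u" if "u \<in> S'" for u using that by (auto simp: rho_def S'_def)
      have "crlim z i j k l = crlim z' i j k l" using one[OF subS sub(2) c] rid sub(1) by simp
      then have "x (i, j, k, l) = Finite 0" using xz[OF q] L.leaf_zero[OF z' ik jl] by simp
      then have "splits A i j k l" using nz[OF q] by blast
      then have "(i \<in> Sb \<and> k \<in> Sb) \<or> (j \<in> Sb \<and> l \<in> Sb)"
        using AB subS unfolding splits_def by auto
      then show False using \<open>Sb \<inter> {i, j, k, l} \<subseteq> {s}\<close> ik(3) jl(3) by blast
    qed
    then obtain c where c: "comps C - {b} = {c}" unfolding C'_simps by (rule card_1_singletonE)
    have "a \<in> comps C - {b}" using a ab by (simp only: Diff_iff singleton_iff) simp
    then have "c = a" unfolding c by simp
    then have comps: "comps C = {a, b}" using insert_Diff[OF b] unfolding c by (metis insert_commute)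
    have Sb: "Sb = {i \<in> {1..n}. mark_comp C i = b}" unfolding Sb_def unfolding S_def ..
    have mb: "marks_on n C b = Sb" unfolding marks_on_def Sb ..
    have mc: "mark_comp C i \<in> {a, b}" if "i \<in> {1..n}" for i
      using C' comps that unfolding tree_curve_def by blast
    have ma: "marks_on n C a = {1..n} - Sb" using mc ab unfolding marks_on_def Sb by blast
    have "x \<in> two_comp_locus n Sb"
      unfolding two_comp_locus_def using C comps mb ma ab
      by (intro CollectI exI[of _ C] conjI exI[of _ b] exI[of _ a]) auto
    moreover have "two_comp_locus n Sb = two_comp_locus n A"
      using AB two_comp_locus_compl[OF A] unfolding S_def by (elim disjE) (simp_all only:)
    ultimately show False using ns by blast
  qed
qed

section \<open>Coordinates near a boundary divisor\<close>

lemma pluecker: "P1_det p i * P1_det q j - P1_det q i * P1_det p j = P1_det p q * P1_det i j"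
  by (simp add: P1_det_def algebra_simps)

text \<open>The factors \<open>t\<close> that are common to numerator and denominator cancel.\<close>

lemma ratio_core:
  fixes e d :: "nat \<Rightarrow> nat \<Rightarrow> complex"
  assumes rel: "\<And>p q. p \<in> {i, j, k, l} \<Longrightarrow> q \<in> {i, j, k, l} \<Longrightarrow> p \<noteq> q \<Longrightarrow>
      e p q * (if p \<notin> B \<and> q \<notin> B then t else 1) = c p * c q * K * d p q"
    and c: "\<And>p. p \<in> {i, j, k, l} \<Longrightarrow> c p \<noteq> 0" and K: "K \<noteq> 0"
    and dist: "distinct [i, j, k, l]" and t: "t \<noteq> 0 \<or> card (B \<inter> {i, j, k, l}) \<ge> 2"
  shows "P1_point ((if splits B i j k l then t else 1) * e i k * e j l)
      ((if splits B j i k l then t else 1) * e j k * e i l) = P1_point (d i k * d j l) (d j k * d i l)"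
proof -
  define T where "T = c i * c j * c k * c l * K * K"
  have T: "T \<noteq> 0" using c K by (simp add: T_def)
  have 1: "e i k * (if i \<notin> B \<and> k \<notin> B then t else 1) = c i * c k * K * d i k"
    "e j l * (if j \<notin> B \<and> l \<notin> B then t else 1) = c j * c l * K * d j l"
    "e j k * (if j \<notin> B \<and> k \<notin> B then t else 1) = c j * c k * K * d j k"
    "e i l * (if i \<notin> B \<and> l \<notin> B then t else 1) = c i * c l * K * d i l"
    by (rule rel; use dist in simp)+
  have "P1_point (d i k * d j l) (d j k * d i l) = P1_point (T * (d i k * d j l)) (T * (d j k * d i l))"
    using P1_point_scale[OF T] by simp
  also have "T * (d i k * d j l) = (c i * c k * K * d i k) * (c j * c l * K * d j l)"
    by (simp add: T_def mult_ac)
  also have "T * (d j k * d i l) = (c j * c k * K * d j k) * (c i * c l * K * d i l)"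
    by (simp add: T_def mult_ac)
  finally have eq: "P1_point (d i k * d j l) (d j k * d i l) =
    P1_point ((e i k * (if i \<notin> B \<and> k \<notin> B then t else 1)) * (e j l * (if j \<notin> B \<and> l \<notin> B then t else 1)))
      ((e j k * (if j \<notin> B \<and> k \<notin> B then t else 1)) * (e i l * (if i \<notin> B \<and> l \<notin> B then t else 1)))"
    unfolding 1 .
  have sc: "t \<noteq> 0 \<Longrightarrow> P1_point (t * a) (t * b) = P1_point a b" for a b by (rule P1_point_scale)
  have sc2: "t \<noteq> 0 \<Longrightarrow> P1_point (t * (t * a)) (t * (t * b)) = P1_point a b" for a b
    by (simp add: P1_point_scale)
  define x y where "x = e i k * e j l" and "y = e j k * e i l"
  have lhs: "f * e i k * e j l = f * x" "f * e j k * e i l = f * y" for f by (simp_all add: x_def y_def)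
  have rhs: "e i k * f * (e j l * g) = f * g * x" "e j k * f * (e i l * g) = f * g * y" for f g
    by (simp_all add: x_def y_def)
  show ?thesis
    unfolding eq lhs rhs
    \<comment> \<open>A common factor \<open>t\<close> or \<open>t * t\<close> is left over only if
      at most one of the four marks lies in \<open>B\<close>, and then \<open>t\<close> is nonzero
      by assumption.\<close>
    by (cases "i \<in> B"; cases "j \<in> B"; cases "k \<in> B"; cases "l \<in> B")
      (use t dist in \<open>simp_all add: splits_def sc sc2 mult.assoc\<close>)
qed

locale boundary_chart =
  fixes n :: nat and A :: "nat set" and i0 i1 j0 j1 :: nat
  assumes A: "A \<subseteq> {1..n}" and i: "i0 \<in> A" "i1 \<in> A" "i0 \<noteq> i1"
    and j: "j0 \<in> {1..n} - A" "j1 \<in> {1..n} - A" "j0 \<noteq> j1"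
begin

text \<open>Automorphisms of a component fix three of its special points: the node and two marks,
  which are put at 0 and 1.\<close>

definition zc :: "nat \<Rightarrow> mp" where
  "zc p = (if p = i0 \<or> p = j0 then 0 else if p = i1 \<or> p = j1 then 1 else Var p)"

text \<open>The marks \<open>p \<in> A\<close> are at \<open>[zc p : 1]\<close>, the other ones at \<open>[1 : t zc p]\<close>, where
  \<open>t = Var 0\<close>. So \<open>E p q\<close> is their determinant, up to a factor \<open>t\<close> if \<open>p\<close> and \<open>q\<close> are not in \<open>A\<close>.\<close>

definition E :: "nat \<Rightarrow> nat \<Rightarrow> mp" where
  "E p q = (if p \<in> A then if q \<in> A then zc p - zc q else Var 0 * zc p * zc q - 1
     else if q \<in> A then 1 - Var 0 * zc p * zc q else zc q - zc p)"

text \<open>The index 0 is free for the smoothing parameter because the marks start at 1. Altogether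
  there are \<open>n - 3\<close> coordinates, the dimension of the moduli space.\<close>

definition vars :: "nat set" where
  "vars = insert 0 ({1..n} - {i0, i1, j0, j1})"

definition disc :: mp where
  "disc = (\<Prod>p\<in>{1..n}. \<Prod>q\<in>{1..n} - {p}. E p q)"

text \<open>\<open>E\<close> omits a factor \<open>t\<close> for pairs outside \<open>A\<close>. The
  \<open>Var 0\<close> of split quadruples is what survives of these factors after cancellation
  between \<open>num\<close> and \<open>den\<close>.\<close>

definition num :: "quad \<Rightarrow> mp" where
  "num = (\<lambda>(i, j, k, l). (if splits A i j k l then Var 0 else 1) * E i k * E j l)"

definition den :: "quad \<Rightarrow> mp" where
  "den = (\<lambda>(i, j, k, l). (if splits A j i k l then Var 0 else 1) * E j k * E i l)"

definition psi :: "(nat \<Rightarrow> complex) \<Rightarrow> quad \<Rightarrow> P1" where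
  "psi v = restrict (\<lambda>q. P1_point (ev (num q) v) (ev (den q) v)) (quads n)"

text \<open>On a singular curve the cross-ratio of two marks on a leaf with two others vanishes.
  Forbidding this for quadruples that \<open>A\<close> does not split is an open condition and
  leaves only smooth curves and curves with two components carrying \<open>A\<close> and its
  complement.\<close>

definition U :: "(quad \<Rightarrow> P1) set" where
  "U = {x \<in> Mbar n. \<forall>i j k l. (i, j, k, l) \<in> quads n \<longrightarrow> \<not> splits A i j k l \<longrightarrow>
      fst (hcoord (x (i, j, k, l))) \<noteq> 0}"

text \<open>A position in \<open>A\<close> is its own cross-ratio with \<open>i1\<close>,
  \<open>i0\<close>, \<open>j0\<close>, which are at 1, 0 and infinity; similarly outside
  \<open>A\<close> with the roles exchanged. The last coordinate \<open>t\<close> is the cross-ratio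
  of the four normalised marks.\<close>

definition qv :: "nat \<Rightarrow> quad" where
  "qv p = (if p = 0 then (i1, j1, i0, j0) else if p \<in> A then (p, i1, i0, j0) else (p, j1, j0, i0))"

lemma mem [simp]: "i0 \<in> A" "i1 \<in> A" "i0 \<noteq> i1" "i1 \<noteq> i0" "j0 \<notin> A" "j1 \<notin> A" "j0 \<noteq> j1" "j1 \<noteq> j0"
  "i0 \<noteq> j0" "i0 \<noteq> j1" "i1 \<noteq> j0" "i1 \<noteq> j1" "j0 \<noteq> i0" "j1 \<noteq> i0" "j0 \<noteq> i1" "j1 \<noteq> i1"
  using i j by auto

lemma mem_n: "i0 \<in> {1..n}" "i1 \<in> {1..n}" "j0 \<in> {1..n}" "j1 \<in> {1..n}"
  using A i j by blast+

lemma An: "p \<in> A \<Longrightarrow> p \<in> {1..n}"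
  using A by blast

lemma finA: "finite A"
  using A finite_subset by blast

lemma boundary_index_A: "boundary_index n A"
proof -
  have "card {i0, i1} \<le> card A" using finA by (intro card_mono) auto
  moreover have "card {j0, j1} \<le> card ({1..n} - A)" using j by (intro card_mono) auto
  moreover have "card ({1..n} - A) = n - card A" using card_Diff_subset[OF finA A] by simp
  ultimately show ?thesis unfolding boundary_index_def using A by simp
qed

lemma vars_zc: "p \<in> {1..n} \<Longrightarrow> vars_in vars (zc p)"
  by (auto simp: zc_def vars_def)

lemma vars_E: "p \<in> {1..n} \<Longrightarrow> q \<in> {1..n} \<Longrightarrow> vars_in vars (E p q)"
  using vars_zc[of p] vars_zc[of q] by (auto simp: E_def vars_def)

lemma vars_num_den: "q \<in> quads n \<Longrightarrow> vars_in vars (num q) \<and> vars_in vars (den q)"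
  using vars_E by (cases q) (auto simp: num_def den_def quads_iff vars_def)

lemma vars_disc: "vars_in vars disc"
  unfolding disc_def by (intro vars_in_prod vars_E) auto

lemma disc_nzD: "ev disc v \<noteq> 0 \<Longrightarrow> p \<in> {1..n} \<Longrightarrow> q \<in> {1..n} \<Longrightarrow> p \<noteq> q \<Longrightarrow> ev (E p q) v \<noteq> 0"
  by (auto simp: disc_def)

lemma disc_nzI: "(\<And>p q. p \<in> {1..n} \<Longrightarrow> q \<in> {1..n} \<Longrightarrow> p \<noteq> q \<Longrightarrow> ev (E p q) v \<noteq> 0) \<Longrightarrow> ev disc v \<noteq> 0"
  by (auto simp: disc_def)

lemma E_dvd_disc: "p \<in> {1..n} \<Longrightarrow> q \<in> {1..n} \<Longrightarrow> p \<noteq> q \<Longrightarrow> E p q dvd disc"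
  unfolding disc_def by (rule dvd_trans[of _ "\<Prod>q\<in>{1..n} - {p}. E p q"]) (auto intro!: dvd_prodI)

lemma ev_num: "ev (num (i, j, k, l)) v = (if splits A i j k l then v 0 else 1) * ev (E i k) v * ev (E j l) v"
  and ev_den: "ev (den (i, j, k, l)) v = (if splits A j i k l then v 0 else 1) * ev (E j k) v * ev (E i l) v"
  by (simp_all add: num_def den_def)

lemma num_den_nz:
  assumes "ev disc v \<noteq> 0" "q \<in> quads n"
  shows "(ev (num q) v, ev (den q) v) \<noteq> (0, 0)"
proof -
  obtain i j k l where q: "q = (i, j, k, l)" by (cases q)
  then have "ev (E i k) v \<noteq> 0" "ev (E j l) v \<noteq> 0" "ev (E j k) v \<noteq> 0" "ev (E i l) v \<noteq> 0"
    using disc_nzD[OF assms(1)] assms(2) by (auto simp: quads_iff)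
  moreover have "\<not> (splits A i j k l \<and> splits A j i k l)" by (auto simp: splits_def)
  ultimately show ?thesis unfolding q by (auto simp: ev_num ev_den)
qed

lemma psi_smooth:
  assumes "ev disc v \<noteq> 0" "v 0 \<noteq> 0"
  shows "psi v \<in> M_smooth n"
proof -
  define P where "P = (\<lambda>p. if p \<in> A then Finite (ev (zc p) v) else P1_point 1 (v 0 * ev (zc p) v))"
  \<comment> \<open>The factor between the coordinates \<open>[1 : t zc p]\<close> and the
    normalised coordinates of \<open>hcoord\<close>.\<close>
  define c where "c = (\<lambda>p. if p \<in> A \<or> v 0 * ev (zc p) v = 0 then 1 else v 0 * ev (zc p) v)"
  have c: "c p \<noteq> 0" for p by (simp add: c_def)
  have rel: "ev (E p q) v * (if p \<notin> A \<and> q \<notin> A then v 0 else 1) = c p * c q * 1 * P1_det (P p) (P q)" for p q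
    by (auto simp: E_def P_def c_def P1_det_def P1_point_def field_simps)
  have inj: "inj_on P {1..n}"
  proof (rule inj_onI, rule ccontr)
    fix p q assume pq: "p \<in> {1..n}" "q \<in> {1..n}" "P p = P q" "p \<noteq> q"
    then have "ev (E p q) v \<noteq> 0" using disc_nzD[OF assms(1)] by blast
    then show False using rel[of p q] pq(3) assms(2) by (simp split: if_splits)
  qed
  have "{i0, i1, j0} \<subseteq> {1..n}" using mem_n by blast
  then have "card {i0, i1, j0} \<le> card {1..n}" by (rule card_mono[rotated]) simp
  then have n3: "n \<ge> 3" by simp
  have "psi v = moduli_point n (smooth_curve P)"
  proof (rule PiE_ext[of _ "quads n" "\<lambda>_. UNIV"])
    show "psi v \<in> quads n \<rightarrow>\<^sub>E UNIV" by (simp add: psi_def)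
    show "moduli_point n (smooth_curve P) \<in> quads n \<rightarrow>\<^sub>E UNIV" by (rule moduli_point_PiE)
    fix q assume q: "q \<in> quads n"
    obtain i j k l where ijkl: "q = (i, j, k, l)" by (cases q)
    have d: "distinct [i, j, k, l]" using q by (simp add: ijkl quads_iff)
    have "psi v q = P1_point (ev (num q) v) (ev (den q) v)" using q by (simp add: psi_def)
    also have "\<dots> = cross_ratio (P i) (P j) (P k) (P l)"
      unfolding ijkl ev_num ev_den cross_ratio_def
      by (rule ratio_core[where c = c and K = 1]) (use rel c d assms(2) in auto)
    also have "\<dots> = moduli_point n (smooth_curve P) q"
      using smooth_curve(2)[OF n3 inj] q by (simp add: ijkl)
    finally show "psi v q = moduli_point n (smooth_curve P) q" .
  qed
  then show ?thesis using smooth_curve(3)[OF n3 inj] by simp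
qed

lemma splits_compl: "splits (- A) = splits A"
  by (intro ext) (auto simp: splits_def)

lemma card_split: "{i, j, k, l} \<subseteq> {1..n} \<Longrightarrow> distinct [i, j, k, l] \<Longrightarrow>
  card (A \<inter> {i, j, k, l}) \<ge> 2 \<or> card (({1..n} - A) \<inter> {i, j, k, l}) \<ge> 2"
proof -
  assume s: "{i, j, k, l} \<subseteq> {1..n}" and d: "distinct [i, j, k, l]"
  have "{i, j, k, l} = (A \<inter> {i, j, k, l}) \<union> (({1..n} - A) \<inter> {i, j, k, l})" using s by blast
  then have "card {i, j, k, l} \<le> card (A \<inter> {i, j, k, l}) + card (({1..n} - A) \<inter> {i, j, k, l})"
    by (metis card_Un_le)
  moreover have "card {i, j, k, l} = 4" using d by simp
  ultimately show ?thesis by linarith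
qed

text \<open>The two relations express the determinants on the two components.\<close>

lemma two_relations_psi:
  assumes f: "two_formula n A \<nu> \<mu> P x" and x: "x \<in> quads n \<rightarrow>\<^sub>E UNIV" and t: "v 0 = 0"
    and rel: "\<And>p q. p \<in> {1..n} \<Longrightarrow> q \<in> {1..n} \<Longrightarrow>
      ev (E p q) v * (if p \<notin> A \<and> q \<notin> A then 0 else 1) = c p * c q * K * P1_det (im A \<nu> P p) (im A \<nu> P q)"
    and rel': "\<And>p q. p \<in> {1..n} \<Longrightarrow> q \<in> {1..n} \<Longrightarrow>
      ev (E p q) v * (if p \<in> A \<and> q \<in> A then 0 else 1) =
        c' p * c' q * K' * P1_det (im ({1..n} - A) \<mu> P p) (im ({1..n} - A) \<mu> P q)"
    and c: "\<And>p. p \<in> {1..n} \<Longrightarrow> c p \<noteq> 0" "\<And>p. p \<in> {1..n} \<Longrightarrow> c' p \<noteq> 0" and K: "K \<noteq> 0" "K' \<noteq> 0"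
  shows "psi v = x"
proof (rule PiE_ext[OF _ x])
  show "psi v \<in> quads n \<rightarrow>\<^sub>E UNIV" by (simp add: psi_def)
  fix q assume q: "q \<in> quads n"
  obtain i j k l where ijkl: "q = (i, j, k, l)" by (cases q)
  have d: "distinct [i, j, k, l]" "{i, j, k, l} \<subseteq> {1..n}" using q unfolding ijkl quads_iff by blast+
  have "psi v q = P1_point (ev (num q) v) (ev (den q) v)" using q by (simp add: psi_def)
  also have "\<dots> = x q"
  proof (cases "card (A \<inter> {i, j, k, l}) \<ge> 2")
    case True
    then have "x q = cross_ratio (im A \<nu> P i) (im A \<nu> P j) (im A \<nu> P k) (im A \<nu> P l)"
      using f q unfolding two_formula_def ijkl by blast
    moreover have "P1_point (ev (num q) v) (ev (den q) v) = cross_ratio (im A \<nu> P i) (im A \<nu> P j) (im A \<nu> P k) (im A \<nu> P l)"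
      unfolding ijkl ev_num ev_den cross_ratio_def t
    proof (rule ratio_core[where c = c and K = K, OF _ _ K(1) d(1) disjI2[OF True]])
      fix p q assume "p \<in> {i, j, k, l}" "q \<in> {i, j, k, l}"
      then have "p \<in> {1..n}" "q \<in> {1..n}" using d(2) by blast+
      then show "ev (E p q) v * (if p \<notin> A \<and> q \<notin> A then 0 else 1) = c p * c q * K * P1_det (im A \<nu> P p) (im A \<nu> P q)"
        by (rule rel)
    next
      fix p assume "p \<in> {i, j, k, l}"
      then show "c p \<noteq> 0" using d(2) c(1) by blast
    qed
    ultimately show ?thesis by simp
  next
    case False
    then have c2: "card (({1..n} - A) \<inter> {i, j, k, l}) \<ge> 2" using card_split[OF d(2,1)] by blast
    moreover have "({1..n} - A) \<inter> {i, j, k, l} = - A \<inter> {i, j, k, l}" using d(2) by blast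
    ultimately have c2': "card (- A \<inter> {i, j, k, l}) \<ge> 2" by simp
    let ?im = "im ({1..n} - A) \<mu> P"
    have "x q = cross_ratio (?im i) (?im j) (?im k) (?im l)"
      using f q c2 unfolding two_formula_def ijkl by blast
    moreover have "P1_point (ev (num q) v) (ev (den q) v) = cross_ratio (?im i) (?im j) (?im k) (?im l)"
      unfolding ijkl ev_num ev_den cross_ratio_def t
    proof (subst (1 2) splits_compl[symmetric],
        rule ratio_core[where c = c' and K = K', OF _ _ K(2) d(1) disjI2[OF c2']])
      fix p q assume "p \<in> {i, j, k, l}" "q \<in> {i, j, k, l}"
      then have "p \<in> {1..n}" "q \<in> {1..n}" using d(2) by blast+
      then show "ev (E p q) v * (if p \<notin> - A \<and> q \<notin> - A then 0 else 1) = c' p * c' q * K' * P1_det (?im p) (?im q)"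
        using rel'[of p q] by (simp only: Compl_iff not_not)
    next
      fix p assume "p \<in> {i, j, k, l}"
      then show "c' p \<noteq> 0" using d(2) c(2) by blast
    qed
    ultimately show ?thesis by simp
  qed
  finally show "psi v q = x q" .
qed

lemma psi_two_comp:
  assumes "ev disc v \<noteq> 0" "v 0 = 0"
  shows "psi v \<in> two_comp_locus n A"
proof -
  define P where "P = (\<lambda>p. Finite (ev (zc p) v))"
  have e: "ev (E p q) v \<noteq> 0" if "p \<in> {1..n}" "q \<in> {1..n}" "p \<noteq> q" for p q
    using disc_nzD[OF assms(1)] that by blast
  have "inj_on P A"
  proof (rule inj_onI, rule ccontr)
    fix p q assume "p \<in> A" "q \<in> A" "P p = P q" "p \<noteq> q"
    then show False using e[OF An An, of p q] by (simp add: E_def P_def)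
  qed
  moreover have "inj_on P ({1..n} - A)"
  proof (rule inj_onI, rule ccontr)
    fix p q assume "p \<in> {1..n} - A" "q \<in> {1..n} - A" "P p = P q" "p \<noteq> q"
    then show False using e[of p q] by (auto simp: E_def P_def)
  qed
  moreover have "Infinity \<notin> P ` B" for B by (auto simp: P_def)
  ultimately have C: "moduli_point n (two_curve A Infinity Infinity P) \<in> two_comp_locus n A"
    "two_formula n A Infinity Infinity P (moduli_point n (two_curve A Infinity Infinity P))"
    using two_curve[OF boundary_index_A] by blast+
  have "psi v = moduli_point n (two_curve A Infinity Infinity P)"
    \<comment> \<open>The sign of \<open>K'\<close> appears because \<open>E\<close> reverses the
      difference for marks outside \<open>A\<close>.\<close>
    by (rule two_relations_psi[where v = v and c = "\<lambda>_. 1" and K = 1 and c' = "\<lambda>_. 1" and K' = "- 1",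
          OF C(2) moduli_point_PiE assms(2)])
      (simp_all add: E_def im_def P_def P1_det_def assms(2))
  then show ?thesis using C(1) by simp
qed

lemma psi_Mbar: "ev disc v \<noteq> 0 \<Longrightarrow> psi v \<in> Mbar n"
  using psi_two_comp psi_smooth two_comp_locus_Mbar M_smooth_Mbar by (cases "v 0 = 0") blast+

lemma fst_hcoord_P1_point: "a \<noteq> 0 \<Longrightarrow> fst (hcoord (P1_point a b)) \<noteq> 0"
  by (simp add: P1_point_def)

lemma psi_U:
  assumes "ev disc v \<noteq> 0"
  shows "psi v \<in> U"
  unfolding U_def
proof (intro CollectI conjI psi_Mbar[OF assms] allI impI)
  fix i j k l assume q: "(i, j, k, l) \<in> quads n" and s: "\<not> splits A i j k l"
  have "ev (E i k) v \<noteq> 0" "ev (E j l) v \<noteq> 0"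
    using disc_nzD[OF assms] q by (auto simp: quads_iff)
  then show "fst (hcoord (psi v (i, j, k, l))) \<noteq> 0"
    using q s by (simp add: psi_def ev_num fst_hcoord_P1_point)
qed

definition coords :: "complex \<Rightarrow> (nat \<Rightarrow> complex) \<Rightarrow> nat \<Rightarrow> complex" where
  "coords t Z = (\<lambda>p. if p = 0 then t else Z p)"

lemma ev_zc_coords: "p \<in> {1..n} \<Longrightarrow> Z i0 = 0 \<Longrightarrow> Z j0 = 0 \<Longrightarrow> Z i1 = 1 \<Longrightarrow> Z j1 = 1 \<Longrightarrow> ev (zc p) (coords t Z) = Z p"
  by (auto simp: zc_def coords_def)

text \<open>The projective transformation that moves \<open>i0\<close>, \<open>i1\<close>,
  \<open>j0\<close> to 0, 1 and infinity puts \<open>j1\<close> at \<open>1 / t\<close>. This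
  determines \<open>t\<close>, and then the coordinates of all other marks.\<close>

lemma smooth_psi:
  assumes "x \<in> M_smooth n"
  shows "\<exists>v. ev disc v \<noteq> 0 \<and> psi v = x \<and> v 0 \<noteq> 0"
proof -
  obtain P where inj: "inj_on P {1..n}"
    and x: "\<And>i j k l. (i, j, k, l) \<in> quads n \<Longrightarrow> x (i, j, k, l) = cross_ratio (P i) (P j) (P k) (P l)"
    using M_smooth_E[OF assms] by blast
  define D where "D = (\<lambda>p q. P1_det (P p) (P q))"
  have Dd: "P1_det (P p) (P q) = D p q" for p q by (simp add: D_def)
  have D: "D p q \<noteq> 0" if "p \<in> {1..n}" "q \<in> {1..n}" "p \<noteq> q" for p q
    using inj that by (auto simp: D_def dest: inj_onD)
  have D0: "D p p = 0" for p by (simp add: D_def)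
  define a b where "a = D i1 j0" and "b = D i1 i0"
  have ab: "a \<noteq> 0" "b \<noteq> 0" using D mem_n by (auto simp: a_def b_def)
  define t where "t = D j1 j0 * b / (D j1 i0 * a)"
  define Z where "Z = (\<lambda>p. if p \<in> A then D p i0 * a / (D p j0 * b) else D p j0 * D j1 i0 / (D p i0 * D j1 j0))"
  define v where "v = coords t Z"
  have nz: "D j1 j0 \<noteq> 0" "D j1 i0 \<noteq> 0" "D i0 j0 \<noteq> 0" "D j0 i0 \<noteq> 0" using D mem_n by auto
  have Z: "ev (zc p) v = Z p" if "p \<in> {1..n}" for p
    unfolding v_def using that
    by (rule ev_zc_coords) (use nz ab in \<open>auto simp: Z_def D0 a_def b_def\<close>)
  have v0: "v 0 = t" by (simp add: v_def coords_def)
  have t: "t \<noteq> 0" using nz ab by (simp add: t_def)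
  \<comment> \<open>\<open>c p\<close> rescales the homogeneous coordinates of the mark
    \<open>p\<close>, and \<open>K\<close> is the determinant of the projective
    transformation.\<close>
  define c where "c = (\<lambda>p. if p \<in> A then 1 / D p j0 else b / (a * D p i0))"
  define K where "K = a / b * D i0 j0"
  have K: "K \<noteq> 0" using ab nz by (simp add: K_def)
  have nA: "D p j0 \<noteq> 0" if "p \<in> A" for p     using D[OF An[OF that] mem_n(3)] that mem(5) by blast
  have nA': "D p i0 \<noteq> 0" if "p \<in> {1..n}" "p \<notin> A" for p     using D[OF that(1) mem_n(1)] that(2) mem(1) by blast
  have c: "c p \<noteq> 0" if "p \<in> {1..n}" for p using that nA nA' ab by (auto simp: c_def)
  have pl: "D p i0 * D q j0 - D q i0 * D p j0 = D p q * D i0 j0" for p q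
    using pluecker[of "P p" "P i0" "P q" "P j0"] by (simp add: D_def)
  have rel: "ev (E p q) v * (if p \<notin> A \<and> q \<notin> A then v 0 else 1) = c p * c q * K * D p q"
    if p: "p \<in> {1..n}" and q: "q \<in> {1..n}" for p q
  proof -
    have tZ: "t * Z p = D p j0 * b / (D p i0 * a)" if "p \<in> {1..n}" "p \<notin> A" for p
      using that nz ab nA'[OF that] by (simp add: t_def Z_def field_simps)
    consider "p \<in> A" "q \<in> A" | "p \<in> A" "q \<notin> A" | "p \<notin> A" "q \<in> A" | "p \<notin> A" "q \<notin> A" by blast
    then show ?thesis
    proof cases
      case 1
      then have "ev (E p q) v = (D p i0 * D q j0 - D q i0 * D p j0) * a / (D p j0 * D q j0 * b)"
        using nA[of p] nA[of q] ab by (simp add: E_def Z[OF p] Z[OF q] Z_def field_simps)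
      then show ?thesis using 1 unfolding pl by (simp add: c_def K_def)
    next
      case 2
      then have "ev (E p q) v = Z p * (t * Z q) - 1" by (simp add: E_def Z[OF p] Z[OF q] v0 mult_ac)
      also have "\<dots> = (D p i0 * D q j0 - D q i0 * D p j0) / (D p j0 * D q i0)"
        using 2 nA[of p] nA'[of q] q ab unfolding tZ[OF q 2(2)] by (simp add: Z_def field_simps)
      finally show ?thesis using 2 ab unfolding pl by (simp add: c_def K_def)
    next
      case 3
      then have "ev (E p q) v = 1 - Z q * (t * Z p)" by (simp add: E_def Z[OF p] Z[OF q] v0 mult_ac)
      also have "\<dots> = (D p i0 * D q j0 - D q i0 * D p j0) / (D q j0 * D p i0)"
        using 3 nA[of q] nA'[of p] p ab unfolding tZ[OF p 3(1)] by (simp add: Z_def field_simps)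
      finally show ?thesis using 3 ab unfolding pl by (simp add: c_def K_def mult.commute)
    next
      case 4
      then have "ev (E p q) v * v 0 = t * Z q - t * Z p" by (simp add: E_def Z[OF p] Z[OF q] v0 algebra_simps)
      also have "\<dots> = (D p i0 * D q j0 - D q i0 * D p j0) * b / (D p i0 * D q i0 * a)"
        using nA'[OF p 4(1)] nA'[OF q 4(2)] ab unfolding tZ[OF p 4(1)] tZ[OF q 4(2)] by (simp add: field_simps)
      finally show ?thesis using 4 ab unfolding pl by (simp add: c_def K_def mult_ac)
    qed
  qed
  have disc: "ev disc v \<noteq> 0"
  proof (rule disc_nzI)
    fix p q assume pq: "p \<in> {1..n}" "q \<in> {1..n}" "p \<noteq> q"
    then have "c p * c q * K * D p q \<noteq> 0" using c[OF pq(1)] c[OF pq(2)] K D[OF pq] by (simp only: mult_eq_0_iff) simp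
    then show "ev (E p q) v \<noteq> 0" unfolding rel[OF pq(1,2), symmetric] by simp
  qed
  have "psi v = x"
  proof (rule PiE_ext[of _ "quads n" "\<lambda>_. UNIV"])
    show "psi v \<in> quads n \<rightarrow>\<^sub>E UNIV" by (simp add: psi_def)
    show "x \<in> quads n \<rightarrow>\<^sub>E UNIV" by (rule subsetD[OF Mbar_PiE subsetD[OF M_smooth_Mbar assms]])
    fix q assume q: "q \<in> quads n"
    obtain i j k l where ijkl: "q = (i, j, k, l)" by (cases q)
    have d: "distinct [i, j, k, l]" "{i, j, k, l} \<subseteq> {1..n}" using q unfolding ijkl quads_iff by blast+
    have "psi v q = P1_point (ev (num q) v) (ev (den q) v)" using q by (simp add: psi_def)
    also have "\<dots> = cross_ratio (P i) (P j) (P k) (P l)"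
      unfolding ijkl ev_num ev_den cross_ratio_def Dd
    proof (rule ratio_core[where c = c and K = K, OF _ _ K d(1)])
      fix p q assume "p \<in> {i, j, k, l}" "q \<in> {i, j, k, l}"
      then have "p \<in> {1..n}" "q \<in> {1..n}" using d(2) by blast+
      then show "ev (E p q) v * (if p \<notin> A \<and> q \<notin> A then v 0 else 1) = c p * c q * K * D p q"
        by (rule rel)
    next
      fix p assume "p \<in> {i, j, k, l}"
      then show "c p \<noteq> 0" using d(2) c by blast
    next
      show "v 0 \<noteq> 0 \<or> card (A \<inter> {i, j, k, l}) \<ge> 2" using t v0 by simp
    qed
    also have "\<dots> = x q" using x q by (simp add: ijkl)
    finally show "psi v q = x q" .
  qed
  then show ?thesis using disc t v0 by blast
qed

text \<open>On each component the node is moved to infinity and the two chosen marks to 0 and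
  1.\<close>

lemma two_comp_psi:
  assumes "x \<in> two_comp_locus n A"
  shows "\<exists>v. ev disc v \<noteq> 0 \<and> psi v = x \<and> v 0 = 0"
proof -
  obtain \<nu> \<mu> P where f: "two_formula n A \<nu> \<mu> P x" using two_comp_locus_E[OF assms] by blast
  define D where "D = (\<lambda>p q. P1_det (P p) (P q))"
  have Dd: "P1_det (P p) (P q) = D p q" for p q by (simp add: D_def)
  define N where "N = (\<lambda>p. P1_det (P p) \<nu>)"
  define M where "M = (\<lambda>p. P1_det (P p) \<mu>)"
  have Nd: "P1_det (P p) \<nu> = N p" and Md: "P1_det (P p) \<mu> = M p" for p
    by (simp_all add: N_def M_def)
  have inj: "inj_on P A" "inj_on P ({1..n} - A)" "\<nu> \<notin> P ` A" "\<mu> \<notin> P ` ({1..n} - A)"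
    using f by (auto simp: two_formula_def)
  have DA: "D p q \<noteq> 0" if "p \<in> A" "q \<in> A" "p \<noteq> q" for p q
    using inj(1) that by (auto simp: D_def dest: inj_onD)
  have DB: "D p q \<noteq> 0" if "p \<in> {1..n} - A" "q \<in> {1..n} - A" "p \<noteq> q" for p q
    using inj(2) that by (auto simp: D_def dest: inj_onD)
  have N: "N p \<noteq> 0" if "p \<in> A" for p using inj(3) that by (auto simp: N_def)
  have M: "M p \<noteq> 0" if "p \<in> {1..n} - A" for p using inj(4) that by (auto simp: M_def)
  have D0: "D p p = 0" for p by (simp add: D_def)
  define Z where "Z = (\<lambda>p. if p \<in> A then D p i0 * N i1 / (N p * D i1 i0) else D p j0 * M j1 / (M p * D j1 j0))"
  define v where "v = coords 0 Z"
  have nz: "D i1 i0 \<noteq> 0" "D j1 j0 \<noteq> 0" "N i0 \<noteq> 0" "N i1 \<noteq> 0" "M j0 \<noteq> 0" "M j1 \<noteq> 0"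
    using DA DB N M i j by auto
  have Z: "ev (zc p) v = Z p" if "p \<in> {1..n}" for p
    unfolding v_def using that
    by (rule ev_zc_coords) (use nz in \<open>auto simp: Z_def D0\<close>)
  have v0: "v 0 = 0" by (simp add: v_def coords_def)
  have plN: "D p i0 * N q - D q i0 * N p = D p q * N i0" for p q
    using pluecker[of "P p" "P i0" "P q" \<nu>] by (simp add: D_def N_def)
  have plM: "D p j0 * M q - D q j0 * M p = D p q * M j0" for p q
    using pluecker[of "P p" "P j0" "P q" \<mu>] by (simp add: D_def M_def)
  define K where "K = N i1 / D i1 i0 * N i0"
  define K' where "K' = - (M j1 / D j1 j0 * M j0)"
  have K: "K \<noteq> 0" "K' \<noteq> 0" using nz by (simp_all add: K_def K'_def)
  \<comment> \<open>Marks off \<open>A\<close> are all seen at the node. Their constant is forced by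
    the value \<open>-1\<close> that \<open>E\<close> takes across the two sides at
    \<open>t = 0\<close>.\<close>
  define c where "c = (\<lambda>p. if p \<in> A then 1 / N p else - 1 / K)"
  define c' where "c' = (\<lambda>p. if p \<in> A then 1 / K' else 1 / M p)"
  have c: "c p \<noteq> 0" "c' p \<noteq> 0" if "p \<in> {1..n}" for p using that N M K by (auto simp: c_def c'_def)
  have sw: "P1_det \<nu> (P p) = - N p" "P1_det \<mu> (P p) = - M p" for p
    by (simp_all add: N_def M_def P1_det_swap[of \<nu>] P1_det_swap[of \<mu>])
  have eAA: "ev (E p q) v = c p * c q * K * D p q" if "p \<in> A" "q \<in> A" for p q
  proof -
    have pq: "p \<in> {1..n}" "q \<in> {1..n}" using that A by auto
    have "ev (E p q) v = (D p i0 * N q - D q i0 * N p) * N i1 / (N p * N q * D i1 i0)"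
      using N[OF that(1)] N[OF that(2)] nz that by (simp add: E_def Z[OF pq(1)] Z[OF pq(2)] Z_def field_simps)
    then show ?thesis using that unfolding plN by (simp add: c_def K_def)
  qed
  have eBB: "ev (E p q) v = c' p * c' q * K' * D p q" if "p \<in> {1..n} - A" "q \<in> {1..n} - A" for p q
  proof -
    have pq: "p \<in> {1..n}" "q \<in> {1..n}" using that by auto
    have "ev (E p q) v = - ((D p j0 * M q - D q j0 * M p) * M j1 / (M p * M q * D j1 j0))"
      using M[OF that(1)] M[OF that(2)] nz that by (simp add: E_def Z[OF pq(1)] Z[OF pq(2)] Z_def field_simps)
    then show ?thesis using that unfolding plM by (simp add: c'_def K'_def)
  qed
  have eAB: "ev (E p q) v = - 1" "ev (E q p) v = 1" if "p \<in> A" "q \<notin> A" for p q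
    using that by (simp_all add: E_def v0)
  have rel: "ev (E p q) v * (if p \<notin> A \<and> q \<notin> A then 0 else 1) = c p * c q * K * P1_det (im A \<nu> P p) (im A \<nu> P q)"
    if "p \<in> {1..n}" "q \<in> {1..n}" for p q
    using that eAA[of p q] eAB[of p q] eAB[of q p] N[of p] N[of q] K
    by (cases "p \<in> A"; cases "q \<in> A") (simp_all add: im_def Dd Nd sw c_def)
  have rel': "ev (E p q) v * (if p \<in> A \<and> q \<in> A then 0 else 1) =
        c' p * c' q * K' * P1_det (im ({1..n} - A) \<mu> P p) (im ({1..n} - A) \<mu> P q)"
    if "p \<in> {1..n}" "q \<in> {1..n}" for p q
    using that eBB[of p q] eAB[of p q] eAB[of q p] M[of p] M[of q] K
    by (cases "p \<in> A"; cases "q \<in> A") (simp_all add: im_def Dd Md sw c'_def)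
  have disc: "ev disc v \<noteq> 0"
  proof (rule disc_nzI)
    fix p q assume pq: "p \<in> {1..n}" "q \<in> {1..n}" "p \<noteq> q"
    then show "ev (E p q) v \<noteq> 0"
      using eAA[of p q] eBB[of p q] eAB[of p q] eAB[of q p] c K DA[of p q] DB[of p q]
      by (cases "p \<in> A"; cases "q \<in> A") auto
  qed
  have "psi v = x"
  proof (rule two_relations_psi[OF f _ v0 rel rel' c K])
    show "x \<in> quads n \<rightarrow>\<^sub>E UNIV" by (rule subsetD[OF Mbar_PiE subsetD[OF two_comp_locus_Mbar assms]])
  qed
  then show ?thesis using disc v0 by blast
qed

end

text \<open>In a factorization of a polynomial of degree 1 in \<open>v\<close>, one factor is free
  of \<open>v\<close>. It divides both coefficients \<open>a\<close> and \<open>b\<close>, one of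
  which is a unit.\<close>

lemma irreducible_linear:
  assumes a: "vars_in (- {v}) a" "a \<noteq> 0" and b: "vars_in (- {v}) b" and u: "is_unit a \<or> is_unit b"
  shows "irreducible (a * Var v + b)"
proof (rule irreducibleI)
  define p where "p = a * Var v + b"
  have F: "in_var v p = [:b, a:]"
    using a b by (intro in_var_eqI coeffs_in_pCons) (auto simp: p_def algebra_simps)
  then have d: "degv v p = 1" using a(2) by (simp add: degv_def)
  have p0: "p \<noteq> 0"
  proof
    assume "p = 0"
    then have "in_var v p = 0" by (simp only: in_var_eq_0_iff)
    then show False using F a(2) by simp
  qed
  then show "a * Var v + b \<noteq> 0" by (simp only: p_def not_False_eq_True)
  have nu: "\<not> is_unit p"
  proof
    assume "is_unit p"
    then obtain q where "1 = p * q" by blast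
    then have "degv v p + degv v q = degv v (1 :: mp)"
      using degv_mult[of p q v] p0 by (metis mult_zero_right zero_neq_one)
    also have "\<dots> = 0" unfolding degv_eq_0_iff by simp
    finally show False using d by simp
  qed
  then show "\<not> is_unit (a * Var v + b)" by (simp only: p_def not_False_eq_True)
  have key: "is_unit g" if fg: "p = f * g" "degv v g = 0" for f g
  proof -
    have "vars_in (- {v}) g" by (rule iffD1[OF degv_eq_0_iff fg(2)])
    then have "in_var v g = [:g:]" by (rule in_var_indep)
    then have e: "[:b, a:] = smult g (in_var v f)"
      using F in_var_mult[of v f g] unfolding fg(1) by simp
    have "g dvd coeff [:b, a:] i" for i unfolding e by simp
    from this[of 0] this[of 1] have "g dvd b" "g dvd a" by simp_all
    then show ?thesis using u dvd_trans by blast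
  qed
  fix f g assume "a * Var v + b = f * g"
  then have fg: "p = f * g" by (simp only: p_def)
  have "f \<noteq> 0" "g \<noteq> 0" using p0 fg by (metis mult_zero_left, metis mult_zero_right)
  then have "degv v f + degv v g = 1" using d degv_mult[of f g v] fg by simp
  then have "degv v g = 0 \<or> degv v f = 0" by linarith
  then show "is_unit f \<or> is_unit g" using key[of f g] key[of g f] fg by (metis mult.commute)
qed

context boundary_chart
begin

lemma zc_simps [simp]: "zc i0 = 0" "zc j0 = 0" "zc i1 = 1" "zc j1 = 1"
  by (simp_all add: zc_def)

lemma pos: "p \<in> {1..n} \<Longrightarrow> p \<noteq> 0"
  by auto

lemma U_cases: "x \<in> U \<Longrightarrow> x \<in> M_smooth n \<or> x \<in> two_comp_locus n A"
proof -
  assume x: "x \<in> U"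
  show ?thesis
  proof (rule stratum_A[OF _ A])
    show "x \<in> Mbar n" using x by (simp add: U_def)
    fix i j k l assume "(i, j, k, l) \<in> quads n" "\<not> splits A i j k l"
    then have "fst (hcoord (x (i, j, k, l))) \<noteq> 0" using x unfolding U_def by blast
    then show "x (i, j, k, l) \<noteq> Finite 0" by auto
  qed
qed

lemma U_psi: "x \<in> U \<Longrightarrow> \<exists>v. ev disc v \<noteq> 0 \<and> psi v = x"
  using U_cases smooth_psi two_comp_psi by blast

lemma qv_quads: "v \<in> vars \<Longrightarrow> qv v \<in> quads n"
proof -
  assume v: "v \<in> vars"
  have "v = 0 \<or> (v \<in> {1..n} \<and> v \<noteq> i0 \<and> v \<noteq> i1 \<and> v \<noteq> j0 \<and> v \<noteq> j1)"
    using v unfolding vars_def by blast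
  then show ?thesis
    using mem_n unfolding qv_def by (auto simp: quads_def simp del: One_nat_def)
qed

lemma psi_qv:
  assumes "ev disc x \<noteq> 0" "v \<in> vars"
  shows "psi x (qv v) = Finite (x v)"
proof -
  have v: "v = 0 \<or> (v \<noteq> 0 \<and> v \<noteq> i0 \<and> v \<noteq> i1 \<and> v \<noteq> j0 \<and> v \<noteq> j1)"
    using assms(2) pos unfolding vars_def by blast
  have "psi x (qv v) = P1_point (ev (num (qv v)) x) (ev (den (qv v)) x)"
    using qv_quads[OF assms(2)] by (simp add: psi_def)
  also have "\<dots> = Finite (x v)"
  proof (cases "v = 0")
    case True
    then show ?thesis by (simp add: qv_def ev_num ev_den splits_def E_def P1_point_def)
  next
    case False
    then have "zc v = Var v" using v by (simp add: zc_def)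
    then show ?thesis using False
      by (cases "v \<in> A") (simp_all add: qv_def ev_num ev_den splits_def E_def P1_point_def)
  qed
  finally show ?thesis .
qed

lemma openU: "openin (zariski (quads n) (Mbar n)) U"
proof -
  define N where "N = {q \<in> quads n. case q of (i, j, k, l) \<Rightarrow> \<not> splits A i j k l}"
  define K where "K = (\<lambda>q. {x \<in> Mbar n. fst (hcoord (x q)) \<noteq> 0})"
  have "openin (zariski (quads n) (Mbar n)) (K q)" if "q \<in> N" for q
  proof (rule openin_zariskiI[OF Mbar_PiE])
    show "K q \<subseteq> Mbar n" by (auto simp: K_def)
    fix x assume x: "x \<in> K q"
    have "multihom_poly (quads n) (\<lambda>r. if r = q then 1 else 0) (\<lambda>x. fst (x q))"
      using that by (intro multihom_poly.coord1) (simp add: N_def)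
    then show "\<exists>F d. multihom_poly (quads n) d F \<and> eval_at F x \<noteq> 0 \<and> {y \<in> Mbar n. eval_at F y \<noteq> 0} \<subseteq> K q"
      using x by (intro exI conjI) (assumption, auto simp: K_def eval_at_def)
  qed
  moreover have "finite N" using finite_quads by (simp add: N_def)
  ultimately have "openin (zariski (quads n) (Mbar n)) ((\<Inter>q\<in>N. K q) \<inter> topspace (zariski (quads n) (Mbar n)))"
    by (intro openin_INT) auto
  moreover have "U = (\<Inter>q\<in>N. K q) \<inter> topspace (zariski (quads n) (Mbar n))"
    unfolding topspace_zariski[OF Mbar_PiE] by (auto simp: U_def K_def N_def)
  ultimately show ?thesis by simp
qed

lemma smooth_U: "M_smooth n \<subseteq> U"
  using smooth_psi psi_U by blast

lemma two_comp_U: "two_comp_locus n A \<subseteq> U"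
  using two_comp_psi psi_U by blast

lemma ex_disc_nz: "\<exists>v. ev disc v \<noteq> 0 \<and> v 0 = 0"
proof -
  \<comment> \<open>The other marks get distinct values \<open>p + 1\<close>, at least 2 and so away
    from 0 and 1. Across the two sides nothing has to be avoided, since there \<open>E\<close> is a
    sign at \<open>t = 0\<close>.\<close>
  define N :: "nat \<Rightarrow> nat" where
    "N = (\<lambda>p. if p = i0 \<or> p = j0 then 0 else if p = i1 \<or> p = j1 then 1 else p + 1)"
  define Z :: "nat \<Rightarrow> complex" where "Z = (\<lambda>p. of_nat (N p))"
  have N: "N i0 = 0" "N j0 = 0" "N i1 = 1" "N j1 = 1" using mem by (auto simp: N_def)
  have Z: "ev (zc p) (coords 0 Z) = Z p" if "p \<in> {1..n}" for p
    by (rule ev_zc_coords[OF that]) (simp_all add: Z_def N)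
  have inj: "Z p \<noteq> Z q" if "p \<in> {1..n}" "q \<in> {1..n}" "p \<noteq> q" "p \<in> A \<longleftrightarrow> q \<in> A" for p q
  proof -
    have nz: "p \<noteq> 0" "q \<noteq> 0" using that pos by blast+
    have "N p \<noteq> N q"
    proof
      assume "N p = N q"
      then consider "p \<in> {i0, j0}" "q \<in> {i0, j0}" | "p \<in> {i1, j1}" "q \<in> {i1, j1}" | "p = q"
        using nz unfolding N_def by (simp split: if_splits)
      then show False using that(3,4) mem by cases blast+
    qed
    then show ?thesis by (simp only: Z_def of_nat_eq_iff not_False_eq_True)
  qed
  have c0: "coords 0 Z 0 = 0" by (simp add: coords_def)
  have "ev disc (coords 0 Z) \<noteq> 0"
  proof (rule disc_nzI)
    fix p q assume pq: "p \<in> {1..n}" "q \<in> {1..n}" "p \<noteq> q"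
    show "ev (E p q) (coords 0 Z) \<noteq> 0"
      using inj[OF pq] Z[OF pq(1)] Z[OF pq(2)] c0 by (auto simp: E_def)
  qed
  then show ?thesis by (intro exI[of _ "coords 0 Z"]) (simp add: coords_def)
qed

lemma n3: "n \<ge> 3"
proof -
  have "{i0, i1, j0} \<subseteq> {1..n}" using mem_n by blast
  then have "card {i0, i1, j0} \<le> card {1..n}" by (rule card_mono[rotated]) simp
  then show ?thesis by simp
qed

sublocale ch: chart "quads n" "Mbar n" U vars disc num den psi qv
proof
  fix W assume "openin (zariski (quads n) (Mbar n)) W" "W \<noteq> {}"
  then show "W \<inter> U \<noteq> {}" using M_smooth_dense[OF n3, of W] smooth_U by blast
next
  fix v q assume "ev disc v \<noteq> 0" "q \<in> quads n"
  then show "psi v q = P1_point (ev (num q) v) (ev (den q) v)" by (simp add: psi_def)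
next
  fix v x assume v: "v \<in> vars" and x: "x \<in> U"
  obtain w where w: "ev disc w \<noteq> 0" "psi w = x" using U_psi[OF x] by blast
  then show "x (qv v) \<noteq> Infinity" using psi_qv[OF w(1) v] by auto
next
  fix x assume x: "x \<in> U"
  obtain w where w: "ev disc w \<noteq> 0" "psi w = x" using U_psi[OF x] by blast
  have e: "(\<lambda>v. if v \<in> vars then fst (hcoord (x (qv v))) else 0) = (\<lambda>v. if v \<in> vars then w v else 0)"
    using psi_qv[OF w(1)] w(2) by auto
  have agree: "ev f (\<lambda>v. if v \<in> vars then w v else 0) = ev f w" if "vars_in vars f" for f
    by (rule vars_inD[OF that]) simp
  show "ev disc (\<lambda>v. if v \<in> vars then fst (hcoord (x (qv v))) else 0) \<noteq> 0"
    unfolding e agree[OF vars_disc] by (rule w(1))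
  have "psi (\<lambda>v. if v \<in> vars then w v else 0) = psi w"
    unfolding psi_def
  proof (rule restrict_ext)
    fix q assume q: "q \<in> quads n"
    show "P1_point (ev (num q) (\<lambda>v. if v \<in> vars then w v else 0)) (ev (den q) (\<lambda>v. if v \<in> vars then w v else 0)) =
        P1_point (ev (num q) w) (ev (den q) w)"
      using agree[of "num q"] agree[of "den q"] vars_num_den[OF q] by simp
  qed
  then show "psi (\<lambda>v. if v \<in> vars then fst (hcoord (x (qv v))) else 0) = x"
    unfolding e using w(2) by simp
next
  show "disc \<noteq> 0" using ex_disc_nz by auto
next
  fix v x assume "ev disc x \<noteq> 0" "v \<in> vars"
  then show "psi x (qv v) = Finite (x v)" by (rule psi_qv)
qed (fact finite_quads Mbar_PiE vars_disc vars_num_den openU psi_U num_den_nz qv_quads)+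

lemma zero_vars: "0 \<in> vars"
  by (simp add: vars_def)

lemma phi_psi_0: "ev disc v \<noteq> 0 \<Longrightarrow> ch.phi (psi v) 0 = v 0"
  using psi_qv[OF _ zero_vars] zero_vars by (simp add: ch.phi_def)

lemma phi_0_smooth: "x \<in> M_smooth n \<Longrightarrow> ch.phi x 0 \<noteq> 0"
  using smooth_psi[of x] phi_psi_0 by auto

lemma phi_0_two_comp: "x \<in> two_comp_locus n A \<Longrightarrow> ch.phi x 0 = 0"
  using two_comp_psi[of x] phi_psi_0 by auto

lemma hyp_0: "ch.hyp (Var 0) = two_comp_locus n A"
  using U_cases phi_0_smooth phi_0_two_comp two_comp_U by (auto simp: ch.hyp_def)

lemma smooth_eq: "M_smooth n = {x\<in>U. ev (Var 0) (ch.phi x) \<noteq> 0}"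
  using U_cases phi_0_smooth phi_0_two_comp smooth_U by auto

lemma good_0: "ch.good (Var 0)"
proof -
  have "irreducible (1 * Var 0 + 0)" by (rule irreducible_linear) auto
  then have "prime_elem (Var 0)" using irreducible_imp_prime_elem_mp by simp
  moreover have "\<not> Var 0 dvd disc" using ex_disc_nz by (auto elim!: dvdE)
  ultimately show ?thesis using zero_vars by (simp add: ch.good_def)
qed

end

section \<open>The boundary divisors\<close>

text \<open>The explicit form of \<open>d_divisor n A\<close>, see \<open>d_divisor_eq\<close>. In a
  chart of \<open>A\<close> it is the hypersurface \<open>t = 0\<close>.\<close>

definition bd :: "nat \<Rightarrow> nat set \<Rightarrow> (quad \<Rightarrow> P1) set" where
  "bd n A = zariski (quads n) (Mbar n) closure_of two_comp_locus n A"

lemma (in boundary_chart) hyp_cl_0: "ch.hyp_cl (Var 0) = bd n A"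
  by (simp add: ch.hyp_cl_def hyp_0 bd_def)

lemma boundary_index_compl: "boundary_index n A \<Longrightarrow> boundary_index n ({1..n} - A)"
proof -
  assume A: "boundary_index n A"
  then have "A \<subseteq> {1..n}" by (simp add: boundary_index_def)
  then have "card ({1..n} - A) = n - card A" "card A \<le> n"
    using card_Diff_subset[of A "{1..n}"] card_mono[of "{1..n}" A] finite_subset by auto
  moreover have "2 \<le> card A" "card A \<le> n - 2" using A by (simp_all add: boundary_index_def)
  moreover from this have "2 \<le> n - card A" "n - card A \<le> n - 2" by linarith+
  ultimately show ?thesis unfolding boundary_index_def by simp
qed

lemma ex_boundary_chart:
  assumes "boundary_index n A"
  shows "\<exists>i0 i1 j0 j1. boundary_chart n A i0 i1 j0 j1"
proof -
  obtain i0 i1 where "i0 \<in> A" "i1 \<in> A" "i0 \<noteq> i1"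
    using assms two_elements[of A] by (auto simp: boundary_index_def)
  moreover obtain j0 j1 where "j0 \<in> {1..n} - A" "j1 \<in> {1..n} - A" "j0 \<noteq> j1"
    using two_elements[of "{1..n} - A"] boundary_index_compl[OF assms] unfolding boundary_index_def by metis
  moreover have "A \<subseteq> {1..n}" using assms by (simp add: boundary_index_def)
  ultimately have "boundary_chart n A i0 i1 j0 j1" by (intro boundary_chart.intro)
  then show ?thesis by blast
qed

lemma prime_divisor_bd:
  assumes "boundary_index n A"
  shows "prime_divisor (quads n) (Mbar n) (bd n A)"
proof -
  obtain i0 i1 j0 j1 where "boundary_chart n A i0 i1 j0 j1" using ex_boundary_chart[OF assms] by blast
  then interpret boundary_chart n A i0 i1 j0 j1 .
  show ?thesis using ch.prime_divisor_hyp_cl[OF good_0] by (simp add: hyp_cl_0)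
qed

lemma bd_props:
  assumes "boundary_index n A"
  shows "closedin (zariski (quads n) (Mbar n)) (bd n A)" "irreducible_in (zariski (quads n) (Mbar n)) (bd n A)"
    "bd n A \<noteq> Mbar n" "two_comp_locus n A \<subseteq> bd n A" "two_comp_locus n A \<noteq> {}"
proof -
  show "closedin (zariski (quads n) (Mbar n)) (bd n A)" "irreducible_in (zariski (quads n) (Mbar n)) (bd n A)"
    "bd n A \<noteq> Mbar n"
    using prime_divisor_bd[OF assms] by (auto simp: prime_divisor_def)
  show "two_comp_locus n A \<subseteq> bd n A"
    unfolding bd_def by (rule closure_of_subset) (simp add: topspace_zariski[OF Mbar_PiE] two_comp_locus_Mbar)
  show "two_comp_locus n A \<noteq> {}"
    using \<open>irreducible_in _ (bd n A)\<close> by (auto simp: irreducible_in_def bd_def)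
qed

lemma smooth_two_comp_disjoint: "boundary_index n A \<Longrightarrow> M_smooth n \<inter> two_comp_locus n A = {}"
proof -
  assume "boundary_index n A"
  then obtain i0 i1 j0 j1 where "boundary_chart n A i0 i1 j0 j1" using ex_boundary_chart by blast
  then interpret boundary_chart n A i0 i1 j0 j1 .
  show ?thesis using phi_0_smooth phi_0_two_comp by auto
qed

lemma bd_compl: "A \<subseteq> {1..n} \<Longrightarrow> bd n ({1..n} - A) = bd n A"
  by (simp only: bd_def two_comp_locus_compl)

lemma two_formula_zero:
  assumes f: "two_formula n B \<nu> \<mu> P x" and q: "(i, j, k, l) \<in> quads n" and ik: "i \<in> B" "k \<in> B" and jl: "j \<notin> B" "l \<notin> B"
  shows "x (i, j, k, l) = Finite 0"
proof -
  have "{i, k} \<subseteq> B \<inter> {i, j, k, l}" using ik by blast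
  then have "card {i, k} \<le> card (B \<inter> {i, j, k, l})" by (rule card_mono[rotated]) simp
  moreover have "i \<noteq> k" using q by (simp add: quads_iff)
  ultimately have "card (B \<inter> {i, j, k, l}) \<ge> 2" by simp
  then have "x (i, j, k, l) = cross_ratio (im B \<nu> P i) (im B \<nu> P j) (im B \<nu> P k) (im B \<nu> P l)"
    using f q unfolding two_formula_def by blast
  also have "\<dots> = cross_ratio (P i) \<nu> (P k) \<nu>" using ik jl by (simp add: im_def)
  also have "\<dots> = Finite 0"
    using f ik by (intro cross_ratio_degenerate(4)) (auto simp: two_formula_def)
  finally show ?thesis .
qed

text \<open>On the stratum of \<open>B\<close>, cross-ratios of two marks inside \<open>B\<close>
  with two outside vanish. In the chart of \<open>A\<close> only quadruples split by
  \<open>A\<close> can do so, and \<open>splits_determine\<close> applies.\<close>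

lemma two_comp_locus_common_point:
  assumes A: "boundary_index n A" and B: "boundary_index n B" and x: "x \<in> two_comp_locus n A" "x \<in> two_comp_locus n B"
  shows "B = A \<or> B = {1..n} - A"
proof -
  obtain i0 i1 j0 j1 where "boundary_chart n A i0 i1 j0 j1" using ex_boundary_chart[OF A] by blast
  then interpret boundary_chart n A i0 i1 j0 j1 .
  obtain \<nu> \<mu> P where f: "two_formula n B \<nu> \<mu> P x" by (rule two_comp_locus_E[OF x(2)])
  have xU: "x \<in> U" using x(1) two_comp_U by blast
  show ?thesis
  proof (rule splits_determine[of A "{1..n}" B])
    show "A \<subseteq> {1..n}" "B \<subseteq> {1..n}" "card B \<ge> 2" using A B by (auto simp only: boundary_index_def)
    show "card ({1..n} - B) \<ge> 2" using boundary_index_compl[OF B] by (simp only: boundary_index_def)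
    fix i j k l assume *: "i \<in> B" "k \<in> B" "i \<noteq> k" "j \<in> {1..n} - B" "l \<in> {1..n} - B" "j \<noteq> l"
    have q: "(i, j, k, l) \<in> quads n"
      unfolding quads_iff
    proof
      show "{i, j, k, l} \<subseteq> {1..n}" using * subsetD[OF \<open>B \<subseteq> {1..n}\<close>] by blast
      have "j \<notin> B" "l \<notin> B" using * by blast+
      then show "distinct [i, j, k, l]" using *(1-3,6) by auto
    qed
    have "x (i, j, k, l) = Finite 0" using two_formula_zero[OF f q] * by blast
    then show "splits A i j k l" using xU q unfolding U_def by (cases "splits A i j k l") (blast, fastforce)
  qed
qed

text \<open>Inside the chart of \<open>A\<close> the closure \<open>bd n A\<close> is no more than
  the stratum of \<open>A\<close>. A point of it lies in the closure of the stratum of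
  \<open>B\<close>, so that stratum meets the chart, necessarily in the stratum of
  \<open>A\<close>.\<close>

lemma bd_inj:
  assumes bA: "boundary_index n A" and B: "boundary_index n B" and eq: "bd n A = bd n B"
  shows "B = A \<or> B = {1..n} - A"
proof -
  obtain i0 i1 j0 j1 where "boundary_chart n A i0 i1 j0 j1" using ex_boundary_chart[OF bA] by blast
  then interpret boundary_chart n A i0 i1 j0 j1 .
  obtain y where y: "y \<in> two_comp_locus n A" using bd_props(5)[OF bA] by blast
  then have "y \<in> U" "y \<in> bd n B" using two_comp_U bd_props(4)[OF bA] eq by blast+
  then obtain z where z: "z \<in> two_comp_locus n B" "z \<in> U"
    using openU unfolding bd_def in_closure_of by blast
  then have "z \<in> bd n A \<inter> U" using bd_props(4)[OF B] eq by blast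
  moreover have "bd n A \<inter> U = two_comp_locus n A"
    using ch.hyp_cl_U[of "Var 0"] zero_vars by (simp add: hyp_cl_0 hyp_0)
  ultimately have "z \<in> two_comp_locus n A" by blast
  then show ?thesis using two_comp_locus_common_point[OF bA B] z(1) by blast
qed

lemma finite_boundary_index: "finite {A. boundary_index n A}"
  by (rule finite_subset[of _ "Pow {1..n}"]) (auto simp: boundary_index_def)

context
  fixes n :: nat
  assumes n: "n \<ge> 4"
begin

lemma ex_boundary_index: "\<exists>A. boundary_index n A"
proof -
  have "boundary_index n {1, 2}" using n by (auto simp: boundary_index_def)
  then show ?thesis by blast
qed

lemma open_M_smooth: "openin (zariski (quads n) (Mbar n)) (M_smooth n)"
proof -
  obtain A i0 i1 j0 j1 where "boundary_chart n A i0 i1 j0 j1"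
    using ex_boundary_chart ex_boundary_index by blast
  then interpret boundary_chart n A i0 i1 j0 j1 .
  show ?thesis using ch.open_nonvanishing[of "Var 0"] zero_vars by (simp add: smooth_eq)
qed

lemma boundary_eq: "Mbar n - M_smooth n = (\<Union>A\<in>{A. boundary_index n A}. bd n A)"
proof (intro subset_antisym subsetI)
  fix x assume "x \<in> Mbar n - M_smooth n"
  then show "x \<in> (\<Union>A\<in>{A. boundary_index n A}. bd n A)"
    using boundary_point_closure[of x n] unfolding bd_def by blast
next
  fix x assume "x \<in> (\<Union>A\<in>{A. boundary_index n A}. bd n A)"
  then obtain A where A: "boundary_index n A" "x \<in> bd n A" by blast
  have "closedin (zariski (quads n) (Mbar n)) (Mbar n - M_smooth n)"
    using closedin_diff[OF closedin_topspace open_M_smooth] by (simp add: topspace_zariski[OF Mbar_PiE])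
  moreover have "two_comp_locus n A \<subseteq> Mbar n - M_smooth n"
    using two_comp_locus_Mbar smooth_two_comp_disjoint[OF A(1)] by blast
  ultimately show "x \<in> Mbar n - M_smooth n" using A(2) closure_of_minimal unfolding bd_def by blast
qed

lemma irreducible_in_boundary:
  assumes "irreducible_in (zariski (quads n) (Mbar n)) D" "D \<subseteq> Mbar n - M_smooth n"
  shows "\<exists>A. boundary_index n A \<and> D \<subseteq> bd n A"
proof -
  have "\<exists>C\<in>bd n ` {A. boundary_index n A}. D \<subseteq> C"
  proof (rule irreducible_in_finite_Union[OF assms(1)])
    show "finite (bd n ` {A. boundary_index n A})" using finite_boundary_index by blast
    show "D \<subseteq> \<Union> (bd n ` {A. boundary_index n A})" using assms(2) unfolding boundary_eq .
    fix C assume "C \<in> bd n ` {A. boundary_index n A}"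
    then show "closedin (zariski (quads n) (Mbar n)) C" using bd_props(1) by blast
  qed
  then show ?thesis by blast
qed

text \<open>The boundary is the finite union of the closures \<open>bd n A\<close>. Each of these is
  maximal because it is a prime divisor, so no other one can properly contain it.\<close>

lemma boundary_divisor_iff: "boundary_divisor n D \<longleftrightarrow> (\<exists>A. boundary_index n A \<and> D = bd n A)"
proof
  assume D: "boundary_divisor n D"
  then obtain A where A: "boundary_index n A" "D \<subseteq> bd n A"
    using irreducible_in_boundary[of D] unfolding boundary_divisor_def irreducible_component_def by blast
  have "bd n A \<subseteq> Mbar n - M_smooth n" using A(1) unfolding boundary_eq by blast
  then have "bd n A = D"
    using D bd_props(2)[OF A(1)] A(2) unfolding boundary_divisor_def irreducible_component_def by blast
  then show "\<exists>A. boundary_index n A \<and> D = bd n A" using A(1) by blast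
next
  assume "\<exists>A. boundary_index n A \<and> D = bd n A"
  then obtain A where A: "boundary_index n A" "D = bd n A" by blast
  show "boundary_divisor n D"
    unfolding boundary_divisor_def irreducible_component_def
  proof (intro conjI allI impI)
    show "irreducible_in (zariski (quads n) (Mbar n)) D" using bd_props(2)[OF A(1)] A(2) by simp
    show "D \<subseteq> Mbar n - M_smooth n" using A unfolding boundary_eq by blast
    fix D' assume D': "irreducible_in (zariski (quads n) (Mbar n)) D' \<and> D' \<subseteq> Mbar n - M_smooth n \<and> D \<subseteq> D'"
    then obtain B where B: "boundary_index n B" "D' \<subseteq> bd n B" using irreducible_in_boundary[of D'] by blast
    then have "bd n A \<subseteq> bd n B" using D' A(2) by blast
    then have "bd n B = bd n A"
      using prime_divisor_bd[OF A(1)] bd_props[OF B(1)] unfolding prime_divisor_def by blast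
    then show "D' = D" using D' B A(2) by blast
  qed
qed

text \<open>A boundary divisor is \<open>bd n B\<close> for some \<open>B\<close>, and an open set
  that meets it meets the stratum of \<open>B\<close>. If the open part lies in the stratum of
  \<open>A\<close>, the two strata have a common point.\<close>

lemma d_divisor_eq:
  assumes bA: "boundary_index n A"
  shows "d_divisor n A = bd n A"
  unfolding d_divisor_def
proof (rule the_equality)
  obtain i0 i1 j0 j1 where "boundary_chart n A i0 i1 j0 j1" using ex_boundary_chart[OF bA] by blast
  then interpret boundary_chart n A i0 i1 j0 j1 .
  have "U \<inter> bd n A = two_comp_locus n A"
    using ch.hyp_cl_U[of "Var 0"] zero_vars by (simp add: hyp_cl_0 hyp_0 Int_commute)
  then show "boundary_divisor n (bd n A) \<and> (\<exists>U. openin (zariski (quads n) (Mbar n)) U \<and>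
      U \<inter> bd n A \<noteq> {} \<and> U \<inter> bd n A \<subseteq> two_comp_locus n A)"
    using boundary_divisor_iff[of "bd n A"] bA openU bd_props(5)[OF bA] by blast
  fix D assume D: "boundary_divisor n D \<and> (\<exists>U. openin (zariski (quads n) (Mbar n)) U \<and>
      U \<inter> D \<noteq> {} \<and> U \<inter> D \<subseteq> two_comp_locus n A)"
  then obtain B W where B: "boundary_index n B" "D = bd n B" and W: "openin (zariski (quads n) (Mbar n)) W"
      "W \<inter> D \<noteq> {}" "W \<inter> D \<subseteq> two_comp_locus n A"
    using boundary_divisor_iff[of D] by blast
  obtain w where "w \<in> W" "w \<in> bd n B" using W(2) B(2) by blast
  then obtain y where y: "y \<in> W" "y \<in> two_comp_locus n B"
    using W(1) unfolding bd_def in_closure_of by metis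
  then have "y \<in> two_comp_locus n A" using W(3) B(2) subsetD[OF bd_props(4)[OF B(1)] y(2)] by blast
  then have "B = A \<or> B = {1..n} - A" using two_comp_locus_common_point[OF bA B(1)] y(2) by blast
  then show "D = bd n A" using B(2) bd_compl[OF A] by blast
qed

text \<open>A prime divisor disjoint from the interior lies in one of the closures
  \<open>bd n A\<close> by irreducibility, and between sets of codimension one inclusion is
  equality.\<close>

lemma prime_divisor_cases:
  assumes "prime_divisor (quads n) (Mbar n) Y"
  shows "(\<exists>A. boundary_index n A \<and> Y = bd n A) \<or> Y \<inter> M_smooth n \<noteq> {}"
proof (rule disjCI)
  assume "\<not> Y \<inter> M_smooth n \<noteq> {}"
  moreover have "Y \<subseteq> Mbar n"
    using assms closedin_subset[of "zariski (quads n) (Mbar n)" Y]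
    by (simp add: prime_divisor_def topspace_zariski[OF Mbar_PiE])
  ultimately have "Y \<subseteq> Mbar n - M_smooth n" by blast
  then obtain A where A: "boundary_index n A" "Y \<subseteq> bd n A"
    using irreducible_in_boundary[of Y] assms unfolding prime_divisor_def by blast
  then have "bd n A = Y" using assms bd_props[OF A(1)] unfolding prime_divisor_def by blast
  then show "\<exists>A. boundary_index n A \<and> Y = bd n A" using A(1) by blast
qed

end

section \<open>Divisors of rational functions\<close>

definition nzrat :: "'q set \<Rightarrow> ('q \<Rightarrow> P1) set \<Rightarrow> (('q \<Rightarrow> P1) \<Rightarrow> complex) \<Rightarrow> bool" where
  "nzrat Q X f \<longleftrightarrow> rational_function Q X f \<and> \<not> rational_eq Q X f (\<lambda>_. 0)"

context chart
begin

lemma nzrat_iff: "nzrat Q X f \<longleftrightarrow> (\<exists>g h. frac_rep f g h \<and> g \<noteq> 0)"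
  unfolding nzrat_def using rational_function_frac[of f] frac_rational_function[of f] frac_zero_iff[of f] by blast

lemma frac_const: "frac_rep (\<lambda>_. c) (Cst c) 1"
  by (simp add: frac_rep_def)

lemma nzrat_const: "c \<noteq> 0 \<Longrightarrow> nzrat Q X (\<lambda>_. c)"
proof -
  assume c: "c \<noteq> 0"
  have "Cst c \<noteq> 0"
  proof
    assume "Cst c = 0"
    then have "ev (Cst c) (\<lambda>_. 0) = 0" by (simp only: ev_simps)
    then show False using c by simp
  qed
  then show ?thesis unfolding nzrat_iff using frac_const by blast
qed

lemma nzrat_mult: "nzrat Q X f \<Longrightarrow> nzrat Q X f' \<Longrightarrow> nzrat Q X (\<lambda>y. f y * f' y)"
proof -
  assume "nzrat Q X f" "nzrat Q X f'"
  then obtain g h g' h' where *: "frac_rep f g h" "g \<noteq> 0" "frac_rep f' g' h'" "g' \<noteq> 0"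
    unfolding nzrat_iff by blast
  then have "g * g' \<noteq> 0" by simp
  then show ?thesis unfolding nzrat_iff using frac_mult[OF *(1,3)] by blast
qed

lemma nzrat_inverse: "nzrat Q X f \<Longrightarrow> nzrat Q X (\<lambda>y. inverse (f y))"
proof -
  assume "nzrat Q X f"
  then obtain g h where *: "frac_rep f g h" "g \<noteq> 0" unfolding nzrat_iff by blast
  moreover have "h * h \<noteq> 0" using * by (simp add: frac_rep_def)
  ultimately show ?thesis unfolding nzrat_iff using frac_inverse by blast
qed

lemma frac_cross_rational_eq:
  assumes "frac_rep f g h" "frac_rep f' g' h'" "g * h' = g' * h"
  shows "rational_eq Q X f f'"
proof (rule rational_eq_fracI[of "h * h'"])
  show "vars_in V (h * h')" "h * h' \<noteq> 0" using assms by (auto simp: frac_rep_def)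
  fix y assume y: "y \<in> U" "ev (h * h') (phi y) \<noteq> 0"
  then have nz: "ev h (phi y) \<noteq> 0" "ev h' (phi y) \<noteq> 0" by auto
  then have "f y = ev g (phi y) / ev h (phi y)" "f' y = ev g' (phi y) / ev h' (phi y)"
    using assms(1,2) y(1) unfolding frac_rep_def by blast+
  moreover have "ev g (phi y) * ev h' (phi y) = ev g' (phi y) * ev h (phi y)"
    using assms(3) ev_simps(6) by metis
  ultimately show "f y = f' y" using nz by (simp add: frac_eq_eq)
qed

context
  fixes Y
  assumes Y: "prime_divisor Q X Y" "Y \<inter> U \<noteq> {}"
begin

abbreviation "oY \<equiv> ord_along Q X Y"

lemma ord_frac_rep:
  "\<exists>p. good p \<and> Y = hyp_cl p \<and> (\<forall>f g h. frac_rep f g h \<longrightarrow> g \<noteq> 0 \<longrightarrow>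
    oY f = int (multiplicity p g) - int (multiplicity p h))"
  using prime_divisor_eq_hyp_cl[OF Y] ord_along_hyp_cl by blast

lemma ord_mult:
  assumes "nzrat Q X f" "nzrat Q X f'"
  shows "oY (\<lambda>y. f y * f' y) = oY f + oY f'"
proof -
  obtain p where p: "good p" and o: "\<And>f g h. frac_rep f g h \<Longrightarrow> g \<noteq> 0 \<Longrightarrow>
    oY f = int (multiplicity p g) - int (multiplicity p h)"
    using ord_frac_rep by blast
  have pe: "prime_elem p" using p by (simp add: good_def)
  obtain g h where g: "frac_rep f g h" "g \<noteq> 0" using assms(1) unfolding nzrat_iff by blast
  obtain g' h' where g': "frac_rep f' g' h'" "g' \<noteq> 0" using assms(2) unfolding nzrat_iff by blast
  have nz: "h \<noteq> 0" "h' \<noteq> 0" using g g' by (auto simp: frac_rep_def)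
  show ?thesis
    using o[OF frac_mult[OF g(1) g'(1)]] o[OF g] o[OF g'] nz g(2) g'(2)
    by (simp add: prime_elem_multiplicity_mult_distrib[OF pe])
qed

lemma ord_inverse:
  assumes "nzrat Q X f"
  shows "oY (\<lambda>y. inverse (f y)) = - oY f"
proof -
  obtain p where p: "good p" and o: "\<And>f g h. frac_rep f g h \<Longrightarrow> g \<noteq> 0 \<Longrightarrow>
    oY f = int (multiplicity p g) - int (multiplicity p h)"
    using ord_frac_rep by blast
  have pe: "prime_elem p" using p by (simp add: good_def)
  obtain g h where g: "frac_rep f g h" "g \<noteq> 0" using assms(1) unfolding nzrat_iff by blast
  have nz: "h \<noteq> 0" using g by (auto simp: frac_rep_def)
  show ?thesis
    using o[OF frac_inverse[OF g]] o[OF g] nz g(2)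
    by (simp add: prime_elem_multiplicity_mult_distrib[OF pe])
qed

lemma ord_const:
  assumes "c \<noteq> 0"
  shows "oY (\<lambda>_. c) = 0"
proof -
  obtain p where p: "good p" and o: "\<And>f g h. frac_rep f g h \<Longrightarrow> g \<noteq> 0 \<Longrightarrow>
    oY f = int (multiplicity p g) - int (multiplicity p h)"
    using ord_frac_rep by blast
  have "\<not> is_unit p" using p by (simp add: good_def prime_elem_def)
  moreover have u: "is_unit (Cst c)" using assms is_unit_mp_iff by blast
  ultimately have "multiplicity p (Cst c) = 0" by (simp add: multiplicity_unit_right)
  moreover have "Cst c \<noteq> 0" using u by auto
  ultimately show ?thesis using o[OF frac_const] by simp
qed

lemma ord_cong:
  assumes "nzrat Q X f" "nzrat Q X f'" "rational_eq Q X f f'"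
  shows "oY f = oY f'"
proof -
  obtain p where p: "good p" and o: "\<And>f g h. frac_rep f g h \<Longrightarrow> g \<noteq> 0 \<Longrightarrow>
    oY f = int (multiplicity p g) - int (multiplicity p h)"
    using ord_frac_rep by blast
  have pe: "prime_elem p" using p by (simp add: good_def)
  obtain g h where g: "frac_rep f g h" "g \<noteq> 0" using assms(1) unfolding nzrat_iff by blast
  obtain g' h' where g': "frac_rep f' g' h'" "g' \<noteq> 0" using assms(2) unfolding nzrat_iff by blast
  have nz: "h \<noteq> 0" "h' \<noteq> 0" using g g' by (auto simp: frac_rep_def)
  have "g * h' = g' * h" by (rule frac_rational_eq[OF g(1) g'(1) assms(3)])
  then have "multiplicity p (g * h') = multiplicity p (g' * h)" by simp
  then have "multiplicity p g + multiplicity p h' = multiplicity p g' + multiplicity p h"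
    using nz g(2) g'(2) by (simp add: prime_elem_multiplicity_mult_distrib[OF pe])
  then show ?thesis using o[OF g] o[OF g'] by simp
qed

end

end

text \<open>At \<open>Infinity\<close> the division by 0 yields the default 0. This is harmless,
  since a rational function may take arbitrary values off a nonempty open set.\<close>

definition xval :: "quad \<Rightarrow> (quad \<Rightarrow> P1) \<Rightarrow> complex" where
  "xval q x = fst (hcoord (x q)) / snd (hcoord (x q))"

definition xord :: "nat set \<Rightarrow> quad \<Rightarrow> int" where
  "xord A = (\<lambda>(i, j, k, l). of_bool (splits A i j k l) - of_bool (splits A j i k l))"

lemma xval_P1_point: "b \<noteq> 0 \<Longrightarrow> x q = P1_point a b \<Longrightarrow> xval q x = a / b"
  by (simp add: xval_def P1_point_def)

context boundary_chart
begin

lemma E_nz: "p \<in> {1..n} \<Longrightarrow> q \<in> {1..n} \<Longrightarrow> p \<noteq> q \<Longrightarrow> E p q \<noteq> 0"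
  using E_dvd_disc[of p q] ch.D_nz by auto

lemma good_not_dvd_E: "ch.good f \<Longrightarrow> p \<in> {1..n} \<Longrightarrow> q \<in> {1..n} \<Longrightarrow> p \<noteq> q \<Longrightarrow> \<not> f dvd E p q"
  using E_dvd_disc[of p q] dvd_trans by (auto simp: ch.good_def)

lemma Var0_nz: "Var 0 \<noteq> 0"
  using good_0 by (auto simp: ch.good_def)

lemma frac_xval: "q \<in> quads n \<Longrightarrow> ch.frac_rep (xval q) (num q) (den q) \<and> num q \<noteq> 0 \<and> den q \<noteq> 0"
proof -
  assume q: "q \<in> quads n"
  obtain i j k l where ijkl: "q = (i, j, k, l)" by (cases q)
  have m: "i \<in> {1..n}" "j \<in> {1..n}" "k \<in> {1..n}" "l \<in> {1..n}" "i \<noteq> k" "j \<noteq> l" "j \<noteq> k" "i \<noteq> l"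
    using q unfolding ijkl quads_iff by auto
  have "num q \<noteq> 0" "den q \<noteq> 0"
    using E_nz[OF m(1,3)] E_nz[OF m(2,4)] E_nz[OF m(2,3)] E_nz[OF m(1,4)] m(5-8) Var0_nz
    by (simp_all add: ijkl num_def den_def)
  moreover have "xval q y = ev (num q) (ch.phi y) / ev (den q) (ch.phi y)"
    if "y \<in> U" "ev (den q) (ch.phi y) \<noteq> 0" for y
  proof (rule xval_P1_point[OF that(2)])
    have "psi (ch.phi y) q = P1_point (ev (num q) (ch.phi y)) (ev (den q) (ch.phi y))"
      by (rule ch.psi_coord[OF ch.D_phi_nz[OF that(1)] q])
    then show "y q = P1_point (ev (num q) (ch.phi y)) (ev (den q) (ch.phi y))"
      using ch.psi_phi[OF that(1)] by simp
  qed
  ultimately show ?thesis using vars_num_den[OF q] by (simp add: ch.frac_rep_def)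
qed

text \<open>The factors \<open>E\<close> divide \<open>disc\<close> and have no zeros on the chart,
  so only the explicit power of \<open>Var 0\<close> contributes.\<close>

lemma multiplicity_num_den:
  assumes q: "(i, j, k, l) \<in> quads n" and p: "ch.good p"
  shows "multiplicity p (num (i, j, k, l)) = (if splits A i j k l then multiplicity p (Var 0) else 0)"
    "multiplicity p (den (i, j, k, l)) = (if splits A j i k l then multiplicity p (Var 0) else 0)"
proof -
  have m: "i \<in> {1..n}" "j \<in> {1..n}" "k \<in> {1..n}" "l \<in> {1..n}" "i \<noteq> k" "j \<noteq> l" "j \<noteq> k" "i \<noteq> l"
    using q unfolding quads_iff by auto
  have pe: "prime_elem p" using p by (simp add: ch.good_def)
  have 0: "multiplicity p (E r s) = 0" if "r \<in> {1..n}" "s \<in> {1..n}" "r \<noteq> s" for r s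
    using good_not_dvd_E[OF p that] by (rule not_dvd_imp_multiplicity_0)
  have nz: "E i k \<noteq> 0" "E j l \<noteq> 0" "E j k \<noteq> 0" "E i l \<noteq> 0"
    using E_nz m by blast+
  have 00: "multiplicity p (E i k) = 0" "multiplicity p (E j l) = 0" "multiplicity p (E j k) = 0" "multiplicity p (E i l) = 0"
    using 0 m by blast+
  show "multiplicity p (num (i, j, k, l)) = (if splits A i j k l then multiplicity p (Var 0) else 0)"
    "multiplicity p (den (i, j, k, l)) = (if splits A j i k l then multiplicity p (Var 0) else 0)"
    using nz Var0_nz 00 by (simp_all add: num_def den_def prime_elem_multiplicity_mult_distrib[OF pe])
qed

lemma ord_xval_bd:
  assumes "q \<in> quads n"
  shows "ord_along (quads n) (Mbar n) (bd n A) (xval q) = xord A q"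
proof -
  obtain i j k l where ijkl: "q = (i, j, k, l)" by (cases q)
  have "ord_along (quads n) (Mbar n) (bd n A) (xval q) =
      int (multiplicity (Var 0) (num q)) - int (multiplicity (Var 0) (den q))"
    unfolding hyp_cl_0[symmetric] using frac_xval[OF assms] by (intro ch.ord_along_hyp_cl[OF good_0]) simp_all
  moreover have "multiplicity (Var 0) (Var 0) = 1"
    using good_0 by (intro multiplicity_self) (auto simp: ch.good_def prime_elem_def)
  ultimately show ?thesis
    using multiplicity_num_den[OF _ good_0, of i j k l] assms by (simp add: ijkl xord_def)
qed

lemma not_dvd_Var0:
  assumes p: "ch.good p" and M: "ch.hyp_cl p \<inter> M_smooth n \<noteq> {}"
  shows "\<not> p dvd Var 0"
proof
  assume "p dvd Var 0"
  then obtain r where r: "Var 0 = p * r" by blast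
  have "irreducible (Var 0)" using good_0 by (auto simp: ch.good_def prime_elem_imp_irreducible)
  then have "is_unit r" using r p by (auto simp: irreducible_def ch.good_def prime_elem_def)
  then obtain c where c: "c \<noteq> 0" "r = Cst c" using is_unit_mp_iff by blast
  have "ch.hyp p = ch.hyp (Var 0)" unfolding ch.hyp_def r c(2) using c(1) by simp
  then have "ch.hyp_cl p = bd n A" using hyp_cl_0 by (simp add: ch.hyp_cl_def)
  moreover obtain x where x: "x \<in> ch.hyp_cl p" "x \<in> M_smooth n" using M by blast
  ultimately have "x \<in> ch.hyp_cl (Var 0) \<inter> U" using smooth_U hyp_cl_0 by blast
  then have "x \<in> two_comp_locus n A" using ch.hyp_cl_U[of "Var 0"] zero_vars hyp_0 by simp
  then show False using x smooth_two_comp_disjoint[OF boundary_index_A] by blast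
qed

lemma smooth_prime_divisor:
  assumes "prime_divisor (quads n) (Mbar n) Y" "Y \<inter> M_smooth n \<noteq> {}"
  shows "\<exists>p. ch.good p \<and> Y = ch.hyp_cl p \<and> \<not> p dvd Var 0"
proof -
  have "Y \<inter> U \<noteq> {}" using assms(2) smooth_U by blast
  then obtain p where "ch.good p" "Y = ch.hyp_cl p" using ch.prime_divisor_eq_hyp_cl[OF assms(1)] by blast
  then show ?thesis using not_dvd_Var0 assms(2) by blast
qed

lemma ord_xval_smooth:
  assumes "prime_divisor (quads n) (Mbar n) Y" "Y \<inter> M_smooth n \<noteq> {}" "q \<in> quads n"
  shows "ord_along (quads n) (Mbar n) Y (xval q) = 0"
proof -
  obtain i j k l where ijkl: "q = (i, j, k, l)" by (cases q)
  obtain p where p: "ch.good p" "Y = ch.hyp_cl p" "\<not> p dvd Var 0"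
    using smooth_prime_divisor[OF assms(1,2)] by blast
  have "multiplicity p (Var 0) = 0" using p(3) by (rule not_dvd_imp_multiplicity_0)
  moreover have "ord_along (quads n) (Mbar n) Y (xval q) = int (multiplicity p (num q)) - int (multiplicity p (den q))"
    unfolding p(2) using frac_xval[OF assms(3)] by (intro ch.ord_along_hyp_cl[OF p(1)]) simp_all
  ultimately show ?thesis
    using multiplicity_num_den[OF _ p(1), of i j k l] assms(3) by (simp add: ijkl)
qed

end

lemma ord_xval_boundary:
  "boundary_index n A \<Longrightarrow> q \<in> quads n \<Longrightarrow> ord_along (quads n) (Mbar n) (bd n A) (xval q) = xord A q"
  using ex_boundary_chart boundary_chart.ord_xval_bd by blast

context
  fixes n :: nat
  assumes n: "n \<ge> 4"
begin

abbreviation "PD \<equiv> prime_divisor (quads n) (Mbar n)"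
abbreviation "Ord \<equiv> ord_along (quads n) (Mbar n)"
abbreviation "Rat \<equiv> nzrat (quads n) (Mbar n)"
abbreviation "Req \<equiv> rational_eq (quads n) (Mbar n)"

lemma prime_divisor_chart:
  assumes "PD Y"
  shows "\<exists>A i0 i1 j0 j1. boundary_chart n A i0 i1 j0 j1 \<and> Y \<inter> boundary_chart.U n A \<noteq> {}"
proof -
  consider A where "boundary_index n A" "Y = bd n A" | "Y \<inter> M_smooth n \<noteq> {}"
    using prime_divisor_cases[OF n assms] by blast
  then have "\<exists>A. boundary_index n A \<and> (Y = bd n A \<or> Y \<inter> M_smooth n \<noteq> {})"
    by cases (blast, use ex_boundary_index[OF n] in blast)
  then obtain A where bA: "boundary_index n A" "Y = bd n A \<or> Y \<inter> M_smooth n \<noteq> {}"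
    by blast
  then obtain i0 i1 j0 j1 where *: "boundary_chart n A i0 i1 j0 j1" using ex_boundary_chart by blast
  then interpret boundary_chart n A i0 i1 j0 j1 .
  have "Y \<inter> U \<noteq> {}"
    using bA(2)
  proof
    assume "Y = bd n A"
    moreover obtain y where "y \<in> two_comp_locus n A" using bd_props(5)[OF bA(1)] by blast
    ultimately show ?thesis using two_comp_U bd_props(4)[OF bA(1)] by blast
  next
    assume "Y \<inter> M_smooth n \<noteq> {}" then show ?thesis using smooth_U by blast
  qed
  then show ?thesis using * by blast
qed

lemma ex_chart: "\<exists>A i0 i1 j0 j1. boundary_chart n A i0 i1 j0 j1"
  using ex_boundary_index[OF n] ex_boundary_chart by blast

lemma Rat_const: "c \<noteq> 0 \<Longrightarrow> Rat (\<lambda>_. c)"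
  and Rat_mult: "Rat f \<Longrightarrow> Rat f' \<Longrightarrow> Rat (\<lambda>y. f y * f' y)"
  and Rat_inverse: "Rat f \<Longrightarrow> Rat (\<lambda>y. inverse (f y))"
  and Rat_xval: "q \<in> quads n \<Longrightarrow> Rat (xval q)"
proof -
  obtain A i0 i1 j0 j1 where "boundary_chart n A i0 i1 j0 j1" using ex_chart by blast
  then interpret boundary_chart n A i0 i1 j0 j1 .
  show "c \<noteq> 0 \<Longrightarrow> Rat (\<lambda>_. c)" by (rule ch.nzrat_const)
  show "Rat f \<Longrightarrow> Rat f' \<Longrightarrow> Rat (\<lambda>y. f y * f' y)" by (rule ch.nzrat_mult)
  show "Rat f \<Longrightarrow> Rat (\<lambda>y. inverse (f y))" by (rule ch.nzrat_inverse)
  show "q \<in> quads n \<Longrightarrow> Rat (xval q)" using frac_xval[of q] unfolding ch.nzrat_iff by blast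
qed

lemma Ord_const: "PD Y \<Longrightarrow> c \<noteq> 0 \<Longrightarrow> Ord Y (\<lambda>_. c) = 0"
  and Ord_mult: "PD Y \<Longrightarrow> Rat f \<Longrightarrow> Rat f' \<Longrightarrow> Ord Y (\<lambda>y. f y * f' y) = Ord Y f + Ord Y f'"
  and Ord_inverse: "PD Y \<Longrightarrow> Rat f \<Longrightarrow> Ord Y (\<lambda>y. inverse (f y)) = - Ord Y f"
  and Ord_cong: "PD Y \<Longrightarrow> Rat f \<Longrightarrow> Rat f' \<Longrightarrow> Req f f' \<Longrightarrow> Ord Y f = Ord Y f'"
proof -
  assume Y: "PD Y"
  then obtain A i0 i1 j0 j1 where *: "boundary_chart n A i0 i1 j0 j1" "Y \<inter> boundary_chart.U n A \<noteq> {}"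
    using prime_divisor_chart by blast
  interpret boundary_chart n A i0 i1 j0 j1 by (rule *(1))
  show "c \<noteq> 0 \<Longrightarrow> Ord Y (\<lambda>_. c) = 0" by (rule ch.ord_const[OF Y *(2)])
  show "Rat f \<Longrightarrow> Rat f' \<Longrightarrow> Ord Y (\<lambda>y. f y * f' y) = Ord Y f + Ord Y f'" by (rule ch.ord_mult[OF Y *(2)])
  show "Rat f \<Longrightarrow> Ord Y (\<lambda>y. inverse (f y)) = - Ord Y f" by (rule ch.ord_inverse[OF Y *(2)])
  show "Rat f \<Longrightarrow> Rat f' \<Longrightarrow> Req f f' \<Longrightarrow> Ord Y f = Ord Y f'" by (rule ch.ord_cong[OF Y *(2)])
qed

lemma Ord_xval_smooth: "PD Y \<Longrightarrow> Y \<inter> M_smooth n \<noteq> {} \<Longrightarrow> q \<in> quads n \<Longrightarrow> Ord Y (xval q) = 0"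
  using ex_chart boundary_chart.ord_xval_smooth by blast

text \<open>The function has the divisor of a product of powers of cross-ratios. Recording only the
  orders is enough for principal divisors and makes closure under products and inverses
  immediate.\<close>

definition Cr :: "((quad \<Rightarrow> P1) \<Rightarrow> complex) \<Rightarrow> bool" where
  "Cr f \<longleftrightarrow> Rat f \<and> (\<exists>k :: quad \<Rightarrow> int. \<forall>Y. PD Y \<longrightarrow> Ord Y f = (\<Sum>q\<in>quads n. k q * Ord Y (xval q)))"

lemma Cr_const: "c \<noteq> 0 \<Longrightarrow> Cr (\<lambda>_. c)"
  unfolding Cr_def using Rat_const Ord_const by (intro conjI exI[of _ "\<lambda>_. 0"]) auto

lemma Cr_xval: "q \<in> quads n \<Longrightarrow> Cr (xval q)"
  unfolding Cr_def using Rat_xval finite_quads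
  by (intro conjI exI[of _ "\<lambda>r. if r = q then 1 else 0"]) (auto simp: if_distrib[of "\<lambda>x. x * _"] cong: if_cong)

lemma Cr_mult: "Cr f \<Longrightarrow> Cr f' \<Longrightarrow> Cr (\<lambda>y. f y * f' y)"
proof -
  assume a: "Cr f" "Cr f'"
  obtain k where k: "\<forall>Y. PD Y \<longrightarrow> Ord Y f = (\<Sum>q\<in>quads n. k q * Ord Y (xval q))" using a(1) unfolding Cr_def by blast
  obtain k' where k': "\<forall>Y. PD Y \<longrightarrow> Ord Y f' = (\<Sum>q\<in>quads n. k' q * Ord Y (xval q))" using a(2) unfolding Cr_def by blast
  have R: "Rat f" "Rat f'" using a by (simp_all add: Cr_def)
  have "Ord Y (\<lambda>y. f y * f' y) = (\<Sum>q\<in>quads n. (k q + k' q) * Ord Y (xval q))" if "PD Y" for Y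
    using k k' that Ord_mult[OF that R] by (simp add: distrib_right sum.distrib)
  then show ?thesis unfolding Cr_def using Rat_mult[OF R] by (intro conjI exI[of _ "\<lambda>q. k q + k' q"]) auto
qed

lemma Cr_inverse: "Cr f \<Longrightarrow> Cr (\<lambda>y. inverse (f y))"
proof -
  assume a: "Cr f"
  obtain k where k: "\<forall>Y. PD Y \<longrightarrow> Ord Y f = (\<Sum>q\<in>quads n. k q * Ord Y (xval q))" using a unfolding Cr_def by blast
  have R: "Rat f" using a by (simp add: Cr_def)
  have "Ord Y (\<lambda>y. inverse (f y)) = (\<Sum>q\<in>quads n. (- k q) * Ord Y (xval q))" if "PD Y" for Y
    using k that Ord_inverse[OF that R] by (simp add: sum_negf)
  then show ?thesis unfolding Cr_def using Rat_inverse[OF R] by (intro conjI exI[of _ "\<lambda>q. - k q"]) auto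
qed

lemma Cr_cong: "Cr f \<Longrightarrow> Rat f' \<Longrightarrow> Req f' f \<Longrightarrow> Cr f'"
proof -
  assume a: "Cr f" "Rat f'" "Req f' f"
  then have "Ord Y f' = Ord Y f" if "PD Y" for Y using Ord_cong[OF that, of f' f] by (simp add: Cr_def)
  then show ?thesis using a unfolding Cr_def by simp
qed

end

section \<open>Functions with divisors supported on the boundary\<close>

lemma prime_elem_dvd_prodD:
  fixes p :: "'a :: comm_semiring_1"
  assumes "prime_elem p" "finite S" "p dvd prod f S"
  shows "\<exists>x\<in>S. p dvd f x"
  using assms(2,3)
proof (induction S rule: finite_induct)
  case empty
  then show ?case using assms(1) by (simp add: prime_elem_def)
next
  case (insert x S)
  then show ?case using prime_elem_dvd_multD[OF assms(1), of "f x" "prod f S"] by auto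
qed

section \<open>Units on the interior as products of cross-ratios\<close>

context boundary_chart
begin

lemma n4: "n \<ge> 4"
proof -
  have "card A \<ge> 2" "card A \<le> n - 2" using boundary_index_A by (simp_all add: boundary_index_def)
  then show ?thesis by linarith
qed

text \<open>Carries \<open>Cr\<close> over to pairs of polynomials. By \<open>crf_cross\<close> it
  depends only on the fraction, so it can be verified on factors.\<close>

definition crf :: "mp \<Rightarrow> mp \<Rightarrow> bool" where
  "crf g h \<longleftrightarrow> (\<exists>f. ch.frac_rep f g h \<and> g \<noteq> 0 \<and> Cr n f)"

lemma crf_nz: "crf g h \<Longrightarrow> g \<noteq> 0 \<and> h \<noteq> 0 \<and> vars_in vars g \<and> vars_in vars h"
  by (auto simp: crf_def ch.frac_rep_def)

lemma crf_mult: "crf g h \<Longrightarrow> crf g' h' \<Longrightarrow> crf (g * g') (h * h')"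
proof -
  assume a: "crf g h" "crf g' h'"
  obtain f where f: "ch.frac_rep f g h" "Cr n f" "g \<noteq> 0" using a(1) unfolding crf_def by blast
  obtain f' where f': "ch.frac_rep f' g' h'" "Cr n f'" "g' \<noteq> 0" using a(2) unfolding crf_def by blast
  have "g * g' \<noteq> 0" using f f' by simp
  then show ?thesis unfolding crf_def using ch.frac_mult[OF f(1) f'(1)] Cr_mult[OF n4 f(2) f'(2)] by blast
qed

lemma crf_inverse_aux: "crf g h \<Longrightarrow> crf (h * h) (g * h)"
proof -
  assume a: "crf g h"
  obtain f where f: "ch.frac_rep f g h" "Cr n f" "g \<noteq> 0" using a unfolding crf_def by blast
  have "h * h \<noteq> 0" using crf_nz[OF a] by simp
  then show ?thesis unfolding crf_def using ch.frac_inverse[OF f(1,3)] Cr_inverse[OF n4 f(2)] by blast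
qed

lemma frac_quot:
  assumes "vars_in vars g" "vars_in vars h" "h \<noteq> 0"
  shows "ch.frac_rep (\<lambda>y. ev g (ch.phi y) / ev h (ch.phi y)) g h"
  using assms by (simp add: ch.frac_rep_def)

lemma crf_cross_rep:
  assumes "crf g h" "ch.frac_rep f g' h'" "g' \<noteq> 0" "g * h' = g' * h"
  shows "Cr n f"
proof -
  obtain f0 where f0: "ch.frac_rep f0 g h" "Cr n f0" using assms(1) unfolding crf_def by blast
  have "rational_eq (quads n) (Mbar n) f f0"
    by (rule ch.frac_cross_rational_eq[OF assms(2) f0(1) assms(4)[symmetric]])
  moreover have "nzrat (quads n) (Mbar n) f" unfolding ch.nzrat_iff using assms(2,3) by blast
  ultimately show ?thesis using Cr_cong[OF n4 f0(2)] by blast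
qed

lemma crf_cross:
  assumes "crf g h" "vars_in vars g'" "vars_in vars h'" "g' \<noteq> 0" "h' \<noteq> 0" "g * h' = g' * h"
  shows "crf g' h'"
  using crf_cross_rep[OF assms(1) frac_quot[OF assms(2,3,5)] assms(4,6)] frac_quot[OF assms(2,3,5)] assms(4)
  unfolding crf_def by blast

lemma crf_inverse: "crf g h \<Longrightarrow> crf h g"
  using crf_cross[OF crf_inverse_aux, of g h h g] crf_nz[of g h] by (simp add: mult_ac)

lemma crf_divide: "crf g 1 \<Longrightarrow> crf h 1 \<Longrightarrow> crf g h"
  using crf_mult[of g 1 1 h] crf_inverse[of h 1] by simp

lemma crf_Cst: "c \<noteq> 0 \<Longrightarrow> crf (Cst c) 1"
proof -
  assume c: "c \<noteq> 0"
  then have "is_unit (Cst c)" using is_unit_mp_iff by blast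
  then have "Cst c \<noteq> 0" by auto
  then show ?thesis unfolding crf_def using ch.frac_const[of c] Cr_const[OF n4 c] by blast
qed

lemma crf_unit: "is_unit u \<Longrightarrow> crf u 1"
  using crf_Cst is_unit_mp_iff by auto

lemma crf_minus: "crf g 1 \<Longrightarrow> crf (- g) 1"
proof -
  assume "crf g 1"
  then have "crf ((- 1) * g) (1 * 1)" by (rule crf_mult[OF crf_unit, rotated]) simp
  then show ?thesis by simp
qed

lemma crf_xval:
  assumes "q \<in> quads n"
  shows "crf (num q) (den q)"
  unfolding crf_def using frac_xval[OF assms] Cr_xval[OF n4 assms] by blast

lemma crf_num: "q \<in> quads n \<Longrightarrow> crf (den q) 1 \<Longrightarrow> crf (num q) 1"
  using crf_mult[OF crf_xval, of q "den q" 1] crf_cross[of "num q * den q" "den q * 1" "num q" 1] crf_nz[OF crf_xval, of q]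
  by simp

text \<open>By the choice of \<open>qv\<close> the coordinate is up to sign a cross-ratio: its
  \<open>den\<close> is 1 or -1.\<close>

lemma crf_Var:
  assumes "v \<in> vars"
  shows "crf (Var v) 1"
proof -
  have v: "v = 0 \<or> (v \<noteq> 0 \<and> v \<noteq> i0 \<and> v \<noteq> i1 \<and> v \<noteq> j0 \<and> v \<noteq> j1)"
    using assms pos unfolding vars_def by blast
  have *: "(num (qv v) = Var v \<or> num (qv v) = - Var v) \<and> (den (qv v) = 1 \<or> den (qv v) = - 1)"
  proof (cases "v = 0")
    case True
    then show ?thesis by (simp add: qv_def num_def den_def splits_def E_def)
  next
    case False
    then have "zc v = Var v" using v by (simp add: zc_def)
    then show ?thesis using False
      by (cases "v \<in> A") (simp_all add: qv_def num_def den_def splits_def E_def)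
  qed
  have "crf (den (qv v)) 1" using * crf_unit[of "den (qv v)"] by auto
  then have "crf (num (qv v)) 1" by (rule crf_num[OF qv_quads[OF assms]])
  then show ?thesis using * crf_minus[of "- Var v"] by (cases "num (qv v) = Var v") simp_all
qed

lemma crf_zc:
  assumes "p \<in> {1..n}" "p \<noteq> i0" "p \<noteq> j0"
  shows "crf (zc p) 1"
proof (cases "p = i1 \<or> p = j1")
  case True
  then show ?thesis using crf_unit[of 1] by auto
next
  case False
  then have "p \<in> vars" using assms unfolding vars_def by blast
  then have "crf (Var p) 1" by (rule crf_Var)
  then show ?thesis using False assms(2,3) by (simp add: zc_def)
qed

text \<open>Complete \<open>p, q\<close> to a quadruple by \<open>i0\<close> and \<open>j0\<close>,
  whose coordinate \<open>zc\<close> is 0. The other three determinants of its cross-ratio are then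
  signs or the coordinate of a single mark, which \<open>crf_zc\<close> covers.\<close>

lemma crf_E:
  assumes "p \<in> {1..n}" "q \<in> {1..n}" "p \<noteq> q"
  shows "crf (E p q) 1"
proof -
  have one: "crf (- 1) 1" "crf 1 1" by (rule crf_unit; simp)+
  have q: "(p, b, q, a) \<in> quads n"
    if "a \<in> {i0, j0}" "b \<in> {i0, j0}" "a \<noteq> b" "p \<notin> {i0, j0}" "q \<notin> {i0, j0}" for a b
    using that assms mem_n unfolding quads_iff by auto
  have z: "E i0 j0 = - 1" "E j0 i0 = 1" by (simp_all add: E_def)
  consider "p \<in> A" "q \<in> A" | "p \<notin> A" "q \<notin> A" | "p \<in> A" "q \<notin> A" | "p \<notin> A" "q \<in> A" by blast
  then show ?thesis
  proof cases
    case 1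
    then have "p \<noteq> j0" "q \<noteq> j0" by auto
    consider "p = i0" | "q = i0" | "p \<noteq> i0" "q \<noteq> i0" by blast
    then show ?thesis
    proof cases
      case a: 1
      have "crf (- zc q) 1" using assms(3) \<open>q \<noteq> j0\<close> a by (intro crf_minus crf_zc[OF assms(2)]) simp_all
      then show ?thesis using a 1 by (simp add: E_def)
    next
      case a: 2
      have "crf (zc p) 1" using assms(3) \<open>p \<noteq> j0\<close> a by (intro crf_zc[OF assms(1)]) simp_all
      then show ?thesis using a 1 by (simp add: E_def)
    next
      case a: 3
      have "crf (zc p) 1" using \<open>p \<noteq> j0\<close> a by (intro crf_zc[OF assms(1)]) simp_all
      moreover have "num (p, j0, q, i0) = E p q" "den (p, j0, q, i0) = zc p"
        using 1 by (simp_all add: num_def den_def splits_def z) (simp_all add: E_def)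
      moreover have "(p, j0, q, i0) \<in> quads n" using a \<open>p \<noteq> j0\<close> \<open>q \<noteq> j0\<close> by (intro q) auto
      ultimately show ?thesis using crf_num[of "(p, j0, q, i0)"] by simp
    qed
  next
    case 2
    then have "p \<noteq> i0" "q \<noteq> i0" by auto
    consider "p = j0" | "q = j0" | "p \<noteq> j0" "q \<noteq> j0" by blast
    then show ?thesis
    proof cases
      case a: 1
      have "crf (zc q) 1" using assms(3) \<open>q \<noteq> i0\<close> a by (intro crf_zc[OF assms(2)]) simp_all
      then show ?thesis using a 2 by (simp add: E_def)
    next
      case a: 2
      have "crf (- zc p) 1" using assms(3) \<open>p \<noteq> i0\<close> a by (intro crf_minus crf_zc[OF assms(1)]) simp_all
      then show ?thesis using a 2 by (simp add: E_def)
    next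
      case a: 3
      have "crf (zc p) 1" using \<open>p \<noteq> i0\<close> a by (intro crf_zc[OF assms(1)]) simp_all
      moreover have "num (p, i0, q, j0) = - E p q" "den (p, i0, q, j0) = zc p"
        using 2 by (simp_all add: num_def den_def splits_def z) (simp_all add: E_def)
      moreover have "(p, i0, q, j0) \<in> quads n" using a \<open>p \<noteq> i0\<close> \<open>q \<noteq> i0\<close> by (intro q) auto
      ultimately show ?thesis using crf_num[of "(p, i0, q, j0)"] crf_minus[of "- E p q"] by simp
    qed
  next
    case 3
    show ?thesis
    proof (cases "p = i0 \<or> q = j0")
      case True
      then have "E p q = - 1" using 3 by (auto simp: E_def)
      then show ?thesis using one by simp
    next
      case False
      then have "num (p, i0, q, j0) = - E p q" "den (p, i0, q, j0) = 1"
        using 3 by (simp_all add: num_def den_def splits_def z) (simp_all add: E_def)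
      moreover have "(p, i0, q, j0) \<in> quads n" using False 3 by (intro q) auto
      ultimately show ?thesis using crf_num[of "(p, i0, q, j0)"] crf_minus[of "- E p q"] one by simp
    qed
  next
    case 4
    show ?thesis
    proof (cases "p = j0 \<or> q = i0")
      case True
      then have "E p q = 1" using 4 by (auto simp: E_def)
      then show ?thesis using one by simp
    next
      case False
      then have "num (p, j0, q, i0) = E p q" "den (p, j0, q, i0) = 1"
        using 4 by (simp_all add: num_def den_def splits_def z) (simp_all add: E_def)
      moreover have "(p, j0, q, i0) \<in> quads n" using False 4 by (intro q) auto
      ultimately show ?thesis using crf_num[of "(p, j0, q, i0)"] one by simp
    qed
  qed
qed

lemma zc_cases: "p \<in> {1..n} \<Longrightarrow> zc p = Var p \<or> zc p \<in> {0, 1}"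
  by (simp add: zc_def)

lemma irreducible_minus: "irreducible (- x) \<longleftrightarrow> irreducible (x :: mp)"
proof -
  have *: "irreducible (- x)" if "irreducible x" for x :: mp
    using irreducible_mult_unit_left[of "- 1" x] that by simp
  show ?thesis using *[of x] *[of "- x"] by auto
qed

lemma zc_diff:
  assumes "p \<in> {1..n}" "q \<in> {1..n}" "p \<noteq> q" "p \<in> A \<longleftrightarrow> q \<in> A"
  shows "irreducible (zc p - zc q) \<or> is_unit (zc p - zc q)"
proof -
  have vq: "vars_in (- {r}) (zc s)" if "r \<noteq> s" for r s
    using that by (auto simp: zc_def)
  have *: "irreducible (zc r - zc s)" if "zc r = Var r" "r \<noteq> s" for r s
  proof -
    have "irreducible (1 * Var r + (- zc s))"
      using vq[OF that(2)] by (intro irreducible_linear) auto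
    then show ?thesis using that(1) by simp
  qed
  consider "zc p = Var p" | "zc q = Var q" | "zc p \<in> {0, 1}" "zc q \<in> {0, 1}"
    using zc_cases[OF assms(1)] zc_cases[OF assms(2)] by blast
  then show ?thesis
  proof cases
    case 1 then show ?thesis using *[of p q] assms(3) by simp
  next
    case 2
    then have "irreducible (- (zc p - zc q))" using *[of q p] assms(3) by simp
    then show ?thesis unfolding irreducible_minus by simp
  next
    case 3
    \<comment> \<open>A variable is neither 0 nor 1, so here both marks are normalised ones, and two
      of these on the same side differ by 1 or -1.\<close>
    have "Var r \<noteq> 0" "Var r \<noteq> 1" for r
    proof -
      have d: "degv r (Var r) = 1"
      proof -
        have "in_var r (Var r) = [:0, 1:]" by (rule in_var_eqI) (auto intro!: coeffs_in_pCons)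
        then show ?thesis by (simp add: degv_def)
      qed
      have "degv r c = 0" if "c = 0 \<or> c = 1" for c :: mp using that unfolding degv_eq_0_iff by auto
      then show "Var r \<noteq> 0" "Var r \<noteq> 1" using d by fastforce+
    qed
    then have "p \<in> {i0, j0, i1, j1}" "q \<in> {i0, j0, i1, j1}" using 3 by (auto simp: zc_def split: if_splits)
    then show ?thesis using assms(3,4) by auto
  qed
qed

text \<open>On one side \<open>E\<close> is a difference of coordinates, linear with leading
  coefficient a sign. Across the sides it is linear in \<open>Var 0\<close> with constant term a
  unit, or itself a unit.\<close>

lemma irreducible_E:
  assumes "p \<in> {1..n}" "q \<in> {1..n}" "p \<noteq> q"
  shows "irreducible (E p q) \<or> is_unit (E p q)"
proof -
  have *: "irreducible (zc p * zc q * Var 0 + (- 1)) \<or> is_unit (zc p * zc q * Var 0 + (- 1))"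
  proof (cases "zc p * zc q = 0")
    case True
    then have "zc p * zc q * Var 0 + (- 1) = - 1" by simp
    then show ?thesis by (simp only:) simp
  next
    case False
    have "vars_in (- {0}) (zc r)" if "r \<in> {1..n}" for r using pos[OF that] by (auto simp: zc_def)
    then have v: "vars_in (- {0}) (zc p)" "vars_in (- {0}) (zc q)" using assms by blast+
    show ?thesis using False v by (intro disjI1[OF irreducible_linear]) simp_all
  qed
  consider "p \<in> A" "q \<in> A" | "p \<notin> A" "q \<notin> A" | "p \<in> A" "q \<notin> A" | "p \<notin> A" "q \<in> A" by blast
  then show ?thesis
  proof cases
    case 1
    then have "E p q = zc p - zc q" by (simp add: E_def)
    then show ?thesis using zc_diff[OF assms] 1 by metis
  next
    case 2
    then have "E p q = zc q - zc p" by (simp add: E_def)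
    then show ?thesis using zc_diff[OF assms(2,1)] assms(3) 2 by metis
  next
    case 3
    then have "E p q = zc p * zc q * Var 0 + (- 1)" by (simp add: E_def)
    then show ?thesis using * by (simp only:)
  next
    case 4
    then have "E p q = - (zc p * zc q * Var 0 + (- 1))" by (simp add: E_def)
    then show ?thesis using * irreducible_minus[of "zc p * zc q * Var 0 + (- 1)"]
      by (simp only: minus_dvd_iff)
  qed
qed

text \<open>The primes whose hypersurface meets the interior; all others are units on
  \<open>M_smooth n\<close>.\<close>

definition live :: "mp \<Rightarrow> bool" where
  "live p \<longleftrightarrow> ch.good p \<and> \<not> p dvd Var 0"

lemma crf_associate:
  assumes x: "irreducible x" "x dvd e" and e: "crf e 1" "irreducible e \<or> is_unit e"
  shows "crf x 1"
proof -
  obtain r where r: "e = x * r" using x(2) by blast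
  have nu: "\<not> is_unit x" using x(1) by (simp add: irreducible_def)
  then have "\<not> is_unit e" using r by (auto simp: is_unit_mult_iff)
  then have ru: "is_unit r" using e(2) nu r by (auto simp: irreducible_def)
  have "crf (x * r) r" using crf_divide[OF e(1) crf_unit[OF ru]] r by simp
  moreover have "vars_in vars x" using vars_in_factor[of vars x r] crf_nz[OF e(1)] r by simp
  moreover have "x \<noteq> 0" using crf_nz[OF e(1)] r by auto
  ultimately show ?thesis using crf_cross[of "x * r" r x 1] by simp
qed

text \<open>Such a prime divides \<open>Var 0\<close> or one of the factors \<open>E\<close> of
  \<open>disc\<close>. These are irreducible or units, so the prime is an associate of one of
  them.\<close>

lemma crf_not_live:
  assumes x: "irreducible x" "vars_in vars x" "\<not> live x"
  shows "crf x 1"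
proof -
  have pe: "prime_elem x" using x(1) by (rule irreducible_imp_prime_elem_mp)
  then have "x dvd Var 0 \<or> x dvd disc" using x(2,3) by (auto simp: live_def ch.good_def)
  then show ?thesis
  proof
    assume "x dvd Var 0"
    moreover have "irreducible (Var 0)" using good_0 by (auto simp: ch.good_def prime_elem_imp_irreducible)
    ultimately show ?thesis using crf_associate[OF x(1) _ crf_Var[OF zero_vars]] by blast
  next
    assume d: "x dvd disc"
    obtain p where p: "p \<in> {1..n}" "x dvd (\<Prod>q\<in>{1..n} - {p}. E p q)"
      using prime_elem_dvd_prodD[OF pe _ d[unfolded disc_def]] by blast
    obtain q where "q \<in> {1..n} - {p}" "x dvd E p q"
      using prime_elem_dvd_prodD[OF pe _ p(2)] by blast
    then have q: "q \<in> {1..n}" "p \<noteq> q" "x dvd E p q" by auto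
    show ?thesis using crf_associate[OF x(1) q(3) crf_E[OF p(1) q(1,2)] irreducible_E[OF p(1) q(1,2)]] .
  qed
qed

lemma live_prime: "live p \<Longrightarrow> prime_elem p"
  by (simp add: live_def ch.good_def)

lemma live_dvd_not_live:
  assumes "live p" "irreducible x" "vars_in vars x" "p dvd x"
  shows "live x"
proof -
  obtain r where r: "x = p * r" using assms(4) by blast
  have "is_unit r" using assms(2) r live_prime[OF assms(1)] by (auto simp: irreducible_def prime_elem_def)
  then have "x dvd f \<longleftrightarrow> p dvd f" for f using r by (simp add: mult_unit_dvd_iff)
  then show ?thesis
    using assms irreducible_imp_prime_elem_mp[OF assms(2)] by (simp add: live_def ch.good_def)
qed

lemma crf_prod_not_live:
  "(\<And>x. x \<in># S \<Longrightarrow> irreducible x \<and> vars_in vars x \<and> \<not> live x) \<Longrightarrow> crf (prod_mset S) 1"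
proof (induction S)
  case empty then show ?case using crf_unit[of 1] by simp
next
  case (add x S)
  have "crf (prod_mset S) 1" by (rule add.IH) (use add.prems in simp)
  moreover have "crf x 1" using add.prems[of x] crf_not_live[of x] by simp
  ultimately have "crf (x * prod_mset S) (1 * 1)" by (intro crf_mult)
  then show ?case by simp
qed

lemma prod_mset_nz: "(\<And>x. x \<in># S \<Longrightarrow> irreducible x) \<Longrightarrow> prod_mset S \<noteq> (0 :: mp)"
proof -
  assume "\<And>x. x \<in># S \<Longrightarrow> irreducible x"
  then have "0 \<notin># S" using not_irreducible_zero by blast
  then show ?thesis by simp
qed

text \<open>Induction on the factors of the numerator. A factor that is not live belongs to
  \<open>crf\<close> on its own; for a live one the equal multiplicities provide an associate among
  the factors of the denominator, and both are cancelled.\<close>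

lemma crf_same_multiplicities:
  assumes "\<And>x. x \<in># S \<Longrightarrow> irreducible x \<and> vars_in vars x"
    and "\<And>x. x \<in># R \<Longrightarrow> irreducible x \<and> vars_in vars x"
    and "\<And>p. live p \<Longrightarrow> multiplicity p (prod_mset S) = multiplicity p (prod_mset R)"
  shows "crf (prod_mset S) (prod_mset R)"
  using assms
proof (induction S arbitrary: R)
  case empty
  have "\<not> live x" if x: "x \<in># R" for x
  proof
    assume "live x"
    have "x dvd prod_mset R" using x by (rule dvd_prod_mset)
    moreover have "prod_mset R \<noteq> 0" using empty.prems(2) by (intro prod_mset_nz) blast
    moreover have "\<not> is_unit x" using live_prime[OF \<open>live x\<close>] by (simp add: prime_elem_def)
    ultimately have "multiplicity x (prod_mset R) \<noteq> 0"
      using multiplicity_eq_zero_iff[of "prod_mset R" x] by blast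
    then show False using empty.prems(3)[OF \<open>live x\<close>] by simp
  qed
  then have "crf (prod_mset R) 1" using empty.prems(2) by (intro crf_prod_not_live) blast
  then show ?case using crf_inverse by simp
next
  case (add x S)
  have x: "irreducible x" "vars_in vars x" "x \<noteq> 0" using add.prems(1)[of x] by auto
  have S: "irreducible y \<and> vars_in vars y" if "y \<in># S" for y using add.prems(1)[of y] that by simp
  have Snz: "prod_mset S \<noteq> 0" using S by (intro prod_mset_nz) blast
  have Rnz: "prod_mset R \<noteq> 0" using add.prems(2) by (intro prod_mset_nz) blast
  have mS: "multiplicity p (x * prod_mset S) = multiplicity p x + multiplicity p (prod_mset S)" if "live p" for p
    using prime_elem_multiplicity_mult_distrib[OF live_prime[OF that]] x(3) Snz by blast
  show ?case
  proof (cases "live x")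
    case False
    have "multiplicity p (prod_mset S) = multiplicity p (prod_mset R)" if p: "live p" for p
    proof -
      have "\<not> p dvd x" using live_dvd_not_live[OF p x(1,2)] False by blast
      then have "multiplicity p x = 0" by (rule not_dvd_imp_multiplicity_0)
      then show ?thesis using add.prems(3)[OF p] mS[OF p] by simp
    qed
    then have "crf (prod_mset S) (prod_mset R)" using add.IH[OF S add.prems(2)] by blast
    then have "crf (x * prod_mset S) (1 * prod_mset R)" by (intro crf_mult crf_not_live x False)
    then show ?thesis by simp
  next
    case True
    have "multiplicity x (prod_mset R) = multiplicity x x + multiplicity x (prod_mset S)"
      using add.prems(3)[OF True] mS[OF True] by simp
    moreover have "multiplicity x x = 1" using x by (intro multiplicity_self) (auto simp: irreducible_def)
    ultimately have "x dvd prod_mset R"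
      using not_dvd_imp_multiplicity_0[of x "prod_mset R"] by (cases "x dvd prod_mset R") auto
    then obtain b where b: "b \<in># R" "x dvd b" using prime_elem_dvd_prod_msetE[OF live_prime[OF True]] by blast
    obtain R' where R': "R = add_mset b R'" using b(1) by (meson multi_member_split)
    obtain r where r: "b = x * r" using b(2) by blast
    have bi: "irreducible b" "vars_in vars b" using add.prems(2)[OF b(1)] by auto
    have ru: "is_unit r" using bi(1) r x(1) by (auto simp: irreducible_def)
    have R'i: "irreducible y \<and> vars_in vars y" if "y \<in># R'" for y using add.prems(2)[of y] that R' by simp
    have R'nz: "prod_mset R' \<noteq> 0" using R'i by (intro prod_mset_nz) blast
    have "multiplicity p (prod_mset S) = multiplicity p (prod_mset R')" if p: "live p" for p
    proof -
      have m: "multiplicity p (f * g) = multiplicity p f + multiplicity p g" if "f \<noteq> 0" "g \<noteq> 0" for f g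
        using prime_elem_multiplicity_mult_distrib[OF live_prime[OF p] that] .
      have "r \<noteq> 0" using ru by auto
      moreover have "multiplicity p r = 0"
        using ru live_prime[OF p] by (simp add: multiplicity_unit_right)
      ultimately have "multiplicity p (prod_mset R) = multiplicity p x + multiplicity p (prod_mset R')"
        using R'nz x(3) by (simp add: R' r m)
      then show ?thesis using add.prems(3)[OF p] mS[OF p] by simp
    qed
    then have "crf (prod_mset S) (prod_mset R')" using add.IH[OF S R'i] by blast
    moreover have "crf x b"
    proof -
      have "crf 1 r" using crf_inverse[OF crf_unit[OF ru]] .
      moreover have "b \<noteq> 0" using bi(1) by auto
      ultimately show ?thesis using r x bi(2) crf_cross[of 1 r x b] by simp
    qed
    ultimately show ?thesis using crf_mult[of x b "prod_mset S" "prod_mset R'"] by (simp add: R')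
  qed
qed

lemma live_prime_divisor:
  assumes "live p"
  shows "prime_divisor (quads n) (Mbar n) (ch.hyp_cl p)" "ch.hyp_cl p \<inter> M_smooth n \<noteq> {}"
proof -
  have p: "ch.good p" "\<not> p dvd Var 0" using assms by (simp_all add: live_def)
  show "prime_divisor (quads n) (Mbar n) (ch.hyp_cl p)" by (rule ch.prime_divisor_hyp_cl[OF p(1)])
  have "vars_in vars (Var 0)" using zero_vars by simp
  then obtain x where x: "x \<in> ch.hyp p" "ev (Var 0) (ch.phi x) \<noteq> 0" using ch.hyp_point[OF p(1) _ p(2)] by blast
  have "x \<in> U" using x(1) by (simp add: ch.hyp_def)
  then have "x \<in> M_smooth n" using x(2) smooth_eq by blast
  moreover have "x \<in> ch.hyp_cl p"
    using x(1) closure_of_subset[of "ch.hyp p" "zariski (quads n) (Mbar n)"] ch.hyp_X unfolding ch.hyp_cl_def by auto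
  ultimately show "ch.hyp_cl p \<inter> M_smooth n \<noteq> {}" by blast
qed

lemma factorization:
  assumes "g \<noteq> 0" "vars_in vars g"
  shows "\<exists>u S. is_unit u \<and> (\<forall>q\<in>#S. irreducible q \<and> vars_in vars q) \<and> g = u * prod_mset S"
proof -
  obtain u S where u: "is_unit u" "\<forall>q\<in>#S. irreducible q" "g = u * prod_mset S"
    using irreducible_factorization[OF assms(1)] by blast
  have "vars_in vars q" if "q \<in># S" for q
    using that u(3) by (intro vars_in_dvd[OF _ assms]) (auto intro: dvd_prod_mset dvd_mult)
  then show ?thesis using u by blast
qed

text \<open>A live prime defines a prime divisor meeting the interior, along which the order is 0;
  so it is equally frequent in numerator and denominator. This determines the units on the interior:
  constants times products of cross-ratios, as far as their divisors are concerned.\<close>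

theorem boundary_supported_Cr:
  assumes f: "nzrat (quads n) (Mbar n) f"
    and o: "\<And>Y. prime_divisor (quads n) (Mbar n) Y \<Longrightarrow> Y \<inter> M_smooth n \<noteq> {} \<Longrightarrow>
      ord_along (quads n) (Mbar n) Y f = 0"
  shows "Cr n f"
proof -
  obtain g h where gh: "ch.frac_rep f g h" "g \<noteq> 0" using f unfolding ch.nzrat_iff by blast
  have v: "vars_in vars g" "vars_in vars h" "h \<noteq> 0" using gh by (auto simp: ch.frac_rep_def)
  obtain u S where S: "is_unit u" "\<forall>q\<in>#S. irreducible q \<and> vars_in vars q" "g = u * prod_mset S"
    using factorization[OF gh(2) v(1)] by blast
  obtain w R where R: "is_unit w" "\<forall>q\<in>#R. irreducible q \<and> vars_in vars q" "h = w * prod_mset R"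
    using factorization[OF v(3,2)] by blast
  have "multiplicity p (prod_mset S) = multiplicity p (prod_mset R)" if p: "live p" for p
  proof -
    have "ord_along (quads n) (Mbar n) (ch.hyp_cl p) f = 0" using o live_prime_divisor[OF p] by blast
    moreover have "ch.good p" using p by (simp add: live_def)
    ultimately have "multiplicity p g = multiplicity p h" using ch.ord_along_hyp_cl[OF _ gh] by simp
    moreover have "multiplicity p (c * prod_mset T) = multiplicity p (prod_mset T)"
      if "is_unit c" "c * prod_mset T \<noteq> 0" for c T
    proof -
      have "multiplicity p c = 0" using that(1) by (simp add: multiplicity_unit_right)
      moreover have "c \<noteq> 0" "prod_mset T \<noteq> 0" using that(2) by auto
      ultimately show ?thesis using prime_elem_multiplicity_mult_distrib[OF live_prime[OF p]] by simp
    qed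
    ultimately show ?thesis using S R gh(2) v(3) by simp
  qed
  note m = this
  have "crf (prod_mset S) (prod_mset R)"
    using S(2) R(2) by (intro crf_same_multiplicities[OF _ _ m]) blast+
  then have "crf (u * prod_mset S) (w * prod_mset R)"
    using crf_divide[OF crf_unit[OF S(1)] crf_unit[OF R(1)]] by (intro crf_mult)
  then show ?thesis using crf_cross_rep[OF _ gh] S(3) R(3) by simp
qed

text \<open>The equation of the divisor in the chart. This expresses that the class group of the
  interior is trivial, its coordinate ring being factorial.\<close>

lemma smooth_prime_principal:
  assumes Y: "prime_divisor (quads n) (Mbar n) Y" "Y \<inter> M_smooth n \<noteq> {}"
  shows "\<exists>f. nzrat (quads n) (Mbar n) f \<and> ord_along (quads n) (Mbar n) Y f = 1 \<and>
    (\<forall>Y'. prime_divisor (quads n) (Mbar n) Y' \<longrightarrow> Y' \<inter> M_smooth n \<noteq> {} \<longrightarrow> Y' \<noteq> Y \<longrightarrow>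
      ord_along (quads n) (Mbar n) Y' f = 0)"
proof -
  obtain p where p: "ch.good p" "Y = ch.hyp_cl p" using smooth_prime_divisor[OF Y] by blast
  have pp: "prime_elem p" "vars_in vars p" "p \<noteq> 0" "\<not> is_unit p"
    using p(1) by (auto simp: ch.good_def prime_elem_def)
  define f where "f = (\<lambda>y. ev p (ch.phi y))"
  have f: "ch.frac_rep f p 1" unfolding f_def by (rule ch.frac_self[OF pp(2)])
  have "ord_along (quads n) (Mbar n) Y f = 1"
    unfolding p(2) ch.ord_along_hyp_cl[OF p(1) f pp(3)] using pp(3,4) by (simp add: multiplicity_self)
  moreover have "ord_along (quads n) (Mbar n) Y' f = 0"
    if Y': "prime_divisor (quads n) (Mbar n) Y'" "Y' \<inter> M_smooth n \<noteq> {}" "Y' \<noteq> Y" for Y'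
  proof -
    obtain p' where p': "ch.good p'" "Y' = ch.hyp_cl p'" using smooth_prime_divisor[OF Y'(1,2)] by blast
    have "\<not> p' dvd p"
    proof
      assume "p' dvd p"
      then obtain r where r: "p = p' * r" by blast
      have "is_unit r"
        using prime_elem_imp_irreducible[OF pp(1)] r p'(1) by (auto simp: irreducible_def ch.good_def prime_elem_def)
      then obtain c where "c \<noteq> 0" "r = Cst c" using is_unit_mp_iff by blast
      then have "ch.hyp p = ch.hyp p'" unfolding ch.hyp_def r by simp
      then show False using Y'(3) p(2) p'(2) by (simp add: ch.hyp_cl_def)
    qed
    then have "multiplicity p' p = 0" by (rule not_dvd_imp_multiplicity_0)
    then show ?thesis unfolding p'(2) ch.ord_along_hyp_cl[OF p'(1) f pp(3)] by simp
  qed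
  ultimately show ?thesis unfolding ch.nzrat_iff using f pp(3) by blast
qed

end

section \<open>Arcs of the polygon and block-gap sequences\<close>

locale cyc =
  fixes n :: nat and \<gamma> :: "nat list"
  assumes cyc: "cyclic_ordering n \<gamma>" and n1: "n \<ge> 1"
begin

lemma length_eq: "length \<gamma> = n"
  using cyc distinct_card[of \<gamma>] by (simp add: cyclic_ordering_def)

lemma set_eq: "set \<gamma> = {1..n}"
  using cyc by (simp add: cyclic_ordering_def)

abbreviation "v \<equiv> vertex \<gamma>"

lemma v_eq_iff: "v p = v q \<longleftrightarrow> p mod n = q mod n"
proof -
  have "p mod n < length \<gamma>" "q mod n < length \<gamma>" using n1 by (simp_all add: length_eq)
  then show ?thesis using cyc by (simp add: vertex_def length_eq cyclic_ordering_def nth_eq_iff_index_eq)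
qed

lemma v_in: "v p \<in> {1..n}"
proof -
  have "p mod n < length \<gamma>" using n1 by (simp add: length_eq)
  then have "\<gamma> ! (p mod n) \<in> set \<gamma>" by (rule nth_mem)
  then show ?thesis by (simp only: set_eq vertex_def length_eq)
qed

lemma v_add_n [simp]: "v (p + n) = v p" "v (n + p) = v p"
  by (simp_all add: v_eq_iff)

lemma ex_v: "x \<in> {1..n} \<Longrightarrow> \<exists>p<n. v p = x"
  unfolding set_eq[symmetric] in_set_conv_nth by (auto simp: vertex_def length_eq)

lemma cong_represent:
  fixes p a :: nat
  shows "\<exists>q. a \<le> q \<and> q < a + n \<and> q mod n = p mod n"
proof -
  \<comment> \<open>The multiple \<open>n * a\<close> keeps the natural number subtraction
    exact.\<close>
  define q where "q = a + (p + n * a - a) mod n"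
  have "q mod n = (a + (p + n * a - a)) mod n" by (simp add: q_def mod_simps)
  also have "a + (p + n * a - a) = p + n * a"
    using n1 by (simp add: trans_le_add2)
  finally have "q mod n = p mod n" by simp
  then show ?thesis using n1 by (intro exI[of _ q]) (auto simp: q_def)
qed

lemma ex_v_from: "x \<in> {1..n} \<Longrightarrow> \<exists>q. a \<le> q \<and> q < a + n \<and> v q = x"
  using ex_v[of x] cong_represent[of a] v_eq_iff by metis

lemma v_mem_run: "v q \<in> run \<gamma> p s \<longleftrightarrow> (\<exists>d<s. v q = v (p + d))"
proof
  assume "v q \<in> run \<gamma> p s"
  then obtain r where r: "p \<le> r" "r < p + s" "v q = v r" by (auto simp: run_def)
  then show "\<exists>d<s. v q = v (p + d)" by (intro exI[of _ "r - p"]) auto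
qed (auto simp: run_def)

lemma run_subset: "run \<gamma> p s \<subseteq> {1..n}"
  unfolding run_def using v_in by blast

lemma run_shift: "v p = v q \<Longrightarrow> run \<gamma> p s = run \<gamma> q s"
proof -
  assume "v p = v q"
  then have "p mod n = q mod n" by (simp add: v_eq_iff)
  then have "v (p + d) = v (q + d)" for d unfolding v_eq_iff by (rule mod_add_cong) simp
  moreover have "run \<gamma> r s = (\<lambda>d. v (r + d)) ` {..<s}" for r
  proof -
    have "{r..<r + s} = (\<lambda>d. r + d) ` {..<s}"
      using image_add_atLeastLessThan[of r 0 s] by (simp add: lessThan_atLeast0 add.commute)
    then show ?thesis by (simp add: run_def image_image)
  qed
  ultimately show ?thesis by simp
qed

lemma run_add: "run \<gamma> p (s + t) = run \<gamma> p s \<union> run \<gamma> (p + s) t"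
proof -
  have "{p..<p + (s + t)} = {p..<p + s} \<union> {p + s..<p + s + t}" by auto
  then show ?thesis by (simp only: run_def image_Un)
qed

lemma run_full: "s \<ge> n \<Longrightarrow> run \<gamma> p s = {1..n}"
proof
  assume s: "s \<ge> n"
  show "{1..n} \<subseteq> run \<gamma> p s"
  proof
    fix x assume "x \<in> {1..n}"
    then obtain q where "p \<le> q" "q < p + n" "v q = x" using ex_v_from by blast
    then show "x \<in> run \<gamma> p s" using s unfolding run_def by (intro image_eqI[of _ _ q]) auto
  qed
qed (rule run_subset)

lemma inj_v: "inj_on v {a..<a + n}"
proof (rule inj_onI)
  fix p q assume *: "p \<in> {a..<a + n}" "q \<in> {a..<a + n}" "v p = v q"
  have e: "p mod n = q mod n" using *(3) by (simp add: v_eq_iff)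
  have le: "r = s" if "s \<le> r" "r < s + n" "r mod n = s mod n" for r s
  proof -
    have "n dvd r - s" using that(1,3) by (simp add: mod_eq_dvd_iff_nat)
    moreover have "r - s < n" using that by linarith
    ultimately have "\<not> 0 < r - s" using nat_dvd_not_less by blast
    then show ?thesis using that(1) by simp
  qed
  have b: "p < q + n" "q < p + n" using *(1,2) by auto
  show "p = q"
  proof (cases "q \<le> p")
    case True then show ?thesis by (rule le[OF _ b(1) e])
  next
    case False
    then have "p \<le> q" by simp
    then show ?thesis by (rule le[OF _ b(2) e[symmetric], symmetric])
  qed
qed

lemma card_run: "s \<le> n \<Longrightarrow> card (run \<gamma> p s) = s"
  unfolding run_def using inj_on_subset[OF inj_v[of p], of "{p..<p + s}"] by (subst card_image) auto

lemma v_eq_dist: "v p = v q \<Longrightarrow> p \<le> q \<Longrightarrow> q < p + n \<Longrightarrow> p = q"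
  using inj_v[of p] by (auto dest: inj_onD)

lemma v_Suc: "v p = v q \<Longrightarrow> v (Suc p) = v (Suc q)"
  unfolding v_eq_iff by (metis mod_Suc_eq)

text \<open>One step back is \<open>n - 1\<close> steps forward, which makes sense at position 0 as
  well.\<close>

lemma v_pred: "v (Suc p) = v (Suc q) \<Longrightarrow> v p = v q"
proof -
  assume "v (Suc p) = v (Suc q)"
  then have "(Suc p + (n - 1)) mod n = (Suc q + (n - 1)) mod n"
    unfolding v_eq_iff by (rule mod_add_cong) simp
  moreover have "Suc r + (n - 1) = r + n" for r using n1 by simp
  ultimately show ?thesis by (simp add: v_eq_iff)
qed

text \<open>The first vertex of a proper arc is the only one whose predecessor is not in the arc;
  the length is the cardinality.\<close>

lemma run_eqD:
  assumes eq: "run \<gamma> p s = run \<gamma> q t" and ne: "run \<gamma> p s \<noteq> {1..n}" and s: "s \<ge> 1"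
  shows "v p = v q \<and> s = t \<and> s < n"
proof -
  have sn: "s < n" "t < n" using run_full ne eq by (metis not_le)+
  then have st: "s = t" using card_run[of s p] card_run[of t q] eq by simp
  have "v p \<in> run \<gamma> q t" using s unfolding eq[symmetric] v_mem_run by (intro exI[of _ 0]) auto
  then obtain d where d: "d < t" "v p = v (q + d)" unfolding v_mem_run by blast
  have "d = 0"
  proof (rule ccontr)
    assume "d \<noteq> 0"
    then obtain e where e: "d = Suc e" by (cases d) auto
    have "v (Suc (p + (n - 1))) = v (Suc (q + e))" using d(2) n1 by (simp add: e)
    then have "v (p + (n - 1)) = v (q + e)" by (rule v_pred)
    moreover have "v (q + e) \<in> run \<gamma> q t" using d(1) e unfolding v_mem_run by (intro exI[of _ e]) auto
    ultimately have "v (p + (n - 1)) \<in> run \<gamma> p s" using eq by simp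
    then obtain f where f: "f < s" "v (p + (n - 1)) = v (p + f)" unfolding v_mem_run by blast
    have "p + f \<le> p + (n - 1)" "p + (n - 1) < p + f + n" using f(1) sn by linarith+
    then have "p + f = p + (n - 1)" by (rule v_eq_dist[OF f(2)[symmetric]])
    then show False using f(1) sn by simp
  qed
  then show ?thesis using d st sn by simp
qed

lemma consecutive_iff: "consecutive \<gamma> S \<longleftrightarrow> S \<noteq> {} \<and> S \<noteq> {1..n} \<and> (\<exists>p s. S = run \<gamma> p s)"
  unfolding consecutive_def set_eq using run_subset by blast

lemma blocks_consecutive: "consecutive \<gamma> A \<Longrightarrow> blocks \<gamma> A = {A}"
  unfolding blocks_def by blast

lemma blocks_subset: "B \<in> blocks \<gamma> A \<Longrightarrow> B \<subseteq> A"
  unfolding blocks_def by blast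

lemma run_subset_self: "d < s \<Longrightarrow> v (p + d) \<in> run \<gamma> p s"
  unfolding v_mem_run by blast

text \<open>Positions \<open>c m\<close> just before the terms of a block-gap sequence, with the polygon unrolled to
  the natural numbers.\<close>

lemma block_gap_positions:
  assumes bg: "block_gap \<gamma> A Bs Gs"
  shows "\<exists>c :: nat \<Rightarrow> nat. \<forall>m. c m < c (Suc m) \<and> bg_term Bs Gs m = run \<gamma> (Suc (c m)) (c (Suc m) - c m) \<and>
    (even m \<longrightarrow> bg_term Bs Gs m \<subseteq> A) \<and> (odd m \<longrightarrow> bg_term Bs Gs m \<inter> A = {})"
proof -
  define N where "N = length Bs"
  have N: "N > 0" "set Bs = blocks \<gamma> A" using bg by (auto simp: block_gap_def N_def)
  have "\<forall>i<N. \<exists>p s t. s \<ge> 1 \<and> t \<ge> 1 \<and> Bs ! i = run \<gamma> p s \<and> Gs ! i = run \<gamma> (p + s) t \<and> Gs ! i \<inter> A = {} \<and>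
        v (p + s + t) \<in> Bs ! (Suc i mod N)"
    using bg unfolding block_gap_def N_def by blast
  then obtain P S T where *: "\<And>i. i < N \<Longrightarrow> S i \<ge> 1 \<and> T i \<ge> 1 \<and> Bs ! i = run \<gamma> (P i) (S i) \<and>
      Gs ! i = run \<gamma> (P i + S i) (T i) \<and> Gs ! i \<inter> A = {} \<and> v (P i + S i + T i) \<in> Bs ! (Suc i mod N)"
    by metis
  have BA: "Bs ! i \<subseteq> A" if "i < N" for i
    using that N(2) blocks_subset nth_mem unfolding N_def by metis
  have next_start: "v (P i + S i + T i) = v (P (Suc i mod N))" if i: "i < N" for i
  proof -
    define k where "k = Suc i mod N"
    have k: "k < N" using N by (simp add: k_def)
    have "v (P i + S i + T i) \<in> run \<gamma> (P k) (S k)" using *[OF i] *[OF k] by (simp add: k_def)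
    then obtain d where d: "d < S k" "v (P i + S i + T i) = v (P k + d)" unfolding v_mem_run by blast
    \<comment> \<open>The next block is entered at its first vertex: the vertex before the point of
      entry ends a gap and is not in \<open>A\<close>.\<close>
    have "d = 0"
    proof (rule ccontr)
      assume "d \<noteq> 0"
      then obtain e where e: "d = Suc e" by (cases d) auto
      obtain t where t: "T i = Suc t" using *[OF i] by (cases "T i") auto
      have "v (Suc (P i + S i + t)) = v (Suc (P k + e))" using d(2) by (simp add: e t)
      then have "v (P i + S i + t) = v (P k + e)" by (rule v_pred)
      moreover have "v (P k + e) \<in> Bs ! k" using *[OF k] run_subset_self[of e "S k" "P k"] d(1) e by auto
      moreover have "v (P i + S i + t) \<in> Gs ! i" using *[OF i] run_subset_self[of t "T i" "P i + S i"] t by auto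
      ultimately show False using BA[OF k] *[OF i] by auto
    qed
    then show ?thesis using d(2) by (simp add: k_def)
  qed
  define r where "r = (\<lambda>m. (m div 2) mod N)"
  have r: "r m < N" for m using N by (simp add: r_def)
  \<comment> \<open>The position just before the first block, reached by going \<open>n - 1\<close>
    steps forward from its start.\<close>
  define c where "c = rec_nat (P 0 + (n - 1)) (\<lambda>m x. x + (if even m then S (r m) else T (r m)))"
  have c0: "c 0 = P 0 + (n - 1)" and cS: "c (Suc m) = c m + (if even m then S (r m) else T (r m))" for m
    by (simp_all add: c_def)
  have start: "v (Suc (c m)) = v (if even m then P (r m) else P (r m) + S (r m))" for m
  proof (induction m)
    case 0
    have "Suc (c 0) = P 0 + n" using n1 by (simp add: c0)
    then show ?case by (simp add: r_def)
  next
    case (Suc m)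
    have add: "v (a + d) = v (b + d)" if "v a = v b" for a b d
      using that unfolding v_eq_iff by (rule mod_add_cong) simp
    show ?case
    proof (cases "even m")
      case True
      then have "r (Suc m) = r m" by (simp add: r_def)
      then show ?thesis using True Suc add[of "Suc (c m)" "P (r m)" "S (r m)"] by (simp add: cS)
    next
      case False
      have "Suc m div 2 = Suc (m div 2)" using False by presburger
      then have "r (Suc m) = Suc (r m) mod N" by (simp add: r_def mod_Suc_eq)
      then show ?thesis
        using False Suc add[of "Suc (c m)" "P (r m) + S (r m)" "T (r m)"] next_start[OF r] by (simp add: cS)
    qed
  qed
  have "bg_term Bs Gs m = (if even m then Bs ! r m else Gs ! r m)" for m
  proof -
    have "even (m mod (2 * N)) \<longleftrightarrow> even m" by (simp add: dvd_mod_iff)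
    moreover have "m mod (2 * N) div 2 = r m"
      by (simp add: r_def mod_mult2_eq)
    ultimately show ?thesis by (simp add: bg_term_def Let_def N_def)
  qed
  note bgt = this
  have "c m < c (Suc m) \<and> bg_term Bs Gs m = run \<gamma> (Suc (c m)) (c (Suc m) - c m) \<and>
    (even m \<longrightarrow> bg_term Bs Gs m \<subseteq> A) \<and> (odd m \<longrightarrow> bg_term Bs Gs m \<inter> A = {})" for m
    using *[OF r, of m] run_shift[OF start, of m "c (Suc m) - c m"] BA[OF r, of m] by (auto simp: cS bgt)
  then show ?thesis by blast
qed

lemma Union_runs:
  assumes "\<And>m. c m < c (Suc m)"
  shows "(\<Union>j<t. run \<gamma> (Suc (c (m + j))) (c (Suc (m + j)) - c (m + j))) = run \<gamma> (Suc (c m)) (c (m + t) - c m)"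
proof (induction t)
  case 0 then show ?case by (simp add: run_def)
next
  case (Suc t)
  have le: "c m \<le> c (m + t)" using strict_mono_less_eq[of c m "m + t"] assms by (simp add: strict_mono_Suc_iff)
  have "c (m + Suc t) - c m = (c (m + t) - c m) + (c (Suc (m + t)) - c (m + t))"
    using le assms[of "m + t"] by simp
  moreover have "Suc (c m) + (c (m + t) - c m) = Suc (c (m + t))" using le by simp
  ultimately have "run \<gamma> (Suc (c m)) (c (m + Suc t) - c m) = run \<gamma> (Suc (c m)) (c (m + t) - c m) \<union>
    run \<gamma> (Suc (c (m + t))) (c (Suc (m + t)) - c (m + t))"
    by (simp only: run_add)
  then show ?case using Suc by (simp add: lessThan_Suc Un_commute)
qed

text \<open>The jump of the indicator function of \<open>A\<close> between neighbouring vertices: 1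
  on leaving \<open>A\<close>, -1 on entering it, 0 otherwise.\<close>

definition brk :: "nat set \<Rightarrow> nat \<Rightarrow> int" where
  "brk A p = of_bool (v p \<in> A) - of_bool (v (Suc p) \<in> A)"

lemma brk_cong: "v p = v q \<Longrightarrow> brk A p = brk A q"
proof -
  assume "v p = v q"
  moreover from this have "v (Suc p) = v (Suc q)" by (rule v_Suc)
  ultimately show ?thesis by (simp only: brk_def)
qed

text \<open>Jumps alternate in sign from one term of the block-gap sequence to the next, so the
  product of the jumps at both ends of a segment is the parity of its length.\<close>

lemma segment_breaks:
  assumes bg: "block_gap \<gamma> A Bs Gs" and seg: "is_segment Bs Gs t (run \<gamma> (Suc p) s)"
    and s: "s \<ge> 1" "s < n"
  shows "brk A p * brk A (p + s) = (-1) ^ t"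
proof -
  obtain c where C: "\<forall>m. c m < c (Suc m) \<and> bg_term Bs Gs m = run \<gamma> (Suc (c m)) (c (Suc m) - c m) \<and>
    (even m \<longrightarrow> bg_term Bs Gs m \<subseteq> A) \<and> (odd m \<longrightarrow> bg_term Bs Gs m \<inter> A = {})"
    using block_gap_positions[OF bg] ..
  have c: "c m < c (Suc m)" "bg_term Bs Gs m = run \<gamma> (Suc (c m)) (c (Suc m) - c m)"
    "even m \<Longrightarrow> bg_term Bs Gs m \<subseteq> A" "odd m \<Longrightarrow> bg_term Bs Gs m \<inter> A = {}" for m
    using spec[OF C, of m] by blast+
  define N where "N = length Bs"
  have N: "N > 0" using bg by (auto simp: block_gap_def N_def)
  have per: "bg_term Bs Gs (m + 2 * N) = bg_term Bs Gs m" for m by (simp add: bg_term_def N_def)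
  have x: "v (Suc (c m)) \<in> A \<longleftrightarrow> even m" "v (c (Suc m)) \<in> A \<longleftrightarrow> even m" for m
  proof -
    have "0 < c (Suc m) - c m" "c (Suc m) - c m - 1 < c (Suc m) - c m" using c(1)[of m] by linarith+
    then have "v (Suc (c m) + 0) \<in> bg_term Bs Gs m" "v (Suc (c m) + (c (Suc m) - c m - 1)) \<in> bg_term Bs Gs m"
      by (simp_all only: c(2)[of m] run_subset_self)
    moreover have "Suc (c m) + (c (Suc m) - c m - 1) = c (Suc m)" using c(1)[of m] by simp
    ultimately have "v (Suc (c m)) \<in> bg_term Bs Gs m" "v (c (Suc m)) \<in> bg_term Bs Gs m" by simp_all
    then show "v (Suc (c m)) \<in> A \<longleftrightarrow> even m" "v (c (Suc m)) \<in> A \<longleftrightarrow> even m"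
      using c(3)[of m] c(4)[of m] by blast+
  qed
  have b: "brk A (c (Suc m)) = (-1) ^ m" for m
    using x(1)[of "Suc m"] x(2)[of m] by (simp add: brk_def)
  obtain m0 where m0: "run \<gamma> (Suc p) s = (\<Union>j<t. bg_term Bs Gs (m0 + j))"
    using seg unfolding is_segment_def by blast
  \<comment> \<open>The starting index is raised by one period so that it has a predecessor.\<close>
  obtain m where m: "m0 + 2 * N = Suc m" using N by (cases "m0 + 2 * N") auto
  have "bg_term Bs Gs (m0 + j) = bg_term Bs Gs (Suc m + j)" for j
    using per[of "m0 + j"] by (simp add: m[symmetric] add_ac)
  then have "run \<gamma> (Suc p) s = (\<Union>j<t. bg_term Bs Gs (Suc m + j))" using m0 by (simp only:)
  also have "\<dots> = run \<gamma> (Suc (c (Suc m))) (c (Suc m + t) - c (Suc m))"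
    unfolding c(2) by (rule Union_runs) (rule c(1))
  finally have "run \<gamma> (Suc p) s = run \<gamma> (Suc (c (Suc m))) (c (Suc m + t) - c (Suc m))" .
  moreover have "run \<gamma> (Suc p) s \<noteq> {1..n}"
  proof
    assume "run \<gamma> (Suc p) s = {1..n}"
    then have "s = card {1..n}" using card_run[of s "Suc p"] s(2) by simp
    then show False using s(2) by simp
  qed
  ultimately have e: "v (Suc p) = v (Suc (c (Suc m)))" "s = c (Suc m + t) - c (Suc m)"
    using run_eqD[OF _ _ s(1)] by blast+
  have vp: "v p = v (c (Suc m))" by (rule v_pred[OF e(1)])
  then have "v (p + s) = v (c (Suc m) + s)" unfolding v_eq_iff by (rule mod_add_cong) simp
  moreover have "c (Suc m) + s = c (Suc (m + t))" using e(2) s(1) by simp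
  ultimately have "brk A (p + s) = (-1) ^ (m + t)" using brk_cong[of "p + s" "c (Suc (m + t))"] b by simp
  moreover have "brk A p = (-1) ^ m" using brk_cong[OF vp] b by simp
  moreover have "(-1 :: int) ^ m * (-1) ^ (m + t) = (-1) ^ t"
    by (simp add: power_add flip: power_mult_distrib mult.assoc)
  ultimately show ?thesis by simp
qed

end

section \<open>Existence of the block-gap sequence\<close>

context cyc
begin

context
  fixes A :: "nat set"
  assumes A: "A \<subseteq> {1..n}" "1 \<in> A" "A \<noteq> {1..n}"
begin

definition R :: "nat set" where "R = {p. (v p \<in> A) \<noteq> (v (Suc p) \<in> A)}"

lemma R_iff: "p \<in> R \<longleftrightarrow> (v p \<in> A) \<noteq> (v (Suc p) \<in> A)"
  by (simp add: R_def)

lemma break_above: "\<exists>p\<ge>a. p \<in> R"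
proof (rule ccontr)
  assume *: "\<not> (\<exists>p\<ge>a. p \<in> R)"
  have const: "v (a + d) \<in> A \<longleftrightarrow> v a \<in> A" for d
  proof (induction d)
    case (Suc d)
    have "a + d \<notin> R" using * by (meson le_add1)
    then show ?case using Suc by (simp add: R_iff)
  qed simp
  obtain x where x: "x \<in> {1..n}" "x \<notin> A" using A by blast
  have "1 \<in> {1..n}" using A by blast
  then obtain q where "a \<le> q" "v q = 1" using ex_v_from by blast
  moreover obtain r where "a \<le> r" "v r = x" using ex_v_from[OF x(1)] by blast
  ultimately show False using const[of "q - a"] const[of "r - a"] A(2) x(2) by simp
qed

lemma infinite_breaks: "infinite R"
  unfolding infinite_nat_iff_unbounded_le using break_above by blast

lemma breaks_shift: "p + n \<in> R \<longleftrightarrow> p \<in> R"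
  using v_add_n(1)[of p] v_add_n(1)[of "Suc p"] by (simp add: R_iff)

text \<open>Enumerate the positions of the jumps on the unrolled polygon, beginning with the last
  one before the mark 1. The number \<open>M\<close> of jumps in one turn is the period, and it is
  even because membership in \<open>A\<close> has returned to its value.\<close>

lemma ex_break_sequence:
  "\<exists>c M. strict_mono (c :: nat \<Rightarrow> nat) \<and> (\<forall>m p. c m < p \<longrightarrow> p \<le> c (Suc m) \<longrightarrow> (v p \<in> A \<longleftrightarrow> even m)) \<and>
    M > 0 \<and> even M \<and> (\<forall>m. c (m + M) = c m + n) \<and> (\<exists>x. c 0 < x \<and> x \<le> c 1 \<and> v x = 1)"
proof -
  define e where "e = enumerate R"
  have eR: "e m \<in> R" for m unfolding e_def by (rule enumerate_in_set[OF infinite_breaks])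
  have sm: "strict_mono e" unfolding e_def by (rule strict_mono_enumerate[OF infinite_breaks])
  have ex: "\<exists>m. e m = p" if "p \<in> R" for p unfolding e_def by (rule enumerate_Ex[OF infinite_breaks that])
  have gap: "p \<notin> R" if "e m < p" "p < e (Suc m)" for m p
  proof
    assume "p \<in> R"
    then obtain k where k: "p = e k" using ex by metis
    have "m < k" "k < Suc m" using that sm unfolding k by (simp_all only: strict_mono_less)
    then show False by simp
  qed
  have const: "v (Suc (e m) + d) \<in> A \<longleftrightarrow> v (Suc (e m)) \<in> A" if "Suc (e m) + d \<le> e (Suc m)" for m d
    using that
  proof (induction d)
    case (Suc d)
    have "Suc (e m) + d \<notin> R" using gap[of m "Suc (e m) + d"] Suc.prems by simp
    then show ?case using Suc by (simp add: R_iff)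
  qed simp
  have const': "v p \<in> A \<longleftrightarrow> v (Suc (e m)) \<in> A" if "e m < p" "p \<le> e (Suc m)" for m p
    using const[of m "p - Suc (e m)"] that by simp
  have alt: "v (Suc (e (Suc m))) \<in> A \<longleftrightarrow> v (Suc (e m)) \<notin> A" for m
  proof -
    have "e m < e (Suc m)" using sm by (simp add: strict_mono_Suc_iff)
    then have "v (e (Suc m)) \<in> A \<longleftrightarrow> v (Suc (e m)) \<in> A" by (rule const') simp
    then show ?thesis using eR[of "Suc m"] unfolding R_iff by blast
  qed
  have "1 \<in> {1..n}" using A by blast
  then obtain x where x: "Suc (e 0) \<le> x" "v x = 1" using ex_v_from by blast
  have "\<exists>k. x \<le> e (Suc k)" using strict_mono_imp_increasing[OF sm, of "Suc x"] by (intro exI[of _ x]) simp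
  \<comment> \<open>The enumeration is shifted so that the mark 1 follows the jump with index 0,
    which puts it into the first block.\<close>
  define k where "k = (LEAST k. x \<le> e (Suc k))"
  have k: "x \<le> e (Suc k)" using LeastI_ex[OF \<open>\<exists>k. x \<le> e (Suc k)\<close>] by (simp add: k_def)
  have k': "e k < x"
  proof (cases k)
    case 0 then show ?thesis using x(1) by simp
  next
    case (Suc l)
    then have "\<not> x \<le> e (Suc l)" using not_less_Least[of l "\<lambda>k. x \<le> e (Suc k)"] by (simp add: k_def)
    then show ?thesis using Suc by simp
  qed
  define c where "c = (\<lambda>m. e (k + m))"
  have csm: "strict_mono c" using sm by (simp add: c_def strict_mono_def)
  have c0: "v (Suc (c 0)) \<in> A" using const'[OF k' k] x(2) A(2) by (simp add: c_def)
  have ceven: "v (Suc (c m)) \<in> A \<longleftrightarrow> even m" for m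
    by (induction m) (use c0 alt in \<open>auto simp: c_def\<close>)
  have cconst: "v p \<in> A \<longleftrightarrow> even m" if "c m < p" "p \<le> c (Suc m)" for m p
  proof -
    have "v p \<in> A \<longleftrightarrow> v (Suc (c m)) \<in> A" using const'[of "k + m" p] that by (simp add: c_def)
    then show ?thesis using ceven by simp
  qed
  have "c 0 + n \<in> R" using eR breaks_shift by (simp add: c_def)
  then obtain k2 where k2: "e k2 = c 0 + n" using ex by blast
  then have "e k < e k2" using n1 by (simp add: c_def)
  then have "k < k2" using sm by (simp add: strict_mono_less)
  define M where "M = k2 - k"
  have M: "M > 0" "c M = c 0 + n" using \<open>k < k2\<close> k2 by (simp_all add: M_def c_def)
  have per: "c (m + M) = c m + n" for m
  proof (induction m)
    case 0 then show ?case using M by simp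
  next
    case (Suc m)
    have "c (Suc m) + n \<in> R" using eR breaks_shift by (simp add: c_def)
    then obtain l where l: "e l = c (Suc m) + n" using ex by blast
    have lt: "c m < c (Suc m)" using csm by (simp add: strict_mono_Suc_iff)
    then have "e (k + (m + M)) < e l" using Suc l by (simp add: c_def)
    then have "k + (m + M) < l" using sm by (simp add: strict_mono_less)
    \<comment> \<open>A jump in between could be moved back by a full turn, where it would lie
      strictly between \<open>c m\<close> and \<open>c (Suc m)\<close>.\<close>
    moreover have "\<not> Suc (k + (m + M)) < l"
    proof
      assume "Suc (k + (m + M)) < l"
      then have "e (Suc (k + (m + M))) < c (Suc m) + n" using sm l by (metis strict_mono_less)
      moreover have "e (k + (m + M)) < e (Suc (k + (m + M)))" using sm by (simp only: strict_mono_Suc_iff)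
      then have "c m + n < e (Suc (k + (m + M)))" using Suc by (simp add: c_def)
      ultimately have b: "c m < e (Suc (k + (m + M))) - n" "e (Suc (k + (m + M))) - n < c (Suc m)"
        "e (Suc (k + (m + M))) = e (Suc (k + (m + M))) - n + n" by linarith+
      have "e (Suc (k + (m + M))) - n \<in> R" using eR[of "Suc (k + (m + M))"] breaks_shift b(3) by metis
      then show False using gap[of "k + m" "e (Suc (k + (m + M))) - n"] b(1,2) by (simp add: c_def)
    qed
    ultimately have "l = k + (Suc m + M)" by simp
    then show ?case using l by (simp add: c_def)
  qed
  have "v (Suc (c M)) = v (Suc (c 0))"
    using v_add_n(1)[of "Suc (c 0)"] by (simp add: M(2))
  then have "even M" using ceven c0 by metis
  moreover have "c 0 < x" "x \<le> c 1" using k k' by (simp_all add: c_def)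
  ultimately show ?thesis using csm cconst M(1) per x(2)
    by (intro exI[of _ c] exI[of _ M] exI[of _ x] conjI allI impI)
qed

text \<open>The converse of \<open>segment_breaks\<close>: nonzero jumps at both ends make the arc a
  segment. The last clause identifies the sets with a single block, which belong to neither sum of
  the relation.\<close>

lemma ex_block_gap:
  assumes p: "brk A p \<noteq> 0" "brk A (p + s) \<noteq> 0" and s: "s \<ge> 1" "s < n"
  shows "\<exists>Bs Gs t. block_gap \<gamma> A Bs Gs \<and> is_segment Bs Gs t (run \<gamma> (Suc p) s) \<and>
    (length Bs = 1 \<longrightarrow> run \<gamma> (Suc p) s = A \<or> run \<gamma> (Suc p) s = {1..n} - A)"
proof -
  obtain c M x where sm: "strict_mono (c :: nat \<Rightarrow> nat)"
    and const0: "\<forall>m p. c m < p \<longrightarrow> p \<le> c (Suc m) \<longrightarrow> (v p \<in> A \<longleftrightarrow> even m)"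
    and M: "M > 0" "even M" and per: "\<And>m. c (m + M) = c m + n"
    and x: "c 0 < x" "x \<le> c 1" "v x = 1"
    using ex_break_sequence by blast
  have const: "v p \<in> A \<longleftrightarrow> even m" if "c m < p" "p \<le> c (Suc m)" for m p
    using const0 that by blast
  have inc: "c m < c (Suc m)" for m using sm by (simp add: strict_mono_Suc_iff)
  define N where "N = M div 2"
  have N: "M = 2 * N" "N > 0" using M by (auto simp: N_def elim!: evenE)
  define T where "T = (\<lambda>m. run \<gamma> (Suc (c m)) (c (Suc m) - c m))"
  have T_eq: "T m = v ` {c m<..c (Suc m)}" for m
  proof -
    have "{Suc (c m)..<Suc (c m) + (c (Suc m) - c m)} = {c m<..c (Suc m)}" using inc[of m] by auto
    then show ?thesis by (simp only: T_def run_def)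
  qed
  have T_even: "T m \<subseteq> A" if "even m" for m using const that by (auto simp: T_eq)
  have T_odd: "T m \<inter> A = {}" if "odd m" for m using const that by (auto simp: T_eq)
  have T_per: "T (m + M) = T m" for m
  proof -
    have "c (Suc m + M) = c (Suc m) + n" "c (m + M) = c m + n" by (rule per)+
    then have "T (m + M) = run \<gamma> (Suc (c m) + n) (c (Suc m) - c m)" by (simp add: T_def)
    also have "\<dots> = T m" unfolding T_def by (rule run_shift) (rule v_add_n)
    finally show ?thesis .
  qed
  have T_mod: "T m = T (m mod M)" for m
  proof -
    have "T (r + k * M) = T r" for r k
    proof (induction k)
      case (Suc k)
      have "r + Suc k * M = r + k * M + M" by simp
      then show ?case using Suc T_per[of "r + k * M"] by (simp only:)
    qed simp
    from this[of "m mod M" "m div M"] show ?thesis by simp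
  qed
  have T_ne: "T m \<noteq> {}" for m using inc[of m] by (auto simp: T_eq)
  \<comment> \<open>This looks at the preceding term; adding the period \<open>M\<close> keeps its
    index a natural number.\<close>
  have first: "v (c m) \<in> A \<longleftrightarrow> odd m" for m
  proof -
    have "c (Suc (m + M - 1)) = c m + n" using M(1) per[of m] by simp
    then have "v (c m) = v (c (Suc (m + M - 1)))" by simp
    also have "\<dots> \<in> A \<longleftrightarrow> even (m + M - 1)" using inc[of "m + M - 1"] by (intro const) auto
    also have "\<dots> \<longleftrightarrow> odd m" using M by auto
    finally show ?thesis .
  qed
  have locate: "\<exists>m<M. c m < q \<and> q \<le> c (Suc m)" if "c 0 < q" "q \<le> c 0 + n" for q
  proof -
    define m where "m = (LEAST m. q \<le> c (Suc m))"
    have "Suc (M - 1) = 0 + M" using M(1) by simp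
    then have qM: "q \<le> c (Suc (M - 1))" using that(2) per[of 0] by (simp only:)
    then have 1: "q \<le> c (Suc m)" unfolding m_def by (rule LeastI)
    have 2: "m \<le> M - 1" unfolding m_def using qM by (rule Least_le)
    have "c m < q"
    proof (cases m)
      case 0 then show ?thesis using that(1) by simp
    next
      case (Suc l)
      then have "\<not> q \<le> c (Suc l)" using not_less_Least[of l "\<lambda>m. q \<le> c (Suc m)"] by (simp add: m_def)
      then show ?thesis using Suc by simp
    qed
    then show ?thesis using 1 2 M(1) by (intro exI[of _ m]) auto
  qed
  have A_run: "run \<gamma> q u \<subseteq> A \<Longrightarrow> c m < q \<Longrightarrow> q \<le> c (Suc m) \<Longrightarrow> even m \<Longrightarrow> u \<ge> 1 \<Longrightarrow> run \<gamma> q u \<subseteq> T m"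
    for q u m
  proof -
    assume *: "run \<gamma> q u \<subseteq> A" "c m < q" "q \<le> c (Suc m)" "even m" "u \<ge> 1"
    have "q + u \<le> Suc (c (Suc m))"
    proof (rule ccontr)
      assume "\<not> ?thesis"
      then have "Suc (c (Suc m)) \<in> {q..<q + u}" using *(3) by simp
      then have "v (Suc (c (Suc m))) \<in> A" using *(1) unfolding run_def by blast
      moreover have "v (Suc (c (Suc m))) \<in> A \<longleftrightarrow> even (Suc m)"
        using inc[of "Suc m"] by (intro const) simp_all
      ultimately show False using *(4) by simp
    qed
    then have "{q..<q + u} \<subseteq> {c m<..c (Suc m)}" using *(2) by auto
    then show ?thesis unfolding run_def T_eq by (rule image_mono)
  qed
  have A_proper: "S \<subseteq> A \<Longrightarrow> S \<noteq> {1..n}" for S using A by blast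
  \<comment> \<open>An arc in \<open>A\<close> that contains this term can neither begin earlier nor
    end later, since the vertices on both sides of the term are not in \<open>A\<close>.\<close>
  have T_block: "T m \<in> blocks \<gamma> A" if m: "even m" for m
    unfolding blocks_def
  proof (intro CollectI conjI allI impI)
    show "consecutive \<gamma> (T m)"
      unfolding consecutive_iff using T_ne A_proper[OF T_even[OF m]] T_def by blast
    show "T m \<subseteq> A" by (rule T_even[OF m])
    fix B' assume B': "consecutive \<gamma> B' \<and> B' \<subseteq> A \<and> T m \<subseteq> B'"
    then obtain q u where qu: "B' = run \<gamma> q u" unfolding consecutive_iff by blast
    have "v (Suc (c m)) \<in> T m" unfolding T_eq using inc[of m] by auto
    then have "v (Suc (c m)) \<in> run \<gamma> q u" using B' qu by blast
    then obtain d where d: "d < u" "v (Suc (c m)) = v (q + d)" unfolding v_mem_run by blast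
    have "d = 0"
    proof (rule ccontr)
      assume "d \<noteq> 0"
      then obtain f where f: "d = Suc f" by (cases d) auto
      have "v (Suc (c m)) = v (Suc (q + f))" using d(2) by (simp add: f)
      then have "v (c m) = v (q + f)" by (rule v_pred)
      moreover have "v (q + f) \<in> A" using run_subset_self[of f u q] d(1) f B' qu by auto
      ultimately show False using first[of m] m by simp
    qed
    then have "run \<gamma> q u = run \<gamma> (Suc (c m)) u" using d(2) by (intro run_shift) simp
    then have "B' \<subseteq> T m" using A_run[of "Suc (c m)" u m] B' qu d(1) inc[of m] m by simp
    then show "B' = T m" using B' by blast
  qed
  define Bs Gs where "Bs = map (\<lambda>i. T (2 * i)) [0..<N]" and "Gs = map (\<lambda>i. T (2 * i + 1)) [0..<N]"
  have len: "length Bs = N" "length Gs = N" by (simp_all add: Bs_def Gs_def)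
  have nth: "Bs ! i = T (2 * i)" "Gs ! i = T (2 * i + 1)" if "i < N" for i
    using that by (simp_all add: Bs_def Gs_def)
  have bgt: "bg_term Bs Gs m = T m" for m
  proof -
    define r where "r = m mod (2 * N)"
    have r: "r < 2 * N" using N by (simp add: r_def)
    have Tr: "T r = T m" using T_mod[of m] by (simp add: r_def N)
    show ?thesis
    proof (cases "even r")
      case True
      then obtain i where "r = 2 * i" by blast
      then show ?thesis using nth(1)[of i] r Tr by (simp add: bg_term_def Let_def len r_def[symmetric])
    next
      case False
      then obtain i where "r = 2 * i + 1" by (rule oddE)
      then show ?thesis using nth(2)[of i] r Tr by (simp add: bg_term_def Let_def len r_def[symmetric])
    qed
  qed
  have T_inj: "i = j" if "i < N" "j < N" "T (2 * i) = T (2 * j)" for i j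
  proof -
    have le: "i = j" if ij: "i \<le> j" "j < N" "T (2 * i) = T (2 * j)" for i j
    proof -
      have "c (Suc (2 * i)) - c (2 * i) \<ge> 1" using inc[of "2 * i"] by simp
      then have "v (Suc (c (2 * i))) = v (Suc (c (2 * j)))"
        using run_eqD[of "Suc (c (2 * i))" _ "Suc (c (2 * j))"] ij(3) A_proper[OF T_even[of "2 * i"]]
        unfolding T_def by simp
      then have e: "v (c (2 * i)) = v (c (2 * j))" by (rule v_pred)
      have "c (2 * i) \<le> c (2 * j)" using sm ij(1) by (simp add: strict_mono_less_eq)
      moreover have "c (2 * j) < c (2 * i) + n"
      proof -
        have "2 * j < 2 * i + M" using ij(2) N(1) by simp
        then have "c (2 * j) < c (2 * i + M)" using sm by (simp add: strict_mono_less)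
        then show ?thesis by (simp add: per)
      qed
      ultimately have "c (2 * i) = c (2 * j)" by (rule v_eq_dist[OF e])
      then have "2 * i = 2 * j" using sm by (simp add: strict_mono_eq)
      then show ?thesis by simp
    qed
    show ?thesis
    proof (cases "i \<le> j")
      case True then show ?thesis using le that by blast
    next
      case False
      then have "j = i" using le[of j i] that by simp
      then show ?thesis by simp
    qed
  qed
  have bg: "block_gap \<gamma> A Bs Gs"
    unfolding block_gap_def
  proof (intro conjI)
    show "distinct Bs" unfolding Bs_def using T_inj by (simp add: distinct_map inj_on_def)
    show "Bs \<noteq> []" using len N by auto
    show "length Gs = length Bs" by (simp add: len)
    have "1 \<in> T 0" unfolding T_eq using x by force
    then show "1 \<in> Bs ! 0" using nth(1)[of 0] N by simp
    show "set Bs = blocks \<gamma> A"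
    proof
      show "set Bs \<subseteq> blocks \<gamma> A" using T_block by (auto simp: Bs_def)
      show "blocks \<gamma> A \<subseteq> set Bs"
      proof
        fix B assume B: "B \<in> blocks \<gamma> A"
        then have Bc: "consecutive \<gamma> B" "B \<subseteq> A" "\<And>B'. consecutive \<gamma> B' \<Longrightarrow> B' \<subseteq> A \<Longrightarrow> B \<subseteq> B' \<Longrightarrow> B' = B"
          unfolding blocks_def by blast+
        obtain q u where qu: "B = run \<gamma> q u" "B \<noteq> {}" using Bc(1) unfolding consecutive_iff by blast
        then have u: "u \<ge> 1" by (cases u) (auto simp: run_def)
        obtain q' where q': "Suc (c 0) \<le> q'" "q' < Suc (c 0) + n" "v q' = v q"
          using ex_v_from[OF v_in] by blast
        have Bq: "B = run \<gamma> q' u" using run_shift[OF q'(3)] qu(1) by simp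
        obtain m where m: "m < M" "c m < q'" "q' \<le> c (Suc m)" using locate[of q'] q' by auto
        have "v q' \<in> B" using run_subset_self[of 0 u q'] u unfolding Bq by simp
        then have "even m" using const[OF m(2,3)] Bc(2) by blast
        then obtain i where i: "m = 2 * i" by blast
        have "B \<subseteq> T m" using A_run[of q' u m] Bc(2) m(2,3) \<open>even m\<close> u unfolding Bq by blast
        moreover have "consecutive \<gamma> (T m)" "T m \<subseteq> A" using T_block[OF \<open>even m\<close>] unfolding blocks_def by blast+
        ultimately have "B = T (2 * i)" using Bc(3)[of "T m"] i by simp
        then show "B \<in> set Bs" using m(1) i N unfolding Bs_def by simp
      qed
    qed
    show "\<forall>i<length Bs. \<exists>p s t. s \<ge> 1 \<and> t \<ge> 1 \<and> Bs ! i = run \<gamma> p s \<and> Gs ! i = run \<gamma> (p + s) t \<and>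
        Gs ! i \<inter> A = {} \<and> v (p + s + t) \<in> Bs ! (Suc i mod length Bs)"
    proof (intro allI impI)
      fix i assume "i < length Bs"
      then have i: "i < N" by (simp add: len)
      define a b d where "a = c (2 * i)" and "b = c (Suc (2 * i))" and "d = c (Suc (Suc (2 * i)))"
      have abd: "a < b" "b < d" using inc by (simp_all add: a_def b_def d_def)
      have "Bs ! i = run \<gamma> (Suc a) (b - a)" using nth(1)[OF i] by (simp add: T_def a_def b_def)
      moreover have "Gs ! i = run \<gamma> (Suc a + (b - a)) (d - b)"
        using nth(2)[OF i] abd by (simp add: T_def b_def d_def)
      moreover have "Gs ! i \<inter> A = {}" using nth(2)[OF i] T_odd[of "2 * i + 1"] by simp
      moreover have "Bs ! (Suc i mod length Bs) = T (2 * Suc i)"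
      proof -
        have "Suc i mod N < N" using N by simp
        then have "Bs ! (Suc i mod N) = T (2 * (Suc i mod N))" by (rule nth(1))
        also have "2 * (Suc i mod N) = (2 * Suc i) mod M" unfolding N(1) by (rule mult_mod_right)
        finally show ?thesis using T_mod[of "2 * Suc i"] by (simp add: len)
      qed
      moreover have "v (Suc a + (b - a) + (d - b)) \<in> T (2 * Suc i)"
      proof -
        have "Suc a + (b - a) + (d - b) = Suc (c (2 * Suc i))" using abd by (simp add: d_def)
        moreover have "Suc (c (2 * Suc i)) \<in> {c (2 * Suc i)<..c (Suc (2 * Suc i))}" using inc[of "2 * Suc i"] by simp
        ultimately show ?thesis unfolding T_eq by (metis imageI)
      qed
      moreover have "b - a \<ge> 1" "d - b \<ge> 1" using abd by simp_all
      ultimately show "\<exists>p s t. s \<ge> 1 \<and> t \<ge> 1 \<and> Bs ! i = run \<gamma> p s \<and> Gs ! i = run \<gamma> (p + s) t \<and>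
        Gs ! i \<inter> A = {} \<and> v (p + s + t) \<in> Bs ! (Suc i mod length Bs)"
        by (intro exI[of _ "Suc a"] exI[of _ "b - a"] exI[of _ "d - b"]) simp
    qed
  qed
  have is_c: "\<exists>m. q = c m" if q: "c 0 < q" "brk A q \<noteq> 0" for q
  proof -
    have "q \<le> c q" by (rule strict_mono_imp_increasing[OF sm])
    then have ex: "\<exists>m. q \<le> c (Suc m)" using inc[of q] by (intro exI[of _ q]) simp
    define m where "m = (LEAST m. q \<le> c (Suc m))"
    have 1: "q \<le> c (Suc m)" unfolding m_def by (rule LeastI_ex[OF ex])
    have 2: "c m < q"
    proof (cases m)
      case 0 then show ?thesis using q(1) by simp
    next
      case (Suc l)
      then have "\<not> q \<le> c (Suc l)" using not_less_Least[of l "\<lambda>m. q \<le> c (Suc m)"] by (simp add: m_def)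
      then show ?thesis using Suc by simp
    qed
    have "q = c (Suc m)"
    proof (rule ccontr)
      assume "q \<noteq> c (Suc m)"
      then have "Suc q \<le> c (Suc m)" using 1 by simp
      then have "v (Suc q) \<in> A \<longleftrightarrow> even m" using 2 by (intro const) simp_all
      moreover have "v q \<in> A \<longleftrightarrow> even m" using 1 2 by (intro const)
      ultimately show False using q(2) by (simp add: brk_def)
    qed
    then show ?thesis by blast
  qed
  \<comment> \<open>A position of the same vertex beyond \<open>c 0\<close>, where every jump is one
    of the \<open>c m\<close>.\<close>
  obtain p' where p': "Suc (c 0) \<le> p'" "v p' = v p" using ex_v_from[OF v_in] by blast
  have "v (p' + s) = v (p + s)" using p'(2) unfolding v_eq_iff by (rule mod_add_cong) simp
  then have b: "brk A p' \<noteq> 0" "brk A (p' + s) \<noteq> 0"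
    using p brk_cong[OF p'(2), of A] brk_cong[of "p' + s" "p + s" A] by simp_all
  have "c 0 < p'" "c 0 < p' + s" using p'(1) by simp_all
  obtain m1 where m1: "p' = c m1" using is_c[OF \<open>c 0 < p'\<close> b(1)] by blast
  obtain m2 where "p' + s = c m2" using is_c[OF \<open>c 0 < p' + s\<close> b(2)] by blast
  note m = m1 this
  have "c m1 < c m2" "c m2 < c (m1 + M)" using m s per[of m1] by linarith+
  then have lt: "m1 < m2" "m2 < m1 + M" using sm by (simp_all add: strict_mono_less)
  define t where "t = m2 - m1"
  have t: "t \<ge> 1" "t < M" "m2 = m1 + t" using lt by (simp_all add: t_def)
  have I: "run \<gamma> (Suc p) s = (\<Union>j<t. bg_term Bs Gs (m1 + j))"
  proof -
    have "(\<Union>j<t. bg_term Bs Gs (m1 + j)) = run \<gamma> (Suc (c m1)) (c (m1 + t) - c m1)"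
      unfolding bgt T_def by (rule Union_runs) (rule inc)
    also have "c (m1 + t) - c m1 = s" unfolding t(3)[symmetric] m(2)[symmetric] m(1)[symmetric] by simp
    also have "run \<gamma> (Suc (c m1)) s = run \<gamma> (Suc p') s" unfolding m(1) ..
    also have "\<dots> = run \<gamma> (Suc p) s" by (rule run_shift[OF v_Suc[OF p'(2)]])
    finally show ?thesis ..
  qed
  have seg: "is_segment Bs Gs t (run \<gamma> (Suc p) s)"
    unfolding is_segment_def len(1) N(1)[symmetric] using t(1,2) by (intro conjI exI[of _ m1] I) simp_all
  have "run \<gamma> (Suc p) s = A \<or> run \<gamma> (Suc p) s = {1..n} - A" if "length Bs = 1"
  proof -
    \<comment> \<open>With one block and one gap the polygon consists of two terms, and a segment
      shorter than the whole cycle is one of them.\<close>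
    have "N = 1" using that unfolding len(1) .
    then have M2: "M = 2" unfolding N(1) by (simp only:)
    then have "t = 1" using t by simp
    then have IT: "run \<gamma> (Suc p) s = T (m1 mod 2)" using I T_mod[of m1] by (simp add: bgt M2 lessThan_Suc)
    have cover: "{1..n} \<subseteq> T 0 \<union> T 1"
    proof
      fix y assume "y \<in> {1..n}"
      then obtain q where q: "Suc (c 0) \<le> q" "q < Suc (c 0) + n" "v q = y" using ex_v_from by blast
      then obtain m where "m < M" "c m < q" "q \<le> c (Suc m)" using locate[of q] by auto
      then have "y \<in> T m" "m = 0 \<or> m = 1" using q(3) M2 by (auto simp: T_eq)
      then show "y \<in> T 0 \<union> T 1" by auto
    qed
    have sub: "T 0 \<subseteq> A" "T 1 \<inter> A = {}" "T 1 \<subseteq> {1..n}"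
      using T_even[of 0] T_odd[of 1] run_subset[of "Suc (c 1)"] T_def by simp_all
    then have "T 0 = A" "T 1 = {1..n} - A" using cover A(1) by blast+
    note T01 = this
    have "m1 mod 2 = 0 \<or> m1 mod 2 = 1" by auto
    then show ?thesis
    proof
      assume "m1 mod 2 = 0"
      then show ?thesis using IT T01(1) by (simp only:) simp
    next
      assume "m1 mod 2 = 1"
      then show ?thesis using IT T01(2) by (simp only:) simp
    qed
  qed
  then show ?thesis using bg seg by blast
qed

end

end

section \<open>The relations in terms of cross-ratios\<close>

definition ind :: "nat set \<Rightarrow> nat \<Rightarrow> int" where
  "ind A i = of_bool (i \<in> A)"

text \<open>Summing over the representatives that contain 1 counts each unordered partition exactly
  once.\<close>

definition bsum :: "nat \<Rightarrow> (nat set \<Rightarrow> int) \<Rightarrow> nat set set \<Rightarrow>\<^sub>0 int" where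
  "bsum n w = (\<Sum>A | boundary_index n A \<and> 1 \<in> A. frag_cmul (w A) (frag_of (bipartition n A)))"

lemma finite_marked: "finite {A. boundary_index n A \<and> 1 \<in> A}"
  using finite_boundary_index by (rule finite_subset[rotated]) blast

lemma bsum_add: "bsum n w + bsum n w' = bsum n (\<lambda>A. w A + w' A)"
  by (simp add: bsum_def frag_cmul_distrib sum.distrib)

lemma bsum_uminus: "- bsum n w = bsum n (\<lambda>A. - w A)"
  by (simp add: bsum_def flip: sum_negf)

lemma bsum_diff: "bsum n w - bsum n w' = bsum n (\<lambda>A. w A - w' A)"
  by (simp add: bsum_def frag_cmul_diff_distrib sum_subtractf)

lemma bsum_scale: "frag_cmul c (bsum n w) = bsum n (\<lambda>A. c * w A)"
  by (simp add: bsum_def frag_cmul_sum)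

lemma bsum_sum: "(\<Sum>q\<in>S. bsum n (w q)) = bsum n (\<lambda>A. \<Sum>q\<in>S. w q A)"
proof (induction S rule: infinite_finite_induct)
  case (insert q S)
  then show ?case by (simp add: bsum_add)
qed (simp_all add: bsum_def)

lemma bsum_cong: "(\<And>A. boundary_index n A \<Longrightarrow> 1 \<in> A \<Longrightarrow> w A = w' A) \<Longrightarrow> bsum n w = bsum n w'"
  unfolding bsum_def by (rule sum.cong) auto

lemma sum_frag_of_bsum:
  assumes "X \<subseteq> {A. boundary_index n A \<and> 1 \<in> A}"
  shows "(\<Sum>J\<in>X. frag_of (bipartition n J)) = bsum n (\<lambda>A. of_bool (A \<in> X))"
  unfolding bsum_def using assms finite_marked
  by (intro sum.mono_neutral_cong_left) auto

lemma keys_bsum: "Poly_Mapping.keys (bsum n w) \<subseteq> {bipartition n A | A. boundary_index n A}"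
proof -
  have "bsum n w \<in> carrier (free_Abelian_group {bipartition n A | A. boundary_index n A})"
    unfolding bsum_def
  proof (rule sum_closed_free_Abelian_group)
    fix A assume "A \<in> {A. boundary_index n A \<and> 1 \<in> A}"
    then show "frag_cmul (w A) (frag_of (bipartition n A)) \<in> carrier (free_Abelian_group {bipartition n A | A. boundary_index n A})"
      by auto
  qed
  then show ?thesis by simp
qed

lemma bipartition_compl: "A \<subseteq> {1..n} \<Longrightarrow> bipartition n ({1..n} - A) = bipartition n A"
proof -
  assume "A \<subseteq> {1..n}"
  then have "{1..n} - ({1..n} - A) = A" by (rule double_diff) simp
  then show ?thesis unfolding bipartition_def by (simp only:) (rule insert_commute)
qed

lemma bipartition_eqD: "bipartition n A = bipartition n B \<Longrightarrow> B = A \<or> B = {1..n} - A"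
proof -
  assume e: "bipartition n A = bipartition n B"
  have "B \<in> bipartition n B" unfolding bipartition_def by (rule insertI1)
  then have "B \<in> bipartition n A" by (simp only: e)
  then have "B = A \<or> B \<in> {{1..n} - A}" unfolding bipartition_def by (rule insertE) simp_all
  then show ?thesis unfolding singleton_iff .
qed

text \<open>The boundary divisor of a cross-ratio, a relation as in Keel's presentation. The weight
  does not change when \<open>A\<close> is replaced by its complement, so the choice of
  representatives does not matter.\<close>

definition keel :: "nat \<Rightarrow> nat \<Rightarrow> nat \<Rightarrow> nat \<Rightarrow> nat \<Rightarrow> nat set set \<Rightarrow>\<^sub>0 int" where
  "keel n i j k l = bsum n (\<lambda>A. (ind A i - ind A j) * (ind A k - ind A l))"

lemma xord_eq_ind: "xord A (i, j, k, l) = (ind A i - ind A j) * (ind A k - ind A l)"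
  by (cases "i \<in> A"; cases "j \<in> A"; cases "k \<in> A"; cases "l \<in> A") (simp_all add: xord_def splits_def ind_def)

lemma keel_xord: "keel n i j k l = bsum n (\<lambda>A. xord A (i, j, k, l))"
  by (simp only: keel_def xord_eq_ind)

text \<open>Each factor of the weight is a difference of two values of the indicator function and
  therefore telescopes.\<close>

lemma keel_add:
  "keel n i j k l + keel n j m k l = keel n i m k l"
  "keel n i j k l + keel n i j l m = keel n i j k m"
  by (simp_all add: keel_def bsum_add algebra_simps)

lemma keel_swap:
  "keel n j i k l = - keel n i j k l" "keel n i j l k = - keel n i j k l" "keel n k l i j = keel n i j k l"
  by (simp_all add: keel_def bsum_uminus algebra_simps)

lemma keel_three_term: "keel n p r q s = keel n p q r s - keel n q r s p"
  by (simp add: keel_def bsum_diff algebra_simps)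

context cyc
begin

lemma card_run_compl: "s \<le> n \<Longrightarrow> {1..n} - run \<gamma> p s = run \<gamma> (p + s) (n - s)"
proof -
  assume s: "s \<le> n"
  have "{1..n} = run \<gamma> p (s + (n - s))" using s run_full[of "s + (n - s)" p] by simp
  then have U: "{1..n} = run \<gamma> p s \<union> run \<gamma> (p + s) (n - s)" by (simp only: run_add)
  have "run \<gamma> p s \<inter> run \<gamma> (p + s) (n - s) = {}"
  proof (rule ccontr)
    assume "\<not> ?thesis"
    then obtain a b where ab: "a \<in> {p..<p + s}" "b \<in> {p + s..<p + s + (n - s)}" "v a = v b"
      unfolding run_def by blast
    have "a = b" using ab s by (intro v_eq_dist[OF ab(3)]) auto
    then show False using ab by simp
  qed
  then show ?thesis using U by blast
qed

lemma run_ends: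
  assumes s: "1 \<le> s" "s < n"
  shows "v p \<notin> run \<gamma> (Suc p) s" "v (Suc p) \<in> run \<gamma> (Suc p) s"
    "v (p + s) \<in> run \<gamma> (Suc p) s" "v (Suc (p + s)) \<notin> run \<gamma> (Suc p) s"
proof -
  show "v (Suc p) \<in> run \<gamma> (Suc p) s" using run_subset_self[of 0 s "Suc p"] s by simp
  show "v (p + s) \<in> run \<gamma> (Suc p) s" using run_subset_self[of "s - 1" s "Suc p"] s by simp
  show "v p \<notin> run \<gamma> (Suc p) s"
  proof
    assume "v p \<in> run \<gamma> (Suc p) s"
    then obtain d where d: "d < s" "v p = v (Suc p + d)" unfolding v_mem_run by blast
    have "p = Suc p + d" using d(1) s by (intro v_eq_dist[OF d(2)]) auto
    then show False by simp
  qed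
  show "v (Suc (p + s)) \<notin> run \<gamma> (Suc p) s"
  proof
    assume "v (Suc (p + s)) \<in> run \<gamma> (Suc p) s"
    then obtain d where d: "d < s" "v (Suc (p + s)) = v (Suc p + d)" unfolding v_mem_run by blast
    have "Suc p + d = Suc (p + s)" using d(1) s by (intro v_eq_dist[OF d(2)[symmetric]]) auto
    then show False using d(1) by simp
  qed
qed

lemma block_gap_length: "block_gap \<gamma> A Bs Gs \<Longrightarrow> length Bs = card (blocks \<gamma> A) \<and> length Bs > 0"
  using distinct_card[of Bs] by (auto simp: block_gap_def)

text \<open>Compare coefficients at each \<open>A\<close> containing 1; the claim is that the
  coefficient is minus the product \<open>b A\<close> of the two jumps. The representative
  \<open>A0\<close> of \<open>I\<close> itself is adjacent, occurs in neither sum and has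
  \<open>b A0 = -1\<close>. Any other \<open>A\<close> with nonzero jumps has at least two blocks
  and \<open>I\<close> as a segment, whose parity decides between the two sums. If a jump is zero,
  \<open>I\<close> is no segment.\<close>

lemma relator_eq_bsum:
  assumes s: "2 \<le> s" "s + 2 \<le> n"
  shows "relator n \<gamma> (run \<gamma> (Suc p) s) = - keel n (v p) (v (Suc p)) (v (p + s)) (v (Suc (p + s)))"
proof -
  define I where "I = run \<gamma> (Suc p) s"
  define b where "b = (\<lambda>A. brk A p * brk A (p + s))"
  have s': "1 \<le> s" "s < n" using s by simp_all
  have cI: "card I = s" "I \<subseteq> {1..n}" using card_run[of s "Suc p"] run_subset s' by (simp_all add: I_def)
  have Ic: "{1..n} - I = run \<gamma> (Suc p + s) (n - s)" unfolding I_def using s' by (intro card_run_compl) simp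
  have biI: "boundary_index n I" using cI s by (simp add: boundary_index_def)
  have biIc: "boundary_index n ({1..n} - I)" by (rule boundary_index_compl[OF biI])
  have con: "consecutive \<gamma> I" "consecutive \<gamma> ({1..n} - I)"
  proof -
    have "v (Suc p) \<in> I" "v p \<in> {1..n} - I" using run_ends[OF s'] v_in by (auto simp only: I_def Diff_iff)
    then have "I \<noteq> {}" "{1..n} - I \<noteq> {}" "I \<noteq> {1..n}" "{1..n} - I \<noteq> {1..n}" using cI(2) by blast+
    then show "consecutive \<gamma> I" "consecutive \<gamma> ({1..n} - I)" unfolding consecutive_iff using I_def Ic by blast+
  qed
  have bI: "b I = -1" "b ({1..n} - I) = -1"
    unfolding b_def brk_def I_def using run_ends[OF s', of p] v_in[of p] v_in[of "Suc p"] v_in[of "p + s"] v_in[of "Suc (p + s)"]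
    by simp_all
  define A0 where "A0 = (if 1 \<in> I then I else {1..n} - I)"
  have A0: "boundary_index n A0" "1 \<in> A0" "consecutive \<gamma> A0" "b A0 = -1" "bipartition n I = bipartition n A0"
    using biI biIc con bI bipartition_compl[OF cI(2)] s' by (simp_all add: A0_def)
  have A0_uniq: "A = A0" if "1 \<in> A" "A = I \<or> A = {1..n} - I" for A
    using that by (auto simp: A0_def)
  have ev: "even_segment_sets n \<gamma> I \<subseteq> {A. boundary_index n A \<and> 1 \<in> A}"
    and od: "odd_segment_sets n \<gamma> I \<subseteq> {A. boundary_index n A \<and> 1 \<in> A}"
    unfolding even_segment_sets_def odd_segment_sets_def boundary_index_def by blast+
  have seg: "b A = (-1) ^ t" if "block_gap \<gamma> A Bs Gs" "is_segment Bs Gs t I" for A Bs Gs t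
    unfolding b_def using segment_breaks[OF that(1) that(2)[unfolded I_def] s'] .
  have evb: "b A = 1 \<and> non_adjacent \<gamma> A" if "A \<in> even_segment_sets n \<gamma> I" for A
  proof -
    obtain Bs Gs t where "block_gap \<gamma> A Bs Gs" "even t" "is_segment Bs Gs t I"
      using \<open>A \<in> even_segment_sets n \<gamma> I\<close> unfolding even_segment_sets_def by blast
    then have "b A = 1" using seg[of A Bs Gs t] by simp
    then show ?thesis using \<open>A \<in> even_segment_sets n \<gamma> I\<close> unfolding even_segment_sets_def by blast
  qed
  have odb: "b A = -1 \<and> non_adjacent \<gamma> A" if "A \<in> odd_segment_sets n \<gamma> I" for A
  proof -
    obtain Bs Gs t where "block_gap \<gamma> A Bs Gs" "odd t" "is_segment Bs Gs t I"
      using \<open>A \<in> odd_segment_sets n \<gamma> I\<close> unfolding odd_segment_sets_def by blast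
    then have "b A = -1" using seg[of A Bs Gs t] by simp
    then show ?thesis using \<open>A \<in> odd_segment_sets n \<gamma> I\<close> unfolding odd_segment_sets_def by blast
  qed
  have coef: "of_bool (A = A0) - (of_bool (A \<in> even_segment_sets n \<gamma> I) - of_bool (A \<in> odd_segment_sets n \<gamma> I)) = - b A"
    if A: "boundary_index n A" "1 \<in> A" for A
  proof (cases "A = A0")
    case True
    have "blocks \<gamma> A = {A}" using True A0(3) by (simp add: blocks_consecutive)
    then have "\<not> non_adjacent \<gamma> A" by (simp add: non_adjacent_def)
    then have "A \<notin> even_segment_sets n \<gamma> I" "A \<notin> odd_segment_sets n \<gamma> I" using evb odb by blast+
    then show ?thesis using True A0(4) by simp
  next
    case False
    show ?thesis
    proof (cases "b A = 0")
      case True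
      then have "A \<notin> even_segment_sets n \<gamma> I" "A \<notin> odd_segment_sets n \<gamma> I" using evb[of A] odb[of A] by auto
      then show ?thesis using False True by simp
    next
      case nz: False
      have sub: "A \<subseteq> {1..n}" "2 \<le> card A" "card A \<le> n - 2" using A(1) by (simp_all add: boundary_index_def)
      have "A \<noteq> {1..n}" using sub(3) s by auto
      moreover have "brk A p \<noteq> 0" "brk A (p + s) \<noteq> 0" using nz by (auto simp: b_def)
      ultimately obtain Bs Gs t where bg: "block_gap \<gamma> A Bs Gs" "is_segment Bs Gs t I"
        "length Bs = 1 \<longrightarrow> I = A \<or> I = {1..n} - A"
        using ex_block_gap[OF sub(1) A(2), of p s] s' unfolding I_def by blast
      have "length Bs \<noteq> 1"
      proof
        assume "length Bs = 1"
        then have "I = A \<or> I = {1..n} - A" using bg(3) by blast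
        then have "A = I \<or> A = {1..n} - I" using sub(1) by blast
        then show False using A0_uniq[OF A(2)] False by blast
      qed
      moreover have "length Bs = card (blocks \<gamma> A)" "length Bs > 0" using block_gap_length[OF bg(1)] by blast+
      ultimately have "card (blocks \<gamma> A) \<ge> 2" by linarith
      then have na: "non_adjacent \<gamma> A" by (simp add: non_adjacent_def)
      have bt: "b A = (-1) ^ t" by (rule seg[OF bg(1,2)])
      show ?thesis
      proof (cases "even t")
        case True
        then have ex: "\<exists>Bs Gs s. block_gap \<gamma> A Bs Gs \<and> even s \<and> is_segment Bs Gs s I" using bg(1,2) by blast
        have "A \<in> even_segment_sets n \<gamma> I"
          unfolding even_segment_sets_def by (intro CollectI conjI sub A(2) na ex)
        moreover have "A \<notin> odd_segment_sets n \<gamma> I" using odb[of A] bt True by auto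
        ultimately show ?thesis using False bt True by simp
      next
        case odd: False
        then have ex: "\<exists>Bs Gs s. block_gap \<gamma> A Bs Gs \<and> odd s \<and> is_segment Bs Gs s I" using bg(1,2) by blast
        have "A \<in> odd_segment_sets n \<gamma> I"
          unfolding odd_segment_sets_def by (intro CollectI conjI sub A(2) na ex)
        moreover have "A \<notin> even_segment_sets n \<gamma> I" using evb[of A] bt odd by auto
        ultimately show ?thesis using False bt odd by simp
      qed
    qed
  qed
  have "frag_of (bipartition n I) = bsum n (\<lambda>A. of_bool (A = A0))"
    using sum_frag_of_bsum[of "{A0}" n] A0 by simp
  then have "relator n \<gamma> I = bsum n (\<lambda>A. of_bool (A = A0) -
      (of_bool (A \<in> even_segment_sets n \<gamma> I) - of_bool (A \<in> odd_segment_sets n \<gamma> I)))"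
    unfolding relator_def sum_frag_of_bsum[OF ev] sum_frag_of_bsum[OF od] by (simp only: bsum_diff)
  also have "\<dots> = bsum n (\<lambda>A. - b A)" by (rule bsum_cong) (rule coef)
  also have "\<dots> = - keel n (v p) (v (Suc p)) (v (p + s)) (v (Suc (p + s)))"
    by (simp add: keel_def bsum_uminus b_def brk_def ind_def)
  finally show ?thesis unfolding I_def .
qed

lemma consecutive_run:
  assumes "boundary_index n I" "consecutive \<gamma> I"
  shows "\<exists>p s. 2 \<le> s \<and> s + 2 \<le> n \<and> I = run \<gamma> (Suc p) s"
proof -
  obtain q s where q: "I = run \<gamma> q s" "I \<noteq> {1..n}" using assms(2) unfolding consecutive_iff by blast
  have "s < n" using run_full[of s q] q by (meson not_le)
  then have "card I = s" using card_run[of s q] q(1) by simp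
  then have s: "2 \<le> s" "s \<le> n - 2" using assms(1) by (simp_all add: boundary_index_def)
  \<comment> \<open>The position before \<open>q\<close>, reached by going forward, as the arc is
    wanted in the form starting at a successor.\<close>
  have "Suc (q + (n - 1)) = q + n" using n1 by simp
  then have "v (Suc (q + (n - 1))) = v q" by simp
  then have "run \<gamma> (Suc (q + (n - 1))) s = run \<gamma> q s" by (rule run_shift)
  then have "I = run \<gamma> (Suc (q + (n - 1))) s" unfolding q(1) by (rule sym)
  moreover have "s + 2 \<le> n" using s by linarith
  ultimately have "2 \<le> s \<and> s + 2 \<le> n \<and> I = run \<gamma> (Suc (q + (n - 1))) s" by (intro conjI s(1))
  then show ?thesis by (intro exI)
qed

lemma quads_v:
  assumes "p < q" "q < r" "r < s" "s < p + n"
  shows "(v p, v q, v r, v s) \<in> quads n"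
proof -
  have ne: "v a \<noteq> v b" if "p \<le> a" "a < b" "b \<le> s" for a b
  proof
    assume "v a = v b"
    moreover have "a \<le> b" "b < a + n" using that assms(4) by linarith+
    ultimately have "a = b" by (rule v_eq_dist)
    then show False using that by simp
  qed
  have "v p \<noteq> v q" by (rule ne) (use assms in linarith)+
  moreover have "v p \<noteq> v r" by (rule ne) (use assms in linarith)+
  moreover have "v p \<noteq> v s" by (rule ne) (use assms in linarith)+
  moreover have "v q \<noteq> v r" by (rule ne) (use assms in linarith)+
  moreover have "v q \<noteq> v s" by (rule ne) (use assms in linarith)+
  moreover have "v r \<noteq> v s" by (rule ne) (use assms in linarith)+
  ultimately have "distinct [v p, v q, v r, v s]" by simp
  moreover have "{v p, v q, v r, v s} \<subseteq> {1..n}" by (intro insert_subsetI empty_subsetI v_in)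
  ultimately show ?thesis unfolding quads_iff by (intro conjI)
qed

lemma relator_keel:
  assumes "boundary_index n I" "consecutive \<gamma> I"
  shows "\<exists>i j k l. (i, j, k, l) \<in> quads n \<and> relator n \<gamma> I = - keel n i j k l"
proof -
  obtain p s where s: "2 \<le> s" "s + 2 \<le> n" "I = run \<gamma> (Suc p) s" using consecutive_run[OF assms] by blast
  have "(v p, v (Suc p), v (p + s), v (Suc (p + s))) \<in> quads n" using s(1,2) by (intro quads_v) simp_all
  then show ?thesis using relator_eq_bsum[OF s(1,2)] s(3) by blast
qed

lemma relators_carrier:
  "{relator n \<gamma> I | I. boundary_index n I \<and> consecutive \<gamma> I} \<subseteq> carrier (free_on_boundary n)"
proof
  fix x assume "x \<in> {relator n \<gamma> I | I. boundary_index n I \<and> consecutive \<gamma> I}"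
  then obtain I where I: "boundary_index n I" "consecutive \<gamma> I" "x = relator n \<gamma> I" by blast
  obtain i j k l where "relator n \<gamma> I = - keel n i j k l" using relator_keel[OF I(1,2)] by blast
  then show "x \<in> carrier (free_on_boundary n)"
    using keys_bsum by (simp add: I(3) keel_def bsum_uminus free_on_boundary_def)
qed

lemma subgroup_relations: "subgroup (relation_subgroup n \<gamma>) (free_on_boundary n)"
  unfolding relation_subgroup_def
  by (rule group.generate_is_subgroup[OF _ relators_carrier]) (simp add: free_on_boundary_def)

lemma relations_closed:
  "0 \<in> relation_subgroup n \<gamma>"
  "x \<in> relation_subgroup n \<gamma> \<Longrightarrow> y \<in> relation_subgroup n \<gamma> \<Longrightarrow> x + y \<in> relation_subgroup n \<gamma>"
  "x \<in> relation_subgroup n \<gamma> \<Longrightarrow> - x \<in> relation_subgroup n \<gamma>"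
proof -
  show "0 \<in> relation_subgroup n \<gamma>"
    using subgroup.one_closed[OF subgroup_relations] by (simp add: free_on_boundary_def)
  show "x + y \<in> relation_subgroup n \<gamma>" if "x \<in> relation_subgroup n \<gamma>" "y \<in> relation_subgroup n \<gamma>"
    using subgroup.m_closed[OF subgroup_relations that] by (simp add: free_on_boundary_def)
  show "- x \<in> relation_subgroup n \<gamma>" if "x \<in> relation_subgroup n \<gamma>"
    using subgroup.m_inv_closed[OF subgroup_relations that] subgroup.mem_carrier[OF subgroup_relations that]
    by (simp add: free_on_boundary_def)
qed

section \<open>Generating the divisors of all cross-ratios\<close>

abbreviation "K p q r s \<equiv> keel n (v p) (v q) (v r) (v s)"

text \<open>Two edges of the polygon without common vertex bound an arc with at least 2 and at most
  \<open>n - 2\<close> vertices, and this is the relation of that arc up to sign.\<close>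

lemma keel_edges:
  assumes "e + 2 \<le> f" "f + 2 \<le> e + n"
  shows "K e (Suc e) f (Suc f) \<in> relation_subgroup n \<gamma>"
proof -
  define s where "s = f - e"
  have s: "2 \<le> s" "s + 2 \<le> n" "f = e + s" using assms by (simp_all add: s_def)
  define I where "I = run \<gamma> (Suc e) s"
  have ce: "card I = s" "I \<subseteq> {1..n}" using card_run[of s "Suc e"] run_subset s by (simp_all add: I_def)
  then have bi: "boundary_index n I" using s by (simp add: boundary_index_def)
  have "I \<noteq> {}" "I \<noteq> {1..n}" using ce s by auto
  then have "consecutive \<gamma> I" unfolding consecutive_iff using I_def by blast
  then have "relator n \<gamma> I \<in> relation_subgroup n \<gamma>"
    unfolding relation_subgroup_def using bi by (intro generate.incl) blast
  then show ?thesis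
    using relations_closed(3)[of "relator n \<gamma> I"] relator_eq_bsum[OF s(1,2), of e] by (simp add: I_def s(3))
qed

lemma keel_refl: "keel n i i k l = 0" "keel n i j k k = 0"
  by (simp_all add: keel_def bsum_def)

text \<open>Telescoping in the first pair over the edges from \<open>p\<close> to
  \<open>p + d\<close>; the second pair is treated in \<open>keel_noncrossing_path\<close>.\<close>

lemma keel_edge_path:
  assumes "p + d < f" "f + 2 \<le> p + n"
  shows "K p (p + d) f (Suc f) \<in> relation_subgroup n \<gamma>"
  using assms(1)
proof (induction d)
  case 0 then show ?case using relations_closed(1) by (simp add: keel_refl)
next
  case (Suc d)
  have "K (p + d) (Suc (p + d)) f (Suc f) \<in> relation_subgroup n \<gamma>"
    using Suc.prems assms(2) by (intro keel_edges) simp_all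
  then have "K p (p + d) f (Suc f) + K (p + d) (Suc (p + d)) f (Suc f) \<in> relation_subgroup n \<gamma>"
    using Suc by (intro relations_closed(2)) simp_all
  then show ?case by (simp add: keel_add)
qed

lemma keel_noncrossing_path:
  assumes "p < q" "q < r" "r + d < p + n"
  shows "K p q r (r + d) \<in> relation_subgroup n \<gamma>"
  using assms(3)
proof (induction d)
  case 0 then show ?case using relations_closed(1) by (simp add: keel_refl)
next
  case (Suc d)
  have "K p (p + (q - p)) (r + d) (Suc (r + d)) \<in> relation_subgroup n \<gamma>"
    using Suc.prems assms(1,2) by (intro keel_edge_path) simp_all
  then have "K p q (r + d) (Suc (r + d)) \<in> relation_subgroup n \<gamma>" using assms(1) by simp
  then have "K p q r (r + d) + K p q (r + d) (Suc (r + d)) \<in> relation_subgroup n \<gamma>"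
    using Suc by (intro relations_closed(2)) simp_all
  then show ?case by (simp add: keel_add)
qed

lemma keel_noncrossing:
  assumes "p < q" "q < r" "r < s" "s < p + n"
  shows "K p q r s \<in> relation_subgroup n \<gamma>"
  using keel_noncrossing_path[OF assms(1,2), of "s - r"] assms(3,4) by simp

text \<open>Moving \<open>p\<close> ahead by a full turn makes the four positions increasing
  again.\<close>

lemma keel_cyclic:
  assumes "p < q" "q < r" "r < s" "s < p + n"
  shows "K q r s p \<in> relation_subgroup n \<gamma>"
  using keel_noncrossing[of q r s "p + n"] assms by simp

text \<open>The pairs are disjoint, crossing or nested. Crossing pairs are a difference of two
  non-crossing ones by \<open>keel_three_term\<close>; nested pairs become disjoint arcs after a
  rotation.\<close>

lemma keel_sorted_first:
  assumes "a < b" "c < d" "a < c" "b \<noteq> c" "b \<noteq> d" "b < n" "d < n"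
  shows "K a b c d \<in> relation_subgroup n \<gamma>"
proof -
  consider "b < c" | "c < b" "b < d" | "d < b" using assms(4,5) by linarith
  then show ?thesis
  proof cases
    case 1 then show ?thesis using assms by (intro keel_noncrossing) simp_all
  next
    case 2
    have "K a c b d \<in> relation_subgroup n \<gamma>" "K c b d a \<in> relation_subgroup n \<gamma>"
      using 2 assms by (intro keel_noncrossing keel_cyclic; simp)+
    then have "K a c b d + - K c b d a \<in> relation_subgroup n \<gamma>" by (intro relations_closed)
    then show ?thesis using keel_three_term[of n "v a" "v b" "v c" "v d"] by simp
  next
    case 3
    have "K c d b a \<in> relation_subgroup n \<gamma>" using 3 assms by (intro keel_cyclic) simp_all
    then have "- K c d b a \<in> relation_subgroup n \<gamma>" by (rule relations_closed)
    moreover have "K c d b a = - K a b c d" by (simp add: keel_def bsum_uminus algebra_simps)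
    ultimately show ?thesis by simp
  qed
qed

text \<open>Antisymmetry within each pair and symmetry between the pairs reduce to sorted
  positions.\<close>

lemma keel_in_relations:
  assumes q: "(i, j, k, l) \<in> quads n"
  shows "keel n i j k l \<in> relation_subgroup n \<gamma>"
proof -
  have m: "i \<in> {1..n}" "j \<in> {1..n}" "k \<in> {1..n}" "l \<in> {1..n}" "distinct [i, j, k, l]"
    using q unfolding quads_iff by auto
  obtain a where a: "a < n" "v a = i" using ex_v[OF m(1)] by blast
  obtain b where b: "b < n" "v b = j" using ex_v[OF m(2)] by blast
  obtain c where c: "c < n" "v c = k" using ex_v[OF m(3)] by blast
  obtain d where d: "d < n" "v d = l" using ex_v[OF m(4)] by blast
  have di: "a \<noteq> b" "a \<noteq> c" "a \<noteq> d" "b \<noteq> c" "b \<noteq> d" "c \<noteq> d" using m(5) a b c d by auto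
  have 1: "K a b c d \<in> relation_subgroup n \<gamma>"
    if "a < b" "c < d" "a \<noteq> c" "a \<noteq> d" "b \<noteq> c" "b \<noteq> d" "b < n" "d < n" for a b c d
  proof (cases "a < c")
    case True
    show ?thesis by (rule keel_sorted_first[OF that(1,2) True that(5,6,7,8)])
  next
    case False
    then have "c < a" using that(3) by simp
    then have "K c d a b \<in> relation_subgroup n \<gamma>"
      by (rule keel_sorted_first[OF that(2,1) _ that(4)[symmetric] that(6)[symmetric] that(8,7)])
    then show ?thesis by (simp only: keel_swap(3)[of n "v c" "v d" "v a" "v b"])
  qed
  have neg: "x \<in> relation_subgroup n \<gamma>" if "- x \<in> relation_subgroup n \<gamma>" for x
    using relations_closed(3)[OF that] by simp
  have 2: "K a b c d \<in> relation_subgroup n \<gamma>"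
    if "a < b" "c \<noteq> d" "a \<noteq> c" "a \<noteq> d" "b \<noteq> c" "b \<noteq> d" "b < n" "d < n" "c < n" for a b c d
  proof (cases "c < d")
    case True
    show ?thesis by (rule 1[OF that(1) True that(3-8)])
  next
    case False
    then have "d < c" using that(2) by simp
    then have "K a b d c \<in> relation_subgroup n \<gamma>"
      by (rule 1[OF that(1) _ that(4,3,6,5,7,9)])
    then have "- K a b c d \<in> relation_subgroup n \<gamma>"
      by (simp only: keel_swap(2)[of n "v a" "v b" "v d" "v c"])
    then show ?thesis by (rule neg)
  qed
  have "K a b c d \<in> relation_subgroup n \<gamma>"
  proof (cases "a < b")
    case True then show ?thesis by (rule 2[OF _ di(6,2,3,4,5) b(1) d(1) c(1)])
  next
    case False
    then have "b < a" using di(1) by simp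
    then have "K b a c d \<in> relation_subgroup n \<gamma>" by (rule 2[OF _ di(6,4,5,2,3) a(1) d(1) c(1)])
    then have "- K a b c d \<in> relation_subgroup n \<gamma>"
      by (simp only: keel_swap(1)[of n "v b" "v a" "v c" "v d"])
    then show ?thesis by (rule neg)
  qed
  then show ?thesis by (simp only: a b c d)
qed

end

section \<open>The divisor class group\<close>

text \<open>The homomorphism from formal sums of partitions to Weil divisors that will induce the
  isomorphism.\<close>

definition bdiv :: "nat \<Rightarrow> (nat set set \<Rightarrow>\<^sub>0 int) \<Rightarrow> ((quad \<Rightarrow> P1) set \<Rightarrow>\<^sub>0 int)" where
  "bdiv n x = (\<Sum>A | boundary_index n A \<and> 1 \<in> A.
     frag_cmul (Poly_Mapping.lookup x (bipartition n A)) (frag_of (bd n A)))"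

abbreviation "WD n \<equiv> weil_divisors (quads n) (Mbar n)"
abbreviation "PrD n \<equiv> principal_divisors (quads n) (Mbar n)"

lemma marked_index:
  assumes "boundary_index n A"
  shows "\<exists>B. boundary_index n B \<and> 1 \<in> B \<and> bipartition n B = bipartition n A \<and> bd n B = bd n A"
proof (cases "1 \<in> A")
  case True then show ?thesis using assms by blast
next
  case False
  have A: "A \<subseteq> {1..n}" "2 \<le> card A" using assms by (simp_all add: boundary_index_def)
  then obtain a where "a \<in> A" by fastforce
  then have "1 \<le> n" using A(1) by fastforce
  then have "1 \<in> {1..n} - A" using False by simp
  then show ?thesis
    using boundary_index_compl[OF assms] bipartition_compl[OF A(1)] bd_compl[OF A(1)]
    by (intro exI[of _ "{1..n} - A"] conjI)
qed

lemma bd_eq_marked: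
  assumes "boundary_index n A" "boundary_index n B" "1 \<in> A" "1 \<in> B" "bd n A = bd n B"
  shows "A = B"
  using bd_inj[OF assms(1,2,5)] assms(3,4) by blast

lemma lookup_sum: "Poly_Mapping.lookup (sum f S) x = (\<Sum>i\<in>S. Poly_Mapping.lookup (f i) x)"
  by (induction S rule: infinite_finite_induct) (simp_all add: lookup_add)

lemma lookup_bdiv_bd:
  assumes "boundary_index n B"
  shows "Poly_Mapping.lookup (bdiv n x) (bd n B) = Poly_Mapping.lookup x (bipartition n B)"
proof -
  obtain C where C: "boundary_index n C" "1 \<in> C" "bipartition n C = bipartition n B" "bd n C = bd n B"
    using marked_index[OF assms] by blast
  have "Poly_Mapping.lookup (bdiv n x) (bd n C) = (\<Sum>A | boundary_index n A \<and> 1 \<in> A.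
      if A = C then Poly_Mapping.lookup x (bipartition n C) else 0)"
    unfolding bdiv_def lookup_sum
  proof (rule sum.cong[OF refl])
    fix A assume "A \<in> {A. boundary_index n A \<and> 1 \<in> A}"
    then have A: "boundary_index n A" "1 \<in> A" by blast+
    have "bd n C = bd n A \<longleftrightarrow> A = C" using bd_eq_marked[OF A(1) C(1) A(2) C(2)] by metis
    then show "Poly_Mapping.lookup (frag_cmul (Poly_Mapping.lookup x (bipartition n A)) (frag_of (bd n A))) (bd n C) =
        (if A = C then Poly_Mapping.lookup x (bipartition n C) else 0)" by simp
  qed
  also have "\<dots> = Poly_Mapping.lookup x (bipartition n C)" using C finite_marked[of n] by simp
  finally show ?thesis by (simp only: C)
qed

lemma lookup_bdiv_smooth:
  assumes "n \<ge> 4" "Y \<inter> M_smooth n \<noteq> {}"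
  shows "Poly_Mapping.lookup (bdiv n x) Y = 0"
proof -
  have "Y \<noteq> bd n A" if "boundary_index n A" for A
    using boundary_eq[OF assms(1)] that assms(2) by blast
  then show ?thesis unfolding bdiv_def lookup_sum by (intro sum.neutral) auto
qed

lemma bdiv_add: "bdiv n (x + y) = bdiv n x + bdiv n y"
  by (simp add: bdiv_def lookup_add frag_cmul_distrib sum.distrib)

lemma bdiv_diff: "bdiv n (x - y) = bdiv n x - bdiv n y"
  by (simp add: bdiv_def lookup_minus frag_cmul_diff_distrib sum_subtractf)

lemma bdiv_0: "bdiv n 0 = 0"
  by (simp add: bdiv_def)

lemma lookup_bsum:
  assumes "boundary_index n B" "1 \<in> B"
  shows "Poly_Mapping.lookup (bsum n w) (bipartition n B) = w B"
proof -
  have "Poly_Mapping.lookup (bsum n w) (bipartition n B) = (\<Sum>A | boundary_index n A \<and> 1 \<in> A.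
      if A = B then w B else 0)"
    unfolding bsum_def lookup_sum
  proof (rule sum.cong[OF refl])
    fix A assume "A \<in> {A. boundary_index n A \<and> 1 \<in> A}"
    then have A: "boundary_index n A" "1 \<in> A" by blast+
    have "bipartition n B = bipartition n A \<longleftrightarrow> A = B"
    proof
      assume "bipartition n B = bipartition n A"
      from bipartition_eqD[OF this] show "A = B" using A(2) assms(2) by blast
    qed simp
    then show "Poly_Mapping.lookup (frag_cmul (w A) (frag_of (bipartition n A))) (bipartition n B) =
        (if A = B then w B else 0)" by simp
  qed
  also have "\<dots> = w B" using assms finite_marked[of n] by simp
  finally show ?thesis .
qed

lemma eq_bsum:
  assumes "x \<in> carrier (free_on_boundary n)"
  shows "x = bsum n (\<lambda>A. Poly_Mapping.lookup x (bipartition n A))"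
proof (rule poly_mapping_eqI)
  fix b
  show "Poly_Mapping.lookup x b = Poly_Mapping.lookup (bsum n (\<lambda>A. Poly_Mapping.lookup x (bipartition n A))) b"
  proof (cases "\<exists>A. boundary_index n A \<and> b = bipartition n A")
    case True
    then obtain A where A: "boundary_index n A" "b = bipartition n A" by blast
    obtain B where B: "boundary_index n B" "1 \<in> B" "bipartition n B = bipartition n A" "bd n B = bd n A"
      using marked_index[OF A(1)] by blast
    note B = B(1,2) trans[OF A(2) B(3)[symmetric]]
    show ?thesis unfolding B(3) lookup_bsum[OF B(1,2)] ..
  next
    case False
    have "Poly_Mapping.keys x \<subseteq> {bipartition n A | A. boundary_index n A}"
      using assms by (simp add: free_on_boundary_def)
    then have "b \<notin> Poly_Mapping.keys x" using False by blast
    moreover have "b \<notin> {bipartition n A | A. boundary_index n A}" using False by blast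
    then have "b \<notin> Poly_Mapping.keys (bsum n (\<lambda>A. Poly_Mapping.lookup x (bipartition n A)))"
      by (rule contra_subsetD[OF keys_bsum])
    ultimately show ?thesis by (simp add: not_in_keys_iff_lookup_eq_zero)
  qed
qed

lemma carrier_WD: "D \<in> carrier (WD n) \<longleftrightarrow> Poly_Mapping.keys D \<subseteq> {Y. prime_divisor (quads n) (Mbar n) Y}"
  by (simp add: weil_divisors_def)

lemma bdiv_carrier: "bdiv n x \<in> carrier (WD n)"
  unfolding bdiv_def weil_divisors_def
proof (rule sum_closed_free_Abelian_group)
  fix A assume "A \<in> {A. boundary_index n A \<and> 1 \<in> A}"
  then have "prime_divisor (quads n) (Mbar n) (bd n A)" using prime_divisor_bd by blast
  then show "frag_cmul (Poly_Mapping.lookup x (bipartition n A)) (frag_of (bd n A)) \<in>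
      carrier (free_Abelian_group {Y. prime_divisor (quads n) (Mbar n) Y})" by auto
qed

lemma group_WD: "comm_group (WD n)"
  by (simp add: weil_divisors_def abelian_free_Abelian_group)

lemma PrD_iff: "D \<in> PrD n \<longleftrightarrow> D \<in> carrier (WD n) \<and> (\<exists>f. nzrat (quads n) (Mbar n) f \<and>
    (\<forall>Y. prime_divisor (quads n) (Mbar n) Y \<longrightarrow> Poly_Mapping.lookup D Y = ord_along (quads n) (Mbar n) Y f))"
  unfolding principal_divisors_def nzrat_def by blast

lemma PrD_closed:
  assumes n: "n \<ge> 4"
  shows "0 \<in> PrD n" "D \<in> PrD n \<Longrightarrow> D' \<in> PrD n \<Longrightarrow> D + D' \<in> PrD n" "D \<in> PrD n \<Longrightarrow> - D \<in> PrD n"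
proof -
  have "Poly_Mapping.lookup 0 Y = ord_along (quads n) (Mbar n) Y (\<lambda>_. 1)" if "prime_divisor (quads n) (Mbar n) Y" for Y
    using Ord_const[OF n that, of 1] by simp
  moreover have "0 \<in> carrier (WD n)" by (simp add: carrier_WD)
  ultimately show "0 \<in> PrD n" unfolding PrD_iff using Rat_const[OF n, of 1] by (metis zero_neq_one)
next
  assume D: "D \<in> PrD n" "D' \<in> PrD n"
  obtain f where f: "nzrat (quads n) (Mbar n) f"
    "\<And>Y. prime_divisor (quads n) (Mbar n) Y \<Longrightarrow> Poly_Mapping.lookup D Y = ord_along (quads n) (Mbar n) Y f"
    using D(1) unfolding PrD_iff by blast
  obtain f' where f': "nzrat (quads n) (Mbar n) f'"
    "\<And>Y. prime_divisor (quads n) (Mbar n) Y \<Longrightarrow> Poly_Mapping.lookup D' Y = ord_along (quads n) (Mbar n) Y f'"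
    using D(2) unfolding PrD_iff by blast
  have "D + D' \<in> carrier (WD n)"
    using D keys_add[of D D'] unfolding PrD_iff carrier_WD by blast
  moreover have "Poly_Mapping.lookup (D + D') Y = ord_along (quads n) (Mbar n) Y (\<lambda>y. f y * f' y)"
    if "prime_divisor (quads n) (Mbar n) Y" for Y
    using Ord_mult[OF n that f(1) f'(1)] f(2)[OF that] f'(2)[OF that] by (simp add: lookup_add)
  ultimately show "D + D' \<in> PrD n" unfolding PrD_iff using Rat_mult[OF n f(1) f'(1)] by blast
next
  assume D: "D \<in> PrD n"
  obtain f where f: "nzrat (quads n) (Mbar n) f"
    "\<And>Y. prime_divisor (quads n) (Mbar n) Y \<Longrightarrow> Poly_Mapping.lookup D Y = ord_along (quads n) (Mbar n) Y f"
    using D(1) unfolding PrD_iff by blast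
  have "- D \<in> carrier (WD n)" using D unfolding PrD_iff carrier_WD by simp
  moreover have "Poly_Mapping.lookup (- D) Y = ord_along (quads n) (Mbar n) Y (\<lambda>y. inverse (f y))"
    if "prime_divisor (quads n) (Mbar n) Y" for Y
    using Ord_inverse[OF n that f(1)] f(2)[OF that] by simp
  ultimately show "- D \<in> PrD n" unfolding PrD_iff using Rat_inverse[OF n f(1)] by blast
qed

lemma subgroup_PrD: "n \<ge> 4 \<Longrightarrow> subgroup (PrD n) (WD n)"
proof -
  assume n: "n \<ge> 4"
  show ?thesis
  proof
    show "PrD n \<subseteq> carrier (WD n)" using PrD_iff by blast
    show "\<one>\<^bsub>WD n\<^esub> \<in> PrD n" using PrD_closed(1)[OF n] by (simp add: weil_divisors_def)
    show "D \<otimes>\<^bsub>WD n\<^esub> D' \<in> PrD n" if "D \<in> PrD n" "D' \<in> PrD n" for D D'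
      using PrD_closed(2)[OF n that] by (simp add: weil_divisors_def)
    show "inv\<^bsub>WD n\<^esub> D \<in> PrD n" if "D \<in> PrD n" for D
    proof -
      have "Poly_Mapping.keys D \<subseteq> {Y. prime_divisor (quads n) (Mbar n) Y}" using that PrD_iff carrier_WD by blast
      then show ?thesis using PrD_closed(3)[OF n that] by (simp add: weil_divisors_def)
    qed
  qed
qed

text \<open>It suffices to treat prime divisors. Those in the boundary are in the image of
  \<open>bdiv\<close>; for one that meets the interior, its equation in a chart moves it into the
  boundary.\<close>

lemma prime_divisor_class_boundary:
  assumes n: "n \<ge> 4" and D: "D \<in> carrier (WD n)"
  shows "\<exists>x\<in>carrier (free_on_boundary n). D - bdiv n x \<in> PrD n"
proof -
  have c: "bsum n w \<in> carrier (free_on_boundary n)" for w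
    using keys_bsum by (simp add: free_on_boundary_def)
  have "Poly_Mapping.keys D \<subseteq> {Y. prime_divisor (quads n) (Mbar n) Y}" using D by (simp add: carrier_WD)
  then show ?thesis
  proof (induction D rule: frag_induction)
    case zero
    then show ?case using c[of "\<lambda>_. 0"] PrD_closed(1)[OF n] by (intro bexI[of _ 0]) (simp_all add: bdiv_0 free_on_boundary_def)
  next
    case (one Y)
    then have Y: "prime_divisor (quads n) (Mbar n) Y" by simp
    consider A where "boundary_index n A" "Y = bd n A" | "Y \<inter> M_smooth n \<noteq> {}"
      using prime_divisor_cases[OF n Y] by blast
    then show ?case
    proof cases
      case (1 A)
      obtain B where B: "boundary_index n B" "1 \<in> B" "bd n B = bd n A"
        using marked_index[OF 1(1)] by blast
      define x where "x = bsum n (\<lambda>C. of_bool (C = B))"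
      have "frag_of Y - bdiv n x = 0"
      proof -
        have "bdiv n x = (\<Sum>C | boundary_index n C \<and> 1 \<in> C. if C = B then frag_of (bd n B) else 0)"
          unfolding bdiv_def by (rule sum.cong[OF refl]) (auto simp: x_def lookup_bsum)
        also have "\<dots> = frag_of (bd n B)" using B finite_marked[of n] by simp
        finally show ?thesis using B 1 by simp
      qed
      then show ?thesis using c PrD_closed(1)[OF n] by (intro bexI[of _ x]) (simp_all add: x_def)
    next
      case 2
      obtain A i0 i1 j0 j1 where "boundary_chart n A i0 i1 j0 j1" using ex_chart[OF n] by blast
      from boundary_chart.smooth_prime_principal[OF this Y 2]
      obtain f where f: "nzrat (quads n) (Mbar n) f" "ord_along (quads n) (Mbar n) Y f = 1"
        "\<And>Y'. prime_divisor (quads n) (Mbar n) Y' \<Longrightarrow> Y' \<inter> M_smooth n \<noteq> {} \<Longrightarrow> Y' \<noteq> Y \<Longrightarrow>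
          ord_along (quads n) (Mbar n) Y' f = 0" by blast
      \<comment> \<open>The divisor of \<open>f\<close> is \<open>Y\<close> plus a boundary part.
        Taking the negative of this part for \<open>x\<close> makes
        \<open>frag_of Y - bdiv n x\<close> the divisor of \<open>f\<close>.\<close>
      define x where "x = bsum n (\<lambda>A. - ord_along (quads n) (Mbar n) (bd n A) f)"
      have "Poly_Mapping.lookup (frag_of Y - bdiv n x) Y' = ord_along (quads n) (Mbar n) Y' f"
        if Y': "prime_divisor (quads n) (Mbar n) Y'" for Y'
        using prime_divisor_cases[OF n Y']
      proof
        assume "\<exists>A. boundary_index n A \<and> Y' = bd n A"
        then obtain A where A: "boundary_index n A" "Y' = bd n A" by blast
        obtain B where B: "boundary_index n B" "1 \<in> B" "bd n B = bd n A"
          using marked_index[OF A(1)] by blast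
        have "Y' = bd n B" using A B by simp
        moreover have "Y \<noteq> bd n B" using 2 boundary_eq[OF n] B(1) by blast
        moreover have "Poly_Mapping.lookup (bdiv n x) (bd n B) = - ord_along (quads n) (Mbar n) (bd n B) f"
          using lookup_bdiv_bd[OF B(1)] lookup_bsum[OF B(1,2)] by (simp add: x_def)
        ultimately show ?thesis by (simp add: lookup_minus)
      next
        assume sm: "Y' \<inter> M_smooth n \<noteq> {}"
        have "Poly_Mapping.lookup (bdiv n x) Y' = 0" by (rule lookup_bdiv_smooth[OF n sm])
        then show ?thesis using f(2) f(3)[OF Y' sm] by (cases "Y' = Y") (simp_all add: lookup_minus)
      qed
      moreover have "frag_of Y - bdiv n x \<in> carrier (WD n)"
        using bdiv_carrier[of n x] Y keys_diff[of "frag_of Y" "bdiv n x"] unfolding carrier_WD by auto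
      ultimately have "frag_of Y - bdiv n x \<in> PrD n" unfolding PrD_iff using f(1) by blast
      then show ?thesis using c by (intro bexI[of _ x]) (simp_all add: x_def)
    qed
  next
    case (diff a b)
    then obtain x y where xy: "x \<in> carrier (free_on_boundary n)" "a - bdiv n x \<in> PrD n"
      "y \<in> carrier (free_on_boundary n)" "b - bdiv n y \<in> PrD n" by blast
    have "(a - bdiv n x) + - (b - bdiv n y) \<in> PrD n" using xy PrD_closed[OF n] by blast
    then have "(a - b) - bdiv n (x - y) \<in> PrD n" by (simp add: bdiv_diff algebra_simps)
    moreover have "x - y \<in> carrier (free_on_boundary n)"
      using xy(1,3) keys_diff[of x y] by (auto simp: free_on_boundary_def)
    ultimately show ?case by blast
  qed
qed

text \<open>It is the divisor of the cross-ratio \<open>xval\<close>, whose order is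
  \<open>xord\<close> along the boundary and 0 along divisors that meet the interior.\<close>

lemma bdiv_keel_principal:
  assumes n: "n \<ge> 4" and q: "(i, j, k, l) \<in> quads n"
  shows "bdiv n (keel n i j k l) \<in> PrD n"
  unfolding PrD_iff
proof (intro conjI exI allI impI)
  show "bdiv n (keel n i j k l) \<in> carrier (WD n)" by (rule bdiv_carrier)
  show "nzrat (quads n) (Mbar n) (xval (i, j, k, l))" by (rule Rat_xval[OF n q])
  fix Y assume Y: "prime_divisor (quads n) (Mbar n) Y"
  show "Poly_Mapping.lookup (bdiv n (keel n i j k l)) Y = ord_along (quads n) (Mbar n) Y (xval (i, j, k, l))"
    using prime_divisor_cases[OF n Y]
  proof
    assume "\<exists>A. boundary_index n A \<and> Y = bd n A"
    then obtain A where A: "boundary_index n A" "Y = bd n A" by blast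
    obtain B where B: "boundary_index n B" "1 \<in> B" "bd n B = bd n A"
      using marked_index[OF A(1)] by blast
    have "Poly_Mapping.lookup (bdiv n (keel n i j k l)) (bd n B) = xord B (i, j, k, l)"
      unfolding lookup_bdiv_bd[OF B(1)] keel_xord lookup_bsum[OF B(1,2)] ..
    then show ?thesis using ord_xval_boundary[OF B(1) q] A(2) B(3) by simp
  next
    assume sm: "Y \<inter> M_smooth n \<noteq> {}"
    show ?thesis using lookup_bdiv_smooth[OF n sm] Ord_xval_smooth[OF n Y sm q] by simp
  qed
qed

context cyc
begin

text \<open>The relators are sent to divisors of inverse cross-ratios. Conversely, a function with
  divisor \<open>bdiv n x\<close> has boundary support, so its divisor is an integral combination of
  divisors of cross-ratios. The coefficients of \<open>x\<close> are its orders along the boundary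
  divisors, hence \<open>x\<close> is the same combination of the elements \<open>keel\<close>,
  which lie in the relation subgroup.\<close>

lemma bdiv_principal_iff:
  assumes n: "n \<ge> 4" and x: "x \<in> carrier (free_on_boundary n)"
  shows "bdiv n x \<in> PrD n \<longleftrightarrow> x \<in> relation_subgroup n \<gamma>"
proof
  assume "x \<in> relation_subgroup n \<gamma>"
  then show "bdiv n x \<in> PrD n"
    unfolding relation_subgroup_def
  proof (induction rule: generate.induct)
    case one
    then show ?case using PrD_closed(1)[OF n] by (simp add: bdiv_0 free_on_boundary_def)
  next
    case (incl h)
    then obtain I where I: "boundary_index n I" "consecutive \<gamma> I" "h = relator n \<gamma> I" by blast
    obtain i j k l where q: "(i, j, k, l) \<in> quads n" "h = - keel n i j k l" using relator_keel[OF I(1,2)] I(3) by blast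
    have "- bdiv n (keel n i j k l) \<in> PrD n" using PrD_closed(3)[OF n bdiv_keel_principal[OF n q(1)]] .
    then show ?case using bdiv_diff[of n 0 "keel n i j k l"] by (simp add: q(2) bdiv_0)
  next
    case (inv h)
    then obtain I where I: "boundary_index n I" "consecutive \<gamma> I" "h = relator n \<gamma> I" by blast
    obtain i j k l where q: "(i, j, k, l) \<in> quads n" "h = - keel n i j k l" using relator_keel[OF I(1,2)] I(3) by blast
    have "h \<in> carrier (free_on_boundary n)" using relators_carrier inv by blast
    then have "inv\<^bsub>free_on_boundary n\<^esub> h = keel n i j k l" by (simp add: q(2) free_on_boundary_def)
    then show ?case using bdiv_keel_principal[OF n q(1)] by simp
  next
    case (eng a b)
    then show ?case using PrD_closed(2)[OF n] by (simp add: bdiv_add free_on_boundary_def)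
  qed
next
  assume "bdiv n x \<in> PrD n"
  then obtain f where f: "nzrat (quads n) (Mbar n) f"
    "\<And>Y. prime_divisor (quads n) (Mbar n) Y \<Longrightarrow> Poly_Mapping.lookup (bdiv n x) Y = ord_along (quads n) (Mbar n) Y f"
    unfolding PrD_iff by blast
  obtain A i0 i1 j0 j1 where ch: "boundary_chart n A i0 i1 j0 j1" using ex_chart[OF n] by blast
  have "Cr n f"
  proof (rule boundary_chart.boundary_supported_Cr[OF ch f(1)])
    fix Y assume "prime_divisor (quads n) (Mbar n) Y" "Y \<inter> M_smooth n \<noteq> {}"
    then show "ord_along (quads n) (Mbar n) Y f = 0" using f(2)[of Y] lookup_bdiv_smooth[OF n, of Y x] by simp
  qed
  then obtain k where k: "\<And>Y. prime_divisor (quads n) (Mbar n) Y \<Longrightarrow>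
      ord_along (quads n) (Mbar n) Y f = (\<Sum>q\<in>quads n. k q * ord_along (quads n) (Mbar n) Y (xval q))"
    unfolding Cr_def[OF n] by blast
  have "Poly_Mapping.lookup x (bipartition n A) = (\<Sum>q\<in>quads n. k q * xord A q)" if A: "boundary_index n A" for A
  proof -
    have "Poly_Mapping.lookup x (bipartition n A) = (\<Sum>q\<in>quads n. k q * ord_along (quads n) (Mbar n) (bd n A) (xval q))"
      using f(2)[OF prime_divisor_bd[OF A]] k[OF prime_divisor_bd[OF A]] lookup_bdiv_bd[OF A, of x] by (simp only:)
    also have "\<dots> = (\<Sum>q\<in>quads n. k q * xord A q)"
      by (rule sum.cong[OF refl]) (simp add: ord_xval_boundary[OF A])
    finally show ?thesis .
  qed
  then have "bsum n (\<lambda>A. Poly_Mapping.lookup x (bipartition n A)) = bsum n (\<lambda>A. \<Sum>q\<in>quads n. k q * xord A q)"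
    by (intro bsum_cong)
  also have "\<dots> = (\<Sum>q\<in>quads n. frag_cmul (k q) (bsum n (\<lambda>A. xord A q)))"
    by (simp only: bsum_scale bsum_sum)
  finally have eq: "x = (\<Sum>q\<in>quads n. frag_cmul (k q) (bsum n (\<lambda>A. xord A q)))"
    using eq_bsum[OF x] by simp
  have sc: "frag_cmul c y \<in> relation_subgroup n \<gamma>" if y: "y \<in> relation_subgroup n \<gamma>" for c :: int and y
  proof -
    have nat: "frag_cmul (int m) y \<in> relation_subgroup n \<gamma>" for m
    proof (induction m)
      case 0
      then show ?case using relations_closed(1) by simp
    next
      case (Suc m)
      have "frag_cmul (int (Suc m)) y = y + frag_cmul (int m) y"
        by (simp add: frag_cmul_distrib)
      then show ?case using relations_closed(2)[OF y Suc] by (simp only:)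
    qed
    show ?thesis
    proof (cases "c \<ge> 0")
      case True then show ?thesis using nat[of "nat c"] by simp
    next
      case False
      then have "frag_cmul c y = - frag_cmul (int (nat (- c))) y" by simp
      then show ?thesis using relations_closed(3)[OF nat[of "nat (- c)"]] by (simp only:)
    qed
  qed
  have "bsum n (\<lambda>A. xord A q) \<in> relation_subgroup n \<gamma>" if "q \<in> quads n" for q
  proof -
    obtain i j k l where "q = (i, j, k, l)" by (cases q)
    then show ?thesis using keel_in_relations[of i j k l] that keel_xord[of n i j k l] by simp
  qed
  then have t: "frag_cmul (k q) (bsum n (\<lambda>A. xord A q)) \<in> relation_subgroup n \<gamma>" if "q \<in> quads n" for q
    using that sc by blast
  have "(\<Sum>q\<in>S. frag_cmul (k q) (bsum n (\<lambda>A. xord A q))) \<in> relation_subgroup n \<gamma>" if "S \<subseteq> quads n" for S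
    using that
  proof (induction S rule: infinite_finite_induct)
    case (insert q S)
    then show ?case using t[of q] relations_closed(2) by simp
  qed (simp_all add: relations_closed(1))
  then show "x \<in> relation_subgroup n \<gamma>" using eq by simp
qed

end

text \<open>The first isomorphism theorem for the class of \<open>bdiv n x\<close>: the kernel is
  computed in \<open>bdiv_principal_iff\<close>, and surjectivity is
  \<open>prime_divisor_class_boundary\<close>.\<close>

theorem theorem2p1:
  fixes n :: nat and \<gamma> :: "nat list"
  assumes "n \<ge> 4" and "cyclic_ordering n \<gamma>"
  shows "\<exists>\<phi> \<in> iso (free_on_boundary n Mod relation_subgroup n \<gamma>) (Pic_Mbar n).
    \<forall>A. A \<subseteq> {1..n} \<and> 2 \<le> card A \<and> card A \<le> n - 2 \<longrightarrow>
      \<phi> (relation_subgroup n \<gamma> #>\<^bsub>free_on_boundary n\<^esub> frag_of (bipartition n A)) = delta n A"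
proof -
  interpret cyc n \<gamma> using assms by unfold_locales simp_all
  note n = assms(1)
  define G where "G = free_on_boundary n"
  define H where "H = relation_subgroup n \<gamma>"
  define P where "P = Pic_Mbar n"
  have gG: "group G" by (simp add: G_def free_on_boundary_def)
  interpret W: comm_group "WD n" by (rule group_WD)
  have sP: "subgroup (PrD n) (WD n)" by (rule subgroup_PrD[OF n])
  then have nP: "PrD n \<lhd> WD n" by (rule W.subgroup_imp_normal)
  have P: "P = WD n Mod PrD n" by (simp add: P_def Pic_Mbar_def divisor_class_group_def)
  have gP: "group P" unfolding P by (rule normal.factorgroup_is_group[OF nP])
  define h where "h = (\<lambda>x. PrD n #>\<^bsub>WD n\<^esub> bdiv n x)"
  have hom: "h \<in> hom G P"
  proof -
    have "bdiv n \<in> hom G (WD n)"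
      by (rule homI) (rule bdiv_carrier, simp add: bdiv_add G_def free_on_boundary_def weil_divisors_def)
    then have "(\<lambda>a. PrD n #>\<^bsub>WD n\<^esub> a) \<circ> bdiv n \<in> hom G P"
      unfolding P using normal.r_coset_hom_Mod[OF nP] by (rule Group.hom_compose)
    then show ?thesis by (simp add: h_def comp_def)
  qed
  interpret h: group_hom G P h by (rule group_hom.intro[OF gG gP]) (rule group_hom_axioms.intro[OF hom])
  have ker: "kernel G P h = H"
  proof -
    have one: "\<one>\<^bsub>P\<^esub> = PrD n" unfolding P FactGroup_def by simp
    have "h x = \<one>\<^bsub>P\<^esub> \<longleftrightarrow> bdiv n x \<in> PrD n" for x
      unfolding h_def one
      by (rule iffI) (erule W.coset_join1[OF _ bdiv_carrier sP], rule W.coset_join2[OF bdiv_carrier sP])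
    moreover have "H \<subseteq> carrier G" unfolding H_def G_def by (rule subgroup.subset[OF subgroup_relations])
    ultimately show ?thesis
      unfolding kernel_def H_def G_def using bdiv_principal_iff[OF n] by blast
  qed
  have surj: "h ` carrier G = carrier P"
  proof
    show "h ` carrier G \<subseteq> carrier P" using h.hom_closed by blast
    show "carrier P \<subseteq> h ` carrier G"
    proof
      fix c assume "c \<in> carrier P"
      then obtain D where D: "D \<in> carrier (WD n)" "c = PrD n #>\<^bsub>WD n\<^esub> D"
        unfolding P FactGroup_def RCOSETS_def by auto
      obtain x where x: "x \<in> carrier G" "D - bdiv n x \<in> PrD n"
        using prime_divisor_class_boundary[OF n D(1)] unfolding G_def by blast
      have "D = (D - bdiv n x) \<otimes>\<^bsub>WD n\<^esub> bdiv n x" by (simp add: weil_divisors_def)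
      then have "D \<in> PrD n #>\<^bsub>WD n\<^esub> bdiv n x" unfolding r_coset_def using x(2) by blast
      then have "h x = c" unfolding h_def D(2) by (rule W.repr_independence[OF _ bdiv_carrier sP])
      then show "c \<in> h ` carrier G" using x(1) by blast
    qed
  qed
  \<comment> \<open>The map induced on cosets: \<open>h\<close> is constant on each of them, so its
    image is a singleton.\<close>
  define \<phi> where "\<phi> = (\<lambda>X. the_elem (h ` X))"
  have iso: "\<phi> \<in> iso (G Mod H) P"
    using h.FactGroup_iso_set[OF surj] unfolding ker \<phi>_def .
  have "\<phi> (H #>\<^bsub>G\<^esub> frag_of (bipartition n A)) = delta n A" if A: "boundary_index n A" for A
  proof -
    define x where "x = frag_of (bipartition n A)"
    have x: "x \<in> carrier G" using A by (auto simp: x_def G_def free_on_boundary_def)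
    have "h ` (H #>\<^bsub>G\<^esub> x) = {h x}"
    proof
      show "h ` (H #>\<^bsub>G\<^esub> x) \<subseteq> {h x}"
      proof
        fix c assume "c \<in> h ` (H #>\<^bsub>G\<^esub> x)"
        then obtain y where y: "y \<in> H" "c = h (y \<otimes>\<^bsub>G\<^esub> x)" unfolding r_coset_def by blast
        have yk: "y \<in> carrier G" "h y = \<one>\<^bsub>P\<^esub>" using y(1) unfolding ker[symmetric] kernel_def by blast+
        have "c = h y \<otimes>\<^bsub>P\<^esub> h x" using y(2) h.hom_mult[OF yk(1) x] by simp
        also have "\<dots> = h x" using yk(2) h.hom_closed[OF x] by simp
        finally show "c \<in> {h x}" by simp
      qed
      have "x \<in> H #>\<^bsub>G\<^esub> x"
        using group.rcos_self[OF gG x] subgroup_relations unfolding H_def G_def by blast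
      then show "{h x} \<subseteq> h ` (H #>\<^bsub>G\<^esub> x)" by blast
    qed
    then have "\<phi> (H #>\<^bsub>G\<^esub> x) = h x" by (simp add: \<phi>_def)
    moreover have "bdiv n x = frag_of (bd n A)"
    proof -
      obtain B where B: "boundary_index n B" "1 \<in> B" "bipartition n B = bipartition n A" "bd n B = bd n A"
        using marked_index[OF A] by blast
      have "bdiv n x = (\<Sum>C | boundary_index n C \<and> 1 \<in> C. if C = B then frag_of (bd n B) else 0)"
        unfolding bdiv_def
      proof (rule sum.cong[OF refl])
        fix C assume "C \<in> {C. boundary_index n C \<and> 1 \<in> C}"
        then have C: "1 \<in> C" by blast
        have "bipartition n C = bipartition n B \<longleftrightarrow> C = B"
        proof
          assume "bipartition n C = bipartition n B"
          from bipartition_eqD[OF this] show "C = B" using C B(2) by blast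
        qed simp
        then show "frag_cmul (Poly_Mapping.lookup x (bipartition n C)) (frag_of (bd n C)) =
            (if C = B then frag_of (bd n B) else 0)" by (simp add: x_def B(3)[symmetric])
      qed
      also have "\<dots> = frag_of (bd n B)" using B finite_marked[of n] by simp
      finally show ?thesis by (simp only: B)
    qed
    ultimately show ?thesis
      by (simp add: h_def x_def delta_def divisor_class_def d_divisor_eq[OF n A])
  qed
  then show ?thesis
    using iso unfolding G_def H_def P_def boundary_index_def by blast
qed

end
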